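(* Let $A$ be a finite-dimensional self-injective $k$-algebra with $A/\operatorname{rad}A$ separable over $k$, with Nakayama automorphism $\nu$ and $\omega=\mathrm DA\cong{}_1A_\nu$. Then for all $n,m\in\mathbb Z$, $$\widehat{\operatorname{Ext}}{}^{\,n}_{A^{\mathrm e}}\bigl(A,\omega^{\otimes m}\bigr)\;\cong\;\mathrm D\,\widehat{\operatorname{Ext}}{}^{\,-n-1}_{A^{\mathrm e}}\bigl(A,\omega^{\otimes(2-m)}\bigr).$$ In particular (case $m=1$) the Tate extension of the Han column is self-dual: $\widehat{\operatorname{Ext}}{}^{\,n}_{A^{\mathrm e}}(A,\omega)\cong\mathrm D\,\widehat{\operatorname{Ext}}{}^{\,-n-1}_{A^{\mathrm e}}(A,\omega)$ for all $n\in\mathbb Z$; and for $n\ge1$ these groups compute the dual twisted Hochschild homologies: $\widehat{\operatorname{Ext}}{}^{\,n}_{A^{\mathrm e}}(A,\omega^{\otimes m})\cong\mathrm D\,\mathrm{HH}_n(A,\omega^{\otimes(1-m)})$.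
   Context: $k$ is a field, $\mathrm D=\operatorname{Hom}_k(-,k)$, $A^{\mathrm e}=A\otimes_kA^{\mathrm{op}}$, bimodules are left $A^{\mathrm e}$-modules, $\mathrm{HH}_n(A,M)=\operatorname{Tor}_n^{A^{\mathrm e}}(A,M)$. For an automorphism $\phi$ of $A$, ${}_1A_\phi$ is $A$ with $a\cdot x\cdot b=ax\phi(b)$. A self-injective algebra is treated as Frobenius, so $\omega=\mathrm DA\cong{}_1A_\nu$ is invertible and $\omega^{\otimes m}:={}_1A_{\nu^m}$ for all $m\in\mathbb Z$ (the $m$-fold tensor power over $A$ when $m\ge0$). The Han column is the family $\mathrm{HH}^\bullet(A,\mathrm DA)\cong\mathrm D\,\mathrm{HH}_\bullet(A)$. For a self-injective algebra $\Lambda$, $\underline{\operatorname{Hom}}_\Lambda(U,V)$ is $\operatorname{Hom}_\Lambda(U,V)$ modulo maps factoring through a projective; the stable category is triangulated with suspension $\Sigma=\Omega^{-1}$ ($\Omega$ the syzygy functor), and $\widehat{\operatorname{Ext}}{}^{\,n}_\Lambda(U,V)=\underline{\operatorname{Hom}}_\Lambda(U,\Sigma^nV)$ for $n\in\mathbb Z$. *)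

theory Defs
  imports "HOL-Algebra.QuotRing" "Jordan_Normal_Form.VS_Connect"
begin

hide_const (open) Multiset.mult Polynomial.smult Modules.module Modules.module_hom

text \<open>
  The ground field is the type \<open>'k\<close> of class \<^class>\<open>field\<close>, made into a ring record by
  \<open>class_ring\<close>. A vector space over it is a record \<open>V\<close> with \<open>vectorspace class_ring V\<close>. A
  \<open>'k\<close>-algebra is a single record carrying both its multiplication and its scalar
  multiplication. A left module over an algebra \<open>L\<close> is a record whose \<open>smult\<close> is the action of
  \<open>L\<close>, and its \<open>'k\<close>-structure is the induced one; right modules are left modules over the
  opposite algebra. In records that only serve as modules or vector spaces, the fields \<open>mult\<close> and
  \<open>one\<close> have no meaning.
\<close>

section \<open>Algebras and modules\<close>

definition k_algebra :: "('k::field, 'a) module \<Rightarrow> bool" where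
  "k_algebra A \<longleftrightarrow> vectorspace class_ring A \<and> ring A \<and>
     (\<forall>c. \<forall>a\<in>carrier A. \<forall>b\<in>carrier A.
        (c \<odot>\<^bsub>A\<^esub> a) \<otimes>\<^bsub>A\<^esub> b = c \<odot>\<^bsub>A\<^esub> (a \<otimes>\<^bsub>A\<^esub> b) \<and>
        a \<otimes>\<^bsub>A\<^esub> (c \<odot>\<^bsub>A\<^esub> b) = c \<odot>\<^bsub>A\<^esub> (a \<otimes>\<^bsub>A\<^esub> b))"

abbreviation finite_dimensional :: "('k::field, 'v) module \<Rightarrow> bool" where
  "finite_dimensional V \<equiv> vectorspace.fin_dim class_ring V"

definition opp :: "('k, 'a) module \<Rightarrow> ('k, 'a) module" where
  "opp A = A\<lparr>mult := (\<lambda>x y. y \<otimes>\<^bsub>A\<^esub> x)\<rparr>"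

definition regular :: "('a, 'c) ring_scheme \<Rightarrow> ('a, 'a) module" where
  "regular R = \<lparr>carrier = carrier R, mult = mult R, one = one R, zero = zero R, add = add R,
                smult = mult R\<rparr>"

abbreviation ground :: "('k::field, 'k) module" where
  "ground \<equiv> regular class_ring"

text \<open>The locale \<^locale>\<open>module\<close> of the library requires a commutative base ring.\<close>

locale left_module = R?: ring R + M?: abelian_group M
  for R :: "('l, 'c) ring_scheme" (structure) and M :: "('l, 'm) module" (structure) +
  assumes smult_closed:
      "\<lbrakk>r \<in> carrier R; x \<in> carrier M\<rbrakk> \<Longrightarrow> r \<odot>\<^bsub>M\<^esub> x \<in> carrier M"
    and smult_l_distr:
      "\<lbrakk>r \<in> carrier R; s \<in> carrier R; x \<in> carrier M\<rbrakk> \<Longrightarrow>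
       (r \<oplus>\<^bsub>R\<^esub> s) \<odot>\<^bsub>M\<^esub> x = r \<odot>\<^bsub>M\<^esub> x \<oplus>\<^bsub>M\<^esub> s \<odot>\<^bsub>M\<^esub> x"
    and smult_r_distr:
      "\<lbrakk>r \<in> carrier R; x \<in> carrier M; y \<in> carrier M\<rbrakk> \<Longrightarrow>
       r \<odot>\<^bsub>M\<^esub> (x \<oplus>\<^bsub>M\<^esub> y) = r \<odot>\<^bsub>M\<^esub> x \<oplus>\<^bsub>M\<^esub> r \<odot>\<^bsub>M\<^esub> y"
    and smult_assoc:
      "\<lbrakk>r \<in> carrier R; s \<in> carrier R; x \<in> carrier M\<rbrakk> \<Longrightarrow>
       (r \<otimes>\<^bsub>R\<^esub> s) \<odot>\<^bsub>M\<^esub> x = r \<odot>\<^bsub>M\<^esub> (s \<odot>\<^bsub>M\<^esub> x)"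
    and smult_one:
      "x \<in> carrier M \<Longrightarrow> \<one>\<^bsub>R\<^esub> \<odot>\<^bsub>M\<^esub> x = x"

definition restrict_scalars :: "('k::field, 'l) module \<Rightarrow> ('l, 'm) module \<Rightarrow> ('k, 'm) module" where
  "restrict_scalars L M = \<lparr>carrier = carrier M, mult = mult M, one = one M, zero = zero M,
     add = add M, smult = (\<lambda>c x. (c \<odot>\<^bsub>L\<^esub> \<one>\<^bsub>L\<^esub>) \<odot>\<^bsub>M\<^esub> x)\<rparr>"

definition fd_module :: "('k::field, 'l) module \<Rightarrow> ('l, 'm) module \<Rightarrow> bool" where
  "fd_module L M \<longleftrightarrow> left_module L M \<and> finite_dimensional (restrict_scalars L M)"

definition lmod_iso ::
  "('l, 'c) ring_scheme \<Rightarrow> ('l, 'm) module \<Rightarrow> ('l, 'n) module \<Rightarrow> bool" where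
  "lmod_iso R M N \<longleftrightarrow> (\<exists>f\<in>module_hom R M N. bij_betw f (carrier M) (carrier N))"

abbreviation k_iso :: "('k::field, 'v) module \<Rightarrow> ('k, 'w) module \<Rightarrow> bool" where
  "k_iso V W \<equiv> lmod_iso class_ring V W"

text \<open>
  The space of homomorphisms. The functions are required to be \<^term>\<open>undefined\<close> outside
  \<open>carrier M\<close>, so that equality in the space is equality of homomorphisms.
\<close>

definition hom_space ::
  "('k::field, 'l) module \<Rightarrow> ('l, 'm) module \<Rightarrow> ('l, 'n) module \<Rightarrow> ('k, 'm \<Rightarrow> 'n) module" where
  "hom_space L M N = \<lparr>carrier = module_hom L M N \<inter> extensional (carrier M),
     mult = undefined, one = undefined,
     zero = (\<lambda>x\<in>carrier M. \<zero>\<^bsub>N\<^esub>),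
     add = (\<lambda>f g. \<lambda>x\<in>carrier M. f x \<oplus>\<^bsub>N\<^esub> g x),
     smult = (\<lambda>c f. \<lambda>x\<in>carrier M. (c \<odot>\<^bsub>L\<^esub> \<one>\<^bsub>L\<^esub>) \<odot>\<^bsub>N\<^esub> f x)\<rparr>"

definition dual :: "('k::field, 'v) module \<Rightarrow> ('k, 'v \<Rightarrow> 'k) module" where
  "dual V = hom_space ground V ground"

text \<open>
  Quotient of a vector space by a subspace, extending \<^const>\<open>FactRing\<close> by the scalar
  multiplication; for a two-sided ideal of an algebra it is the quotient algebra.
\<close>

definition quot :: "('k, 'v) module \<Rightarrow> 'v set \<Rightarrow> ('k, 'v set) module" where
  "quot V S = \<lparr>carrier = a_rcosets\<^bsub>V\<^esub> S, mult = rcoset_mult V S, one = S +>\<^bsub>V\<^esub> \<one>\<^bsub>V\<^esub>,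
     zero = S, add = set_add V,
     smult = (\<lambda>c X. \<Union>x\<in>X. S +>\<^bsub>V\<^esub> (c \<odot>\<^bsub>V\<^esub> x))\<rparr>"

section \<open>Tensor products\<close>

definition free_vs :: "'s set \<Rightarrow> ('k::field, 's \<Rightarrow> 'k) module" where
  "free_vs S = \<lparr>carrier = {f. finite {s. f s \<noteq> 0} \<and> {s. f s \<noteq> 0} \<subseteq> S},
     mult = undefined, one = undefined, zero = (\<lambda>s. 0), add = (\<lambda>f g s. f s + g s),
     smult = (\<lambda>c f s. c * f s)\<rparr>"

definition single :: "'m \<Rightarrow> 'n \<Rightarrow> 'm \<times> 'n \<Rightarrow> 'k::field" where
  "single m n = (\<lambda>p. if p = (m, n) then 1 else 0)"

text \<open>\<open>M\<close> is a right and \<open>N\<close> a left \<open>L\<close>-module, so \<open>l \<odot>\<^bsub>M\<^esub> m\<close> below is \<open>m\<cdot>l\<close>.\<close>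

definition tensor_rels ::
  "('k::field, 'l) module \<Rightarrow> ('l, 'm) module \<Rightarrow> ('l, 'n) module \<Rightarrow> ('m \<times> 'n \<Rightarrow> 'k) set" where
  "tensor_rels L M N =
     {\<lambda>p. single (m \<oplus>\<^bsub>M\<^esub> m') n p - single m n p - single m' n p | m m' n.
        m \<in> carrier M \<and> m' \<in> carrier M \<and> n \<in> carrier N} \<union>
     {\<lambda>p. single m (n \<oplus>\<^bsub>N\<^esub> n') p - single m n p - single m n' p | m n n'.
        m \<in> carrier M \<and> n \<in> carrier N \<and> n' \<in> carrier N} \<union>
     {\<lambda>p. single (l \<odot>\<^bsub>M\<^esub> m) n p - single m (l \<odot>\<^bsub>N\<^esub> n) p | l m n.
        l \<in> carrier L \<and> m \<in> carrier M \<and> n \<in> carrier N} \<union>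
     {\<lambda>p. single ((c \<odot>\<^bsub>L\<^esub> \<one>\<^bsub>L\<^esub>) \<odot>\<^bsub>M\<^esub> m) n p - c * single m n p | c m n.
        m \<in> carrier M \<and> n \<in> carrier N}"

definition tensor_ker ::
  "('k::field, 'l) module \<Rightarrow> ('l, 'm) module \<Rightarrow> ('l, 'n) module \<Rightarrow> ('m \<times> 'n \<Rightarrow> 'k) set" where
  "tensor_ker L M N =
     (\<lambda>H. Module.submodule H class_ring (free_vs (carrier M \<times> carrier N) :: ('k, 'm \<times> 'n \<Rightarrow> 'k) module))
     hull tensor_rels L M N"

definition tensor ::
  "('k::field, 'l) module \<Rightarrow> ('l, 'm) module \<Rightarrow> ('l, 'n) module \<Rightarrow>
   ('k, ('m \<times> 'n \<Rightarrow> 'k) set) module" where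
  "tensor L M N = quot (free_vs (carrier M \<times> carrier N)) (tensor_ker L M N)"

definition pure_tensor ::
  "('k::field, 'l) module \<Rightarrow> ('l, 'm) module \<Rightarrow> ('l, 'n) module \<Rightarrow> 'm \<Rightarrow> 'n \<Rightarrow>
   ('m \<times> 'n \<Rightarrow> 'k) set" where
  "pure_tensor L M N m n =
     tensor_ker L M N +>\<^bsub>(free_vs (carrier M \<times> carrier N) :: ('k, 'm \<times> 'n \<Rightarrow> 'k) module)\<^esub> single m n"

text \<open>
  The linear map out of a tensor product induced by a balanced bilinear map \<open>b\<close> into the vector
  space \<open>X\<close>. The value does not depend on the chosen representative of the coset \<open>t\<close>.
\<close>

definition tensor_lift ::
  "('k::field, 'x) module \<Rightarrow> ('m \<Rightarrow> 'n \<Rightarrow> 'x) \<Rightarrow> ('m \<times> 'n \<Rightarrow> 'k) set \<Rightarrow> 'x" where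
  "tensor_lift X b t =
     (let f = (SOME f. f \<in> t)
      in finsum X (\<lambda>p. f p \<odot>\<^bsub>X\<^esub> b (fst p) (snd p)) {p. f p \<noteq> 0})"

definition tensor_algebra ::
  "('k::field, 'a) module \<Rightarrow> ('k, 'b) module \<Rightarrow> ('k, ('a \<times> 'b \<Rightarrow> 'k) set) module" where
  "tensor_algebra A B = (let T = tensor ground A B in
     T\<lparr>mult := (\<lambda>s t. tensor_lift T (\<lambda>a b. tensor_lift T (\<lambda>a' b'.
                  pure_tensor ground A B (a \<otimes>\<^bsub>A\<^esub> a') (b \<otimes>\<^bsub>B\<^esub> b')) t) s),
       one := pure_tensor ground A B \<one>\<^bsub>A\<^esub> \<one>\<^bsub>B\<^esub>\<rparr>)"

section \<open>The enveloping algebra and bimodules\<close>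

type_synonym ('k, 'a) env = "('a \<times> 'a \<Rightarrow> 'k) set"

definition enveloping :: "('k::field, 'a) module \<Rightarrow> ('k, ('k, 'a) env) module" where
  "enveloping A = tensor_algebra A (opp A)"

text \<open>
  The left module over the enveloping algebra given by a vector space \<open>X\<close> with a left action
  \<open>l a x\<close> and a right action \<open>r x b\<close> of the algebra: \<open>(a \<otimes> b)\<cdot>x = a\<cdot>x\<cdot>b\<close>.
\<close>

definition bimodule ::
  "('k::field, 'x) module \<Rightarrow> ('a \<Rightarrow> 'x \<Rightarrow> 'x) \<Rightarrow> ('x \<Rightarrow> 'a \<Rightarrow> 'x) \<Rightarrow>
   (('k, 'a) env, 'x) module" where
  "bimodule X l r = \<lparr>carrier = carrier X, mult = mult X, one = one X, zero = zero X, add = add X,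
     smult = (\<lambda>t x. tensor_lift X (\<lambda>a b. l a (r x b)) t)\<rparr>"

definition twisted_bimodule ::
  "('k::field, 'a) module \<Rightarrow> ('a \<Rightarrow> 'a) \<Rightarrow> (('k, 'a) env, 'a) module" where
  "twisted_bimodule A \<phi> = bimodule A (\<lambda>a x. a \<otimes>\<^bsub>A\<^esub> x) (\<lambda>x b. x \<otimes>\<^bsub>A\<^esub> \<phi> b)"

definition regular_bimodule :: "('k::field, 'a) module \<Rightarrow> (('k, 'a) env, 'a) module" where
  "regular_bimodule A = bimodule A (\<lambda>a x. a \<otimes>\<^bsub>A\<^esub> x) (\<lambda>x b. x \<otimes>\<^bsub>A\<^esub> b)"

definition dual_bimodule :: "('k::field, 'a) module \<Rightarrow> (('k, 'a) env, 'a \<Rightarrow> 'k) module" where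
  "dual_bimodule A = bimodule (dual A)
     (\<lambda>a f. \<lambda>x\<in>carrier A. f (x \<otimes>\<^bsub>A\<^esub> a)) (\<lambda>f b. \<lambda>x\<in>carrier A. f (b \<otimes>\<^bsub>A\<^esub> x))"

text \<open>
  The algebra as a right module over its enveloping algebra, \<open>x\<cdot>(a \<otimes> b) = b\<cdot>x\<cdot>a\<close>.
\<close>

definition regular_bimodule_right :: "('k::field, 'a) module \<Rightarrow> (('k, 'a) env, 'a) module" where
  "regular_bimodule_right A = bimodule A (\<lambda>a x. x \<otimes>\<^bsub>A\<^esub> a) (\<lambda>x b. b \<otimes>\<^bsub>A\<^esub> x)"

section \<open>Projective and injective modules\<close>

text \<open>
  Every finite-dimensional module is isomorphic to one whose carrier is a subset of the type
  \<open>nat \<Rightarrow> 'k\<close>. Quantifying over modules on that type therefore amounts to quantifying over all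
  objects of the category of finite-dimensional modules; projective and injective mean projective
  and injective in this category.
\<close>

type_synonym ('k, 'l) umodule = "('l, nat \<Rightarrow> 'k) module"

definition projective :: "('k::field, 'l) module \<Rightarrow> ('l, 'm) module \<Rightarrow> bool" where
  "projective L P \<longleftrightarrow> left_module L P \<and>
     (\<forall>(X :: ('k, 'l) umodule) (Y :: ('k, 'l) umodule).
        \<forall>g\<in>module_hom L X Y. \<forall>f\<in>module_hom L P Y.
          fd_module L X \<and> fd_module L Y \<and> g ` carrier X = carrier Y \<longrightarrow>
          (\<exists>h\<in>module_hom L P X. \<forall>x\<in>carrier P. g (h x) = f x))"

definition injective :: "('k::field, 'l) module \<Rightarrow> ('l, 'm) module \<Rightarrow> bool" where
  "injective L I \<longleftrightarrow> left_module L I \<and>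
     (\<forall>(X :: ('k, 'l) umodule) (Y :: ('k, 'l) umodule).
        \<forall>i\<in>module_hom L X Y. \<forall>f\<in>module_hom L X I.
          fd_module L X \<and> fd_module L Y \<and> inj_on i (carrier X) \<longrightarrow>
          (\<exists>h\<in>module_hom L Y I. \<forall>x\<in>carrier X. h (i x) = f x))"

definition self_injective :: "('k::field, 'a) module \<Rightarrow> bool" where
  "self_injective A \<longleftrightarrow> injective A (regular A)"

definition maximal_left_ideal :: "('k, 'a) module \<Rightarrow> 'a set \<Rightarrow> bool" where
  "maximal_left_ideal A I \<longleftrightarrow> Module.submodule I A (regular A) \<and> I \<noteq> carrier A \<and>
     (\<forall>J. Module.submodule J A (regular A) \<and> I \<subseteq> J \<longrightarrow> J = I \<or> J = carrier A)"

definition jacobson_radical :: "('k, 'a) module \<Rightarrow> 'a set" where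
  "jacobson_radical A = carrier A \<inter> \<Inter>{I. maximal_left_ideal A I}"

definition separable_algebra :: "('k::field, 'a) module \<Rightarrow> bool" where
  "separable_algebra B \<longleftrightarrow> k_algebra B \<and> projective (enveloping B) (regular_bimodule B)"

section \<open>The stable category and Tate extension groups\<close>

definition proj_maps ::
  "('k::field, 'l) module \<Rightarrow> ('l, 'm) module \<Rightarrow> ('l, 'n) module \<Rightarrow> ('m \<Rightarrow> 'n) set" where
  "proj_maps L U V = {f \<in> carrier (hom_space L U V).
     \<exists>P :: ('k, 'l) umodule. fd_module L P \<and> projective L P \<and>
       (\<exists>g\<in>module_hom L U P. \<exists>h\<in>module_hom L P V. \<forall>x\<in>carrier U. f x = h (g x))}"

definition stable_hom ::
  "('k::field, 'l) module \<Rightarrow> ('l, 'm) module \<Rightarrow> ('l, 'n) module \<Rightarrow> ('k, ('m \<Rightarrow> 'n) set) module" where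
  "stable_hom L U V = quot (hom_space L U V) (proj_maps L U V)"

definition short_exact ::
  "('k::field, 'l) module \<Rightarrow> ('l, 'm) module \<Rightarrow> ('m \<Rightarrow> 'n) \<Rightarrow> ('l, 'n) module \<Rightarrow>
   ('n \<Rightarrow> 'p) \<Rightarrow> ('l, 'p) module \<Rightarrow> bool" where
  "short_exact L X i Y p Z \<longleftrightarrow>
     i \<in> module_hom L X Y \<and> p \<in> module_hom L Y Z \<and>
     inj_on i (carrier X) \<and> p ` carrier Y = carrier Z \<and>
     i ` carrier X = {y \<in> carrier Y. p y = \<zero>\<^bsub>Z\<^esub>}"

text \<open>
  The kernel of some surjection from a projective module and the cokernel of some embedding into
  an injective module. By Schanuel's lemma they are unique up to projective, respectively
  injective, direct summands, that is, up to isomorphism in the stable category.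
\<close>

definition Syzygy :: "('k::field, 'l) module \<Rightarrow> ('k, 'l) umodule \<Rightarrow> ('k, 'l) umodule" where
  "Syzygy L V = (SOME W. fd_module L W \<and>
     (\<exists>(P :: ('k, 'l) umodule) i p.
        fd_module L P \<and> projective L P \<and> short_exact L W i P p V))"

definition Cosyzygy :: "('k::field, 'l) module \<Rightarrow> ('k, 'l) umodule \<Rightarrow> ('k, 'l) umodule" where
  "Cosyzygy L V = (SOME W. fd_module L W \<and>
     (\<exists>(I :: ('k, 'l) umodule) i p.
        fd_module L I \<and> injective L I \<and> short_exact L V i I p W))"

text \<open>
  The \<open>n\<close>-fold suspension in the stable category. The module \<open>V\<close> is first replaced by an
  isomorphic copy on the type \<open>nat \<Rightarrow> 'k\<close>, so that syzygies and cosyzygies can be iterated.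
\<close>

definition Suspension ::
  "('k::field, 'l) module \<Rightarrow> int \<Rightarrow> ('l, 'm) module \<Rightarrow> ('k, 'l) umodule" where
  "Suspension L n V =
     (let V' = (SOME W. fd_module L W \<and> lmod_iso L V W)
      in if n \<ge> 0 then (Cosyzygy L ^^ nat n) V' else (Syzygy L ^^ nat (- n)) V')"

definition tate_ext ::
  "('k::field, 'l) module \<Rightarrow> int \<Rightarrow> ('l, 'm) module \<Rightarrow> ('l, 'n) module \<Rightarrow>
   ('k, ('m \<Rightarrow> nat \<Rightarrow> 'k) set) module" where
  "tate_ext L n U V = stable_hom L U (Suspension L n V)"

section \<open>Tor and Hochschild homology\<close>

definition proj_resolution ::
  "('k::field, 'l) module \<Rightarrow> ('l, 'm) module \<Rightarrow> (nat \<Rightarrow> ('k, 'l) umodule) \<Rightarrow>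
   (nat \<Rightarrow> (nat \<Rightarrow> 'k) \<Rightarrow> (nat \<Rightarrow> 'k)) \<Rightarrow> bool" where
  "proj_resolution L M P d \<longleftrightarrow>
     (\<forall>n. fd_module L (P n) \<and> projective L (P n) \<and> d n \<in> module_hom L (P (Suc n)) (P n)) \<and>
     (\<forall>n. d (Suc n) ` carrier (P (Suc (Suc n))) =
          {x \<in> carrier (P (Suc n)). d n x = \<zero>\<^bsub>P n\<^esub>}) \<and>
     (\<exists>\<epsilon>\<in>module_hom L (P 0) M. \<epsilon> ` carrier (P 0) = carrier M \<and>
          d 0 ` carrier (P 1) = {x \<in> carrier (P 0). \<epsilon> x = \<zero>\<^bsub>M\<^esub>})"

text \<open>
  \<open>tor L n M N\<close> is the homology in degree \<open>n\<close> of \<open>P \<otimes>\<^bsub>L\<^esub> N\<close>, where \<open>P\<close> is a projective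
  resolution of the right module \<open>M\<close>.
\<close>

definition tensor_differential ::
  "('k::field, 'l) module \<Rightarrow> (nat \<Rightarrow> ('k, 'l) umodule) \<Rightarrow>
   (nat \<Rightarrow> (nat \<Rightarrow> 'k) \<Rightarrow> (nat \<Rightarrow> 'k)) \<Rightarrow> ('l, 'n) module \<Rightarrow> nat \<Rightarrow>
   ((nat \<Rightarrow> 'k) \<times> 'n \<Rightarrow> 'k) set \<Rightarrow> ((nat \<Rightarrow> 'k) \<times> 'n \<Rightarrow> 'k) set" where
  "tensor_differential L P d N n =
     tensor_lift (tensor L (P n) N) (\<lambda>x y. pure_tensor L (P n) N (d n x) y)"

definition tensor_cycles ::
  "('k::field, 'l) module \<Rightarrow> (nat \<Rightarrow> ('k, 'l) umodule) \<Rightarrow>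
   (nat \<Rightarrow> (nat \<Rightarrow> 'k) \<Rightarrow> (nat \<Rightarrow> 'k)) \<Rightarrow> ('l, 'n) module \<Rightarrow> nat \<Rightarrow>
   ((nat \<Rightarrow> 'k) \<times> 'n \<Rightarrow> 'k) set set" where
  "tensor_cycles L P d N n =
     (case n of
        0 \<Rightarrow> carrier (tensor L (P 0) N)
      | Suc k \<Rightarrow> {t \<in> carrier (tensor L (P (Suc k)) N).
                   tensor_differential L P d N k t = \<zero>\<^bsub>tensor L (P k) N\<^esub>})"

definition tor ::
  "('k::field, 'l) module \<Rightarrow> nat \<Rightarrow> ('l, 'm) module \<Rightarrow> ('l, 'n) module \<Rightarrow>
   ('k, ((nat \<Rightarrow> 'k) \<times> 'n \<Rightarrow> 'k) set set) module" where
  "tor L n M N =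
     (let (P, d) = (SOME (P, d). proj_resolution (opp L) M P d)
      in quot ((tensor L (P n) N)\<lparr>carrier := tensor_cycles L P d N n\<rparr>)
              (tensor_differential L P d N n ` carrier (tensor L (P (Suc n)) N)))"

definition hochschild_homology ::
  "('k::field, 'a) module \<Rightarrow> nat \<Rightarrow> (('k, 'a) env, 'm) module \<Rightarrow>
   ('k, ((nat \<Rightarrow> 'k) \<times> 'm \<Rightarrow> 'k) set set) module" where
  "hochschild_homology A n M = tor (enveloping A) n (regular_bimodule_right A) M"

section \<open>The Nakayama automorphism\<close>

definition nakayama_automorphism :: "('k::field, 'a) module \<Rightarrow> ('a \<Rightarrow> 'a) \<Rightarrow> bool" where
  "nakayama_automorphism A \<nu> \<longleftrightarrow>
     \<nu> \<in> ring_iso A A \<and> \<nu> \<in> module_hom class_ring A A \<and>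
     lmod_iso (enveloping A) (dual_bimodule A) (twisted_bimodule A \<nu>)"

definition aut_power :: "('k, 'a) module \<Rightarrow> ('a \<Rightarrow> 'a) \<Rightarrow> int \<Rightarrow> 'a \<Rightarrow> 'a" where
  "aut_power A \<nu> m = (if m \<ge> 0 then \<nu> ^^ nat m else inv_into (carrier A) \<nu> ^^ nat (- m))"

definition omega_power ::
  "('k::field, 'a) module \<Rightarrow> ('a \<Rightarrow> 'a) \<Rightarrow> int \<Rightarrow> (('k, 'a) env, 'a) module" where
  "omega_power A \<nu> m = twisted_bimodule A (aut_power A \<nu> m)"

end

theory Submission
  imports Defs
begin

text \<open>
  All spaces involved are finite-dimensional, so only dimensions have to be compared. The image of
  the unit under \<open>\<^sub>1A\<^sub>\<nu> \<cong> DA\<close> is a Frobenius form \<open>\<lambda>\<close> on \<open>A\<close> with \<open>\<lambda>(xy) = \<lambda>(y \<nu>(x))\<close>; hence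
  \<open>A\<^sup>e\<close> is a Frobenius algebra with Nakayama automorphism \<open>\<sigma> = \<nu> \<otimes> \<nu>\<^sup>-\<^sup>1\<close>. Over a Frobenius algebra
  projective and injective modules coincide and the maps that factor through a projective are the
  traces \<open>x \<mapsto> \<Sum> c\<^sub>i \<phi>(b\<^sub>i x)\<close> of linear maps \<open>\<phi>\<close>. The bilinear form
  \<open>tr(\<phi> \<psi>)\<close> makes taking traces self-adjoint up to the twist by \<open>\<tau> = \<sigma>\<^sup>-\<^sup>1\<close>, so as many
  independent maps \<open>U \<rightarrow> V\<close> as maps \<open>V \<rightarrow> \<^sub>\<tau>U\<close> factor through projectives. Along
  \<open>0 \<rightarrow> \<Omega>V \<rightarrow> P \<rightarrow> V \<rightarrow> 0\<close> this becomes Serre duality: the stable homomorphisms \<open>U \<rightarrow> \<Omega>V\<close> and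
  \<open>V \<rightarrow> \<^sub>\<tau>U\<close> form spaces of equal dimension. For \<open>U = A\<close> one twists by \<open>1 \<otimes> \<nu>\<^sup>m\<^sup>-\<^sup>2\<close> and shifts.

  For Hochschild homology, \<open>P \<otimes> N\<close> is dual to \<open>Hom(P, DN)\<close>. Applied to a projective resolution
  of \<open>A\<close> this makes \<open>Tor\<^sub>n(A, N)\<close>, for \<open>n \<ge> 1\<close>, dual to the stable homomorphisms
  \<open>\<Omega>\<^sup>nA \<rightarrow> DN\<close>, and \<open>D(\<omega>\<^sup>1\<^sup>-\<^sup>m) \<cong> \<omega>\<^sup>m\<close>.
\<close>

section \<open>Linear algebra over the ground field\<close>

text \<open>Syzygies, cosyzygies and the resolution behind \<open>tor\<close> are chosen by
  \<open>SOME\<close>, and \<open>projective\<close> tests only against modules on one carrier type.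
  So nothing may depend on a particular choice: projectivity is replaced by \<open>relproj\<close>,
  a condition on a single module of any carrier type, and iterated syzygies and cosyzygies by
  arbitrary sequences \<open>syz_seq\<close> and \<open>cosyz_seq\<close>. No triangulated structure
  is set up: the adjunction between \<Omega> and its inverse comes from applying Serre duality
  twice.

  The exponent 2 - m has its origin in \<tau> = \<nu>^-1 \<otimes> \<nu>. Pulled back along \<tau>,
  the bimodule A is twisted on both sides; the map \<nu> moves the left twist to the right and
  identifies the result with \<omega>^2. The further twist by 1 \<otimes> \<nu>^(m-2) turns this
  into \<omega>^m and turns \<omega>^(2-m) into A. The degree -n-1 in place of -n reflects the
  single \<Omega> in Serre duality.\<close>

locale kspace = abelian_group V for V :: "('k::field, 'v) module" (structure) +
  assumes smult_closed [simp, intro]: "x \<in> carrier V \<Longrightarrow> c \<odot> x \<in> carrier V"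
    and smult_l_distr: "x \<in> carrier V \<Longrightarrow> (c + d) \<odot> x = c \<odot> x \<oplus> d \<odot> x"
    and smult_r_distr: "x \<in> carrier V \<Longrightarrow> y \<in> carrier V \<Longrightarrow> c \<odot> (x \<oplus> y) = c \<odot> x \<oplus> c \<odot> y"
    and smult_assoc: "x \<in> carrier V \<Longrightarrow> (c * d) \<odot> x = c \<odot> (d \<odot> x)"
    and smult_one [simp]: "x \<in> carrier V \<Longrightarrow> 1 \<odot> x = x"

text \<open>In \<open>kspace\<close> the scalars range over the whole type, which removes the
  membership conditions in \<open>carrier class_ring\<close>; through this equivalence bases and
  rank-nullity are imported from \<open>vectorspace\<close>.\<close>

lemma kspace_iff: "kspace V \<longleftrightarrow> vectorspace class_ring (V :: ('k::field, 'v) module)"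
proof
  assume "kspace V"
  then interpret kspace V .
  show "vectorspace class_ring V"
    by (intro vectorspace.intro Module.module.intro class_field class_cring.is_cring abelian_group_axioms
        Module.module_axioms.intro)
      (auto simp: smult_l_distr smult_r_distr smult_assoc)
next
  assume "vectorspace class_ring V"
  then interpret vectorspace class_ring V .
  show "kspace V"
    using smult_l_distr smult_r_distr smult_assoc1 smult_one smult_closed by unfold_locales auto
qed

section \<open>Additive maps and finite sums in abelian groups\<close>

lemma additive_zero:
  assumes "abelian_group M" "abelian_group N" "f \<in> carrier M \<rightarrow> carrier N"
    and "\<And>x y. x \<in> carrier M \<Longrightarrow> y \<in> carrier M \<Longrightarrow> f (x \<oplus>\<^bsub>M\<^esub> y) = f x \<oplus>\<^bsub>N\<^esub> f y"
  shows "f \<zero>\<^bsub>M\<^esub> = \<zero>\<^bsub>N\<^esub>"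
proof -
  interpret M: abelian_group M by fact
  interpret N: abelian_group N by fact
  have "f \<zero>\<^bsub>M\<^esub> \<in> carrier N" using assms(3) by auto
  moreover have "f \<zero>\<^bsub>M\<^esub> \<oplus>\<^bsub>N\<^esub> f \<zero>\<^bsub>M\<^esub> = f \<zero>\<^bsub>M\<^esub>"
    using assms(4)[of "\<zero>\<^bsub>M\<^esub>" "\<zero>\<^bsub>M\<^esub>"] by simp
  ultimately show ?thesis by (metis N.add.l_cancel_one)
qed

text \<open>Only additivity is asked for, so the lemma also applies to evaluation at a point, to the
  action of a fixed ring element and to \<open>pure_tensor\<close> in one argument. For an infinite
  index set both sums are zero by convention.\<close>

lemma additive_finsum:
  assumes "abelian_group M" "abelian_group N" "f \<in> carrier M \<rightarrow> carrier N"
    and "\<And>x y. x \<in> carrier M \<Longrightarrow> y \<in> carrier M \<Longrightarrow> f (x \<oplus>\<^bsub>M\<^esub> y) = f x \<oplus>\<^bsub>N\<^esub> f y"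
    and "g \<in> A \<rightarrow> carrier M"
  shows "f (finsum M g A) = finsum N (\<lambda>i. f (g i)) A"
proof -
  interpret M: abelian_group M by fact
  interpret N: abelian_group N by fact
  note z = additive_zero[OF assms(1-4)]
  show ?thesis using assms(5)
  proof (induction A rule: infinite_finite_induct)
    case (insert a A)
    then have "g a \<in> carrier M" "g \<in> A \<rightarrow> carrier M" by auto
    moreover from this have "(\<lambda>i. f (g i)) \<in> A \<rightarrow> carrier N" "f (g a) \<in> carrier N"
      using assms(3) by auto
    ultimately show ?case using insert by (simp add: assms(4))
  qed (use z in auto)
qed

lemma (in abelian_monoid) finsum_swap:
  assumes "finite A" "finite B" "\<And>i j. i \<in> A \<Longrightarrow> j \<in> B \<Longrightarrow> f i j \<in> carrier G"
  shows "(\<Oplus>i\<in>A. \<Oplus>j\<in>B. f i j) = (\<Oplus>j\<in>B. \<Oplus>i\<in>A. f i j)"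
  using assms(1,3)
proof (induction A)
  case (insert a A)
  have "(\<Oplus>j\<in>B. \<Oplus>i\<in>insert a A. f i j) = (\<Oplus>j\<in>B. f a j \<oplus> (\<Oplus>i\<in>A. f i j))"
    using insert by (intro finsum_cong') auto
  also have "\<dots> = (\<Oplus>j\<in>B. f a j) \<oplus> (\<Oplus>j\<in>B. \<Oplus>i\<in>A. f i j)"
    using insert by (intro finsum_addf) auto
  finally show ?case using insert by (subst finsum_insert) auto
qed auto

lemma (in abelian_monoid) finsum_Times:
  assumes "finite A" "finite B" "\<And>i j. i \<in> A \<Longrightarrow> j \<in> B \<Longrightarrow> f i j \<in> carrier G"
  shows "(\<Oplus>p\<in>A \<times> B. f (fst p) (snd p)) = (\<Oplus>i\<in>A. \<Oplus>j\<in>B. f i j)"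
  using assms(1,3)
proof (induction A)
  case (insert a A)
  have "insert a A \<times> B = ({a} \<times> B) \<union> (A \<times> B)" by auto
  moreover have "(\<Oplus>p\<in>{a} \<times> B. f (fst p) (snd p)) = (\<Oplus>j\<in>B. f a j)"
  proof -
    have "{a} \<times> B = Pair a ` B" by auto
    then show ?thesis using insert by (subst \<open>{a} \<times> B = _\<close>, subst finsum_reindex) (auto simp: inj_on_def)
  qed
  ultimately show ?case using insert assms(2) by (simp add: finsum_Un_disjoint) (subst finsum_Un_disjoint, auto)
qed auto

lemma (in abelian_monoid) finsum_all_zero: "(\<And>i. i \<in> A \<Longrightarrow> f i = \<zero>) \<Longrightarrow> finsum G f A = \<zero>"
  using add.finprod_one_eqI by auto

lemma (in abelian_monoid) finsum_single:
  assumes "finite A" "a \<in> A" "f a \<in> carrier G" "\<And>i. i \<in> A \<Longrightarrow> i \<noteq> a \<Longrightarrow> f i = \<zero>"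
  shows "finsum G f A = f a"
proof -
  have "finsum G f A = (\<Oplus>i\<in>A. if a = i then f i else \<zero>)"
    using assms by (intro finsum_cong') auto
  also have "\<dots> = f a" using add.finprod_singleton[of a A "\<lambda>_. f a"] assms
    by (intro trans[OF finsum_cong' finsum_singleton]) auto
  finally show ?thesis .
qed

section \<open>Homomorphisms and linear maps\<close>

abbreviation klin :: "('k::field, 'v) module \<Rightarrow> ('k, 'w) module \<Rightarrow> ('v \<Rightarrow> 'w) set" where
  "klin V W \<equiv> module_hom class_ring V W"

lemma modhomI:
  assumes "\<And>x. x \<in> carrier M \<Longrightarrow> f x \<in> carrier N"
    and "\<And>x y. x \<in> carrier M \<Longrightarrow> y \<in> carrier M \<Longrightarrow> f (x \<oplus>\<^bsub>M\<^esub> y) = f x \<oplus>\<^bsub>N\<^esub> f y"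
    and "\<And>r x. r \<in> carrier R \<Longrightarrow> x \<in> carrier M \<Longrightarrow> f (r \<odot>\<^bsub>M\<^esub> x) = r \<odot>\<^bsub>N\<^esub> f x"
  shows "f \<in> module_hom R M N"
  using assms unfolding LinearCombinations.module_hom_def by auto

lemma modhom_closed: "f \<in> module_hom R M N \<Longrightarrow> x \<in> carrier M \<Longrightarrow> f x \<in> carrier N"
  unfolding LinearCombinations.module_hom_def by auto

lemma modhom_add: "f \<in> module_hom R M N \<Longrightarrow> x \<in> carrier M \<Longrightarrow> y \<in> carrier M \<Longrightarrow>
    f (x \<oplus>\<^bsub>M\<^esub> y) = f x \<oplus>\<^bsub>N\<^esub> f y"
  unfolding LinearCombinations.module_hom_def by auto

lemma modhom_smult: "f \<in> module_hom R M N \<Longrightarrow> r \<in> carrier R \<Longrightarrow> x \<in> carrier M \<Longrightarrow>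
    f (r \<odot>\<^bsub>M\<^esub> x) = r \<odot>\<^bsub>N\<^esub> f x"
  unfolding LinearCombinations.module_hom_def by auto

lemma klin_smult: "f \<in> klin V W \<Longrightarrow> x \<in> carrier V \<Longrightarrow> f (c \<odot>\<^bsub>V\<^esub> x) = c \<odot>\<^bsub>W\<^esub> f x"
  by (simp add: LinearCombinations.module_hom_def)

lemma modhom_comp:
  "f \<in> module_hom R M N \<Longrightarrow> g \<in> module_hom R N P \<Longrightarrow> (\<lambda>x. g (f x)) \<in> module_hom R M P"
  by (intro modhomI) (auto simp: modhom_closed modhom_add modhom_smult)

lemma modhom_id: "(\<lambda>x. x) \<in> module_hom R M M"
  unfolding LinearCombinations.module_hom_def by auto

lemma modhom_cong:
  assumes "abelian_group M" "\<And>r x. r \<in> carrier R \<Longrightarrow> x \<in> carrier M \<Longrightarrow> r \<odot>\<^bsub>M\<^esub> x \<in> carrier M"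
    "f \<in> module_hom R M N" "\<And>x. x \<in> carrier M \<Longrightarrow> g x = f x"
  shows "g \<in> module_hom R M N"
proof -
  interpret abelian_group M by fact
  show ?thesis using assms(2-4) unfolding LinearCombinations.module_hom_def by auto
qed

lemma modhom_zero:
  assumes "abelian_group M" "abelian_group N" "f \<in> module_hom R M N"
  shows "f \<zero>\<^bsub>M\<^esub> = \<zero>\<^bsub>N\<^esub>"
  using assms by (intro additive_zero) (auto simp: LinearCombinations.module_hom_def)

lemma modhom_finsum:
  assumes "abelian_group M" "abelian_group N" "f \<in> module_hom R M N" "g \<in> A \<rightarrow> carrier M"
  shows "f (finsum M g A) = finsum N (\<lambda>i. f (g i)) A"
  using assms by (intro additive_finsum) (auto simp: LinearCombinations.module_hom_def)

lemma modhom_inv_into: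
  assumes "f \<in> module_hom R M N" "bij_betw f (carrier M) (carrier N)"
    "abelian_group M" "\<And>r x. r \<in> carrier R \<Longrightarrow> x \<in> carrier M \<Longrightarrow> r \<odot>\<^bsub>M\<^esub> x \<in> carrier M"
  shows "inv_into (carrier M) f \<in> module_hom R N M"
proof -
  interpret M: abelian_group M by fact
  let ?g = "inv_into (carrier M) f"
  have g: "?g y \<in> carrier M" "f (?g y) = y" if "y \<in> carrier N" for y
    using assms(2) that by (auto simp: bij_betw_def inv_into_into f_inv_into_f)
  have gf: "?g (f x) = x" if "x \<in> carrier M" for x
    using assms(2) that by (auto simp: bij_betw_def)
  show ?thesis
  proof (rule modhomI)
    fix x y assume "x \<in> carrier N" "y \<in> carrier N"
    then have "x \<oplus>\<^bsub>N\<^esub> y = f (?g x \<oplus>\<^bsub>M\<^esub> ?g y)" using g modhom_add[OF assms(1)] by simp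
    then show "?g (x \<oplus>\<^bsub>N\<^esub> y) = ?g x \<oplus>\<^bsub>M\<^esub> ?g y"
      using gf g \<open>x \<in> _\<close> \<open>y \<in> _\<close> by simp
  next
    fix r x assume "r \<in> carrier R" "x \<in> carrier N"
    then have "r \<odot>\<^bsub>N\<^esub> x = f (r \<odot>\<^bsub>M\<^esub> ?g x)" using g modhom_smult[OF assms(1)] by simp
    then show "?g (r \<odot>\<^bsub>N\<^esub> x) = r \<odot>\<^bsub>M\<^esub> ?g x"
      using gf g assms(4) \<open>x \<in> _\<close> \<open>r \<in> _\<close> by simp
  qed (use g in auto)
qed

section \<open>The ground field, scalars and coordinates\<close>

lemma ground_simps [simp]:
  "carrier ground = UNIV" "add ground = (+)" "zero ground = 0" "smult ground = (*)"
  "mult ground = (*)" "one ground = (1 :: 'k::field)"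
  by (auto simp: regular_def)

lemma kspace_ground [simp]: "kspace ground"
proof -
  have *: "abelian_group (ground :: ('k::field, 'k) module)"
    by (rule abelian_groupI) (auto simp: algebra_simps, metis add.right_inverse)
  show ?thesis by (intro kspace.intro * kspace_axioms.intro) (auto simp: algebra_simps)
qed

lemma finsum_ground [simp]: "finsum ground f A = sum f A"
proof -
  interpret kspace ground by simp
  show ?thesis by (induction A rule: infinite_finite_induct) auto
qed

context kspace
begin

lemma smult_zero [simp]: "x \<in> carrier V \<Longrightarrow> 0 \<odot> x = \<zero>"
proof -
  assume x: "x \<in> carrier V"
  have "0 \<odot> x \<oplus> 0 \<odot> x = 0 \<odot> x" using smult_l_distr[OF x, of 0 0] by simp
  then show ?thesis using x by (metis add.l_cancel_one smult_closed)
qed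

lemma smult_zero_right [simp]: "c \<odot> \<zero> = \<zero>"
proof -
  have "c \<odot> \<zero> \<oplus> c \<odot> \<zero> = c \<odot> \<zero>" using smult_r_distr[of \<zero> \<zero> c] by simp
  then show ?thesis by (metis add.l_cancel_one smult_closed zero_closed)
qed

lemma smult_minus_one: "x \<in> carrier V \<Longrightarrow> (- 1) \<odot> x = \<ominus> x"
proof -
  assume x: "x \<in> carrier V"
  have "(-1) \<odot> x \<oplus> x = \<zero>" using smult_l_distr[OF x, of "-1" 1] x by simp
  then show ?thesis using x by (metis minus_equality smult_closed)
qed

lemma smult_finsum:
  "f \<in> A \<rightarrow> carrier V \<Longrightarrow> c \<odot> finsum V f A = (\<Oplus>i\<in>A. c \<odot> f i)"
  using abelian_group_axioms by (intro additive_finsum) (auto simp: smult_r_distr)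

lemma vectorspace: "vectorspace class_ring V"
  using kspace_iff kspace_axioms by blast

text \<open>The generators form a family, possibly with repetitions, which suits generators such as
  pure tensors whose distinctness is unknown.\<close>

lemma fin_dimI:
  assumes "finite I" "\<And>i. i \<in> I \<Longrightarrow> v i \<in> carrier V"
    and "\<And>x. x \<in> carrier V \<Longrightarrow> \<exists>a. x = (\<Oplus>i\<in>I. a i \<odot> v i)"
  shows "finite_dimensional V"
proof -
  interpret vs: vectorspace class_ring V by (rule vectorspace)
  have sub: "v ` I \<subseteq> carrier V" using assms by auto
  interpret S: LinearCombinations.submodule class_ring "vs.span (v ` I)" V
    by (rule vs.span_is_submodule[OF sub])
  have "(\<Oplus>i\<in>J. a i \<odot> v i) \<in> vs.span (v ` I)" if "J \<subseteq> I" "finite J" for a J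
    using that(2,1)
  proof (induction J)
    case empty then show ?case by simp
  next
    case (insert j J)
    have "v j \<in> vs.span (v ` I)" using insert sub by (intro vs.span_mem) auto
    moreover have "finsum V (\<lambda>i. a i \<odot> v i) (insert j J) = a j \<odot> v j \<oplus> (\<Oplus>i\<in>J. a i \<odot> v i)"
      using insert assms by (intro finsum_insert) auto
    ultimately show ?case using insert by auto
  qed
  then have "carrier V \<subseteq> vs.span (v ` I)" using assms(1,3) by fastforce
  then show ?thesis unfolding vs.fin_dim_def using assms(1) sub S.subset by (intro exI[of _ "v ` I"]) auto
qed

text \<open>Coefficients in a basis are unique once they are fixed outside \<open>B\<close>; this
  uniqueness makes each coordinate linear and gives the Kronecker delta on the basis.\<close>

lemma coordinates:
  assumes "finite_dimensional V"
  obtains B \<xi> where "finite B" "B \<subseteq> carrier V" "card B = vectorspace.dim class_ring V"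
    "\<And>b. b \<in> B \<Longrightarrow> \<xi> b \<in> klin V ground"
    "\<And>x. x \<in> carrier V \<Longrightarrow> x = (\<Oplus>b\<in>B. \<xi> b x \<odot> b)"
    "\<And>b b'. b \<in> B \<Longrightarrow> b' \<in> B \<Longrightarrow> \<xi> b b' = (if b = b' then 1 else 0)"
proof -
  interpret vs: vectorspace class_ring V by (rule vectorspace)
  obtain B where B: "finite B" "vs.basis B" using vs.finite_basis_exists assms by blast
  then have BV: "B \<subseteq> carrier V" by (simp add: vs.basis_def)
  have ex1: "\<exists>!a. a \<in> B \<rightarrow>\<^sub>E UNIV \<and> (\<Oplus>b\<in>B. a b \<odot> b) = x" if "x \<in> carrier V" for x
    using vs.basis_criterion[OF B(1) BV] B(2) that unfolding vs.lincomb_def by simp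
  define co where "co x = (THE a. a \<in> B \<rightarrow>\<^sub>E UNIV \<and> (\<Oplus>b\<in>B. a b \<odot> b) = x)" for x
  have co: "co x \<in> B \<rightarrow>\<^sub>E UNIV" "(\<Oplus>b\<in>B. co x b \<odot> b) = x" if "x \<in> carrier V" for x
    using theI'[OF ex1[OF that]] unfolding co_def by auto
  have co_unique: "co x b = a b" if "x \<in> carrier V" "(\<Oplus>b\<in>B. a b \<odot> b) = x" "b \<in> B" for x a b
  proof -
    have "(\<Oplus>b\<in>B. restrict a B b \<odot> b) = (\<Oplus>b\<in>B. a b \<odot> b)"
      using BV by (intro finsum_cong') auto
    then have "restrict a B \<in> B \<rightarrow>\<^sub>E UNIV \<and> (\<Oplus>b\<in>B. restrict a B b \<odot> b) = x" using that(2) by auto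
    then have "co x = restrict a B" unfolding co_def using ex1[OF that(1)] by (intro the1_equality)
    then show ?thesis using that by simp
  qed
  show ?thesis
  proof (rule that[OF B(1) BV, of "\<lambda>b x. co x b"])
    show "card B = vs.dim" using vs.dim_basis B by simp
    show "(\<lambda>x. co x b) \<in> klin V ground" if "b \<in> B" for b
    proof (rule modhomI)
      fix x y assume xy: "x \<in> carrier V" "y \<in> carrier V"
      have "(\<Oplus>b\<in>B. (co x b + co y b) \<odot> b) = (\<Oplus>b\<in>B. co x b \<odot> b \<oplus> co y b \<odot> b)"
        using BV by (intro finsum_cong') (auto simp: smult_l_distr)
      also have "\<dots> = x \<oplus> y" using BV xy co by (subst finsum_addf) auto
      finally show "co (x \<oplus> y) b = co x b \<oplus>\<^bsub>ground\<^esub> co y b" using xy that by (simp add: co_unique)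
    next
      fix c x assume x: "x \<in> carrier V"
      have "(\<Oplus>b\<in>B. (c * co x b) \<odot> b) = (\<Oplus>b\<in>B. c \<odot> (co x b \<odot> b))"
        using BV by (intro finsum_cong') (auto simp: smult_assoc)
      also have "\<dots> = c \<odot> x" using BV x co by (subst smult_finsum[symmetric]) auto
      finally show "co (c \<odot> x) b = c \<odot>\<^bsub>ground\<^esub> co x b" using x that by (simp add: co_unique)
    qed simp
    show "x = (\<Oplus>b\<in>B. co x b \<odot> b)" if "x \<in> carrier V" for x using co that by simp
    show "co b' b = (if b = b' then 1 else 0)" if "b \<in> B" "b' \<in> B" for b b'
    proof (rule co_unique)
      show "(\<Oplus>b\<in>B. (if b = b' then 1 else 0) \<odot> b) = b'"
        using B(1) BV that by (subst finsum_single[of B b']) auto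
    qed (use that BV in auto)
  qed
qed

end

section \<open>Subspaces, dimension and rank\<close>

definition ksub :: "('k::field, 'v) module \<Rightarrow> 'v set \<Rightarrow> bool" where
  "ksub V S \<longleftrightarrow> S \<subseteq> carrier V \<and> \<zero>\<^bsub>V\<^esub> \<in> S \<and> (\<forall>x\<in>S. \<forall>y\<in>S. x \<oplus>\<^bsub>V\<^esub> y \<in> S) \<and>
     (\<forall>c. \<forall>x\<in>S. c \<odot>\<^bsub>V\<^esub> x \<in> S)"

abbreviation sub :: "('k::field, 'v) module \<Rightarrow> 'v set \<Rightarrow> ('k, 'v) module" where
  "sub V S \<equiv> V\<lparr>carrier := S\<rparr>"

definition fdspace :: "('k::field, 'v) module \<Rightarrow> bool" where
  "fdspace V \<longleftrightarrow> kspace V \<and> finite_dimensional V"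

definition kdim :: "('k::field, 'v) module \<Rightarrow> nat" where
  "kdim V = vectorspace.dim class_ring V"

lemma ksub_iff: "kspace V \<Longrightarrow> ksub V S \<longleftrightarrow> LinearCombinations.submodule class_ring S V"
  unfolding kspace_iff ksub_def LinearCombinations.submodule_def vectorspace_def by auto

lemma kspace_sub: "kspace V \<Longrightarrow> ksub V S \<Longrightarrow> kspace (sub V S)"
  by (metis kspace_iff ksub_iff subspace_def vectorspace.subspace_is_vs)

text \<open>Independence in the subspace and in \<open>V\<close> agree, so an independent subset of
  \<open>S\<close> has at most dim \<open>V\<close> elements; a maximal one exists and spans
  \<open>S\<close>.\<close>

lemma fdspace_sub:
  assumes "fdspace V" "ksub V S"
  shows "fdspace (sub V S)"
proof -
  have kV: "kspace V" using assms by (simp add: fdspace_def)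
  interpret V: vectorspace class_ring V using kV by (simp add: kspace_iff)
  have kS: "kspace (sub V S)" using kspace_sub kV assms by blast
  interpret S: vectorspace class_ring "sub V S" using kS by (simp add: kspace_iff)
  have sm: "LinearCombinations.submodule class_ring S V" using assms kV by (simp add: ksub_iff)
  let ?P = "\<lambda>A. A \<subseteq> carrier (sub V S) \<and> S.lin_indpt A"
  have ld: "S.lin_dep A = V.lin_dep A" if "A \<subseteq> S" for A
    by (rule V.span_li_not_depend(2)[OF that sm])
  have "\<exists>A. finite A \<and> maximal A ?P"
  proof (rule maximal_exists)
    show "finite A \<and> card A \<le> V.dim" if "?P A" for A
      using that ld assms V.li_le_dim[of A] unfolding ksub_def fdspace_def by auto
    show "?P {}" by (auto simp: S.lin_dep_def)
  qed
  then obtain A where A: "finite A" "maximal A ?P" by blast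
  then have "S.gen_set A" "A \<subseteq> S" using S.max_li_is_gen by (auto simp: maximal_def)
  then have "S.fin_dim" unfolding S.fin_dim_def using A by (intro exI[of _ A]) auto
  then show ?thesis using kS by (simp add: fdspace_def)
qed

lemma ksub_image:
  assumes "kspace V" "kspace W" "f \<in> klin V W"
  shows "ksub W (f ` carrier V)"
proof -
  interpret V: kspace V by fact
  interpret W: kspace W by fact
  have "f \<zero>\<^bsub>V\<^esub> = \<zero>\<^bsub>W\<^esub>"
    using modhom_zero assms V.abelian_group_axioms W.abelian_group_axioms by blast
  then have "\<zero>\<^bsub>W\<^esub> \<in> f ` carrier V" by (metis V.zero_closed imageI)
  moreover have "f x \<oplus>\<^bsub>W\<^esub> f y \<in> f ` carrier V" if "x \<in> carrier V" "y \<in> carrier V" for x y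
    using modhom_add[OF assms(3) that] that by (metis V.a_closed imageI)
  moreover have "c \<odot>\<^bsub>W\<^esub> f x \<in> f ` carrier V" if "x \<in> carrier V" for x c
    using klin_smult[OF assms(3) that] that by (metis V.smult_closed imageI)
  ultimately show ?thesis using modhom_closed[OF assms(3)] unfolding ksub_def by auto
qed

lemma ksub_kernel:
  assumes "kspace V" "kspace W" "f \<in> klin V W"
  shows "ksub V {x \<in> carrier V. f x = \<zero>\<^bsub>W\<^esub>}"
proof -
  interpret V: kspace V by fact
  interpret W: kspace W by fact
  have "f \<zero>\<^bsub>V\<^esub> = \<zero>\<^bsub>W\<^esub>"
    using modhom_zero assms V.abelian_group_axioms W.abelian_group_axioms by blast
  then show ?thesis using assms(3) by (auto simp: ksub_def modhom_add klin_smult)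
qed

text \<open>For the second claim \<open>f\<close> is viewed as a surjection onto its image, which
  inherits a finite generating set.\<close>

lemma rank_nullity:
  assumes "fdspace V" "kspace W" "f \<in> klin V W"
  shows "kdim V = kdim (sub V {x \<in> carrier V. f x = \<zero>\<^bsub>W\<^esub>}) + kdim (sub W (f ` carrier V))"
    and "fdspace (sub W (f ` carrier V))"
proof -
  have kV: "kspace V" using assms by (simp add: fdspace_def)
  have lm: "linear_map class_ring V X f" if "kspace X" "f \<in> klin V X" for X
    using kV that unfolding linear_map_def mod_hom_def mod_hom_axioms_def kspace_iff vectorspace_def
    by auto
  interpret linear_map class_ring V W f using lm assms by blast
  show "kdim V = kdim (sub V {x \<in> carrier V. f x = \<zero>\<^bsub>W\<^esub>}) + kdim (sub W (f ` carrier V))"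
    using rank_nullity assms(1) by (simp add: kdim_def fdspace_def im_def ker_def add.commute)
  have k: "kspace (sub W (f ` carrier V))" using kspace_sub ksub_image assms kV by blast
  have "f \<in> klin V (sub W (f ` carrier V))" using assms(3) by (auto simp: LinearCombinations.module_hom_def)
  then interpret I: linear_map class_ring V "sub W (f ` carrier V)" f using lm k by blast
  show "fdspace (sub W (f ` carrier V))" using I.surj_fin_dim assms(1) k by (simp add: fdspace_def)
qed

lemma fdspace_bij:
  assumes "fdspace V" "kspace W" "f \<in> klin V W" "bij_betw f (carrier V) (carrier W)"
  shows "fdspace W" "kdim W = kdim V"
proof -
  have eq: "sub W (f ` carrier V) = W" using assms(4) by (simp add: bij_betw_def)
  have kV: "kspace V" using assms by (simp add: fdspace_def)
  show "fdspace W" using rank_nullity(2)[OF assms(1-3)] eq by simp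
  interpret linear_map class_ring V W f
    using kV assms unfolding linear_map_def mod_hom_def mod_hom_axioms_def kspace_iff vectorspace_def
    by auto
  show "kdim W = kdim V" using dim_eq assms unfolding fdspace_def kdim_def bij_betw_def by auto
qed

lemma kdim_sub_zero:
  assumes "kspace V" shows "kdim (sub V {\<zero>\<^bsub>V\<^esub>}) = 0"
proof -
  interpret kspace V by fact
  have "kspace (sub V {\<zero>\<^bsub>V\<^esub>})" using kspace_sub[of V "{\<zero>\<^bsub>V\<^esub>}"] assms by (auto simp: ksub_def)
  then interpret S: vectorspace class_ring "sub V {\<zero>\<^bsub>V\<^esub>}" by (simp add: kspace_iff)
  have "S.span {\<zero>\<^bsub>V\<^esub>} = {\<zero>\<^bsub>V\<^esub>}"
    using S.span_self[of "\<zero>\<^bsub>V\<^esub>"] S.span_closed[of "{\<zero>\<^bsub>V\<^esub>}"] by auto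
  then show ?thesis unfolding kdim_def by (intro S.dim0I) simp
qed

lemma kdim_inj_image:
  assumes "fdspace V" "kspace W" "f \<in> klin V W" "\<And>x. x \<in> carrier V \<Longrightarrow> f x = \<zero>\<^bsub>W\<^esub> \<Longrightarrow> x = \<zero>\<^bsub>V\<^esub>"
  shows "kdim (sub W (f ` carrier V)) = kdim V"
proof -
  have kV: "kspace V" using assms by (simp add: fdspace_def)
  interpret V: kspace V by fact
  interpret W: kspace W by fact
  have "{x \<in> carrier V. f x = \<zero>\<^bsub>W\<^esub>} = {\<zero>\<^bsub>V\<^esub>}"
    using assms(4) modhom_zero[OF V.abelian_group_axioms W.abelian_group_axioms assms(3)] by auto
  then show ?thesis using rank_nullity(1)[OF assms(1-3)] kdim_sub_zero[OF kV] by simp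
qed

text \<open>A basis of the subspace stays independent in \<open>V\<close>.\<close>

lemma kdim_sub_le:
  assumes "fdspace V" "ksub V S" shows "kdim (sub V S) \<le> kdim V"
proof -
  have kV: "kspace V" using assms by (simp add: fdspace_def)
  interpret V: vectorspace class_ring V using kV by (simp add: kspace_iff)
  interpret S: vectorspace class_ring "sub V S" using kspace_sub kV assms by (simp add: kspace_iff)
  have sm: "LinearCombinations.submodule class_ring S V" using assms kV by (simp add: ksub_iff)
  have "S.fin_dim" using fdspace_sub[OF assms] by (simp add: fdspace_def)
  then obtain B where B: "finite B" "S.basis B" using S.finite_basis_exists by blast
  then have "S.lin_indpt B" "B \<subseteq> S" by (auto simp: S.basis_def)
  then have "V.lin_indpt B" "B \<subseteq> carrier V"
    using V.span_li_not_depend(2)[OF _ sm] assms(2) by (auto simp: ksub_def)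
  then have "card B \<le> V.dim" using V.li_le_dim assms(1) by (auto simp: fdspace_def)
  then show ?thesis using S.dim_basis B by (simp add: kdim_def)
qed

lemma kdim_le_inj:
  assumes "fdspace V" "fdspace W" "f \<in> klin V W" "\<And>x. x \<in> carrier V \<Longrightarrow> f x = \<zero>\<^bsub>W\<^esub> \<Longrightarrow> x = \<zero>\<^bsub>V\<^esub>"
  shows "kdim V \<le> kdim W"
proof -
  have k: "kspace V" "kspace W" using assms by (auto simp: fdspace_def)
  show ?thesis
    using kdim_inj_image[OF assms(1) k(2) assms(3,4)] kdim_sub_le[OF assms(2) ksub_image[OF k assms(3)]]
    by simp
qed

text \<open>A basis together with its dual basis; the basis vectors themselves serve as
  indices.\<close>

definition coord_system :: "('k::field, 'v) module \<Rightarrow> 'v set \<Rightarrow> ('v \<Rightarrow> 'v \<Rightarrow> 'k) \<Rightarrow> bool" where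
  "coord_system V B \<xi> \<longleftrightarrow> finite B \<and> B \<subseteq> carrier V \<and> card B = kdim V \<and>
     (\<forall>b\<in>B. \<xi> b \<in> klin V ground) \<and>
     (\<forall>x\<in>carrier V. x = (\<Oplus>\<^bsub>V\<^esub>b\<in>B. \<xi> b x \<odot>\<^bsub>V\<^esub> b)) \<and>
     (\<forall>b\<in>B. \<forall>b'\<in>B. \<xi> b b' = (if b = b' then 1 else 0))"

lemma coord_systemD:
  assumes "coord_system V B \<xi>"
  shows "finite B" "B \<subseteq> carrier V" "card B = kdim V" "\<And>b. b \<in> B \<Longrightarrow> \<xi> b \<in> klin V ground"
    "\<And>x. x \<in> carrier V \<Longrightarrow> x = (\<Oplus>\<^bsub>V\<^esub>b\<in>B. \<xi> b x \<odot>\<^bsub>V\<^esub> b)"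
    "\<And>b b'. b \<in> B \<Longrightarrow> b' \<in> B \<Longrightarrow> \<xi> b b' = (if b = b' then 1 else 0)"
  using assms unfolding coord_system_def by blast+

lemma coord_system_exists:
  assumes "fdspace V" obtains B \<xi> where "coord_system V B \<xi>"
proof -
  interpret kspace V using assms by (simp add: fdspace_def)
  have "finite_dimensional V" using assms by (simp add: fdspace_def)
  then show thesis
    by (rule coordinates, intro that) (auto simp: coord_system_def kdim_def)
qed

lemma k_isoI: "f \<in> klin V W \<Longrightarrow> bij_betw f (carrier V) (carrier W) \<Longrightarrow> k_iso V W"
  unfolding lmod_iso_def by auto

text \<open>A bijection between two bases extends to mutually inverse linear maps. Every isomorphism
  in the final theorem is obtained here, from an equality of dimensions.\<close>

lemma k_iso_of_kdim:
  assumes V: "fdspace V" and W: "fdspace W" and d: "kdim V = kdim W"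
  shows "k_iso V W"
proof -
  interpret V: kspace V using V by (simp add: fdspace_def)
  interpret W: kspace W using W by (simp add: fdspace_def)
  obtain B \<xi> where "coord_system V B \<xi>" using coord_system_exists[OF V] .
  note B = coord_systemD[OF this]
  obtain C \<eta> where "coord_system W C \<eta>" using coord_system_exists[OF W] .
  note C = coord_systemD[OF this]
  have "card B = card C" using B(3) C(3) d by (simp add: kdim_def)
  then obtain \<pi> where pi: "bij_betw \<pi> B C" using B(1) C(1) finite_same_card_bij by blast
  then have piC: "\<And>b. b \<in> B \<Longrightarrow> \<pi> b \<in> C" and inj: "inj_on \<pi> B" and im: "\<pi> ` B = C"
    by (auto simp: bij_betw_def)
  define f where "f x = (\<Oplus>\<^bsub>W\<^esub>b\<in>B. \<xi> b x \<odot>\<^bsub>W\<^esub> \<pi> b)" for x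
  define g where "g y = (\<Oplus>\<^bsub>V\<^esub>b\<in>B. \<eta> (\<pi> b) y \<odot>\<^bsub>V\<^esub> b)" for y
  have f: "f \<in> klin V W"
  proof (rule modhomI)
    show "f x \<in> carrier W" for x unfolding f_def using C(2) piC by (intro W.finsum_closed) auto
    show "f (x \<oplus>\<^bsub>V\<^esub> y) = f x \<oplus>\<^bsub>W\<^esub> f y" if "x \<in> carrier V" "y \<in> carrier V" for x y
    proof -
      have "f (x \<oplus>\<^bsub>V\<^esub> y) = (\<Oplus>\<^bsub>W\<^esub>b\<in>B. \<xi> b x \<odot>\<^bsub>W\<^esub> \<pi> b \<oplus>\<^bsub>W\<^esub> \<xi> b y \<odot>\<^bsub>W\<^esub> \<pi> b)"
        unfolding f_def using that C(2) piC modhom_add[OF B(4)]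
        by (intro W.finsum_cong') (auto simp: subset_iff W.smult_l_distr)
      also have "\<dots> = f x \<oplus>\<^bsub>W\<^esub> f y" unfolding f_def using C(2) piC
        by (intro W.finsum_addf) auto
      finally show ?thesis .
    qed
    show "f (c \<odot>\<^bsub>V\<^esub> x) = c \<odot>\<^bsub>W\<^esub> f x" if "x \<in> carrier V" for c x
    proof -
      have "f (c \<odot>\<^bsub>V\<^esub> x) = (\<Oplus>\<^bsub>W\<^esub>b\<in>B. c \<odot>\<^bsub>W\<^esub> (\<xi> b x \<odot>\<^bsub>W\<^esub> \<pi> b))"
        unfolding f_def using that C(2) piC klin_smult[OF B(4)]
        by (intro W.finsum_cong') (auto simp: subset_iff W.smult_assoc)
      then show ?thesis unfolding f_def using C(2) piC by (subst W.smult_finsum) auto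
    qed
  qed
  have \<xi>g: "\<xi> b (g y) = \<eta> (\<pi> b) y" if b: "b \<in> B" for b y
  proof -
    have "\<xi> b (g y) = (\<Sum>b'\<in>B. \<xi> b (\<eta> (\<pi> b') y \<odot>\<^bsub>V\<^esub> b'))"
      unfolding g_def using modhom_finsum[OF V.abelian_group_axioms kspace.axioms(1)[OF kspace_ground]
        B(4)[OF b], of "\<lambda>b. \<eta> (\<pi> b) y \<odot>\<^bsub>V\<^esub> b" B] B(2) by (simp add: Pi_def subset_iff)
    also have "\<dots> = (\<Sum>b'\<in>B. if b' = b then \<eta> (\<pi> b) y else 0)"
      using b B(2) by (intro sum.cong) (auto simp: subset_iff klin_smult[OF B(4)[OF b]] B(6))
    finally show ?thesis using b B(1) by simp
  qed
  have \<eta>f: "\<eta> (\<pi> b) (f x) = \<xi> b x" if b: "b \<in> B" for b x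
  proof -
    have "\<eta> (\<pi> b) (f x) = (\<Sum>b'\<in>B. \<eta> (\<pi> b) (\<xi> b' x \<odot>\<^bsub>W\<^esub> \<pi> b'))"
      unfolding f_def using modhom_finsum[OF W.abelian_group_axioms kspace.axioms(1)[OF kspace_ground]
        C(4)[OF piC[OF b]], of "\<lambda>b. \<xi> b x \<odot>\<^bsub>W\<^esub> \<pi> b" B] C(2) piC by (simp add: Pi_def subset_iff)
    also have "\<dots> = (\<Sum>b'\<in>B. if b' = b then \<xi> b x else 0)"
      using b C(2) piC inj
      by (intro sum.cong) (auto simp: subset_iff klin_smult[OF C(4)[OF piC[OF b]]] C(6) inj_on_eq_iff)
    finally show ?thesis using b B(1) by simp
  qed
  have gV: "g y \<in> carrier V" for y unfolding g_def using B(2) by (intro V.finsum_closed) auto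
  have gf: "g (f x) = x" if "x \<in> carrier V" for x
  proof -
    have "g (f x) = (\<Oplus>\<^bsub>V\<^esub>b\<in>B. \<xi> b x \<odot>\<^bsub>V\<^esub> b)"
      unfolding g_def using \<eta>f B(2) by (intro V.finsum_cong') auto
    then show ?thesis using B(5) that by simp
  qed
  have fg: "f (g y) = y" if "y \<in> carrier W" for y
  proof -
    have "f (g y) = (\<Oplus>\<^bsub>W\<^esub>b\<in>B. \<eta> (\<pi> b) y \<odot>\<^bsub>W\<^esub> \<pi> b)"
      unfolding f_def using \<xi>g subsetD[OF C(2) piC] by (intro W.finsum_cong') auto
    also have "\<dots> = (\<Oplus>\<^bsub>W\<^esub>b\<in>C. \<eta> b y \<odot>\<^bsub>W\<^esub> b)"
      unfolding im[symmetric] using inj piC C(2) by (subst W.finsum_reindex) auto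
    finally show ?thesis using C(5) that by simp
  qed
  have "bij_betw f (carrier V) (carrier W)"
    by (rule bij_betwI[where g = g]) (use gf fg gV modhom_closed[OF f] in auto)
  then show ?thesis using f by (rule k_isoI[rotated])
qed

text \<open>Injectivity of the map is not assumed, which covers quotients; with the identity as map
  the lemma carries the axioms between records that share carrier, zero and addition.\<close>

lemma abelian_group_transport:
  assumes "abelian_group M" "f ` carrier M = carrier N" "f \<zero>\<^bsub>M\<^esub> = \<zero>\<^bsub>N\<^esub>"
    and add: "\<And>x y. x \<in> carrier M \<Longrightarrow> y \<in> carrier M \<Longrightarrow> f (x \<oplus>\<^bsub>M\<^esub> y) = f x \<oplus>\<^bsub>N\<^esub> f y"
  shows "abelian_group N"
proof -
  interpret M: abelian_group M by fact
  have ex: "\<exists>a\<in>carrier M. x = f a" if "x \<in> carrier N" for x using that assms(2) by auto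
  have fin: "f a \<in> carrier N" if "a \<in> carrier M" for a using that assms(2) by auto
  show ?thesis
  proof (rule abelian_groupI)
    fix x y assume "x \<in> carrier N" "y \<in> carrier N"
    then obtain a b where ab: "a \<in> carrier M" "x = f a" "b \<in> carrier M" "y = f b" using ex by metis
    then show "x \<oplus>\<^bsub>N\<^esub> y \<in> carrier N" using fin add by (metis M.a_closed)
    show "x \<oplus>\<^bsub>N\<^esub> y = y \<oplus>\<^bsub>N\<^esub> x" using ab add by (metis M.a_comm)
    fix z assume "z \<in> carrier N"
    then obtain c where c: "c \<in> carrier M" "z = f c" using ex by metis
    have "f ((a \<oplus>\<^bsub>M\<^esub> b) \<oplus>\<^bsub>M\<^esub> c) = f (a \<oplus>\<^bsub>M\<^esub> (b \<oplus>\<^bsub>M\<^esub> c))" using ab c by (simp add: M.a_assoc)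
    then show "x \<oplus>\<^bsub>N\<^esub> y \<oplus>\<^bsub>N\<^esub> z = x \<oplus>\<^bsub>N\<^esub> (y \<oplus>\<^bsub>N\<^esub> z)" using ab c by (simp add: add)
  next
    show "\<zero>\<^bsub>N\<^esub> \<in> carrier N" using assms(3) fin by (metis M.zero_closed)
  next
    fix x assume "x \<in> carrier N"
    then obtain a where a: "a \<in> carrier M" "x = f a" using ex by metis
    show "\<zero>\<^bsub>N\<^esub> \<oplus>\<^bsub>N\<^esub> x = x" using a assms(3) add[of "\<zero>\<^bsub>M\<^esub>" a] by simp
    have "f (\<ominus>\<^bsub>M\<^esub> a) \<oplus>\<^bsub>N\<^esub> x = \<zero>\<^bsub>N\<^esub>" using a assms(3) add[of "\<ominus>\<^bsub>M\<^esub> a" a] by (simp add: M.l_neg)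
    then show "\<exists>y\<in>carrier N. y \<oplus>\<^bsub>N\<^esub> x = \<zero>\<^bsub>N\<^esub>" using a fin by (metis M.a_inv_closed)
  qed
qed

lemma left_module_transport:
  assumes "left_module L M" "f ` carrier M = carrier N" "f \<zero>\<^bsub>M\<^esub> = \<zero>\<^bsub>N\<^esub>"
    and add: "\<And>x y. x \<in> carrier M \<Longrightarrow> y \<in> carrier M \<Longrightarrow> f (x \<oplus>\<^bsub>M\<^esub> y) = f x \<oplus>\<^bsub>N\<^esub> f y"
    and smult: "\<And>r x. r \<in> carrier L \<Longrightarrow> x \<in> carrier M \<Longrightarrow> f (r \<odot>\<^bsub>M\<^esub> x) = r \<odot>\<^bsub>N\<^esub> f x"
  shows "left_module L N"
proof -
  interpret M: left_module L M by fact
  have ex: "\<exists>a\<in>carrier M. x = f a" if "x \<in> carrier N" for x using that assms(2) by auto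
  have fin: "f a \<in> carrier N" if "a \<in> carrier M" for a using that assms(2) by auto
  have ab: "abelian_group N"
    by (rule abelian_group_transport[OF M.M.abelian_group_axioms assms(2,3) add])
  interpret N: abelian_group N by (rule ab)
  show ?thesis
  proof (intro left_module.intro M.R.ring_axioms ab left_module_axioms.intro)
    fix r x assume r: "r \<in> carrier L" and "x \<in> carrier N"
    then obtain a where a: "a \<in> carrier M" "x = f a" using ex by metis
    show "r \<odot>\<^bsub>N\<^esub> x \<in> carrier N" using a r fin smult M.smult_closed by metis
    show "(r \<oplus>\<^bsub>L\<^esub> s) \<odot>\<^bsub>N\<^esub> x = r \<odot>\<^bsub>N\<^esub> x \<oplus>\<^bsub>N\<^esub> s \<odot>\<^bsub>N\<^esub> x" if "s \<in> carrier L" for s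
      using a r that smult[of "r \<oplus>\<^bsub>L\<^esub> s" a] by (simp add: M.smult_l_distr M.smult_closed smult add)
    show "(r \<otimes>\<^bsub>L\<^esub> s) \<odot>\<^bsub>N\<^esub> x = r \<odot>\<^bsub>N\<^esub> (s \<odot>\<^bsub>N\<^esub> x)" if "s \<in> carrier L" for s
      using a r that smult[of "r \<otimes>\<^bsub>L\<^esub> s" a] by (simp add: M.smult_assoc M.smult_closed smult)
    fix y assume "y \<in> carrier N"
    then obtain b where b: "b \<in> carrier M" "y = f b" using ex by metis
    show "r \<odot>\<^bsub>N\<^esub> (x \<oplus>\<^bsub>N\<^esub> y) = r \<odot>\<^bsub>N\<^esub> x \<oplus>\<^bsub>N\<^esub> r \<odot>\<^bsub>N\<^esub> y"
      using a b r smult[of r "a \<oplus>\<^bsub>M\<^esub> b"] by (simp add: M.smult_r_distr M.smult_closed smult add)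
  next
    fix x assume "x \<in> carrier N"
    then obtain a where a: "a \<in> carrier M" "x = f a" using ex by metis
    then show "\<one>\<^bsub>L\<^esub> \<odot>\<^bsub>N\<^esub> x = x" using smult[of "\<one>\<^bsub>L\<^esub>" a] by (simp add: M.smult_one)
  qed
qed

lemma kspace_iff_left_module: "kspace V \<longleftrightarrow> left_module class_ring V"
proof
  assume "kspace V"
  then interpret kspace V .
  show "left_module class_ring V"
    by (intro left_module.intro class_ring.ring_axioms abelian_group_axioms left_module_axioms.intro)
      (auto simp: smult_l_distr smult_r_distr smult_assoc)
next
  assume "left_module class_ring V"
  then interpret V: left_module class_ring V .
  show "kspace V"
    by (intro kspace.intro V.M.abelian_group_axioms kspace_axioms.intro)
      (use V.smult_closed V.smult_l_distr V.smult_r_distr V.smult_assoc V.smult_one in auto)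
qed

lemma kspace_transport:
  assumes "kspace V" "f ` carrier V = carrier W" "f \<zero>\<^bsub>V\<^esub> = \<zero>\<^bsub>W\<^esub>" "f \<in> klin V W"
  shows "kspace W"
  using assms left_module_transport[of class_ring V f W]
  by (auto simp: kspace_iff_left_module modhom_add klin_smult)

subsection \<open>Quotients\<close>

context kspace
begin

lemma smult_neg_right: "x \<in> carrier V \<Longrightarrow> c \<odot> (\<ominus> x) = \<ominus> (c \<odot> x)"
proof -
  assume x: "x \<in> carrier V"
  have "c \<odot> (\<ominus> x) \<oplus> c \<odot> x = \<zero>"
    using x smult_r_distr[of "\<ominus> x" x c] by (simp add: l_neg)
  then show ?thesis using x by (metis minus_equality a_inv_closed smult_closed)
qed

text \<open>Negatives arise in \<open>S\<close> as multiples by -1.\<close>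

lemma abelian_subgroup_ksub:
  assumes "ksub V S" shows "abelian_subgroup S V"
proof -
  have "subgroup S (add_monoid V)"
  proof (rule subgroup.intro)
    show "inv\<^bsub>add_monoid V\<^esub> x \<in> S" if "x \<in> S" for x
    proof -
      have "(- 1) \<odot> x \<in> S" "x \<in> carrier V" using that assms by (auto simp: ksub_def)
      then show ?thesis using smult_minus_one[of x] by (simp add: a_inv_def)
    qed
  qed (use assms in \<open>auto simp: ksub_def\<close>)
  then show ?thesis using abelian_subgroupI3[OF additive_subgroup.intro abelian_group_axioms] by blast
qed

lemma coset_eq_iff:
  assumes "ksub V S" "x \<in> carrier V" "y \<in> carrier V"
  shows "S +> x = S +> y \<longleftrightarrow> x \<ominus> y \<in> S"
proof -
  interpret S: abelian_subgroup S V by (rule abelian_subgroup_ksub) fact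
  have "S +> x = S +> y \<longleftrightarrow> x \<in> S +> y"
    using S.a_rcos_self[OF assms(2)] a_repr_independence[OF _ assms(3) S.a_subgroup] by blast
  also have "\<dots> \<longleftrightarrow> x \<ominus> y \<in> S"
    using S.a_rcos_module assms by (simp add: a_minus_def)
  finally show ?thesis .
qed

lemma quot_carrier: "carrier (quot V S) = (\<lambda>x. S +> x) ` carrier V"
  by (auto simp: quot_def A_RCOSETS_def')

lemma coset_zero: "ksub V S \<Longrightarrow> S +> \<zero> = S"
  by (auto simp: a_r_coset_def' ksub_def subset_iff)

lemma quot_zero [simp]: "\<zero>\<^bsub>quot V S\<^esub> = S"
  by (simp add: quot_def)

lemma quot_add:
  assumes "ksub V S" "x \<in> carrier V" "y \<in> carrier V"
  shows "(S +> x) \<oplus>\<^bsub>quot V S\<^esub> (S +> y) = S +> (x \<oplus> y)"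
  using abelian_subgroup.a_rcos_sum[OF abelian_subgroup_ksub] assms by (simp add: quot_def)

lemma mem_coset:
  assumes "ksub V S" "x \<in> carrier V" "y \<in> S +> x"
  shows "y \<in> carrier V" "S +> y = S +> x"
proof -
  interpret S: abelian_subgroup S V by (rule abelian_subgroup_ksub) fact
  show "y \<in> carrier V" using assms by (auto simp: a_r_coset_def' ksub_def)
  show "S +> y = S +> x" using a_repr_independence[OF assms(3,2) S.a_subgroup] by simp
qed

text \<open>\<open>quot\<close> scales a coset by a union over its representatives. Two
  representatives differ by an element of \<open>S\<close>, and \<open>S\<close> is closed under
  scalars, so all members of the union are one and the same coset.\<close>

lemma quot_smult:
  assumes "ksub V S" "x \<in> carrier V"
  shows "c \<odot>\<^bsub>quot V S\<^esub> (S +> x) = S +> (c \<odot> x)"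
proof -
  interpret S: abelian_subgroup S V by (rule abelian_subgroup_ksub) fact
  have *: "S +> (c \<odot> y) = S +> (c \<odot> x)" if "y \<in> S +> x" for y
  proof -
    note y = mem_coset[OF assms that]
    then have "y \<ominus> x \<in> S" using coset_eq_iff assms by blast
    then have "c \<odot> (y \<ominus> x) \<in> S" using assms by (simp add: ksub_def)
    moreover have "c \<odot> (y \<ominus> x) = c \<odot> y \<ominus> c \<odot> x"
      using assms y(1) by (simp add: a_minus_def smult_r_distr smult_neg_right)
    ultimately show ?thesis using coset_eq_iff assms y(1) by simp
  qed
  have "c \<odot>\<^bsub>quot V S\<^esub> (S +> x) = (\<Union>y\<in>S +> x. S +> (c \<odot> y))" by (simp add: quot_def)
  also have "\<dots> = (\<Union>y\<in>S +> x. S +> (c \<odot> x))" using * by (rule SUP_cong[OF refl])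
  also have "\<dots> = S +> (c \<odot> x)" using S.a_rcos_self[OF assms(2)] by auto
  finally show ?thesis .
qed

lemma quot_proj: "ksub V S \<Longrightarrow> (\<lambda>x. S +> x) \<in> klin V (quot V S)"
  by (rule modhomI) (auto simp: quot_carrier quot_add quot_smult)

lemma kspace_quot: "ksub V S \<Longrightarrow> kspace (quot V S)"
  by (rule kspace_transport[OF kspace_axioms _ _ quot_proj]) (auto simp: quot_carrier coset_zero)

lemma quot_kernel: "ksub V S \<Longrightarrow> {x \<in> carrier V. S +> x = S} = S"
proof -
  assume S: "ksub V S"
  have m: "\<ominus> \<zero> = \<zero>" by (rule minus_equality) auto
  have "S +> x = S \<longleftrightarrow> x \<in> S" if "x \<in> carrier V" for x
  proof -
    have "x \<ominus> \<zero> = x" unfolding a_minus_def m using that by simp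
    then show ?thesis using coset_eq_iff[OF S that zero_closed] coset_zero[OF S] by simp
  qed
  then show ?thesis using S unfolding ksub_def by blast
qed

end

lemma fdspace_kspace: "fdspace V \<Longrightarrow> kspace V"
  by (simp add: fdspace_def)

lemma
  assumes "fdspace V" "ksub V S"
  shows fdspace_quot: "fdspace (quot V S)"
    and kdim_quot: "kdim V = kdim (sub V S) + kdim (quot V S)"
proof -
  interpret kspace V by (rule fdspace_kspace) fact
  have q: "kspace (quot V S)" using kspace_quot assms by blast
  have im: "sub (quot V S) ((\<lambda>x. S +>\<^bsub>V\<^esub> x) ` carrier V) = quot V S"
    by (simp flip: quot_carrier)
  note rn = rank_nullity[OF assms(1) q quot_proj[OF assms(2)]]
  show "fdspace (quot V S)" using rn(2) im by simp
  show "kdim V = kdim (sub V S) + kdim (quot V S)"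
    using rn(1) im quot_kernel[OF assms(2)] by simp
qed

subsection \<open>Modules over an algebra as vector spaces\<close>

locale kalgebra =
  fixes L :: "('k::field, 'l) module" (structure)
  assumes k_algebra: "k_algebra L"

sublocale kalgebra \<subseteq> ring L
  using k_algebra by (simp add: k_algebra_def)

sublocale kalgebra \<subseteq> kspace L
  using k_algebra by (simp add: k_algebra_def kspace_iff)

context kalgebra
begin

lemma smult_mult_left: "a \<in> carrier L \<Longrightarrow> b \<in> carrier L \<Longrightarrow> (c \<odot> a) \<otimes> b = c \<odot> (a \<otimes> b)"
  and smult_mult_right: "a \<in> carrier L \<Longrightarrow> b \<in> carrier L \<Longrightarrow> a \<otimes> (c \<odot> b) = c \<odot> (a \<otimes> b)"
  using k_algebra unfolding k_algebra_def by auto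

lemma scalar_mult: "a \<in> carrier L \<Longrightarrow> (c \<odot> \<one>) \<otimes> a = c \<odot> a"
  and mult_scalar: "a \<in> carrier L \<Longrightarrow> a \<otimes> (c \<odot> \<one>) = c \<odot> a"
  by (simp_all add: smult_mult_left smult_mult_right)

end

lemma restrict_scalars_simps [simp]:
  "carrier (restrict_scalars L M) = carrier M" "zero (restrict_scalars L M) = zero M"
  "add (restrict_scalars L M) = add M"
  "smult (restrict_scalars L M) = (\<lambda>c x. (c \<odot>\<^bsub>L\<^esub> \<one>\<^bsub>L\<^esub>) \<odot>\<^bsub>M\<^esub> x)"
  by (auto simp: restrict_scalars_def)

lemma finsum_restrict_scalars [simp]: "finsum (restrict_scalars L M) = finsum M"
  by (intro ext) (simp add: finsum_def finprod_def)

lemma (in kalgebra) kspace_restrict_scalars: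
  assumes "left_module L M" shows "kspace (restrict_scalars L M)"
proof -
  interpret M: left_module L M by fact
  have "abelian_group (restrict_scalars L M)"
    by (rule abelian_group_transport[OF M.M.abelian_group_axioms, of "\<lambda>x. x"]) auto
  then show ?thesis
  proof (intro kspace.intro kspace_axioms.intro, goal_cases)
    case (5 x c d)
    have "(c * d) \<odot> \<one> = (c \<odot> \<one>) \<otimes> (d \<odot> \<one>)" by (simp add: scalar_mult smult_assoc)
    then show ?case using 5 by (simp add: M.smult_assoc)
  qed (auto simp: M.smult_closed M.smult_r_distr M.smult_one smult_l_distr M.smult_l_distr)
qed

lemma (in kalgebra) fdspace_restrict_scalars:
  "fd_module L M \<longleftrightarrow> left_module L M \<and> fdspace (restrict_scalars L M)"
  using kspace_restrict_scalars by (auto simp: fd_module_def fdspace_def)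

lemma (in kalgebra) modhom_klin:
  "f \<in> module_hom L M N \<Longrightarrow> f \<in> klin (restrict_scalars L M) (restrict_scalars L N)"
  by (auto simp: LinearCombinations.module_hom_def)

section \<open>Spaces of homomorphisms\<close>

lemma hom_space_simps [simp]:
  "carrier (hom_space L M N) = module_hom L M N \<inter> extensional (carrier M)"
  "zero (hom_space L M N) = (\<lambda>x\<in>carrier M. \<zero>\<^bsub>N\<^esub>)"
  "add (hom_space L M N) = (\<lambda>f g. \<lambda>x\<in>carrier M. f x \<oplus>\<^bsub>N\<^esub> g x)"
  "smult (hom_space L M N) = (\<lambda>c f. \<lambda>x\<in>carrier M. (c \<odot>\<^bsub>L\<^esub> \<one>\<^bsub>L\<^esub>) \<odot>\<^bsub>N\<^esub> f x)"
  by (auto simp: hom_space_def)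

lemma modhom_restrict:
  assumes "left_module L M" "f \<in> module_hom L M N"
  shows "restrict f (carrier M) \<in> module_hom L M N"
proof -
  interpret left_module L M by fact
  show ?thesis using assms(2) smult_closed
    by (auto simp: LinearCombinations.module_hom_def)
qed

lemma (in left_module) smult_zero_right [simp]: "r \<in> carrier R \<Longrightarrow> r \<odot>\<^bsub>M\<^esub> \<zero>\<^bsub>M\<^esub> = \<zero>\<^bsub>M\<^esub>"
  using smult_r_distr[of r "\<zero>\<^bsub>M\<^esub>" "\<zero>\<^bsub>M\<^esub>"] smult_closed[of r "\<zero>\<^bsub>M\<^esub>"]
  by (metis M.add.l_cancel_one M.l_zero M.zero_closed)

lemma (in left_module) smult_minus_right:
  assumes "r \<in> carrier R" "x \<in> carrier M"
  shows "r \<odot>\<^bsub>M\<^esub> (\<ominus>\<^bsub>M\<^esub> x) = \<ominus>\<^bsub>M\<^esub> (r \<odot>\<^bsub>M\<^esub> x)"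
proof -
  have "r \<odot>\<^bsub>M\<^esub> (\<ominus>\<^bsub>M\<^esub> x) \<oplus>\<^bsub>M\<^esub> r \<odot>\<^bsub>M\<^esub> x = \<zero>\<^bsub>M\<^esub>"
    using assms smult_r_distr[of r "\<ominus>\<^bsub>M\<^esub> x" x] by (simp add: M.l_neg)
  then show ?thesis using assms by (metis M.minus_equality M.a_inv_closed smult_closed)
qed

lemma (in left_module) finsum_smult:
  assumes "r \<in> carrier R" "f \<in> A \<rightarrow> carrier M"
  shows "r \<odot>\<^bsub>M\<^esub> finsum M f A = (\<Oplus>\<^bsub>M\<^esub>i\<in>A. r \<odot>\<^bsub>M\<^esub> f i)"
  using assms M.abelian_group_axioms
  by (intro additive_finsum[where f = "\<lambda>x. r \<odot>\<^bsub>M\<^esub> x"]) (auto simp: smult_r_distr smult_closed)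

lemma (in kalgebra) scalar_smult_commute:
  assumes "left_module L M" "r \<in> carrier L" "y \<in> carrier M"
  shows "(c \<odot> \<one>) \<odot>\<^bsub>M\<^esub> (r \<odot>\<^bsub>M\<^esub> y) = r \<odot>\<^bsub>M\<^esub> ((c \<odot> \<one>) \<odot>\<^bsub>M\<^esub> y)"
    and "(c \<odot> r) \<odot>\<^bsub>M\<^esub> y = (c \<odot> \<one>) \<odot>\<^bsub>M\<^esub> (r \<odot>\<^bsub>M\<^esub> y)"
proof -
  interpret M: left_module L M by fact
  show "(c \<odot> \<one>) \<odot>\<^bsub>M\<^esub> (r \<odot>\<^bsub>M\<^esub> y) = r \<odot>\<^bsub>M\<^esub> ((c \<odot> \<one>) \<odot>\<^bsub>M\<^esub> y)"
    "(c \<odot> r) \<odot>\<^bsub>M\<^esub> y = (c \<odot> \<one>) \<odot>\<^bsub>M\<^esub> (r \<odot>\<^bsub>M\<^esub> y)"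
    using assms by (simp_all add: scalar_mult mult_scalar flip: M.smult_assoc)
qed

text \<open>Scalar multiples of a homomorphism stay L-linear because \<open>c \<odot> \<one>\<close>
  is central (\<open>scalar_smult_commute\<close>). Identities are checked pointwise on
  \<open>carrier M\<close>, which suffices for extensional functions.\<close>

lemma (in kalgebra) kspace_hom_space:
  assumes "left_module L M" "left_module L N"
  shows "kspace (hom_space L M N)"
proof -
  interpret M: left_module L M by fact
  interpret N: left_module L N by fact
  interpret NK: kspace "restrict_scalars L N" by (rule kspace_restrict_scalars) fact
  let ?H = "hom_space L M N"
  have in_H: "restrict f (carrier M) \<in> carrier ?H" if "f \<in> module_hom L M N" for f
    using modhom_restrict[OF assms(1) that] by simp
  have HD: "f x \<in> carrier N" if "f \<in> carrier ?H" "x \<in> carrier M" for f x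
    using that modhom_closed[of f] by auto
  note ext = extensionalityI[where A = "carrier M"]
  have hm: "f \<in> module_hom L M N" if "f \<in> carrier ?H" for f using that by simp
  have Hext: "f \<in> extensional (carrier M)" if "f \<in> carrier ?H" for f using that by simp
  have add: "f \<oplus>\<^bsub>?H\<^esub> g \<in> carrier ?H" if f: "f \<in> carrier ?H" and g: "g \<in> carrier ?H" for f g
  proof -
    have "(\<lambda>x. f x \<oplus>\<^bsub>N\<^esub> g x) \<in> module_hom L M N"
    proof (rule modhomI)
      fix x y assume "x \<in> carrier M" "y \<in> carrier M"
      then show "f (x \<oplus>\<^bsub>M\<^esub> y) \<oplus>\<^bsub>N\<^esub> g (x \<oplus>\<^bsub>M\<^esub> y) = f x \<oplus>\<^bsub>N\<^esub> g x \<oplus>\<^bsub>N\<^esub> (f y \<oplus>\<^bsub>N\<^esub> g y)"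
        using HD[OF f] HD[OF g]
        by (simp add: modhom_add[OF hm[OF f]] modhom_add[OF hm[OF g]] N.M.add.m_ac)
    next
      fix r x assume "r \<in> carrier L" "x \<in> carrier M"
      then show "f (r \<odot>\<^bsub>M\<^esub> x) \<oplus>\<^bsub>N\<^esub> g (r \<odot>\<^bsub>M\<^esub> x) = r \<odot>\<^bsub>N\<^esub> (f x \<oplus>\<^bsub>N\<^esub> g x)"
        using HD[OF f] HD[OF g]
        by (simp add: modhom_smult[OF hm[OF f]] modhom_smult[OF hm[OF g]] N.smult_r_distr)
    qed (use HD[OF f] HD[OF g] in simp)
    from in_H[OF this] show ?thesis by simp
  qed
  have "(\<lambda>x. \<zero>\<^bsub>N\<^esub>) \<in> module_hom L M N" by (rule modhomI) auto
  from in_H[OF this] have zero: "\<zero>\<^bsub>?H\<^esub> \<in> carrier ?H" by simp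
  have smult: "c \<odot>\<^bsub>?H\<^esub> f \<in> carrier ?H" if f: "f \<in> carrier ?H" for f c
  proof -
    have "(\<lambda>x. (c \<odot> \<one>) \<odot>\<^bsub>N\<^esub> f x) \<in> module_hom L M N"
    proof (rule modhomI)
      fix r x assume "r \<in> carrier L" "x \<in> carrier M"
      then show "(c \<odot> \<one>) \<odot>\<^bsub>N\<^esub> f (r \<odot>\<^bsub>M\<^esub> x) = r \<odot>\<^bsub>N\<^esub> ((c \<odot> \<one>) \<odot>\<^bsub>N\<^esub> f x)"
        using HD[OF f] by (simp add: modhom_smult[OF hm[OF f]] scalar_smult_commute(1)[OF assms(2)])
    next
      fix x y assume "x \<in> carrier M" "y \<in> carrier M"
      then show "(c \<odot> \<one>) \<odot>\<^bsub>N\<^esub> f (x \<oplus>\<^bsub>M\<^esub> y) = (c \<odot> \<one>) \<odot>\<^bsub>N\<^esub> f x \<oplus>\<^bsub>N\<^esub> (c \<odot> \<one>) \<odot>\<^bsub>N\<^esub> f y"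
        using HD[OF f] by (simp add: modhom_add[OF hm[OF f]] N.smult_r_distr)
    qed (use HD[OF f] in \<open>simp add: N.smult_closed\<close>)
    from in_H[OF this] show ?thesis by simp
  qed
  have zf: "\<zero>\<^bsub>?H\<^esub> \<oplus>\<^bsub>?H\<^esub> f = f" if "f \<in> carrier ?H" for f
    by (rule ext) (use that HD[OF that] in simp_all)
  have ag: "abelian_group ?H"
  proof (rule abelian_groupI)
    fix f g h assume f: "f \<in> carrier ?H" and g: "g \<in> carrier ?H" and h: "h \<in> carrier ?H"
    show "f \<oplus>\<^bsub>?H\<^esub> g \<oplus>\<^bsub>?H\<^esub> h = f \<oplus>\<^bsub>?H\<^esub> (g \<oplus>\<^bsub>?H\<^esub> h)"
      by (rule ext) (use HD[OF f] HD[OF g] HD[OF h] in \<open>simp_all add: N.M.a_assoc\<close>)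
  next
    fix f g assume f: "f \<in> carrier ?H" and g: "g \<in> carrier ?H"
    show "f \<oplus>\<^bsub>?H\<^esub> g = g \<oplus>\<^bsub>?H\<^esub> f"
      by (rule ext) (use HD[OF f] HD[OF g] in \<open>simp_all add: N.M.a_comm\<close>)
  next
    fix f assume f: "f \<in> carrier ?H"
    have "((- 1) \<odot>\<^bsub>?H\<^esub> f) \<oplus>\<^bsub>?H\<^esub> f = \<zero>\<^bsub>?H\<^esub>"
    proof (rule ext)
      fix x assume x: "x \<in> carrier M"
      have "f x \<in> carrier (restrict_scalars L N)" using HD[OF f x] by simp
      then have "((- 1) \<odot>\<^bsub>restrict_scalars L N\<^esub> f x) \<oplus>\<^bsub>restrict_scalars L N\<^esub> f x = \<zero>\<^bsub>restrict_scalars L N\<^esub>"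
        by (simp only: NK.smult_minus_one NK.l_neg)
      then show "(((- 1) \<odot>\<^bsub>?H\<^esub> f) \<oplus>\<^bsub>?H\<^esub> f) x = \<zero>\<^bsub>?H\<^esub> x" using x by simp
    qed simp_all
    then show "\<exists>g\<in>carrier ?H. g \<oplus>\<^bsub>?H\<^esub> f = \<zero>\<^bsub>?H\<^esub>" using smult[OF f] by blast
  qed (fact add zero zf)+
  show ?thesis
  proof (intro kspace.intro ag kspace_axioms.intro)
    fix f g c d assume f: "f \<in> carrier ?H"
    show "(c + d) \<odot>\<^bsub>?H\<^esub> f = c \<odot>\<^bsub>?H\<^esub> f \<oplus>\<^bsub>?H\<^esub> d \<odot>\<^bsub>?H\<^esub> f"
      by (rule ext) (use NK.smult_l_distr HD[OF f] in simp_all)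
    show "(c * d) \<odot>\<^bsub>?H\<^esub> f = c \<odot>\<^bsub>?H\<^esub> (d \<odot>\<^bsub>?H\<^esub> f)"
      by (rule ext) (use NK.smult_assoc HD[OF f] in simp_all)
    assume g: "g \<in> carrier ?H"
    show "c \<odot>\<^bsub>?H\<^esub> (f \<oplus>\<^bsub>?H\<^esub> g) = c \<odot>\<^bsub>?H\<^esub> f \<oplus>\<^bsub>?H\<^esub> c \<odot>\<^bsub>?H\<^esub> g"
      by (rule ext) (use NK.smult_r_distr HD[OF f] HD[OF g] in simp_all)
  next
    fix f assume f: "f \<in> carrier ?H"
    show "1 \<odot>\<^bsub>?H\<^esub> f = f"
      by (rule ext) (use NK.smult_one HD[OF f] f in simp_all)
  qed (fact smult)
qed

lemma (in kalgebra) hom_space_eq_sub: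
  "hom_space L M N = sub (hom_space ground (restrict_scalars L M) (restrict_scalars L N))
     (carrier (hom_space L M N))"
  by (simp add: hom_space_def)

lemma k_algebra_ground [simp]: "k_algebra ground"
proof -
  have "ring (ground :: ('a, 'a) module)"
  proof (rule ringI)
    show "abelian_group (ground :: ('a, 'a) module)" using kspace_ground by (rule kspace.axioms(1))
    show "monoid (ground :: ('a, 'a) module)" by (rule monoidI) (auto simp: mult.assoc)
  qed (auto simp: algebra_simps)
  moreover have "vectorspace class_ring (ground :: ('a, 'a) module)"
    using kspace_ground kspace_iff by blast
  ultimately show ?thesis by (simp add: k_algebra_def)
qed

interpretation ground: kalgebra ground
  by unfold_locales simp

lemma module_hom_ground [simp]: "module_hom ground V W = klin V W"
  by (auto simp: LinearCombinations.module_hom_def)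

lemma restrict_scalars_ground [simp]: "restrict_scalars ground V = V"
  by (simp add: restrict_scalars_def)

lemma left_module_ground_iff [simp]: "left_module ground V \<longleftrightarrow> kspace V"
proof
  show "kspace V" if "left_module ground V" using ground.kspace_restrict_scalars[OF that] by simp
  assume "kspace V"
  then interpret kspace V .
  show "left_module ground V"
    by (intro left_module.intro ground.ring_axioms abelian_group_axioms left_module_axioms.intro)
      (auto simp: smult_l_distr smult_r_distr smult_assoc)
qed

abbreviation khom :: "('k::field, 'v) module \<Rightarrow> ('k, 'w) module \<Rightarrow> ('k, 'v \<Rightarrow> 'w) module" where
  "khom V W \<equiv> hom_space ground V W"

lemma kspace_khom: "kspace V \<Longrightarrow> kspace W \<Longrightarrow> kspace (khom V W)"
  by (simp add: ground.kspace_hom_space)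

lemma hom_space_apply_finsum:
  assumes "k_algebra L" "left_module L M" "left_module L N" "f \<in> A \<rightarrow> carrier (hom_space L M N)"
    "x \<in> carrier M"
  shows "finsum (hom_space L M N) f A x = (\<Oplus>\<^bsub>N\<^esub>i\<in>A. f i x)"
proof -
  interpret kalgebra L by unfold_locales fact
  interpret N: left_module L N by fact
  interpret H: kspace "hom_space L M N" using assms by (simp add: kspace_hom_space)
  show ?thesis
    by (rule additive_finsum[OF H.abelian_group_axioms N.M.abelian_group_axioms _ _ assms(4)])
      (use assms(5) modhom_closed in auto)
qed

text \<open>The rank one maps \<open>E (b, c)\<close>, the matrix units for the two bases, span the
  space.\<close>

lemma fdspace_khom:
  assumes "fdspace V" "fdspace W" shows "fdspace (khom V W)"
proof -
  interpret V: kspace V using assms by (simp add: fdspace_def)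
  interpret W: kspace W using assms by (simp add: fdspace_def)
  have kV: "kspace V" and kW: "kspace W" using assms by (auto simp: fdspace_def)
  interpret H: kspace "khom V W" using kV kW by (rule kspace_khom)
  obtain B \<xi> where "coord_system V B \<xi>" using coord_system_exists[OF assms(1)] .
  note B = coord_systemD[OF this]
  obtain C \<eta> where "coord_system W C \<eta>" using coord_system_exists[OF assms(2)] .
  note C = coord_systemD[OF this]
  define E where "E p = (\<lambda>x\<in>carrier V. \<xi> (fst p) x \<odot>\<^bsub>W\<^esub> snd p)" for p
  have E: "E p \<in> carrier (khom V W)" if "p \<in> B \<times> C" for p
  proof -
    obtain b c where p: "p = (b, c)" "b \<in> B" "c \<in> C" using \<open>p \<in> B \<times> C\<close> by auto
    have "(\<lambda>x. \<xi> b x \<odot>\<^bsub>W\<^esub> c) \<in> module_hom ground V W"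
      using p C(2) by (intro modhomI)
        (auto simp: modhom_add[OF B(4)[OF p(2)]] klin_smult[OF B(4)[OF p(2)]] W.smult_l_distr W.smult_assoc)
    from modhom_restrict[OF _ this] show ?thesis using kV by (simp add: E_def p)
  qed
  have "finite_dimensional (khom V W)"
  proof (rule H.fin_dimI[of "B \<times> C" E])
    show "finite (B \<times> C)" using B C by simp
    show "E p \<in> carrier (khom V W)" if "p \<in> B \<times> C" for p using E that .
    fix \<phi> assume phi: "\<phi> \<in> carrier (khom V W)"
    then have lin: "\<phi> \<in> klin V W" by simp
    \<comment> \<open>The matrix entry of \<open>\<phi>\<close> in row \<open>snd p\<close> and
      column \<open>fst p\<close>.\<close>
    let ?a = "\<lambda>p. \<eta> (snd p) (\<phi> (fst p))"
    let ?s = "\<Oplus>\<^bsub>khom V W\<^esub>p\<in>B \<times> C. ?a p \<odot>\<^bsub>khom V W\<^esub> E p"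
    have EH: "(\<lambda>p. ?a p \<odot>\<^bsub>khom V W\<^esub> E p) \<in> B \<times> C \<rightarrow> carrier (khom V W)"
      by (intro Pi_I H.smult_closed E)
    have s: "?s \<in> carrier (khom V W)" using EH by (rule H.finsum_closed)
    have "\<phi> = ?s"
    proof (rule extensionalityI[where A = "carrier V"])
      fix x assume x: "x \<in> carrier V"
      have "?s x = (\<Oplus>\<^bsub>W\<^esub>p\<in>B \<times> C. (?a p \<odot>\<^bsub>khom V W\<^esub> E p) x)"
        using kV kW by (intro hom_space_apply_finsum[OF k_algebra_ground _ _ EH x]) simp_all
      also have "\<dots> = (\<Oplus>\<^bsub>W\<^esub>p\<in>B \<times> C. (\<lambda>b c. (\<eta> c (\<phi> b) * \<xi> b x) \<odot>\<^bsub>W\<^esub> c) (fst p) (snd p))"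
        using x C(2) by (intro W.finsum_cong') (auto simp: E_def W.smult_assoc)
      also have "\<dots> = (\<Oplus>\<^bsub>W\<^esub>b\<in>B. \<Oplus>\<^bsub>W\<^esub>c\<in>C. (\<eta> c (\<phi> b) * \<xi> b x) \<odot>\<^bsub>W\<^esub> c)"
        using B(1) C(1,2) by (intro W.finsum_Times) auto
      also have "\<dots> = (\<Oplus>\<^bsub>W\<^esub>b\<in>B. \<phi> (\<xi> b x \<odot>\<^bsub>V\<^esub> b))"
      proof (rule W.finsum_cong'[OF refl])
        show "(\<lambda>b. \<phi> (\<xi> b x \<odot>\<^bsub>V\<^esub> b)) \<in> B \<rightarrow> carrier W" using B(2) modhom_closed[OF lin] by auto
        fix b assume b: "b \<in> B"
        then have bV: "b \<in> carrier V" using B(2) by auto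
        then have pb: "\<phi> b \<in> carrier W" using modhom_closed[OF lin] by simp
        have "(\<Oplus>\<^bsub>W\<^esub>c\<in>C. (\<eta> c (\<phi> b) * \<xi> b x) \<odot>\<^bsub>W\<^esub> c) = (\<Oplus>\<^bsub>W\<^esub>c\<in>C. \<xi> b x \<odot>\<^bsub>W\<^esub> (\<eta> c (\<phi> b) \<odot>\<^bsub>W\<^esub> c))"
          using C(2) by (intro W.finsum_cong') (auto simp: mult.commute simp flip: W.smult_assoc)
        also have "\<dots> = \<xi> b x \<odot>\<^bsub>W\<^esub> \<phi> b"
          using C(2) C(5)[OF pb] by (subst W.smult_finsum[symmetric]) auto
        finally show "(\<Oplus>\<^bsub>W\<^esub>c\<in>C. (\<eta> c (\<phi> b) * \<xi> b x) \<odot>\<^bsub>W\<^esub> c) = \<phi> (\<xi> b x \<odot>\<^bsub>V\<^esub> b)"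
          using klin_smult[OF lin bV] by simp
      qed
      also have "\<dots> = \<phi> (\<Oplus>\<^bsub>V\<^esub>b\<in>B. \<xi> b x \<odot>\<^bsub>V\<^esub> b)"
        using B(2) by (intro modhom_finsum[OF V.abelian_group_axioms W.abelian_group_axioms lin, symmetric]) auto
      also have "\<dots> = \<phi> x" using B(5)[OF x] by simp
      finally show "\<phi> x = ?s x" by simp
    qed (use phi s in simp_all)
    then show "\<exists>a. \<phi> = (\<Oplus>\<^bsub>khom V W\<^esub>p\<in>B \<times> C. a p \<odot>\<^bsub>khom V W\<^esub> E p)" by (rule exI[of _ ?a])
  qed
  then show ?thesis using H.kspace_axioms by (simp add: fdspace_def)
qed

text \<open>The L-linear maps form a subspace of all linear maps with the same operations
  (\<open>hom_space_eq_sub\<close>).\<close>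

lemma (in kalgebra) fdspace_hom_space:
  assumes "fd_module L M" "fd_module L N"
  shows "fdspace (hom_space L M N)"
proof -
  let ?K = "khom (restrict_scalars L M) (restrict_scalars L N)"
  have lm: "left_module L M" "left_module L N" using assms by (auto simp: fd_module_def)
  interpret H: kspace "hom_space L M N" using lm by (rule kspace_hom_space)
  have K: "fdspace ?K" using assms by (auto simp: fdspace_restrict_scalars intro!: fdspace_khom)
  have "carrier (hom_space L M N) \<subseteq> carrier ?K"
    using modhom_klin by auto
  then have "ksub ?K (carrier (hom_space L M N))"
    using H.zero_closed H.a_closed H.smult_closed unfolding ksub_def by (auto simp: hom_space_def)
  then show ?thesis using fdspace_sub[OF K] hom_space_eq_sub by metis
qed

subsection \<open>Duality and pairings\<close>

lemma fdspace_ground [simp]: "fdspace ground"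
proof -
  have "finite_dimensional ground"
    by (rule kspace.fin_dimI[of ground "{()}" "\<lambda>_. 1"]) auto
  then show ?thesis by (simp add: fdspace_def)
qed

lemma kspace_dual: "kspace V \<Longrightarrow> kspace (dual V)"
  by (simp add: dual_def kspace_khom)

lemma fdspace_dual: "fdspace V \<Longrightarrow> fdspace (dual V)"
  by (simp add: dual_def fdspace_khom)

text \<open>\<open>\<Phi>\<close> is the isomorphism attached to the symmetric form for which
  \<open>B\<close> is orthonormal: it sends each basis vector to its coordinate functional, and a
  functional \<open>f\<close> is recovered from the vector with coordinates f(b).\<close>

lemma kdim_dual:
  assumes V: "fdspace V" shows "kdim (dual V) = kdim V"
proof -
  interpret V: kspace V using V by (simp add: fdspace_def)
  obtain B \<xi> where "coord_system V B \<xi>" using coord_system_exists[OF V] .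
  note B = coord_systemD[OF this]
  define \<Phi> where "\<Phi> w = (\<lambda>x\<in>carrier V. \<Sum>b\<in>B. \<xi> b w * \<xi> b x)" for w
  have delta: "\<xi> b (\<Oplus>\<^bsub>V\<^esub>b'\<in>B. a b' \<odot>\<^bsub>V\<^esub> b') = a b" if b: "b \<in> B" for a b
  proof -
    have "\<xi> b (\<Oplus>\<^bsub>V\<^esub>b'\<in>B. a b' \<odot>\<^bsub>V\<^esub> b') = (\<Sum>b'\<in>B. \<xi> b (a b' \<odot>\<^bsub>V\<^esub> b'))"
      using modhom_finsum[OF V.abelian_group_axioms kspace.axioms(1)[OF kspace_ground]
        B(4)[OF b], of "\<lambda>b. a b \<odot>\<^bsub>V\<^esub> b" B] B(2) by (simp add: Pi_def subset_iff)
    also have "\<dots> = (\<Sum>b'\<in>B. if b' = b then a b else 0)"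
      using b B(2) by (intro sum.cong) (auto simp: subset_iff klin_smult[OF B(4)[OF b]] B(6))
    finally show ?thesis using b B(1) by simp
  qed
  have P: "\<Phi> w \<in> carrier (dual V)" for w
  proof -
    have "(\<lambda>x. \<Sum>b\<in>B. \<xi> b w * \<xi> b x) \<in> klin V ground"
      by (intro modhomI) (auto simp: modhom_add[OF B(4)] klin_smult[OF B(4)] algebra_simps
          sum.distrib sum_distrib_left intro!: sum.cong)
    then show ?thesis using modhom_restrict[of ground V _ ground] V.kspace_axioms
      by (simp add: \<Phi>_def dual_def)
  qed
  have "\<Phi> \<in> klin V (dual V)"
    by (rule modhomI[OF P]) (auto simp: \<Phi>_def dual_def modhom_add[OF B(4)] klin_smult[OF B(4)]
        algebra_simps sum.distrib sum_distrib_left intro!: sum.cong)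
  moreover have "bij_betw \<Phi> (carrier V) (carrier (dual V))"
  proof (rule bij_betwI[where g = "\<lambda>f. \<Oplus>\<^bsub>V\<^esub>b\<in>B. f b \<odot>\<^bsub>V\<^esub> b"])
    show "\<Phi> \<in> carrier V \<rightarrow> carrier (dual V)" using P by auto
    show "(\<lambda>f. \<Oplus>\<^bsub>V\<^esub>b\<in>B. f b \<odot>\<^bsub>V\<^esub> b) \<in> carrier (dual V) \<rightarrow> carrier V"
      using B(2) by (intro Pi_I V.finsum_closed) auto
    fix w assume w: "w \<in> carrier V"
    have "\<Phi> w b = \<xi> b w" if b: "b \<in> B" for b
    proof -
      have "\<Phi> w b = (\<Sum>b'\<in>B. if b' = b then \<xi> b w else 0)"
        unfolding \<Phi>_def using b B(2) by (auto simp: B(6) intro!: sum.cong)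
      then show ?thesis using b B(1) by simp
    qed
    then have "(\<Oplus>\<^bsub>V\<^esub>b\<in>B. \<Phi> w b \<odot>\<^bsub>V\<^esub> b) = (\<Oplus>\<^bsub>V\<^esub>b\<in>B. \<xi> b w \<odot>\<^bsub>V\<^esub> b)"
      using B(2) by (intro V.finsum_cong') auto
    then show "(\<Oplus>\<^bsub>V\<^esub>b\<in>B. \<Phi> w b \<odot>\<^bsub>V\<^esub> b) = w" using B(5)[OF w] by simp
  next
    fix f assume f: "f \<in> carrier (dual V)"
    then have fl: "f \<in> klin V ground" by (simp add: dual_def)
    show "\<Phi> (\<Oplus>\<^bsub>V\<^esub>b\<in>B. f b \<odot>\<^bsub>V\<^esub> b) = f"
    proof (rule extensionalityI[where A = "carrier V"])
      fix x assume x: "x \<in> carrier V"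
      have "\<Phi> (\<Oplus>\<^bsub>V\<^esub>b\<in>B. f b \<odot>\<^bsub>V\<^esub> b) x = (\<Sum>b\<in>B. f (\<xi> b x \<odot>\<^bsub>V\<^esub> b))"
        unfolding \<Phi>_def using x B(2) by (auto simp: delta klin_smult[OF fl] subset_iff intro!: sum.cong)
      also have "\<dots> = f (\<Oplus>\<^bsub>V\<^esub>b\<in>B. \<xi> b x \<odot>\<^bsub>V\<^esub> b)"
        using modhom_finsum[OF V.abelian_group_axioms kspace.axioms(1)[OF kspace_ground] fl,
          of "\<lambda>b. \<xi> b x \<odot>\<^bsub>V\<^esub> b" B] B(2) by (simp add: Pi_def subset_iff)
      finally show "\<Phi> (\<Oplus>\<^bsub>V\<^esub>b\<in>B. f b \<odot>\<^bsub>V\<^esub> b) x = f x" using B(5)[OF x] by simp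
    qed (use f in \<open>auto simp: \<Phi>_def dual_def\<close>)
  qed
  ultimately show ?thesis
    using fdspace_bij(2)[OF V kspace_dual[OF V.kspace_axioms]] by blast
qed

lemma separating_functional:
  assumes "fdspace V" "x \<in> carrier V" "x \<noteq> \<zero>\<^bsub>V\<^esub>"
  shows "\<exists>f\<in>klin V ground. f x \<noteq> 0"
proof (rule ccontr)
  assume neg: "\<not> ?thesis"
  interpret V: kspace V using assms(1) by (simp add: fdspace_def)
  obtain B \<xi> where "coord_system V B \<xi>" using coord_system_exists[OF assms(1)] .
  note B = coord_systemD[OF this]
  have "(\<Oplus>\<^bsub>V\<^esub>b\<in>B. \<xi> b x \<odot>\<^bsub>V\<^esub> b) = \<zero>\<^bsub>V\<^esub>"
    using neg B(2,4) by (intro V.finsum_all_zero) (metis V.smult_zero subsetD)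
  then show False using B(5)[OF assms(2)] assms(3) by simp
qed

text \<open>Nondegeneracy on the left makes \<open>v \<mapsto> \<beta> v\<close> an embedding of
  \<open>V\<close> into the dual of \<open>W\<close>.\<close>

lemma pairing_kdim_le:
  assumes V: "fdspace V" and W: "fdspace W"
    and "\<And>v. v \<in> carrier V \<Longrightarrow> \<beta> v \<in> klin W ground"
    and "\<And>w. w \<in> carrier W \<Longrightarrow> (\<lambda>v. \<beta> v w) \<in> klin V ground"
    and "\<And>v. v \<in> carrier V \<Longrightarrow> (\<And>w. w \<in> carrier W \<Longrightarrow> \<beta> v w = 0) \<Longrightarrow> v = \<zero>\<^bsub>V\<^esub>"
  shows "kdim V \<le> kdim W"
proof -
  have kW: "kspace W" using W by (simp add: fdspace_def)
  interpret W: kspace W by fact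
  have "kdim V \<le> kdim (dual W)"
  proof (rule kdim_le_inj[OF V fdspace_dual[OF W], of "\<lambda>v. \<lambda>w\<in>carrier W. \<beta> v w"])
    show "(\<lambda>v. \<lambda>w\<in>carrier W. \<beta> v w) \<in> klin V (dual W)"
    proof (rule modhomI)
      show "restrict (\<beta> v) (carrier W) \<in> carrier (dual W)" if "v \<in> carrier V" for v
        using modhom_restrict[of ground W "\<beta> v" ground] assms(3)[OF that] kW by (simp add: dual_def)
    qed (auto simp: dual_def modhom_add[OF assms(4)] klin_smult[OF assms(4)] intro!: restrict_ext)
    fix v assume v: "v \<in> carrier V" and z: "restrict (\<beta> v) (carrier W) = \<zero>\<^bsub>dual W\<^esub>"
    have "\<beta> v w = 0" if w: "w \<in> carrier W" for w
    proof -
      have "restrict (\<beta> v) (carrier W) w = \<zero>\<^bsub>dual W\<^esub> w" unfolding z ..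
      then show ?thesis using w by (simp add: dual_def)
    qed
    then show "v = \<zero>\<^bsub>V\<^esub>" using assms(5)[OF v] by simp
  qed
  then show ?thesis using kdim_dual[OF W] by simp
qed

lemma pairing_kdim_eq:
  assumes "fdspace V" "fdspace W"
    and "\<And>v. v \<in> carrier V \<Longrightarrow> \<beta> v \<in> klin W ground"
    and "\<And>w. w \<in> carrier W \<Longrightarrow> (\<lambda>v. \<beta> v w) \<in> klin V ground"
    and "\<And>v. v \<in> carrier V \<Longrightarrow> (\<And>w. w \<in> carrier W \<Longrightarrow> \<beta> v w = 0) \<Longrightarrow> v = \<zero>\<^bsub>V\<^esub>"
    and "\<And>w. w \<in> carrier W \<Longrightarrow> (\<And>v. v \<in> carrier V \<Longrightarrow> \<beta> v w = 0) \<Longrightarrow> w = \<zero>\<^bsub>W\<^esub>"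
  shows "kdim V = kdim W"
  using pairing_kdim_le[of V W \<beta>] pairing_kdim_le[of W V "\<lambda>w v. \<beta> v w"] assms
  by (intro antisym) blast+

text \<open>The number \<open>\<beta>' (T v) w = \<beta> v (S w)\<close> depends only on
  \<open>T v\<close> by its first form and only on \<open>S w\<close> by its second, so it is a
  pairing of the two images. It is nondegenerate because \<open>\<beta>\<close> separates points of
  \<open>W\<close> and \<open>\<beta>'\<close> separates points of \<open>V'\<close>. This is the
  rank equality for an operator and its adjoint; it serves both for traces and for the differentials
  of Tor.\<close>

lemma adjoint_rank:
  assumes V: "fdspace V" "kspace V'" and W: "kspace W" "fdspace W'"
    and T: "T \<in> klin V V'" and S: "S \<in> klin W' W"
    and \<beta>: "\<And>v. v \<in> carrier V \<Longrightarrow> \<beta> v \<in> klin W ground"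
    and \<beta>': "\<And>w. w \<in> carrier W' \<Longrightarrow> (\<lambda>v. \<beta>' v w) \<in> klin V' ground"
    and adj: "\<And>v w. v \<in> carrier V \<Longrightarrow> w \<in> carrier W' \<Longrightarrow> \<beta>' (T v) w = \<beta> v (S w)"
    and nd: "\<And>w. w \<in> carrier W \<Longrightarrow> (\<And>v. v \<in> carrier V \<Longrightarrow> \<beta> v w = 0) \<Longrightarrow> w = \<zero>\<^bsub>W\<^esub>"
    and nd': "\<And>v. v \<in> carrier V' \<Longrightarrow> (\<And>w. w \<in> carrier W' \<Longrightarrow> \<beta>' v w = 0) \<Longrightarrow> v = \<zero>\<^bsub>V'\<^esub>"
  shows "kdim (sub V' (T ` carrier V)) = kdim (sub W (S ` carrier W'))"
proof -
  \<comment> \<open>Any preimage under \<open>T\<close> will do: on the image of \<open>S\<close>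
    the value is rewritten as \<open>\<beta>' x w\<close>, where the choice no longer
    occurs.\<close>
  define \<gamma> where "\<gamma> x y = \<beta> (inv_into (carrier V) T x) y" for x y
  have kV: "kspace V" "kspace W'" using V W by (auto simp: fdspace_def)
  have TV: "T v \<in> carrier V'" if "v \<in> carrier V" for v using modhom_closed[OF T that] .
  have SW: "S w \<in> carrier W" if "w \<in> carrier W'" for w using modhom_closed[OF S that] .
  have g: "\<gamma> x (S w) = \<beta>' x w" if "x \<in> T ` carrier V" "w \<in> carrier W'" for x w
    using that adj[of "inv_into (carrier V) T x" w] by (simp add: \<gamma>_def inv_into_into f_inv_into_f)
  show ?thesis
  proof (rule pairing_kdim_eq[where \<beta> = \<gamma>])
    show "fdspace (sub V' (T ` carrier V))" "fdspace (sub W (S ` carrier W'))"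
      using rank_nullity(2) V W T S by blast+
    show "\<gamma> x \<in> klin (sub W (S ` carrier W')) ground" if "x \<in> carrier (sub V' (T ` carrier V))" for x
    proof -
      have "inv_into (carrier V) T x \<in> carrier V" using that by (simp add: inv_into_into)
      note b = \<beta>[OF this]
      show ?thesis using SW
        by (intro modhomI) (auto simp: \<gamma>_def modhom_add[OF b] klin_smult[OF b])
    qed
    show "(\<lambda>x. \<gamma> x y) \<in> klin (sub V' (T ` carrier V)) ground"
      if "y \<in> carrier (sub W (S ` carrier W'))" for y
    proof -
      obtain w where w: "w \<in> carrier W'" "y = S w" using \<open>y \<in> _\<close> by auto
      have l: "(\<lambda>x. \<beta>' x w) \<in> klin (sub V' (T ` carrier V)) ground"
        using TV by (intro modhomI) (auto simp: modhom_add[OF \<beta>'[OF w(1)]] klin_smult[OF \<beta>'[OF w(1)]])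
      have k: "kspace (sub V' (T ` carrier V))"
        using kspace_sub ksub_image[OF kV(1) V(2) T] V(2) by blast
      show ?thesis
      proof (rule modhom_cong[OF kspace.axioms(1)[OF k] _ l])
        show "\<gamma> x y = \<beta>' x w" if "x \<in> carrier (sub V' (T ` carrier V))" for x
          using g[of x w] w that by simp
      qed (rule kspace.smult_closed[OF k])
    qed
    show "x = \<zero>\<^bsub>sub V' (T ` carrier V)\<^esub>"
      if "x \<in> carrier (sub V' (T ` carrier V))" "\<And>w. w \<in> carrier (sub W (S ` carrier W')) \<Longrightarrow> \<gamma> x w = 0" for x
      using nd'[of x] that g[of x] TV by auto
    show "y = \<zero>\<^bsub>sub W (S ` carrier W')\<^esub>"
      if "y \<in> carrier (sub W (S ` carrier W'))" and y0: "\<And>v. v \<in> carrier (sub V' (T ` carrier V)) \<Longrightarrow> \<gamma> v y = 0" for y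
    proof -
      obtain w where w: "w \<in> carrier W'" "y = S w" using \<open>y \<in> _\<close> by auto
      have "\<beta> v y = 0" if v: "v \<in> carrier V" for v
      proof -
        have "\<gamma> (T v) y = 0" using y0[of "T v"] v by simp
        then show ?thesis using adj[OF v w(1)] g[of "T v" w] v w by simp
      qed
      then show ?thesis using nd[of y] SW w by simp
    qed
  qed
qed

section \<open>Finite-dimensional modules\<close>

text \<open>Lift the members of a basis of \<open>Y\<close> and extend linearly. Such linear
  splittings are later turned into L-linear maps by \<open>trace\<close>.\<close>

lemma klin_section:
  assumes "kspace X" "fdspace Y" "g \<in> klin X Y" "g ` carrier X = carrier Y"
  obtains \<sigma> where "\<sigma> \<in> klin Y X" "\<And>y. y \<in> carrier Y \<Longrightarrow> g (\<sigma> y) = y"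
proof -
  interpret X: kspace X by fact
  interpret Y: kspace Y using assms(2) by (rule fdspace_kspace)
  obtain B \<xi> where "coord_system Y B \<xi>" using coord_system_exists[OF assms(2)] .
  note B = coord_systemD[OF this]
  have "\<forall>b\<in>B. \<exists>x\<in>carrier X. g x = b" using B(2) assms(4) by (metis imageE subsetD)
  then obtain s where s: "\<And>b. b \<in> B \<Longrightarrow> s b \<in> carrier X" "\<And>b. b \<in> B \<Longrightarrow> g (s b) = b" by metis
  define \<sigma> where "\<sigma> y = (\<Oplus>\<^bsub>X\<^esub>b\<in>B. \<xi> b y \<odot>\<^bsub>X\<^esub> s b)" for y
  have "\<sigma> \<in> klin Y X"
  proof (rule modhomI)
    show "\<sigma> y \<in> carrier X" for y unfolding \<sigma>_def using s by (intro X.finsum_closed) auto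
    fix y z assume yz: "y \<in> carrier Y" "z \<in> carrier Y"
    have "\<sigma> (y \<oplus>\<^bsub>Y\<^esub> z) = (\<Oplus>\<^bsub>X\<^esub>b\<in>B. \<xi> b y \<odot>\<^bsub>X\<^esub> s b \<oplus>\<^bsub>X\<^esub> \<xi> b z \<odot>\<^bsub>X\<^esub> s b)"
      unfolding \<sigma>_def using s yz
      by (intro X.finsum_cong') (auto simp: modhom_add[OF B(4)] X.smult_l_distr)
    then show "\<sigma> (y \<oplus>\<^bsub>Y\<^esub> z) = \<sigma> y \<oplus>\<^bsub>X\<^esub> \<sigma> z"
      unfolding \<sigma>_def using s by (subst X.finsum_addf[symmetric]) auto
  next
    fix c y assume y: "y \<in> carrier Y"
    have "\<sigma> (c \<odot>\<^bsub>Y\<^esub> y) = (\<Oplus>\<^bsub>X\<^esub>b\<in>B. c \<odot>\<^bsub>X\<^esub> (\<xi> b y \<odot>\<^bsub>X\<^esub> s b))"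
      unfolding \<sigma>_def using s y
      by (intro X.finsum_cong') (auto simp: klin_smult[OF B(4)] X.smult_assoc)
    then show "\<sigma> (c \<odot>\<^bsub>Y\<^esub> y) = c \<odot>\<^bsub>X\<^esub> \<sigma> y"
      unfolding \<sigma>_def using s by (subst X.smult_finsum) auto
  qed
  moreover have "g (\<sigma> y) = y" if y: "y \<in> carrier Y" for y
  proof -
    have "g (\<sigma> y) = (\<Oplus>\<^bsub>Y\<^esub>b\<in>B. g (\<xi> b y \<odot>\<^bsub>X\<^esub> s b))"
      unfolding \<sigma>_def using s
      by (intro modhom_finsum[OF X.abelian_group_axioms Y.abelian_group_axioms assms(3)]) auto
    also have "\<dots> = (\<Oplus>\<^bsub>Y\<^esub>b\<in>B. \<xi> b y \<odot>\<^bsub>Y\<^esub> b)"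
      using s B(2) by (intro Y.finsum_cong') (auto simp: klin_smult[OF assms(3)])
    finally show ?thesis using B(5)[OF y] by simp
  qed
  ultimately show ?thesis by (rule that)
qed

lemma modhom_minus:
  assumes "abelian_group M" "abelian_group N" "f \<in> module_hom R M N" "x \<in> carrier M" "y \<in> carrier M"
  shows "f (x \<ominus>\<^bsub>M\<^esub> y) = f x \<ominus>\<^bsub>N\<^esub> f y"
proof -
  interpret M: abelian_group M by fact
  interpret N: abelian_group N by fact
  have "f (x \<ominus>\<^bsub>M\<^esub> y) \<oplus>\<^bsub>N\<^esub> f y = f x"
    using assms(4,5) modhom_add[OF assms(3), of "x \<ominus>\<^bsub>M\<^esub> y" y]
    by (simp add: M.minus_eq M.a_assoc M.l_neg)
  then show ?thesis using assms(4,5) modhom_closed[OF assms(3)]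
    by (metis M.minus_closed N.add.inv_solve_right N.minus_eq)
qed

text \<open>Let p be the projection of \<open>Y\<close> onto its quotient by the image of
  \<open>i\<close>, with a linear section \<open>\<sigma>\<close>. Then y - \<sigma>(p y) projects
  \<open>Y\<close> onto that image, on which \<open>i\<close> is inverted.\<close>

lemma klin_retraction:
  assumes "kspace X" "fdspace Y" "i \<in> klin X Y" "inj_on i (carrier X)"
  obtains \<rho> where "\<rho> \<in> klin Y X" "\<And>x. x \<in> carrier X \<Longrightarrow> \<rho> (i x) = x"
proof -
  interpret X: kspace X by fact
  have kY: "kspace Y" using assms(2) by (rule fdspace_kspace)
  interpret Y: kspace Y by fact
  let ?S = "i ` carrier X" and ?p = "\<lambda>y. (i ` carrier X) +>\<^bsub>Y\<^esub> y"
  have S: "ksub Y ?S" using ksub_image[OF assms(1) kY assms(3)] .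
  have p: "?p \<in> klin Y (quot Y ?S)" using Y.quot_proj[OF S] .
  obtain \<sigma> where sg: "\<sigma> \<in> klin (quot Y ?S) Y" "\<And>q. q \<in> carrier (quot Y ?S) \<Longrightarrow> ?p (\<sigma> q) = q"
    using klin_section[OF kY fdspace_quot[OF assms(2) S] p] Y.quot_carrier[of ?S] by metis
  let ?d = "\<lambda>y. y \<ominus>\<^bsub>Y\<^esub> \<sigma> (?p y)"
  have spY: "\<sigma> (?p y) \<in> carrier Y" if "y \<in> carrier Y" for y
    using modhom_closed[OF sg(1) modhom_closed[OF p that]] .
  have dS: "?d y \<in> ?S" if "y \<in> carrier Y" for y
    using Y.coset_eq_iff[OF S that spY[OF that]] sg(2)[OF modhom_closed[OF p that]] by simp
  have d: "?d \<in> klin Y Y"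
  proof (rule modhomI)
    fix y z assume "y \<in> carrier Y" "z \<in> carrier Y"
    then show "?d (y \<oplus>\<^bsub>Y\<^esub> z) = ?d y \<oplus>\<^bsub>Y\<^esub> ?d z"
      using spY by (simp add: modhom_add[OF p] modhom_add[OF sg(1)] modhom_closed[OF p] Y.minus_eq
          Y.minus_add Y.a_ac)
  next
    fix c y assume "y \<in> carrier Y"
    then show "?d (c \<odot>\<^bsub>Y\<^esub> y) = c \<odot>\<^bsub>Y\<^esub> ?d y"
      using spY by (simp add: klin_smult[OF p] klin_smult[OF sg(1)] modhom_closed[OF p] Y.minus_eq
          Y.smult_r_distr Y.smult_neg_right)
  qed (use spY in simp)
  have iS: "i \<in> klin X (sub Y ?S)" using assms(3) by (auto simp: LinearCombinations.module_hom_def)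
  have j: "inv_into (carrier X) i \<in> klin (sub Y ?S) X"
    by (rule modhom_inv_into[OF iS _ X.abelian_group_axioms]) (use assms(4) in \<open>auto simp: bij_betw_def\<close>)
  have dS': "?d \<in> klin Y (sub Y ?S)" using d dS by (auto simp: LinearCombinations.module_hom_def)
  show ?thesis
  proof (rule that)
    show "(\<lambda>y. inv_into (carrier X) i (?d y)) \<in> klin Y X" by (rule modhom_comp[OF dS' j])
    fix x assume x: "x \<in> carrier X"
    then have ix: "i x \<in> carrier Y" "i x \<in> ?S" using modhom_closed[OF assms(3)] by auto
    have "?p (i x) = ?S" using Y.quot_kernel[OF S] ix by blast
    moreover have "\<sigma> ?S = \<zero>\<^bsub>Y\<^esub>"
      using modhom_zero[OF kspace.axioms(1)[OF Y.kspace_quot[OF S]] Y.abelian_group_axioms sg(1)] by simp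
    ultimately have "?d (i x) = i x \<ominus>\<^bsub>Y\<^esub> \<zero>\<^bsub>Y\<^esub>" by simp
    also have "\<dots> = i x" unfolding a_minus_def using ix Y.minus_equality[of "\<zero>\<^bsub>Y\<^esub>" "\<zero>\<^bsub>Y\<^esub>"] by simp
    finally show "inv_into (carrier X) i (?d (i x)) = x" using x assms(4) by simp
  qed
qed

text \<open>Carries a module along \<open>p\<close> to the type of the values of \<open>p\<close>,
  computing on chosen preimages. The result is a module once the fibres of \<open>p\<close> respect
  the operations; it serves to realise quotients on \<open>nat \<Rightarrow> 'k\<close>.\<close>

definition image_module :: "('m \<Rightarrow> 'w) \<Rightarrow> ('l, 'm) module \<Rightarrow> ('l, 'w) module" where
  "image_module p M = (let s = inv_into (carrier M) p in
     \<lparr>carrier = p ` carrier M, mult = undefined, one = undefined, zero = p \<zero>\<^bsub>M\<^esub>,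
      add = (\<lambda>u v. p (s u \<oplus>\<^bsub>M\<^esub> s v)), smult = (\<lambda>l u. p (l \<odot>\<^bsub>M\<^esub> s u))\<rparr>)"

lemma
  assumes "left_module L M"
    and add: "\<And>x x' y y'. \<lbrakk>x \<in> carrier M; x' \<in> carrier M; y \<in> carrier M; y' \<in> carrier M; p x = p x'; p y = p y'\<rbrakk>
      \<Longrightarrow> p (x \<oplus>\<^bsub>M\<^esub> y) = p (x' \<oplus>\<^bsub>M\<^esub> y')"
    and smult: "\<And>l x x'. \<lbrakk>l \<in> carrier L; x \<in> carrier M; x' \<in> carrier M; p x = p x'\<rbrakk>
      \<Longrightarrow> p (l \<odot>\<^bsub>M\<^esub> x) = p (l \<odot>\<^bsub>M\<^esub> x')"
  shows image_module_hom: "p \<in> module_hom L M (image_module p M)"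
    and left_module_image_module: "left_module L (image_module p M)"
proof -
  have s: "inv_into (carrier M) p (p x) \<in> carrier M" "p (inv_into (carrier M) p (p x)) = p x"
    if "x \<in> carrier M" for x
    using that by (auto simp: inv_into_into f_inv_into_f)
  show h: "p \<in> module_hom L M (image_module p M)"
    by (rule modhomI) (auto simp: image_module_def Let_def s intro!: add smult)
  show "left_module L (image_module p M)"
    by (rule left_module_transport[OF assms(1), of p])
      (auto simp: modhom_add[OF h] modhom_smult[OF h], auto simp: image_module_def Let_def)
qed

section \<open>Submodules, and quotients realised on \<open>nat \<Rightarrow> 'k\<close>\<close>

definition lsub :: "('l, 'c) ring_scheme \<Rightarrow> ('l, 'm) module \<Rightarrow> 'm set \<Rightarrow> bool" where
  "lsub L M S \<longleftrightarrow> S \<subseteq> carrier M \<and> \<zero>\<^bsub>M\<^esub> \<in> S \<and> (\<forall>x\<in>S. \<forall>y\<in>S. x \<oplus>\<^bsub>M\<^esub> y \<in> S) \<and>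
     (\<forall>l\<in>carrier L. \<forall>x\<in>S. l \<odot>\<^bsub>M\<^esub> x \<in> S)"

lemma lsub_kernel:
  assumes "left_module L M" "left_module L N" "f \<in> module_hom L M N"
  shows "lsub L M {x \<in> carrier M. f x = \<zero>\<^bsub>N\<^esub>}"
proof -
  interpret M: left_module L M by fact
  interpret N: left_module L N by fact
  show ?thesis
    using modhom_zero[OF M.M.abelian_group_axioms N.M.abelian_group_axioms assms(3)]
    by (auto simp: lsub_def modhom_add[OF assms(3)] modhom_smult[OF assms(3)] M.smult_closed)
qed

lemma lsub_image:
  assumes "left_module L M" "left_module L N" "f \<in> module_hom L M N"
  shows "lsub L N (f ` carrier M)"
proof -
  interpret M: left_module L M by fact
  interpret N: left_module L N by fact
  have "\<zero>\<^bsub>N\<^esub> = f \<zero>\<^bsub>M\<^esub>"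
    using modhom_zero[OF M.M.abelian_group_axioms N.M.abelian_group_axioms assms(3)] by simp
  then show ?thesis
    using modhom_closed[OF assms(3)]
    by (auto simp: lsub_def modhom_add[OF assms(3), symmetric] modhom_smult[OF assms(3), symmetric]
        M.smult_closed)
qed

context kalgebra
begin

abbreviation rs :: "('l, 'm) module \<Rightarrow> ('k, 'm) module" where
  "rs \<equiv> restrict_scalars L"

lemma lsub_ksub: "lsub L M S \<Longrightarrow> ksub (rs M) S"
  by (auto simp: lsub_def ksub_def)

lemma fd_moduleD:
  assumes "fd_module L M"
  shows "left_module L M" "fdspace (rs M)" "kspace (rs M)"
  using assms kspace_restrict_scalars by (auto simp: fdspace_restrict_scalars)

lemma
  assumes "lsub L M S"
  shows left_module_sub: "left_module L M \<Longrightarrow> left_module L (M\<lparr>carrier := S\<rparr>)"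
    and fd_module_sub: "fd_module L M \<Longrightarrow> fd_module L (M\<lparr>carrier := S\<rparr>)"
proof -
  have eq: "rs (M\<lparr>carrier := S\<rparr>) = sub (rs M) S" by (simp add: restrict_scalars_def)
  show *: "left_module L (M\<lparr>carrier := S\<rparr>)" if "left_module L M"
  proof -
    interpret M: left_module L M by fact
    interpret S: kspace "sub (rs M) S"
      by (rule kspace_sub[OF kspace_restrict_scalars[OF that] lsub_ksub[OF assms]])
    have "abelian_group (M\<lparr>carrier := S\<rparr>)"
      by (rule abelian_group_transport[OF S.abelian_group_axioms, of "\<lambda>x. x"]) auto
    then show ?thesis
      by (intro left_module.intro ring_axioms left_module_axioms.intro)
        (use assms in \<open>auto simp: lsub_def subset_iff M.smult_l_distr M.smult_r_distr M.smult_assoc M.smult_one\<close>)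
  qed
  show "fd_module L (M\<lparr>carrier := S\<rparr>)" if "fd_module L M"
    using that * fdspace_sub lsub_ksub[OF assms] by (auto simp: fdspace_restrict_scalars eq)
qed

text \<open>A coset is encoded as its sequence of coordinates in an enumerated basis of the quotient
  space, and the module structure is carried along this encoding.\<close>

lemma quotient_umodule:
  assumes "fd_module L M" "lsub L M S"
  obtains W :: "('k, 'l) umodule" and p where "fd_module L W" "p \<in> module_hom L M W"
    "p ` carrier M = carrier W" "\<And>x. x \<in> carrier M \<Longrightarrow> p x = \<zero>\<^bsub>W\<^esub> \<longleftrightarrow> x \<in> S"
proof -
  note M = fd_moduleD[OF assms(1)]
  interpret M: left_module L M by (rule M)
  interpret K: kspace "rs M" by (rule M)
  have S: "ksub (rs M) S" using assms(2) by (rule lsub_ksub)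
  let ?Q = "quot (rs M) S" and ?c = "\<lambda>x. S +>\<^bsub>rs M\<^esub> x"
  interpret Q: kspace ?Q using S by (rule K.kspace_quot)
  obtain B \<xi> where "coord_system ?Q B \<xi>" using coord_system_exists[OF fdspace_quot[OF M(2) S]] .
  note B = coord_systemD[OF this]
  obtain h where h: "bij_betw h {0..<card B} B" using ex_bij_betw_nat_finite[OF B(1)] by blast
  \<comment> \<open>Coordinates are padded with zeros beyond the dimension; what matters is
    injectivity on the quotient.\<close>
  define emb where "emb q = (\<lambda>i. if i < card B then \<xi> (h i) q else 0)" for q
  have emb_inj: "q = q'" if "q \<in> carrier ?Q" "q' \<in> carrier ?Q" "emb q = emb q'" for q q'
  proof -
    have "\<xi> b q = \<xi> b q'" if "b \<in> B" for b
    proof -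
      obtain i where "i < card B" "b = h i" using h \<open>b \<in> B\<close> unfolding bij_betw_def
        by (metis atLeastLessThan_iff imageE)
      then show ?thesis using fun_cong[OF \<open>emb q = emb q'\<close>, of i] by (simp add: emb_def)
    qed
    then have "(\<Oplus>\<^bsub>?Q\<^esub>b\<in>B. \<xi> b q \<odot>\<^bsub>?Q\<^esub> b) = (\<Oplus>\<^bsub>?Q\<^esub>b\<in>B. \<xi> b q' \<odot>\<^bsub>?Q\<^esub> b)"
      using B(2) by (intro Q.finsum_cong') auto
    then show ?thesis using B(5)[OF that(1)] B(5)[OF that(2)] by simp
  qed
  have c: "?c x \<in> carrier ?Q" if "x \<in> carrier M" for x
    using that by (auto simp: K.quot_carrier)
  define p where "p x = emb (?c x)" for x
  have p_iff: "p x = p y \<longleftrightarrow> x \<ominus>\<^bsub>rs M\<^esub> y \<in> S" if "x \<in> carrier M" "y \<in> carrier M" for x y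
  proof -
    have "p x = p y \<longleftrightarrow> ?c x = ?c y" using emb_inj[OF c[OF that(1)] c[OF that(2)]] unfolding p_def by auto
    then show ?thesis using K.coset_eq_iff[OF S, of x y] that by simp
  qed
  have lm: "left_module L (image_module p M)" and ph: "p \<in> module_hom L M (image_module p M)"
  proof -
    have 1: "p (x \<oplus>\<^bsub>M\<^esub> y) = p (x' \<oplus>\<^bsub>M\<^esub> y')"
      if x: "x \<in> carrier M" "x' \<in> carrier M" "y \<in> carrier M" "y' \<in> carrier M" "p x = p x'" "p y = p y'"
      for x x' y y'
    proof -
      have "?c x = ?c x'" "?c y = ?c y'" using x emb_inj[OF c c] unfolding p_def by auto
      then have "?c (x \<oplus>\<^bsub>rs M\<^esub> y) = ?c (x' \<oplus>\<^bsub>rs M\<^esub> y')" using x K.quot_add[OF S] by (metis restrict_scalars_simps(1))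
      then show ?thesis by (simp add: p_def)
    qed
    have 2: "p (l \<odot>\<^bsub>M\<^esub> x) = p (l \<odot>\<^bsub>M\<^esub> x')"
      if x: "l \<in> carrier L" "x \<in> carrier M" "x' \<in> carrier M" "p x = p x'" for l x x'
    proof -
      \<comment> \<open>Subtraction refers only to carrier, zero and addition of a record, and these
        are kept by restriction of scalars.\<close>
      have m: "u \<ominus>\<^bsub>rs M\<^esub> v = u \<ominus>\<^bsub>M\<^esub> v" for u v by (simp add: a_minus_def a_inv_def m_inv_def)
      have "x \<ominus>\<^bsub>M\<^esub> x' \<in> S" using x p_iff m by simp
      then have "l \<odot>\<^bsub>M\<^esub> (x \<ominus>\<^bsub>M\<^esub> x') \<in> S" using assms(2) x by (simp add: lsub_def)
      moreover have "l \<odot>\<^bsub>M\<^esub> (x \<ominus>\<^bsub>M\<^esub> x') = l \<odot>\<^bsub>M\<^esub> x \<ominus>\<^bsub>M\<^esub> l \<odot>\<^bsub>M\<^esub> x'"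
        using x by (simp add: a_minus_def M.smult_r_distr M.smult_minus_right)
      ultimately show ?thesis using x p_iff[of "l \<odot>\<^bsub>M\<^esub> x" "l \<odot>\<^bsub>M\<^esub> x'"] m M.smult_closed by simp
    qed
    show "left_module L (image_module p M)" by (rule left_module_image_module[OF M(1) 1 2])
    show "p \<in> module_hom L M (image_module p M)" by (rule image_module_hom[OF M(1) 1 2])
  qed
  show ?thesis
  proof (rule that[of "image_module p M" p])
    show im: "p ` carrier M = carrier (image_module p M)" by (simp add: image_module_def Let_def)
    have "fdspace (sub (rs (image_module p M)) (p ` carrier (rs M)))"
      by (rule rank_nullity(2)[OF M(2) kspace_restrict_scalars[OF lm] modhom_klin[OF ph]])
    moreover have "sub (rs (image_module p M)) (p ` carrier (rs M)) = rs (image_module p M)"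
      using im by (simp add: restrict_scalars_def)
    ultimately show "fd_module L (image_module p M)" using lm by (simp add: fdspace_restrict_scalars)
    show "p x = \<zero>\<^bsub>image_module p M\<^esub> \<longleftrightarrow> x \<in> S" if "x \<in> carrier M" for x
    proof -
      have "p x = \<zero>\<^bsub>image_module p M\<^esub> \<longleftrightarrow> ?c x = ?c \<zero>\<^bsub>M\<^esub>"
        using emb_inj[OF c c] that by (auto simp: image_module_def Let_def p_def)
      also have "\<dots> \<longleftrightarrow> x \<in> S" using K.coset_zero[OF S] K.quot_kernel[OF S] that by auto
      finally show ?thesis .
    qed
  qed (fact lm ph)+
qed

lemma inj_on_hom_iff:
  assumes "left_module L M" "left_module L N" "f \<in> module_hom L M N"
  shows "inj_on f (carrier M) \<longleftrightarrow> (\<forall>x\<in>carrier M. f x = \<zero>\<^bsub>N\<^esub> \<longrightarrow> x = \<zero>\<^bsub>M\<^esub>)"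
proof -
  interpret M: left_module L M by fact
  interpret N: left_module L N by fact
  note z = modhom_zero[OF M.M.abelian_group_axioms N.M.abelian_group_axioms assms(3)]
  show ?thesis
  proof
    assume "inj_on f (carrier M)"
    then show "\<forall>x\<in>carrier M. f x = \<zero>\<^bsub>N\<^esub> \<longrightarrow> x = \<zero>\<^bsub>M\<^esub>" using z by (metis M.M.zero_closed inj_onD)
  next
    assume *: "\<forall>x\<in>carrier M. f x = \<zero>\<^bsub>N\<^esub> \<longrightarrow> x = \<zero>\<^bsub>M\<^esub>"
    show "inj_on f (carrier M)"
    proof (rule inj_onI)
      fix x y assume xy: "x \<in> carrier M" "y \<in> carrier M" "f x = f y"
      have "f (x \<ominus>\<^bsub>M\<^esub> y) = \<zero>\<^bsub>N\<^esub>"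
        using modhom_minus[OF M.M.abelian_group_axioms N.M.abelian_group_axioms assms(3) xy(1,2)] xy
          modhom_closed[OF assms(3)] by (simp add: N.M.r_neg a_minus_def)
      then have "x \<ominus>\<^bsub>M\<^esub> y = \<zero>\<^bsub>M\<^esub>" using * xy by simp
      then have "(x \<ominus>\<^bsub>M\<^esub> y) \<oplus>\<^bsub>M\<^esub> y = y" using xy by simp
      then show "x = y" using xy by (simp add: a_minus_def M.M.a_assoc M.M.l_neg)
    qed
  qed
qed

text \<open>The quotient by the zero submodule. It justifies the choice with which
  \<open>Suspension\<close> starts.\<close>

lemma umodule_copy:
  assumes "fd_module L M"
  obtains W :: "('k, 'l) umodule" where "fd_module L W" "lmod_iso L M W"
proof -
  note M = fd_moduleD[OF assms]
  interpret M: left_module L M by (rule M)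
  have "lsub L M {\<zero>\<^bsub>M\<^esub>}" by (auto simp: lsub_def)
  from quotient_umodule[OF assms this] obtain W :: "('k, 'l) umodule" and p
    where W: "fd_module L W" "p \<in> module_hom L M W"
    "p ` carrier M = carrier W" "\<And>x. x \<in> carrier M \<Longrightarrow> p x = \<zero>\<^bsub>W\<^esub> \<longleftrightarrow> x \<in> {\<zero>\<^bsub>M\<^esub>}" by metis
  have "inj_on p (carrier M)"
    using W(4) by (subst inj_on_hom_iff[OF M(1) fd_moduleD(1)[OF W(1)] W(2)]) auto
  then have "lmod_iso L M W" using W(2,3) by (auto simp: lmod_iso_def bij_betw_def)
  with W(1) show ?thesis by (rule that)
qed

lemma lmod_iso_sym:
  assumes "left_module L M" "lmod_iso L M N" shows "lmod_iso L N M"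
proof -
  interpret M: left_module L M by fact
  obtain f where "f \<in> module_hom L M N" "bij_betw f (carrier M) (carrier N)"
    using assms(2) by (auto simp: lmod_iso_def)
  then have "inv_into (carrier M) f \<in> module_hom L N M"
    "bij_betw (inv_into (carrier M) f) (carrier N) (carrier M)"
    using modhom_inv_into[of f L M N] M.M.abelian_group_axioms M.smult_closed bij_betw_inv_into
    by blast+
  then show ?thesis by (auto simp: lmod_iso_def)
qed

lemma lmod_iso_trans: "lmod_iso L M N \<Longrightarrow> lmod_iso L N P \<Longrightarrow> lmod_iso L M P"
  unfolding lmod_iso_def using modhom_comp bij_betw_trans unfolding comp_def by blast

text \<open>The coinduced module. Over a Frobenius algebra \<open>M\<close> embeds into it, is a
  quotient of it, and it is relatively projective, so this one construction supplies both covers and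
  hulls.\<close>

definition coind :: "('l, 'm) module \<Rightarrow> ('l, 'l \<Rightarrow> 'm) module" where
  "coind M = \<lparr>carrier = carrier (khom L (rs M)), mult = undefined, one = undefined,
     zero = zero (khom L (rs M)), add = add (khom L (rs M)),
     smult = (\<lambda>l f. \<lambda>x\<in>carrier L. f (x \<otimes> l))\<rparr>"

lemma coind_simps [simp]:
  "carrier (coind M) = klin L (rs M) \<inter> extensional (carrier L)"
  "zero (coind M) = (\<lambda>x\<in>carrier L. \<zero>\<^bsub>M\<^esub>)"
  "add (coind M) = (\<lambda>f g. \<lambda>x\<in>carrier L. f x \<oplus>\<^bsub>M\<^esub> g x)"
  "smult (coind M) = (\<lambda>l f. \<lambda>x\<in>carrier L. f (x \<otimes> l))"
  by (auto simp: coind_def)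

lemma left_module_coind:
  assumes "left_module L M" shows "left_module L (coind M)"
proof -
  interpret M: left_module L M by fact
  interpret K: kspace "rs M" using assms by (rule kspace_restrict_scalars)
  interpret H: kspace "khom L (rs M)" by (rule kspace_khom[OF kspace_axioms K.kspace_axioms])
  note ext = extensionalityI[where A = "carrier L"]
  have ag: "abelian_group (coind M)"
    by (rule abelian_group_transport[OF H.abelian_group_axioms, of "\<lambda>x. x"]) (auto simp: coind_def)
  show ?thesis
  proof (intro left_module.intro ring_axioms ag left_module_axioms.intro)
    fix r f assume r: "r \<in> carrier L" and f: "f \<in> carrier (coind M)"
    then have fl: "f \<in> klin L (rs M)" by simp
    have "(\<lambda>x. f (x \<otimes> r)) \<in> module_hom ground L (rs M)"
      using r modhom_closed[OF fl] by (intro modhomI)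
        (auto simp: l_distr modhom_add[OF fl] smult_mult_left klin_smult[OF fl])
    from modhom_restrict[OF _ this] show "r \<odot>\<^bsub>coind M\<^esub> f \<in> carrier (coind M)"
      using kspace_axioms by simp
    fix s assume s: "s \<in> carrier L"
    show "(r \<oplus> s) \<odot>\<^bsub>coind M\<^esub> f = r \<odot>\<^bsub>coind M\<^esub> f \<oplus>\<^bsub>coind M\<^esub> s \<odot>\<^bsub>coind M\<^esub> f"
      by (rule ext) (use r s in \<open>auto simp: r_distr modhom_add[OF fl]\<close>)
    show "(r \<otimes> s) \<odot>\<^bsub>coind M\<^esub> f = r \<odot>\<^bsub>coind M\<^esub> (s \<odot>\<^bsub>coind M\<^esub> f)"
      by (rule ext) (use r s in \<open>auto simp: m_assoc\<close>)
  next
    fix r f g assume r: "r \<in> carrier L" and f: "f \<in> carrier (coind M)" and g: "g \<in> carrier (coind M)"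
    show "r \<odot>\<^bsub>coind M\<^esub> (f \<oplus>\<^bsub>coind M\<^esub> g) = r \<odot>\<^bsub>coind M\<^esub> f \<oplus>\<^bsub>coind M\<^esub> r \<odot>\<^bsub>coind M\<^esub> g"
      by (rule ext) (use r in auto)
  next
    fix f assume f: "f \<in> carrier (coind M)"
    show "\<one> \<odot>\<^bsub>coind M\<^esub> f = f"
      by (rule ext) (use f in auto)
  qed
qed

text \<open>The scalar \<open>c\<close> acts through the algebra as f(x (c 1)), which by linearity
  of \<open>f\<close> is the pointwise multiple; so the underlying space is the \<open>khom\<close>
  known to be finite-dimensional.\<close>

lemma fd_module_coind:
  assumes "fdspace L" "fd_module L M" shows "fd_module L (coind M)"
proof -
  note M = fd_moduleD[OF assms(2)]
  have lm: "left_module L (coind M)" using M by (intro left_module_coind)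
  have "(\<lambda>f. f) \<in> klin (khom L (rs M)) (rs (coind M))"
  proof (rule modhomI)
    fix c f assume "f \<in> carrier (khom L (rs M))"
    then have fl: "f \<in> klin L (rs M)" by simp
    show "c \<odot>\<^bsub>khom L (rs M)\<^esub> f = c \<odot>\<^bsub>rs (coind M)\<^esub> f"
      by (rule extensionalityI[where A = "carrier L"]) (auto simp: mult_scalar klin_smult[OF fl])
  qed (auto simp: coind_def)
  moreover have "bij_betw (\<lambda>f. f) (carrier (khom L (rs M))) (carrier (rs (coind M)))"
    by (auto simp: coind_def bij_betw_def)
  ultimately have "fdspace (rs (coind M))"
    using fdspace_bij(1)[OF fdspace_khom[OF assms(1) M(2)] kspace_restrict_scalars[OF lm]] by blast
  then show ?thesis using lm by (simp add: fdspace_restrict_scalars)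
qed

end

section \<open>Frobenius systems\<close>

text \<open>\<open>b\<close> and \<open>c\<close> are dual bases for the form
  \<open>lam (x \<otimes> y)\<close>. Nondegeneracy is encoded in the two expansions, a form that
  passes directly to opposite algebras, isomorphic algebras and tensor products.\<close>

locale frobenius = kalgebra L for L :: "('k::field, 'l) module" (structure) +
  fixes I :: "'i set" and b c :: "'i \<Rightarrow> 'l" and lam :: "'l \<Rightarrow> 'k"
  assumes finite_I: "finite I"
    and b_closed: "i \<in> I \<Longrightarrow> b i \<in> carrier L"
    and c_closed: "i \<in> I \<Longrightarrow> c i \<in> carrier L"
    and lam_linear: "lam \<in> klin L ground"
    and expand_b: "x \<in> carrier L \<Longrightarrow> x = (\<Oplus>i\<in>I. lam (x \<otimes> c i) \<odot> b i)"
    and expand_c: "x \<in> carrier L \<Longrightarrow> x = (\<Oplus>i\<in>I. lam (b i \<otimes> x) \<odot> c i)"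
begin

lemma fdspace_algebra: "fdspace L"
proof -
  have "finite_dimensional L"
  proof (rule fin_dimI[of I b])
    show "\<exists>a. x = (\<Oplus>i\<in>I. a i \<odot> b i)" if "x \<in> carrier L" for x
      by (rule exI, rule expand_b[OF that])
  qed (simp_all add: finite_I b_closed)
  then show ?thesis using kspace_axioms by (simp add: fdspace_def)
qed

text \<open>The coefficient of \<open>c j\<close> in \<open>l \<otimes> c i\<close> and that of
  \<open>b i\<close> in \<open>b j \<otimes> l\<close> are both
  \<open>lam (b j \<otimes> l \<otimes> c i)\<close>. This is the invariance of the Casimir element
  \<Sum> c_i \<otimes> b_i, phrased with a bilinear map \<open>G\<close> in place of a tensor
  product.\<close>

lemma casimir:
  assumes W: "kspace W" and l: "l \<in> carrier L"
    and G1: "\<And>q. q \<in> carrier L \<Longrightarrow> (\<lambda>p. G p q) \<in> klin L W"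
    and G2: "\<And>p. p \<in> carrier L \<Longrightarrow> (\<lambda>q. G p q) \<in> klin L W"
  shows "(\<Oplus>\<^bsub>W\<^esub>i\<in>I. G (l \<otimes> c i) (b i)) = (\<Oplus>\<^bsub>W\<^esub>i\<in>I. G (c i) (b i \<otimes> l))"
proof -
  interpret W: kspace W by fact
  let ?a = "\<lambda>j i. lam (b j \<otimes> l \<otimes> c i)"
  have GW: "G p q \<in> carrier W" if "p \<in> carrier L" "q \<in> carrier L" for p q
    using modhom_closed[OF G1[OF that(2)] that(1)] .
  have 1: "G (l \<otimes> c i) (b i) = (\<Oplus>\<^bsub>W\<^esub>j\<in>I. ?a j i \<odot>\<^bsub>W\<^esub> G (c j) (b i))" if i: "i \<in> I" for i
  proof -
    have "l \<otimes> c i = (\<Oplus>j\<in>I. ?a j i \<odot> c j)"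
    proof -
      have "l \<otimes> c i = (\<Oplus>j\<in>I. lam (b j \<otimes> (l \<otimes> c i)) \<odot> c j)"
        using expand_c[of "l \<otimes> c i"] l i c_closed by simp
      also have "\<dots> = (\<Oplus>j\<in>I. ?a j i \<odot> c j)"
        using l i b_closed c_closed by (intro finsum_cong') (auto simp: m_assoc)
      finally show ?thesis .
    qed
    then have "G (l \<otimes> c i) (b i) = G (\<Oplus>j\<in>I. ?a j i \<odot> c j) (b i)" by simp
    also have "\<dots> = (\<Oplus>\<^bsub>W\<^esub>j\<in>I. G (?a j i \<odot> c j) (b i))"
      using c_closed by (intro modhom_finsum[OF abelian_group_axioms W.abelian_group_axioms G1[OF b_closed[OF i]]]) auto
    also have "\<dots> = (\<Oplus>\<^bsub>W\<^esub>j\<in>I. ?a j i \<odot>\<^bsub>W\<^esub> G (c j) (b i))"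
      using i b_closed c_closed GW by (intro W.finsum_cong') (auto simp: klin_smult[OF G1[OF b_closed[OF i]]])
    finally show ?thesis .
  qed
  have 2: "G (c j) (b j \<otimes> l) = (\<Oplus>\<^bsub>W\<^esub>i\<in>I. ?a j i \<odot>\<^bsub>W\<^esub> G (c j) (b i))" if j: "j \<in> I" for j
  proof -
    have "b j \<otimes> l = (\<Oplus>i\<in>I. ?a j i \<odot> b i)" using expand_b[of "b j \<otimes> l"] l j b_closed by simp
    then have "G (c j) (b j \<otimes> l) = G (c j) (\<Oplus>i\<in>I. ?a j i \<odot> b i)" by simp
    also have "\<dots> = (\<Oplus>\<^bsub>W\<^esub>i\<in>I. G (c j) (?a j i \<odot> b i))"
      using b_closed by (intro modhom_finsum[OF abelian_group_axioms W.abelian_group_axioms G2[OF c_closed[OF j]]]) auto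
    also have "\<dots> = (\<Oplus>\<^bsub>W\<^esub>i\<in>I. ?a j i \<odot>\<^bsub>W\<^esub> G (c j) (b i))"
      using j b_closed c_closed GW by (intro W.finsum_cong') (auto simp: klin_smult[OF G2[OF c_closed[OF j]]])
    finally show ?thesis .
  qed
  have "(\<Oplus>\<^bsub>W\<^esub>i\<in>I. G (l \<otimes> c i) (b i)) = (\<Oplus>\<^bsub>W\<^esub>i\<in>I. \<Oplus>\<^bsub>W\<^esub>j\<in>I. ?a j i \<odot>\<^bsub>W\<^esub> G (c j) (b i))"
    using 1 b_closed c_closed GW by (intro W.finsum_cong' refl Pi_I W.finsum_closed) auto
  also have "\<dots> = (\<Oplus>\<^bsub>W\<^esub>j\<in>I. \<Oplus>\<^bsub>W\<^esub>i\<in>I. ?a j i \<odot>\<^bsub>W\<^esub> G (c j) (b i))"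
    using b_closed c_closed GW finite_I by (intro W.finsum_swap) auto
  also have "\<dots> = (\<Oplus>\<^bsub>W\<^esub>j\<in>I. G (c j) (b j \<otimes> l))"
    using 2 b_closed c_closed GW l by (intro W.finsum_cong') auto
  finally show ?thesis .
qed

definition trace :: "('l, 'm) module \<Rightarrow> ('l, 'n) module \<Rightarrow> ('m \<Rightarrow> 'n) \<Rightarrow> 'm \<Rightarrow> 'n" where
  "trace U V \<phi> = (\<lambda>x\<in>carrier U. \<Oplus>\<^bsub>V\<^esub>i\<in>I. c i \<odot>\<^bsub>V\<^esub> \<phi> (b i \<odot>\<^bsub>U\<^esub> x))"

definition trace_maps :: "('l, 'm) module \<Rightarrow> ('l, 'n) module \<Rightarrow> ('m \<Rightarrow> 'n) set" where
  "trace_maps U V = trace U V ` klin (rs U) (rs V)"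

lemma trace_apply:
  "x \<in> carrier U \<Longrightarrow> trace U V \<phi> x = (\<Oplus>\<^bsub>V\<^esub>i\<in>I. c i \<odot>\<^bsub>V\<^esub> \<phi> (b i \<odot>\<^bsub>U\<^esub> x))"
  by (simp add: trace_def)

text \<open>Moving \<open>l\<close> through the sum is \<open>casimir\<close> for the bilinear
  expression p \<phi>(q x) in p and q.\<close>

lemma trace_hom:
  assumes "left_module L U" "left_module L V" and phi: "\<phi> \<in> klin (rs U) (rs V)"
  shows "trace U V \<phi> \<in> carrier (hom_space L U V)"
proof -
  interpret U: left_module L U by fact
  interpret V: left_module L V by fact
  interpret VK: kspace "rs V" by (rule kspace_restrict_scalars) fact
  have pc: "\<phi> x \<in> carrier V" if "x \<in> carrier U" for x using modhom_closed[OF phi] that by simp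
  have pa: "\<phi> (x \<oplus>\<^bsub>U\<^esub> y) = \<phi> x \<oplus>\<^bsub>V\<^esub> \<phi> y" if "x \<in> carrier U" "y \<in> carrier U" for x y
    using modhom_add[OF phi] that by simp
  have ps: "\<phi> ((k \<odot> \<one>) \<odot>\<^bsub>U\<^esub> x) = (k \<odot> \<one>) \<odot>\<^bsub>V\<^esub> \<phi> x" if "x \<in> carrier U" for x k
    using klin_smult[OF phi] that by simp
  have "(\<lambda>x. \<Oplus>\<^bsub>V\<^esub>i\<in>I. c i \<odot>\<^bsub>V\<^esub> \<phi> (b i \<odot>\<^bsub>U\<^esub> x)) \<in> module_hom L U V"
  proof (rule modhomI)
    show "(\<Oplus>\<^bsub>V\<^esub>i\<in>I. c i \<odot>\<^bsub>V\<^esub> \<phi> (b i \<odot>\<^bsub>U\<^esub> x)) \<in> carrier V" if "x \<in> carrier U" for x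
      using that b_closed c_closed by (intro V.M.finsum_closed) (auto simp: pc U.smult_closed V.smult_closed)
    fix x y assume xy: "x \<in> carrier U" "y \<in> carrier U"
    have "(\<Oplus>\<^bsub>V\<^esub>i\<in>I. c i \<odot>\<^bsub>V\<^esub> \<phi> (b i \<odot>\<^bsub>U\<^esub> (x \<oplus>\<^bsub>U\<^esub> y))) =
        (\<Oplus>\<^bsub>V\<^esub>i\<in>I. c i \<odot>\<^bsub>V\<^esub> \<phi> (b i \<odot>\<^bsub>U\<^esub> x) \<oplus>\<^bsub>V\<^esub> c i \<odot>\<^bsub>V\<^esub> \<phi> (b i \<odot>\<^bsub>U\<^esub> y))"
      using xy b_closed c_closed by (intro V.M.finsum_cong')
        (auto simp: U.smult_r_distr V.smult_r_distr pa pc U.smult_closed V.smult_closed)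
    also have "\<dots> = (\<Oplus>\<^bsub>V\<^esub>i\<in>I. c i \<odot>\<^bsub>V\<^esub> \<phi> (b i \<odot>\<^bsub>U\<^esub> x)) \<oplus>\<^bsub>V\<^esub> (\<Oplus>\<^bsub>V\<^esub>i\<in>I. c i \<odot>\<^bsub>V\<^esub> \<phi> (b i \<odot>\<^bsub>U\<^esub> y))"
      using xy b_closed c_closed by (intro V.M.finsum_addf) (auto simp: pc U.smult_closed V.smult_closed)
    finally show "(\<Oplus>\<^bsub>V\<^esub>i\<in>I. c i \<odot>\<^bsub>V\<^esub> \<phi> (b i \<odot>\<^bsub>U\<^esub> (x \<oplus>\<^bsub>U\<^esub> y))) = \<dots>" .
  next
    fix l x assume l: "l \<in> carrier L" and x: "x \<in> carrier U"
    let ?G = "\<lambda>p q. p \<odot>\<^bsub>V\<^esub> \<phi> (q \<odot>\<^bsub>U\<^esub> x)"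
    have "(\<Oplus>\<^bsub>rs V\<^esub>i\<in>I. ?G (l \<otimes> c i) (b i)) = (\<Oplus>\<^bsub>rs V\<^esub>i\<in>I. ?G (c i) (b i \<otimes> l))"
    proof (rule casimir[OF VK.kspace_axioms l])
      show "(\<lambda>p. ?G p q) \<in> klin L (rs V)" if q: "q \<in> carrier L" for q
      proof (rule modhomI)
        have y: "\<phi> (q \<odot>\<^bsub>U\<^esub> x) \<in> carrier V" using q x by (simp add: pc U.smult_closed)
        show "?G p q \<in> carrier (rs V)" if "p \<in> carrier L" for p
          using that y by (simp add: V.smult_closed)
        show "?G (p \<oplus> p') q = ?G p q \<oplus>\<^bsub>rs V\<^esub> ?G p' q" if "p \<in> carrier L" "p' \<in> carrier L" for p p'
          using that y by (simp add: V.smult_l_distr)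
        show "?G (k \<odot> p) q = k \<odot>\<^bsub>rs V\<^esub> ?G p q" if "p \<in> carrier L" for k p
          using scalar_smult_commute(2)[OF assms(2) that y] by simp
      qed
      show "(\<lambda>q. ?G p q) \<in> klin L (rs V)" if p: "p \<in> carrier L" for p
      proof (rule modhomI)
        have ux: "q \<odot>\<^bsub>U\<^esub> x \<in> carrier U" if "q \<in> carrier L" for q using that x by (rule U.smult_closed)
        show "?G p q \<in> carrier (rs V)" if "q \<in> carrier L" for q
          using that p ux by (simp add: V.smult_closed pc)
        show "?G p (q \<oplus> q') = ?G p q \<oplus>\<^bsub>rs V\<^esub> ?G p q'" if "q \<in> carrier L" "q' \<in> carrier L" for q q'
          using that p ux x by (simp add: U.smult_l_distr V.smult_r_distr pc pa)
        show "?G p (k \<odot> q) = k \<odot>\<^bsub>rs V\<^esub> ?G p q" if q: "q \<in> carrier L" for k q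
          using scalar_smult_commute(2)[OF assms(1) q x] scalar_smult_commute(1)[OF assms(2) p pc[OF ux[OF q]]]
            ps[OF ux[OF q]] by simp
      qed
    qed
    moreover have "(\<Oplus>\<^bsub>V\<^esub>i\<in>I. ?G (l \<otimes> c i) (b i)) = l \<odot>\<^bsub>V\<^esub> (\<Oplus>\<^bsub>V\<^esub>i\<in>I. ?G (c i) (b i))"
      using l x b_closed c_closed
      by (subst V.finsum_smult) (auto simp: V.smult_assoc V.smult_closed U.smult_closed pc intro!: V.M.finsum_cong')
    moreover have "(\<Oplus>\<^bsub>V\<^esub>i\<in>I. ?G (c i) (b i \<otimes> l)) = (\<Oplus>\<^bsub>V\<^esub>i\<in>I. c i \<odot>\<^bsub>V\<^esub> \<phi> (b i \<odot>\<^bsub>U\<^esub> (l \<odot>\<^bsub>U\<^esub> x)))"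
      using l x b_closed c_closed
      by (auto simp: U.smult_assoc V.smult_closed U.smult_closed pc intro!: V.M.finsum_cong')
    ultimately show "(\<Oplus>\<^bsub>V\<^esub>i\<in>I. c i \<odot>\<^bsub>V\<^esub> \<phi> (b i \<odot>\<^bsub>U\<^esub> (l \<odot>\<^bsub>U\<^esub> x))) =
      l \<odot>\<^bsub>V\<^esub> (\<Oplus>\<^bsub>V\<^esub>i\<in>I. c i \<odot>\<^bsub>V\<^esub> \<phi> (b i \<odot>\<^bsub>U\<^esub> x))" by simp
  qed
  from modhom_restrict[OF assms(1) this] show ?thesis by (simp add: trace_def)
qed

text \<open>Together with \<open>trace_comp_right\<close> this lets module homomorphisms pass
  through the trace on either side; liftings, extensions and retractions below are all computed by
  these two rules.\<close>

lemma trace_comp_left: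
  assumes "left_module L U" "left_module L V" "left_module L W"
    and phi: "\<phi> \<in> klin (rs U) (rs V)" and f: "f \<in> module_hom L V W" and x: "x \<in> carrier U"
  shows "f (trace U V \<phi> x) = trace U W (\<lambda>x. f (\<phi> x)) x"
proof -
  interpret U: left_module L U by fact
  interpret V: left_module L V by fact
  interpret W: left_module L W by fact
  have pc: "\<phi> x \<in> carrier V" if "x \<in> carrier U" for x using modhom_closed[OF phi] that by simp
  have "f (trace U V \<phi> x) = (\<Oplus>\<^bsub>W\<^esub>i\<in>I. f (c i \<odot>\<^bsub>V\<^esub> \<phi> (b i \<odot>\<^bsub>U\<^esub> x)))"
    unfolding trace_apply[OF x] using x b_closed c_closed
    by (intro modhom_finsum[OF V.M.abelian_group_axioms W.M.abelian_group_axioms f])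
      (auto simp: V.smult_closed U.smult_closed pc)
  also have "\<dots> = trace U W (\<lambda>x. f (\<phi> x)) x"
    unfolding trace_apply[OF x] using x b_closed c_closed
    by (intro W.M.finsum_cong') (auto simp: W.smult_closed U.smult_closed pc modhom_smult[OF f] modhom_closed[OF f])
  finally show ?thesis .
qed

lemma trace_comp_right:
  assumes "left_module L U" "left_module L V" "left_module L W"
    and phi: "\<phi> \<in> klin (rs V) (rs W)" and f: "f \<in> module_hom L U V" and x: "x \<in> carrier U"
  shows "trace V W \<phi> (f x) = trace U W (\<lambda>x. \<phi> (f x)) x"
proof -
  interpret U: left_module L U by fact
  interpret V: left_module L V by fact
  interpret W: left_module L W by fact
  have pc: "\<phi> x \<in> carrier W" if "x \<in> carrier V" for x using modhom_closed[OF phi] that by simp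
  show ?thesis
    unfolding trace_apply[OF x] trace_apply[OF modhom_closed[OF f x]] using x b_closed c_closed
    by (intro W.M.finsum_cong') (auto simp: W.smult_closed U.smult_closed pc modhom_smult[OF f, symmetric] modhom_closed[OF f])
qed

end

lemma bij_betw_inv_into_simps:
  assumes "bij_betw f A B"
  shows "x \<in> A \<Longrightarrow> inv_into A f (f x) = x" "y \<in> B \<Longrightarrow> f (inv_into A f y) = y"
    "y \<in> B \<Longrightarrow> inv_into A f y \<in> A"
  using assms by (auto simp: bij_betw_def inv_into_into f_inv_into_f)

section \<open>Relatively projective modules\<close>

context frobenius
begin

text \<open>Composites of linear maps are in general not extensional; their values off the carrier
  must not influence the trace.\<close>

lemma trace_cong:
  assumes "left_module L U" "left_module L V" "\<phi> \<in> klin (rs U) (rs V)"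
    "\<And>x. x \<in> carrier U \<Longrightarrow> \<phi> x = \<psi> x"
  shows "trace U V \<phi> = trace U V \<psi>"
proof -
  interpret U: left_module L U by fact
  interpret V: left_module L V by fact
  have pc: "\<phi> x \<in> carrier V" if "x \<in> carrier U" for x using modhom_closed[OF assms(3)] that by simp
  show ?thesis
    unfolding trace_def
    by (intro restrict_ext V.M.finsum_cong')
      (use b_closed c_closed assms(4) pc in \<open>auto simp: U.smult_closed V.smult_closed\<close>)
qed

text \<open>Higman's condition that the identity is a trace. It refers to \<open>P\<close> alone and
  is symmetric between lifting and extending, so it yields projectivity and injectivity at
  once.\<close>

definition relproj :: "('l, 'm) module \<Rightarrow> bool" where
  "relproj P \<longleftrightarrow> left_module L P \<and>
    (\<exists>\<phi>\<in>klin (rs P) (rs P). \<forall>x\<in>carrier P. trace P P \<phi> x = x)"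

text \<open>For \<open>\<Phi>\<close> sending f to lam(-) f(1), the i-th summand of the trace has
  the value lam(x c_i) f(b_i) at x, and these sum to f(x) by \<open>expand_b\<close>.\<close>

lemma relproj_coind:
  assumes "left_module L M" shows "relproj (coind M)"
proof -
  interpret M: left_module L M by fact
  interpret K: kspace "rs M" using assms by (rule kspace_restrict_scalars)
  interpret C: left_module L "coind M" using assms by (rule left_module_coind)
  define \<Phi> where "\<Phi> f = (\<lambda>x\<in>carrier L. (lam x \<odot> \<one>) \<odot>\<^bsub>M\<^esub> f \<one>)" for f
  have PC: "\<Phi> f \<in> carrier (coind M)" if "f \<in> carrier (coind M)" for f
  proof -
    from that have fl: "f \<in> klin L (rs M)" by simp
    have f1: "f \<one> \<in> carrier (rs M)" using modhom_closed[OF fl] by simp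
    have "(\<lambda>x. lam x \<odot>\<^bsub>rs M\<^esub> f \<one>) \<in> module_hom ground L (rs M)"
    proof (rule modhomI)
      show "lam x \<odot>\<^bsub>rs M\<^esub> f \<one> \<in> carrier (rs M)" for x using f1 by (rule K.smult_closed)
      show "lam (x \<oplus> y) \<odot>\<^bsub>rs M\<^esub> f \<one> = (lam x \<odot>\<^bsub>rs M\<^esub> f \<one>) \<oplus>\<^bsub>rs M\<^esub> (lam y \<odot>\<^bsub>rs M\<^esub> f \<one>)"
        if "x \<in> carrier L" "y \<in> carrier L" for x y
        using K.smult_l_distr[OF f1] modhom_add[OF lam_linear that] by simp
      show "lam (r \<odot> x) \<odot>\<^bsub>rs M\<^esub> f \<one> = r \<odot>\<^bsub>rs M\<^esub> (lam x \<odot>\<^bsub>rs M\<^esub> f \<one>)" if "x \<in> carrier L" for r x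
        using K.smult_assoc[OF f1, of r "lam x"] klin_smult[OF lam_linear that] by simp
    qed
    from modhom_restrict[OF _ this] show ?thesis using kspace_axioms by (simp add: \<Phi>_def)
  qed
  have Plin: "\<Phi> \<in> klin (rs (coind M)) (rs (coind M))"
  proof (rule modhomI)
    show "\<Phi> f \<in> carrier (rs (coind M))" if "f \<in> carrier (rs (coind M))" for f
      using PC[of f] that by simp
    fix f g assume "f \<in> carrier (rs (coind M))" "g \<in> carrier (rs (coind M))"
    then have "f \<one> \<in> carrier M" "g \<one> \<in> carrier M"
      using modhom_closed[of f class_ring L "rs M" \<one>] modhom_closed[of g class_ring L "rs M" \<one>]
      by auto
    then show "\<Phi> (f \<oplus>\<^bsub>rs (coind M)\<^esub> g) = \<Phi> f \<oplus>\<^bsub>rs (coind M)\<^esub> \<Phi> g"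
      by (auto simp: \<Phi>_def M.smult_r_distr intro!: restrict_ext)
  next
    fix r f assume "f \<in> carrier (rs (coind M))"
    then have f: "f \<in> klin L (rs M)" by simp
    then have f1: "f \<one> \<in> carrier M" using modhom_closed[OF f] by simp
    have "f (r \<odot> \<one>) = (r \<odot> \<one>) \<odot>\<^bsub>M\<^esub> f \<one>" using klin_smult[OF f] by simp
    moreover have "(lam (r \<odot> x) \<odot> \<one>) \<odot>\<^bsub>M\<^esub> f \<one> = (lam x \<odot> \<one>) \<odot>\<^bsub>M\<^esub> ((r \<odot> \<one>) \<odot>\<^bsub>M\<^esub> f \<one>)"
      if "x \<in> carrier L" for x
    proof -
      have "lam (r \<odot> x) = lam x * r" using klin_smult[OF lam_linear that] by (simp add: mult.commute)
      then show ?thesis using K.smult_assoc[of "f \<one>" "lam x" r] f1 by simp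
    qed
    ultimately show "\<Phi> (r \<odot>\<^bsub>rs (coind M)\<^esub> f) = r \<odot>\<^bsub>rs (coind M)\<^esub> \<Phi> f"
      by (auto simp: \<Phi>_def mult_scalar intro!: restrict_ext)
  qed
  have "trace (coind M) (coind M) \<Phi> f = f" if f: "f \<in> carrier (coind M)" for f
  proof (rule extensionalityI[where A = "carrier L"])
    have fl: "f \<in> klin L (rs M)" using f by simp
    have t: "trace (coind M) (coind M) \<Phi> f \<in> carrier (coind M)"
      using modhom_closed[of "trace (coind M) (coind M) \<Phi>" L "coind M" "coind M"]
        trace_hom[OF C.left_module_axioms C.left_module_axioms Plin] f by auto
    then show "trace (coind M) (coind M) \<Phi> f \<in> extensional (carrier L)" by simp
    show "f \<in> extensional (carrier L)" using f by simp
    fix x assume x: "x \<in> carrier L"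
    have bf: "b i \<odot>\<^bsub>coind M\<^esub> f \<in> carrier (coind M)" if "i \<in> I" for i
      using C.smult_closed[OF b_closed[OF that] f] .
    have cP: "(\<lambda>i. c i \<odot>\<^bsub>coind M\<^esub> \<Phi> (b i \<odot>\<^bsub>coind M\<^esub> f)) \<in> I \<rightarrow> carrier (coind M)"
      by (intro Pi_I C.smult_closed c_closed PC bf)
    have "trace (coind M) (coind M) \<Phi> f x =
        (\<Oplus>\<^bsub>M\<^esub>i\<in>I. (c i \<odot>\<^bsub>coind M\<^esub> \<Phi> (b i \<odot>\<^bsub>coind M\<^esub> f)) x)"
      unfolding trace_apply[OF f]
      by (rule additive_finsum[OF C.M.abelian_group_axioms M.M.abelian_group_axioms _ _ cP, of "\<lambda>f. f x"])
        (use x modhom_closed[of _ _ L "rs M"] in auto)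
    also have "\<dots> = (\<Oplus>\<^bsub>rs M\<^esub>i\<in>I. f (lam (x \<otimes> c i) \<odot> b i))"
      unfolding finsum_restrict_scalars
    proof (rule M.M.finsum_cong'[OF refl])
      show "(\<lambda>i. f (lam (x \<otimes> c i) \<odot> b i)) \<in> I \<rightarrow> carrier M"
        using b_closed modhom_closed[OF fl] by auto
      fix i assume i: "i \<in> I"
      show "(c i \<odot>\<^bsub>coind M\<^esub> \<Phi> (b i \<odot>\<^bsub>coind M\<^esub> f)) x = f (lam (x \<otimes> c i) \<odot> b i)"
        using x i b_closed c_closed by (simp add: \<Phi>_def klin_smult[OF fl])
    qed
    also have "\<dots> = f (\<Oplus>i\<in>I. lam (x \<otimes> c i) \<odot> b i)"
      using b_closed
      by (intro modhom_finsum[OF abelian_group_axioms K.abelian_group_axioms fl, symmetric]) auto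
    also have "\<dots> = f x" using expand_b[OF x] by simp
    finally show "trace (coind M) (coind M) \<Phi> f x = f x" .
  qed
  then show ?thesis unfolding relproj_def using Plin C.left_module_axioms by blast
qed

text \<open>A vector \<open>v\<close> goes to the map x \<mapsto> x v and is recovered by evaluation
  at the unit.\<close>

lemma coind_embedding:
  assumes "left_module L M"
  shows "\<exists>\<eta>\<in>module_hom L M (coind M). inj_on \<eta> (carrier M)"
proof -
  interpret M: left_module L M by fact
  define \<eta> where "\<eta> v = (\<lambda>x\<in>carrier L. x \<odot>\<^bsub>M\<^esub> v)" for v
  have "\<eta> \<in> module_hom L M (coind M)"
  proof (rule modhomI)
    fix v assume v: "v \<in> carrier M"
    have "(\<lambda>x. x \<odot>\<^bsub>M\<^esub> v) \<in> module_hom ground L (rs M)"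
    proof (rule modhomI)
      show "(k \<odot> x) \<odot>\<^bsub>M\<^esub> v = k \<odot>\<^bsub>rs M\<^esub> (x \<odot>\<^bsub>M\<^esub> v)" if "x \<in> carrier L" for k x
        using scalar_smult_commute(2)[OF assms that v] by simp
    qed (use v in \<open>auto simp: M.smult_closed M.smult_l_distr\<close>)
    from modhom_restrict[OF _ this] show "\<eta> v \<in> carrier (coind M)"
      using kspace_axioms by (simp add: \<eta>_def)
  qed (auto simp: \<eta>_def M.smult_r_distr M.smult_assoc intro!: restrict_ext)
  moreover have "inj_on \<eta> (carrier M)"
  proof (rule inj_onI)
    fix v w assume vw: "v \<in> carrier M" "w \<in> carrier M" and "\<eta> v = \<eta> w"
    then have "\<eta> v \<one> = \<eta> w \<one>" by simp
    then show "v = w" using vw by (simp add: \<eta>_def M.smult_one)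
  qed
  ultimately show ?thesis by blast
qed

text \<open>The map f \<mapsto> \<Sum> c_i f(b_i) is L-linear by \<open>casimir\<close>.\<close>

lemma coind_surjection:
  assumes "left_module L M"
  shows "\<exists>\<epsilon>\<in>module_hom L (coind M) M. \<epsilon> ` carrier (coind M) = carrier M"
proof -
  interpret M: left_module L M by fact
  interpret K: kspace "rs M" using assms by (rule kspace_restrict_scalars)
  define \<epsilon> where "\<epsilon> f = (\<Oplus>\<^bsub>M\<^esub>i\<in>I. c i \<odot>\<^bsub>M\<^esub> f (b i))" for f
  have eM: "\<epsilon> f \<in> carrier M" if "f \<in> klin L (rs M)" for f
    unfolding \<epsilon>_def using b_closed c_closed modhom_closed[OF that]
    by (intro M.M.finsum_closed) (auto simp: M.smult_closed)
  have hom: "\<epsilon> \<in> module_hom L (coind M) M"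
  proof (rule modhomI)
    show "\<epsilon> f \<in> carrier M" if "f \<in> carrier (coind M)" for f using eM that by simp
    fix f g assume "f \<in> carrier (coind M)" "g \<in> carrier (coind M)"
    then have f: "f \<in> klin L (rs M)" and g: "g \<in> klin L (rs M)" by auto
    have "\<epsilon> (f \<oplus>\<^bsub>coind M\<^esub> g) = (\<Oplus>\<^bsub>M\<^esub>i\<in>I. c i \<odot>\<^bsub>M\<^esub> f (b i) \<oplus>\<^bsub>M\<^esub> c i \<odot>\<^bsub>M\<^esub> g (b i))"
      unfolding \<epsilon>_def using b_closed c_closed modhom_closed[OF f] modhom_closed[OF g]
      by (intro M.M.finsum_cong') (auto simp: M.smult_closed M.smult_r_distr)
    then show "\<epsilon> (f \<oplus>\<^bsub>coind M\<^esub> g) = \<epsilon> f \<oplus>\<^bsub>M\<^esub> \<epsilon> g"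
      unfolding \<epsilon>_def using b_closed c_closed modhom_closed[OF f] modhom_closed[OF g]
      by (subst M.M.finsum_addf[symmetric]) (auto simp: M.smult_closed)
  next
    fix l f assume l: "l \<in> carrier L" and "f \<in> carrier (coind M)"
    then have f: "f \<in> klin L (rs M)" by simp
    have fc: "f q \<in> carrier M" if "q \<in> carrier L" for q using modhom_closed[OF f that] by simp
    have "(\<Oplus>\<^bsub>rs M\<^esub>i\<in>I. (l \<otimes> c i) \<odot>\<^bsub>M\<^esub> f (b i)) = (\<Oplus>\<^bsub>rs M\<^esub>i\<in>I. c i \<odot>\<^bsub>M\<^esub> f (b i \<otimes> l))"
    proof (rule casimir[OF K.kspace_axioms l])
      show "(\<lambda>p. p \<odot>\<^bsub>M\<^esub> f q) \<in> klin L (rs M)" if q: "q \<in> carrier L" for q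
      proof (rule modhomI)
        show "(k \<odot> p) \<odot>\<^bsub>M\<^esub> f q = k \<odot>\<^bsub>rs M\<^esub> (p \<odot>\<^bsub>M\<^esub> f q)" if "p \<in> carrier L" for k p
          using scalar_smult_commute(2)[OF assms that fc[OF q]] by simp
      qed (use fc[OF q] in \<open>auto simp: M.smult_closed M.smult_l_distr\<close>)
      show "(\<lambda>q. p \<odot>\<^bsub>M\<^esub> f q) \<in> klin L (rs M)" if p: "p \<in> carrier L" for p
      proof (rule modhomI)
        show "p \<odot>\<^bsub>M\<^esub> f (k \<odot> q) = k \<odot>\<^bsub>rs M\<^esub> (p \<odot>\<^bsub>M\<^esub> f q)" if "q \<in> carrier L" for k q
          using scalar_smult_commute(1)[OF assms p fc[OF that]] klin_smult[OF f that] by simp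
        show "p \<odot>\<^bsub>M\<^esub> f (q \<oplus> q') = p \<odot>\<^bsub>M\<^esub> f q \<oplus>\<^bsub>rs M\<^esub> p \<odot>\<^bsub>M\<^esub> f q'"
          if "q \<in> carrier L" "q' \<in> carrier L" for q q'
          using that p fc modhom_add[OF f that] by (simp add: M.smult_r_distr)
      qed (use p fc in \<open>auto simp: M.smult_closed\<close>)
    qed
    moreover have "(\<Oplus>\<^bsub>M\<^esub>i\<in>I. (l \<otimes> c i) \<odot>\<^bsub>M\<^esub> f (b i)) = l \<odot>\<^bsub>M\<^esub> \<epsilon> f"
      unfolding \<epsilon>_def using l b_closed c_closed fc
      by (subst M.finsum_smult) (auto simp: M.smult_assoc M.smult_closed intro!: M.M.finsum_cong')
    moreover have "\<epsilon> (l \<odot>\<^bsub>coind M\<^esub> f) = (\<Oplus>\<^bsub>M\<^esub>i\<in>I. c i \<odot>\<^bsub>M\<^esub> f (b i \<otimes> l))"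
      unfolding \<epsilon>_def using l b_closed c_closed fc
      by (intro M.M.finsum_cong') (auto simp: M.smult_closed)
    ultimately show "\<epsilon> (l \<odot>\<^bsub>coind M\<^esub> f) = l \<odot>\<^bsub>M\<^esub> \<epsilon> f" by simp
  qed
  have "\<exists>f\<in>carrier (coind M). \<epsilon> f = v" if v: "v \<in> carrier M" for v
  proof -
    \<comment> \<open>A preimage of \<open>v\<close>: its image is (\<Sum> lam(b_i) c_i) v, and the
      sum in brackets is the unit by \<open>expand_c\<close>.\<close>
    let ?f = "\<lambda>x\<in>carrier L. (lam x \<odot> \<one>) \<odot>\<^bsub>M\<^esub> v"
    have v': "v \<in> carrier (rs M)" using v by simp
    have "(\<lambda>x. lam x \<odot>\<^bsub>rs M\<^esub> v) \<in> module_hom ground L (rs M)"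
    proof (rule modhomI)
      show "lam x \<odot>\<^bsub>rs M\<^esub> v \<in> carrier (rs M)" for x using v' by (rule K.smult_closed)
      show "lam (x \<oplus> y) \<odot>\<^bsub>rs M\<^esub> v = (lam x \<odot>\<^bsub>rs M\<^esub> v) \<oplus>\<^bsub>rs M\<^esub> (lam y \<odot>\<^bsub>rs M\<^esub> v)"
        if "x \<in> carrier L" "y \<in> carrier L" for x y
        using K.smult_l_distr[OF v'] modhom_add[OF lam_linear that] by simp
      show "lam (r \<odot> x) \<odot>\<^bsub>rs M\<^esub> v = r \<odot>\<^bsub>rs M\<^esub> (lam x \<odot>\<^bsub>rs M\<^esub> v)" if "x \<in> carrier L" for r x
        using K.smult_assoc[OF v', of r "lam x"] klin_smult[OF lam_linear that] by simp
    qed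
    from modhom_restrict[OF _ this] have "?f \<in> carrier (coind M)" using kspace_axioms by simp
    moreover have "\<epsilon> ?f = v"
    proof -
      have "\<epsilon> ?f = (\<Oplus>\<^bsub>M\<^esub>i\<in>I. (lam (b i \<otimes> \<one>) \<odot> c i) \<odot>\<^bsub>M\<^esub> v)"
        unfolding \<epsilon>_def
      proof (rule M.M.finsum_cong'[OF refl])
        show "(\<lambda>i. (lam (b i \<otimes> \<one>) \<odot> c i) \<odot>\<^bsub>M\<^esub> v) \<in> I \<rightarrow> carrier M"
          using v c_closed by (auto simp: M.smult_closed)
        fix i assume i: "i \<in> I"
        show "c i \<odot>\<^bsub>M\<^esub> ?f (b i) = (lam (b i \<otimes> \<one>) \<odot> c i) \<odot>\<^bsub>M\<^esub> v"
          using scalar_smult_commute[OF assms c_closed[OF i] v, of "lam (b i)"] i b_closed by simp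
      qed
      also have "\<dots> = (\<Oplus>i\<in>I. lam (b i \<otimes> \<one>) \<odot> c i) \<odot>\<^bsub>M\<^esub> v"
        by (rule additive_finsum[OF abelian_group_axioms M.M.abelian_group_axioms, of "\<lambda>l. l \<odot>\<^bsub>M\<^esub> v", symmetric])
          (use v c_closed in \<open>auto simp: M.smult_closed M.smult_l_distr\<close>)
      also have "\<dots> = v" using expand_c[of \<one>] v by (simp add: M.smult_one)
      finally show ?thesis .
    qed
    ultimately show ?thesis by blast
  qed
  then have "\<epsilon> ` carrier (coind M) = carrier M" using modhom_closed[OF hom] by blast
  with hom show ?thesis by blast
qed

text \<open>If the identity of \<open>Q\<close> is the trace of \<phi>, then the trace of \<pi>
  \<phi> \<sigma> is \<pi> \<sigma>, the identity of \<open>P\<close>.\<close>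

lemma relproj_retract:
  assumes P: "left_module L P" and Q: "relproj Q" and s: "\<sigma> \<in> module_hom L P Q"
    and p: "\<pi> \<in> module_hom L Q P" and ps: "\<And>x. x \<in> carrier P \<Longrightarrow> \<pi> (\<sigma> x) = x"
  shows "relproj P"
proof -
  obtain \<phi> where phi: "\<phi> \<in> klin (rs Q) (rs Q)" "\<And>x. x \<in> carrier Q \<Longrightarrow> trace Q Q \<phi> x = x"
    and lQ: "left_module L Q"
    using Q unfolding relproj_def by blast
  have pp: "(\<lambda>x. \<pi> (\<phi> x)) \<in> klin (rs Q) (rs P)"
    using modhom_comp[OF phi(1) modhom_klin[OF p]] .
  have "trace P P (\<lambda>x. \<pi> (\<phi> (\<sigma> x))) x = x" if x: "x \<in> carrier P" for x
  proof -
    have "trace P P (\<lambda>x. \<pi> (\<phi> (\<sigma> x))) x = trace Q P (\<lambda>x. \<pi> (\<phi> x)) (\<sigma> x)"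
      using trace_comp_right[OF P lQ P pp s x] by simp
    also have "\<dots> = \<pi> (trace Q Q \<phi> (\<sigma> x))"
      using trace_comp_left[OF lQ lQ P phi(1) p modhom_closed[OF s x]] by simp
    finally show ?thesis using phi(2) modhom_closed[OF s x] ps x by simp
  qed
  then show ?thesis
    unfolding relproj_def using P modhom_comp[OF modhom_klin[OF s] pp] by blast
qed

lemma relproj_iso:
  assumes "relproj Q" "left_module L P" "lmod_iso L Q P" shows "relproj P"
proof -
  have Q: "left_module L Q" using assms by (simp add: relproj_def)
  interpret Q: left_module L Q by fact
  obtain f where f: "f \<in> module_hom L Q P" "bij_betw f (carrier Q) (carrier P)"
    using assms(3) by (auto simp: lmod_iso_def)
  show ?thesis
    by (rule relproj_retract[OF assms(2,1) modhom_inv_into[OF f Q.M.abelian_group_axioms Q.smult_closed] f(1)])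
      (simp_all add: bij_betw_inv_into_simps[OF f(2)])
qed

text \<open>The coinduced module consists of functions on the algebra; it is copied to
  \<open>nat \<Rightarrow> 'k\<close>, the carrier type that \<open>Syzygy\<close>
  prescribes.\<close>

lemma relproj_cover:
  assumes "fd_module L V"
  obtains F :: "('k, 'l) umodule" and g where "fd_module L F" "relproj F" "g \<in> module_hom L F V"
    "g ` carrier F = carrier V"
proof -
  note V = fd_moduleD[OF assms]
  have fc: "fd_module L (coind V)" using fdspace_algebra assms by (rule fd_module_coind)
  obtain \<epsilon> where e: "\<epsilon> \<in> module_hom L (coind V) V" "\<epsilon> ` carrier (coind V) = carrier V"
    using coind_surjection[OF V(1)] by blast
  obtain F :: "('k, 'l) umodule" where F: "fd_module L F" "lmod_iso L (coind V) F"
    using umodule_copy[OF fc] .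
  obtain j where j: "j \<in> module_hom L F (coind V)" "bij_betw j (carrier F) (carrier (coind V))"
    using lmod_iso_sym[OF fd_moduleD(1)[OF fc] F(2)] by (auto simp: lmod_iso_def)
  show ?thesis
  proof (rule that[OF F(1)])
    show "relproj F" using relproj_iso[OF relproj_coind[OF V(1)] fd_moduleD(1)[OF F(1)] F(2)] .
    show "(\<lambda>x. \<epsilon> (j x)) \<in> module_hom L F V" using modhom_comp[OF j(1) e(1)] .
    show "(\<lambda>x. \<epsilon> (j x)) ` carrier F = carrier V"
      using j(2) e(2) unfolding bij_betw_def by (metis image_image)
  qed
qed

lemma relproj_hull:
  assumes "fd_module L V"
  obtains F :: "('k, 'l) umodule" and g where "fd_module L F" "relproj F" "g \<in> module_hom L V F"
    "inj_on g (carrier V)"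
proof -
  note V = fd_moduleD[OF assms]
  have fc: "fd_module L (coind V)" using fdspace_algebra assms by (rule fd_module_coind)
  obtain \<eta> where e: "\<eta> \<in> module_hom L V (coind V)" "inj_on \<eta> (carrier V)"
    using coind_embedding[OF V(1)] by blast
  obtain F :: "('k, 'l) umodule" where F: "fd_module L F" "lmod_iso L (coind V) F"
    using umodule_copy[OF fc] .
  obtain j where j: "j \<in> module_hom L (coind V) F" "bij_betw j (carrier (coind V)) (carrier F)"
    using F(2) by (auto simp: lmod_iso_def)
  show ?thesis
  proof (rule that[OF F(1)])
    show "relproj F" using relproj_iso[OF relproj_coind[OF V(1)] fd_moduleD(1)[OF F(1)] F(2)] .
    show "(\<lambda>x. j (\<eta> x)) \<in> module_hom L V F" using modhom_comp[OF e(1) j(1)] .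
    have "inj_on j (\<eta> ` carrier V)"
      using j(2) modhom_closed[OF e(1)] unfolding bij_betw_def by (blast intro: inj_on_subset)
    from comp_inj_on[OF e(2) this] show "inj_on (\<lambda>x. j (\<eta> x)) (carrier V)" by (simp add: comp_def)
  qed
qed

text \<open>Lift f \<phi> through a linear section \<sigma> of \<open>g\<close> and take the trace:
  g tr(\<sigma> f \<phi>) = tr(f \<phi>) = f tr(\<phi>) = f.\<close>

lemma relproj_projective:
  assumes "relproj P" shows "projective L P"
  unfolding projective_def
proof (intro conjI allI ballI impI)
  show P: "left_module L P" using assms by (simp add: relproj_def)
  obtain \<phi> where phi: "\<phi> \<in> klin (rs P) (rs P)" "\<And>x. x \<in> carrier P \<Longrightarrow> trace P P \<phi> x = x"
    using assms unfolding relproj_def by blast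
  fix X Y :: "('k, 'l) umodule" and g f
  assume g: "g \<in> module_hom L X Y" and f: "f \<in> module_hom L P Y"
    and "fd_module L X \<and> fd_module L Y \<and> g ` carrier X = carrier Y"
  then have X: "fd_module L X" and Y: "fd_module L Y" and gs: "g ` carrier X = carrier Y" by auto
  note X = fd_moduleD[OF X] and Y = fd_moduleD[OF Y]
  obtain \<sigma> where sg: "\<sigma> \<in> klin (rs Y) (rs X)" "\<And>y. y \<in> carrier (rs Y) \<Longrightarrow> g (\<sigma> y) = y"
    using klin_section[OF X(3) Y(2) modhom_klin[OF g]] gs by auto
  have fp: "(\<lambda>x. f (\<phi> x)) \<in> klin (rs P) (rs Y)" using modhom_comp[OF phi(1) modhom_klin[OF f]] .
  have sfp: "(\<lambda>x. \<sigma> (f (\<phi> x))) \<in> klin (rs P) (rs X)" using modhom_comp[OF fp sg(1)] .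
  have "trace P X (\<lambda>x. \<sigma> (f (\<phi> x))) \<in> module_hom L P X" using trace_hom[OF P X(1) sfp] by simp
  moreover have "g (trace P X (\<lambda>x. \<sigma> (f (\<phi> x))) x) = f x" if x: "x \<in> carrier P" for x
  proof -
    have "g (trace P X (\<lambda>x. \<sigma> (f (\<phi> x))) x) = trace P Y (\<lambda>x. g (\<sigma> (f (\<phi> x)))) x"
      by (rule trace_comp_left[OF P X(1) Y(1) sfp g x])
    also have "trace P Y (\<lambda>x. g (\<sigma> (f (\<phi> x)))) = trace P Y (\<lambda>x. f (\<phi> x))"
      using trace_cong[OF P Y(1) fp, of "\<lambda>x. g (\<sigma> (f (\<phi> x)))"] sg(2) modhom_closed[OF fp] by simp
    also have "trace P Y (\<lambda>x. f (\<phi> x)) x = f (trace P P \<phi> x)"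
      using trace_comp_left[OF P P Y(1) phi(1) f x] by simp
    finally show ?thesis using phi(2) x by simp
  qed
  ultimately show "\<exists>h\<in>module_hom L P X. \<forall>x\<in>carrier P. g (h x) = f x" by blast
qed

text \<open>Dually, with a linear retraction \<rho> of \<open>i\<close>: tr(\<phi> f \<rho>) i =
  tr(\<phi> f) = tr(\<phi>) f = f.\<close>

lemma relproj_injective:
  assumes "relproj P" shows "injective L P"
  unfolding injective_def
proof (intro conjI allI ballI impI)
  show P: "left_module L P" using assms by (simp add: relproj_def)
  obtain \<phi> where phi: "\<phi> \<in> klin (rs P) (rs P)" "\<And>x. x \<in> carrier P \<Longrightarrow> trace P P \<phi> x = x"
    using assms unfolding relproj_def by blast
  fix X Y :: "('k, 'l) umodule" and i f
  assume i: "i \<in> module_hom L X Y" and f: "f \<in> module_hom L X P"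
    and "fd_module L X \<and> fd_module L Y \<and> inj_on i (carrier X)"
  then have X: "fd_module L X" and Y: "fd_module L Y" and inj: "inj_on i (carrier (rs X))" by auto
  note X = fd_moduleD[OF X] and Y = fd_moduleD[OF Y]
  obtain \<rho> where rho: "\<rho> \<in> klin (rs Y) (rs X)" "\<And>x. x \<in> carrier (rs X) \<Longrightarrow> \<rho> (i x) = x"
    by (rule klin_retraction[OF X(3) Y(2) modhom_klin[OF i] inj], rule that)
  have pf: "(\<lambda>x. \<phi> (f x)) \<in> klin (rs X) (rs P)" using modhom_comp[OF modhom_klin[OF f] phi(1)] .
  have pfr: "(\<lambda>x. \<phi> (f (\<rho> x))) \<in> klin (rs Y) (rs P)" using modhom_comp[OF rho(1) pf] .
  have "trace Y P (\<lambda>x. \<phi> (f (\<rho> x))) \<in> module_hom L Y P" using trace_hom[OF Y(1) P pfr] by simp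
  moreover have "trace Y P (\<lambda>x. \<phi> (f (\<rho> x))) (i x) = f x" if x: "x \<in> carrier X" for x
  proof -
    have "trace Y P (\<lambda>x. \<phi> (f (\<rho> x))) (i x) = trace X P (\<lambda>x. \<phi> (f (\<rho> (i x)))) x"
      by (rule trace_comp_right[OF X(1) Y(1) P pfr i x])
    also have "trace X P (\<lambda>x. \<phi> (f (\<rho> (i x)))) = trace X P (\<lambda>x. \<phi> (f x))"
      using trace_cong[OF X(1) P pf, of "\<lambda>x. \<phi> (f (\<rho> (i x)))"] rho(2) by simp
    also have "trace X P (\<lambda>x. \<phi> (f x)) x = trace P P \<phi> (f x)"
      using trace_comp_right[OF X(1) P P phi(1) f x] by simp
    finally show ?thesis using phi(2) modhom_closed[OF f x] by simp
  qed
  ultimately show "\<exists>h\<in>module_hom L Y P. \<forall>x\<in>carrier X. h (i x) = f x" by blast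
qed

text \<open>A projective module lifts its identity through the cover from
  \<open>relproj_cover\<close> and so is a retract of a relatively projective module.\<close>

lemma projective_iff_relproj:
  fixes P :: "('k, 'l) umodule"
  assumes "fd_module L P" shows "projective L P \<longleftrightarrow> relproj P"
proof
  assume pr: "projective L P"
  obtain F :: "('k, 'l) umodule" and g where F: "fd_module L F" "relproj F" "g \<in> module_hom L F P"
    "g ` carrier F = carrier P" using relproj_cover[OF assms] .
  obtain h where "h \<in> module_hom L P F" "\<forall>x\<in>carrier P. g (h x) = x"
    using pr[unfolded projective_def, THEN conjunct2, rule_format, OF F(3) modhom_id] F assms by blast
  then show "relproj P"
    by (elim relproj_retract[OF fd_moduleD(1)[OF assms] F(2) _ F(3)]) blast
qed (rule relproj_projective)

lemma injective_iff_relproj: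
  fixes P :: "('k, 'l) umodule"
  assumes "fd_module L P" shows "injective L P \<longleftrightarrow> relproj P"
proof
  assume pr: "injective L P"
  obtain F :: "('k, 'l) umodule" and g where F: "fd_module L F" "relproj F" "g \<in> module_hom L P F"
    "inj_on g (carrier P)" using relproj_hull[OF assms] .
  obtain h where "h \<in> module_hom L F P" "\<forall>x\<in>carrier P. h (g x) = x"
    using pr[unfolded injective_def, THEN conjunct2, rule_format, OF F(3) modhom_id] F assms by blast
  then show "relproj P"
    by (elim relproj_retract[OF fd_moduleD(1)[OF assms] F(2) F(3)]) blast
qed (rule relproj_injective)

text \<open>Higman's criterion: the maps that factor through a projective module are the traces of linear
  maps.\<close>

lemma proj_maps_eq_trace_maps:
  assumes U: "fd_module L U" and V: "fd_module L V"
  shows "proj_maps L U V = trace_maps U V"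
proof
  note lU = fd_moduleD(1)[OF U] and lV = fd_moduleD(1)[OF V]
  show "proj_maps L U V \<subseteq> trace_maps U V"
  proof
    fix f assume "f \<in> proj_maps L U V"
    then obtain P :: "('k, 'l) umodule" and g h where f: "f \<in> carrier (hom_space L U V)"
      and P: "fd_module L P" "projective L P" and g: "g \<in> module_hom L U P" and h: "h \<in> module_hom L P V"
      and fhg: "\<And>x. x \<in> carrier U \<Longrightarrow> f x = h (g x)"
      unfolding proj_maps_def by blast
    have lP: "left_module L P" using fd_moduleD(1)[OF P(1)] .
    obtain \<phi> where phi: "\<phi> \<in> klin (rs P) (rs P)" "\<And>x. x \<in> carrier P \<Longrightarrow> trace P P \<phi> x = x"
      using P projective_iff_relproj[OF P(1)] unfolding relproj_def by blast
    have hp: "(\<lambda>x. h (\<phi> x)) \<in> klin (rs P) (rs V)" using modhom_comp[OF phi(1) modhom_klin[OF h]] .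
    have hpg: "(\<lambda>x. h (\<phi> (g x))) \<in> klin (rs U) (rs V)" using modhom_comp[OF modhom_klin[OF g] hp] .
    have "f = trace U V (\<lambda>x. h (\<phi> (g x)))"
    proof (rule extensionalityI[where A = "carrier U"])
      fix x assume x: "x \<in> carrier U"
      have "trace U V (\<lambda>x. h (\<phi> (g x))) x = trace P V (\<lambda>x. h (\<phi> x)) (g x)"
        using trace_comp_right[OF lU lP lV hp g x] by simp
      also have "\<dots> = h (trace P P \<phi> (g x))"
        using trace_comp_left[OF lP lP lV phi(1) h modhom_closed[OF g x]] by simp
      finally show "f x = trace U V (\<lambda>x. h (\<phi> (g x))) x"
        using phi(2) modhom_closed[OF g x] fhg x by simp
    qed (use f in \<open>auto simp: trace_def\<close>)
    then show "f \<in> trace_maps U V" using hpg unfolding trace_maps_def by blast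
  qed
  show "trace_maps U V \<subseteq> proj_maps L U V"
  proof
    fix f assume "f \<in> trace_maps U V"
    then obtain \<phi> where phi: "\<phi> \<in> klin (rs U) (rs V)" and f: "f = trace U V \<phi>"
      unfolding trace_maps_def by blast
    obtain F :: "('k, 'l) umodule" and g where F: "fd_module L F" "relproj F" "g \<in> module_hom L F V"
      "g ` carrier F = carrier V" using relproj_cover[OF V] .
    note lF = fd_moduleD[OF F(1)]
    obtain \<sigma> where sg: "\<sigma> \<in> klin (rs V) (rs F)" "\<And>y. y \<in> carrier (rs V) \<Longrightarrow> g (\<sigma> y) = y"
      using klin_section[OF lF(3) fd_moduleD(2)[OF V] modhom_klin[OF F(3)]] F(4) by auto
    have sp: "(\<lambda>x. \<sigma> (\<phi> x)) \<in> klin (rs U) (rs F)" using modhom_comp[OF phi sg(1)] .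
    have "f x = g (trace U F (\<lambda>x. \<sigma> (\<phi> x)) x)" if x: "x \<in> carrier U" for x
    proof -
      have "g (trace U F (\<lambda>x. \<sigma> (\<phi> x)) x) = trace U V (\<lambda>x. g (\<sigma> (\<phi> x))) x"
        by (rule trace_comp_left[OF lU lF(1) lV sp F(3) x])
      also have "trace U V (\<lambda>x. g (\<sigma> (\<phi> x))) = trace U V \<phi>"
        using trace_cong[OF lU lV phi, of "\<lambda>x. g (\<sigma> (\<phi> x))"] sg(2) modhom_closed[OF phi] by simp
      finally show ?thesis using f by simp
    qed
    moreover have "trace U F (\<lambda>x. \<sigma> (\<phi> x)) \<in> module_hom L U F" using trace_hom[OF lU lF(1) sp] by simp
    moreover have "f \<in> carrier (hom_space L U V)" using trace_hom[OF lU lV phi] f by blast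
    moreover have "projective L F" using F(2) by (rule relproj_projective)
    ultimately show "f \<in> proj_maps L U V" unfolding proj_maps_def using F by blast
  qed
qed

end

section \<open>Left exactness of Hom\<close>

context kalgebra
begin

lemma post_comp_klin:
  assumes "left_module L X" "left_module L M" "p \<in> module_hom L M N"
  shows "(\<lambda>f. \<lambda>x\<in>carrier X. p (f x)) \<in> klin (hom_space L X M) (hom_space L X N)"
proof -
  interpret X: left_module L X by fact
  interpret M: left_module L M by fact
  show ?thesis
  proof (rule modhomI)
    fix f assume "f \<in> carrier (hom_space L X M)"
    then have "f \<in> module_hom L X M" by simp
    from modhom_restrict[OF assms(1) modhom_comp[OF this assms(3)]]
    show "(\<lambda>x\<in>carrier X. p (f x)) \<in> carrier (hom_space L X N)" by simp
  next
    fix f g assume "f \<in> carrier (hom_space L X M)" "g \<in> carrier (hom_space L X M)"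
    then have "f \<in> module_hom L X M" "g \<in> module_hom L X M" by auto
    then show "(\<lambda>x\<in>carrier X. p ((f \<oplus>\<^bsub>hom_space L X M\<^esub> g) x)) =
        (\<lambda>x\<in>carrier X. p (f x)) \<oplus>\<^bsub>hom_space L X N\<^esub> (\<lambda>x\<in>carrier X. p (g x))"
      by (auto simp: modhom_add[OF assms(3)] modhom_closed intro!: restrict_ext)
  next
    fix r f assume "f \<in> carrier (hom_space L X M)"
    then have "f \<in> module_hom L X M" by auto
    then show "(\<lambda>x\<in>carrier X. p ((r \<odot>\<^bsub>hom_space L X M\<^esub> f) x)) =
        r \<odot>\<^bsub>hom_space L X N\<^esub> (\<lambda>x\<in>carrier X. p (f x))"
      by (auto simp: modhom_smult[OF assms(3)] modhom_closed intro!: restrict_ext)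
  qed
qed

lemma pre_comp_klin:
  assumes "left_module L M" "left_module L N" "i \<in> module_hom L M N"
  shows "(\<lambda>f. \<lambda>x\<in>carrier M. f (i x)) \<in> klin (hom_space L N Y) (hom_space L M Y)"
proof (rule modhomI)
  fix f assume "f \<in> carrier (hom_space L N Y)"
  then have "f \<in> module_hom L N Y" by simp
  from modhom_restrict[OF assms(1) modhom_comp[OF assms(3) this]]
  show "(\<lambda>x\<in>carrier M. f (i x)) \<in> carrier (hom_space L M Y)" by simp
qed (auto simp: modhom_closed[OF assms(3)] intro!: restrict_ext)

text \<open>Left exactness of Hom(-, Y): composition with \<open>p\<close> is injective, and its
  image is the kernel of composition with \<open>i\<close>.\<close>

lemma short_exact_pre_comp_kernel:
  assumes W: "fd_module L W" and P: "fd_module L P" and V: "fd_module L V" and Y: "fd_module L Y"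
    and se: "short_exact L W i P p V"
  shows "kdim (sub (hom_space L P Y) {f \<in> carrier (hom_space L P Y).
    (\<lambda>x\<in>carrier W. f (i x)) = \<zero>\<^bsub>hom_space L W Y\<^esub>}) = kdim (hom_space L V Y)"
proof -
  note lW = fd_moduleD(1)[OF W] and lP = fd_moduleD(1)[OF P] and lV = fd_moduleD(1)[OF V]
    and lY = fd_moduleD(1)[OF Y]
  interpret P: left_module L P by (rule lP)
  interpret Y: left_module L Y by (rule lY)
  from se have i: "i \<in> module_hom L W P" and p: "p \<in> module_hom L P V"
    and ps: "p ` carrier P = carrier V" and ker: "i ` carrier W = {y \<in> carrier P. p y = \<zero>\<^bsub>V\<^esub>}"
    by (auto simp: short_exact_def)
  interpret V: left_module L V by (rule lV)
  let ?\<Psi> = "\<lambda>g. \<lambda>x\<in>carrier P. g (p x)"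
  have im: "?\<Psi> ` carrier (hom_space L V Y) = {f \<in> carrier (hom_space L P Y).
      (\<lambda>x\<in>carrier W. f (i x)) = \<zero>\<^bsub>hom_space L W Y\<^esub>}" (is "_ = ?K")
  proof (intro equalityI subsetI)
    fix f assume "f \<in> ?\<Psi> ` carrier (hom_space L V Y)"
    then obtain g where g: "g \<in> carrier (hom_space L V Y)" "f = ?\<Psi> g" by blast
    have "f (i x) = \<zero>\<^bsub>Y\<^esub>" if "x \<in> carrier W" for x
    proof -
      have "i x \<in> carrier P" "p (i x) = \<zero>\<^bsub>V\<^esub>" using ker that by auto
      then show ?thesis
        using g modhom_zero[OF V.M.abelian_group_axioms Y.M.abelian_group_axioms, of g L] by simp
    qed
    moreover have "f \<in> carrier (hom_space L P Y)"
      using modhom_closed[OF pre_comp_klin[OF lP lV p] g(1)] g(2) by simp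
    ultimately show "f \<in> ?K" by (auto intro!: restrict_ext)
  next
    fix f assume f: "f \<in> ?K"
    then have fh: "f \<in> module_hom L P Y" by simp
    have f0: "f (i x) = \<zero>\<^bsub>Y\<^esub>" if "x \<in> carrier W" for x
    proof -
      have "(\<lambda>x\<in>carrier W. f (i x)) x = (\<zero>\<^bsub>hom_space L W Y\<^esub>) x" using f by simp
      then show ?thesis using that by simp
    qed
    \<comment> \<open>\<open>f\<close> vanishes on the kernel of \<open>p\<close>, so composing it
      with a choice of preimages under \<open>p\<close> gives a homomorphism on
      \<open>V\<close>.\<close>
    define s where "s = inv_into (carrier P) p"
    have s: "s v \<in> carrier P" "p (s v) = v" if "v \<in> carrier V" for v
      using that ps by (auto simp: s_def inv_into_into f_inv_into_f)
    have fs: "f (s (p x)) = f x" if x: "x \<in> carrier P" for x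
    proof -
      have px: "p x \<in> carrier V" using modhom_closed[OF p x] .
      have "p (s (p x) \<ominus>\<^bsub>P\<^esub> x) = \<zero>\<^bsub>V\<^esub>"
        using modhom_minus[OF P.M.abelian_group_axioms V.M.abelian_group_axioms p s(1)[OF px] x] s(2)[OF px] px
        by (simp add: V.M.r_neg a_minus_def)
      then have "s (p x) \<ominus>\<^bsub>P\<^esub> x \<in> i ` carrier W" using ker s(1)[OF px] x by simp
      then have "f (s (p x) \<ominus>\<^bsub>P\<^esub> x) = \<zero>\<^bsub>Y\<^esub>" using f0 by auto
      moreover have "f ((s (p x) \<ominus>\<^bsub>P\<^esub> x) \<oplus>\<^bsub>P\<^esub> x) = f (s (p x) \<ominus>\<^bsub>P\<^esub> x) \<oplus>\<^bsub>Y\<^esub> f x"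
        using modhom_add[OF fh] s(1)[OF px] x by simp
      moreover have "(s (p x) \<ominus>\<^bsub>P\<^esub> x) \<oplus>\<^bsub>P\<^esub> x = s (p x)"
        using s(1)[OF px] x by (simp add: a_minus_def P.M.a_assoc P.M.l_neg)
      ultimately show ?thesis using modhom_closed[OF fh x] by simp
    qed
    define g where "g = (\<lambda>v\<in>carrier V. f (s v))"
    have "g \<in> carrier (hom_space L V Y)"
    proof -
      have "(\<lambda>v. f (s v)) \<in> module_hom L V Y"
      proof (rule modhomI)
        show "f (s v) \<in> carrier Y" if "v \<in> carrier V" for v using modhom_closed[OF fh s(1)[OF that]] .
        fix v w assume vw: "v \<in> carrier V" "w \<in> carrier V"
        have "f (s (v \<oplus>\<^bsub>V\<^esub> w)) = f (s (p (s v \<oplus>\<^bsub>P\<^esub> s w)))" using vw s modhom_add[OF p] by simp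
        also have "\<dots> = f (s v \<oplus>\<^bsub>P\<^esub> s w)" using fs s vw by simp
        finally show "f (s (v \<oplus>\<^bsub>V\<^esub> w)) = f (s v) \<oplus>\<^bsub>Y\<^esub> f (s w)" using modhom_add[OF fh] s vw by simp
      next
        fix l v assume lv: "l \<in> carrier L" "v \<in> carrier V"
        have "f (s (l \<odot>\<^bsub>V\<^esub> v)) = f (s (p (l \<odot>\<^bsub>P\<^esub> s v)))" using lv s modhom_smult[OF p] by simp
        also have "\<dots> = f (l \<odot>\<^bsub>P\<^esub> s v)" using fs s lv P.smult_closed by simp
        finally show "f (s (l \<odot>\<^bsub>V\<^esub> v)) = l \<odot>\<^bsub>Y\<^esub> f (s v)" using modhom_smult[OF fh] s lv by simp
      qed
      from modhom_restrict[OF lV this] show ?thesis by (simp add: g_def)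
    qed
    moreover have "f = ?\<Psi> g"
    proof (rule extensionalityI[where A = "carrier P"])
      show "f x = ?\<Psi> g x" if "x \<in> carrier P" for x
        using that fs modhom_closed[OF p that] by (simp add: g_def)
    qed (use f in auto)
    ultimately show "f \<in> ?\<Psi> ` carrier (hom_space L V Y)" by blast
  qed
  have "kdim (sub (hom_space L P Y) (?\<Psi> ` carrier (hom_space L V Y))) = kdim (hom_space L V Y)"
  proof (rule kdim_inj_image[OF fdspace_hom_space[OF V Y] kspace_hom_space[OF lP lY]
        pre_comp_klin[OF lP lV p]])
    fix g assume g: "g \<in> carrier (hom_space L V Y)" and z: "?\<Psi> g = \<zero>\<^bsub>hom_space L P Y\<^esub>"
    show "g = \<zero>\<^bsub>hom_space L V Y\<^esub>"
    proof (rule extensionalityI[where A = "carrier V"])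
      fix v assume v: "v \<in> carrier V"
      then obtain x where x: "x \<in> carrier P" "v = p x" using ps by blast
      have "?\<Psi> g x = (\<zero>\<^bsub>hom_space L P Y\<^esub>) x" unfolding z ..
      then show "g v = (\<zero>\<^bsub>hom_space L V Y\<^esub>) v" using x v by simp
    qed (use g in auto)
  qed
  then show ?thesis unfolding im .
qed

text \<open>Left exactness of Hom(X, -): a map into \<open>P\<close> killed by \<open>p\<close>
  takes its values in the image of \<open>i\<close>, where \<open>i\<close> can be inverted.\<close>

lemma short_exact_post_comp_kernel:
  assumes W: "fd_module L W" and P: "fd_module L P" and V: "fd_module L V" and X: "fd_module L X"
    and se: "short_exact L W i P p V"
  shows "kdim (sub (hom_space L X P) {f \<in> carrier (hom_space L X P).
    (\<lambda>x\<in>carrier X. p (f x)) = \<zero>\<^bsub>hom_space L X V\<^esub>}) = kdim (hom_space L X W)"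
proof -
  note lW = fd_moduleD(1)[OF W] and lP = fd_moduleD(1)[OF P] and lV = fd_moduleD(1)[OF V]
    and lX = fd_moduleD(1)[OF X]
  interpret P: left_module L P by (rule lP)
  interpret W: left_module L W by (rule lW)
  from se have i: "i \<in> module_hom L W P" and inj: "inj_on i (carrier W)"
    and ker: "i ` carrier W = {y \<in> carrier P. p y = \<zero>\<^bsub>V\<^esub>}"
    by (auto simp: short_exact_def)
  let ?\<Psi> = "\<lambda>g. \<lambda>x\<in>carrier X. i (g x)"
  define j where "j = inv_into (carrier W) i"
  let ?S = "P\<lparr>carrier := i ` carrier W\<rparr>"
  have "i \<in> module_hom L W ?S" using i by (auto simp: LinearCombinations.module_hom_def)
  moreover have "bij_betw i (carrier W) (carrier ?S)" using inj by (auto simp: bij_betw_def)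
  ultimately have jS: "j \<in> module_hom L ?S W"
    unfolding j_def using modhom_inv_into W.M.abelian_group_axioms W.smult_closed by blast
  have im: "?\<Psi> ` carrier (hom_space L X W) = {f \<in> carrier (hom_space L X P).
      (\<lambda>x\<in>carrier X. p (f x)) = \<zero>\<^bsub>hom_space L X V\<^esub>}" (is "_ = ?K")
  proof (intro equalityI subsetI)
    fix f assume "f \<in> ?\<Psi> ` carrier (hom_space L X W)"
    then obtain g where g: "g \<in> carrier (hom_space L X W)" "f = ?\<Psi> g" by blast
    have "p (f x) = \<zero>\<^bsub>V\<^esub>" if "x \<in> carrier X" for x
    proof -
      have "g x \<in> carrier W" using g that modhom_closed[of g L X W] by simp
      then have "i (g x) \<in> {y \<in> carrier P. p y = \<zero>\<^bsub>V\<^esub>}" using ker by blast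
      then show ?thesis using g that by simp
    qed
    moreover have "f \<in> carrier (hom_space L X P)"
      using modhom_closed[OF post_comp_klin[OF lX lW i] g(1)] g(2) by simp
    ultimately show "f \<in> ?K" by (auto intro!: restrict_ext)
  next
    fix f assume f: "f \<in> ?K"
    then have fh: "f \<in> module_hom L X P" by simp
    have fS: "f x \<in> i ` carrier W" if "x \<in> carrier X" for x
    proof -
      have "(\<lambda>x\<in>carrier X. p (f x)) x = (\<zero>\<^bsub>hom_space L X V\<^esub>) x" using f by simp
      then show ?thesis using that ker modhom_closed[OF fh that] by simp
    qed
    have "f \<in> module_hom L X ?S" using fh fS by (auto simp: LinearCombinations.module_hom_def)
    from modhom_restrict[OF lX modhom_comp[OF this jS]]
    have "(\<lambda>x\<in>carrier X. j (f x)) \<in> carrier (hom_space L X W)" by simp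
    moreover have "f = ?\<Psi> (\<lambda>x\<in>carrier X. j (f x))"
    proof (rule extensionalityI[where A = "carrier X"])
      show "f x = ?\<Psi> (\<lambda>x\<in>carrier X. j (f x)) x" if "x \<in> carrier X" for x
        using that fS[OF that] by (simp add: j_def f_inv_into_f)
    qed (use f in auto)
    ultimately show "f \<in> ?\<Psi> ` carrier (hom_space L X W)" by blast
  qed
  have "kdim (sub (hom_space L X P) (?\<Psi> ` carrier (hom_space L X W))) = kdim (hom_space L X W)"
  proof (rule kdim_inj_image[OF fdspace_hom_space[OF X W] kspace_hom_space[OF lX lP]
        post_comp_klin[OF lX lW i]])
    fix g assume g: "g \<in> carrier (hom_space L X W)" and z: "?\<Psi> g = \<zero>\<^bsub>hom_space L X P\<^esub>"
    show "g = \<zero>\<^bsub>hom_space L X W\<^esub>"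
    proof (rule extensionalityI[where A = "carrier X"])
      fix x assume x: "x \<in> carrier X"
      have "?\<Psi> g x = (\<zero>\<^bsub>hom_space L X P\<^esub>) x" unfolding z ..
      then have "i (g x) = \<zero>\<^bsub>P\<^esub>" using x by simp
      moreover have "g x \<in> carrier W" using g x modhom_closed[of g L X W] by simp
      ultimately have "g x = \<zero>\<^bsub>W\<^esub>" using inj inj_on_hom_iff[OF lW lP i] by blast
      then show "g x = (\<zero>\<^bsub>hom_space L X W\<^esub>) x" using x by simp
    qed (use g in auto)
  qed
  then show ?thesis unfolding im .
qed

end

definition hdim :: "('k::field, 'l) module \<Rightarrow> ('l, 'm) module \<Rightarrow> ('l, 'n) module \<Rightarrow> nat" where
  "hdim L U V = kdim (hom_space L U V)"

definition tdim :: "('k::field, 'l) module \<Rightarrow> ('l, 'm) module \<Rightarrow> ('l, 'n) module \<Rightarrow> nat" where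
  "tdim L U V = kdim (sub (hom_space L U V) (proj_maps L U V))"

definition sdim :: "('k::field, 'l) module \<Rightarrow> ('l, 'm) module \<Rightarrow> ('l, 'n) module \<Rightarrow> nat" where
  "sdim L U V = kdim (stable_hom L U V)"

section \<open>Dimensions of trace maps along short exact sequences\<close>

context frobenius
begin

lemma tdim_eq_trace:
  assumes "fd_module L U" "fd_module L V"
  shows "tdim L U V = kdim (sub (hom_space L U V) (trace_maps U V))"
  by (simp add: tdim_def proj_maps_eq_trace_maps[OF assms])

lemma trace_klin:
  assumes lU: "left_module L U" and lV: "left_module L V"
  shows "trace U V \<in> klin (khom (rs U) (rs V)) (hom_space L U V)"
proof -
  interpret U: left_module L U by fact
  interpret V: left_module L V by fact
  note ext = extensionalityI[where A = "carrier U"]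
  show ?thesis
  proof (rule modhomI)
    show "trace U V \<phi> \<in> carrier (hom_space L U V)" if "\<phi> \<in> carrier (khom (rs U) (rs V))" for \<phi>
      using trace_hom[OF assms, of \<phi>] that by simp
    fix \<phi> \<psi> assume "\<phi> \<in> carrier (khom (rs U) (rs V))" "\<psi> \<in> carrier (khom (rs U) (rs V))"
    then have p: "\<phi> \<in> klin (rs U) (rs V)" and q: "\<psi> \<in> klin (rs U) (rs V)" by auto
    have pc: "\<phi> x \<in> carrier V" "\<psi> x \<in> carrier V" if "x \<in> carrier U" for x
      using modhom_closed[OF p] modhom_closed[OF q] that by auto
    show "trace U V (\<phi> \<oplus>\<^bsub>khom (rs U) (rs V)\<^esub> \<psi>) = trace U V \<phi> \<oplus>\<^bsub>hom_space L U V\<^esub> trace U V \<psi>"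
    proof (rule ext)
      fix x assume x: "x \<in> carrier U"
      have "trace U V (\<phi> \<oplus>\<^bsub>khom (rs U) (rs V)\<^esub> \<psi>) x =
          (\<Oplus>\<^bsub>V\<^esub>i\<in>I. c i \<odot>\<^bsub>V\<^esub> \<phi> (b i \<odot>\<^bsub>U\<^esub> x) \<oplus>\<^bsub>V\<^esub> c i \<odot>\<^bsub>V\<^esub> \<psi> (b i \<odot>\<^bsub>U\<^esub> x))"
        unfolding trace_apply[OF x] using x pc b_closed c_closed
        by (intro V.M.finsum_cong') (auto simp: U.smult_closed V.smult_closed V.smult_r_distr)
      also have "\<dots> = trace U V \<phi> x \<oplus>\<^bsub>V\<^esub> trace U V \<psi> x"
        unfolding trace_apply[OF x] using x pc b_closed c_closed
        by (intro V.M.finsum_addf) (auto simp: U.smult_closed V.smult_closed)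
      finally show "trace U V (\<phi> \<oplus>\<^bsub>khom (rs U) (rs V)\<^esub> \<psi>) x = (trace U V \<phi> \<oplus>\<^bsub>hom_space L U V\<^esub> trace U V \<psi>) x"
        using x by simp
    qed (auto simp: trace_def)
  next
    fix r \<phi> assume "\<phi> \<in> carrier (khom (rs U) (rs V))"
    then have p: "\<phi> \<in> klin (rs U) (rs V)" by auto
    have pc: "\<phi> x \<in> carrier V" if "x \<in> carrier U" for x
      using modhom_closed[OF p] that by auto
    show "trace U V (r \<odot>\<^bsub>khom (rs U) (rs V)\<^esub> \<phi>) = r \<odot>\<^bsub>hom_space L U V\<^esub> trace U V \<phi>"
    proof (rule ext)
      fix x assume x: "x \<in> carrier U"
      have "trace U V (r \<odot>\<^bsub>khom (rs U) (rs V)\<^esub> \<phi>) x =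
          (\<Oplus>\<^bsub>V\<^esub>i\<in>I. (r \<odot> \<one>) \<odot>\<^bsub>V\<^esub> (c i \<odot>\<^bsub>V\<^esub> \<phi> (b i \<odot>\<^bsub>U\<^esub> x)))"
        unfolding trace_apply[OF x] using x pc b_closed c_closed
        by (intro V.M.finsum_cong')
          (auto simp: U.smult_closed V.smult_closed scalar_smult_commute(1)[OF lV])
      also have "\<dots> = (r \<odot> \<one>) \<odot>\<^bsub>V\<^esub> trace U V \<phi> x"
        unfolding trace_apply[OF x] using x pc b_closed c_closed
        by (subst V.finsum_smult) (auto simp: U.smult_closed V.smult_closed)
      finally show "trace U V (r \<odot>\<^bsub>khom (rs U) (rs V)\<^esub> \<phi>) x = (r \<odot>\<^bsub>hom_space L U V\<^esub> trace U V \<phi>) x"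
        using x by simp
    qed (auto simp: trace_def)
  qed
qed

text \<open>\<open>trace_maps\<close> ranges over all linear maps and \<open>khom\<close> over
  extensional ones; restricting a map leaves its trace unchanged. This presents the trace maps as
  the image of one linear operator, so that rank arguments apply.\<close>

lemma trace_maps_eq_image:
  assumes "left_module L U" "left_module L V"
  shows "trace_maps U V = trace U V ` carrier (khom (rs U) (rs V))"
proof -
  have "trace U V \<phi> \<in> trace U V ` carrier (khom (rs U) (rs V))" if p: "\<phi> \<in> klin (rs U) (rs V)" for \<phi>
  proof -
    have "restrict \<phi> (carrier U) \<in> carrier (khom (rs U) (rs V))"
      using modhom_restrict[of ground "rs U" \<phi> "rs V"] kspace_restrict_scalars[OF assms(1)] p by simp
    moreover have "trace U V (restrict \<phi> (carrier U)) = trace U V \<phi>"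
      using trace_cong[OF assms p, of "restrict \<phi> (carrier U)"] by simp
    ultimately show ?thesis by (metis imageI)
  qed
  then show ?thesis by (auto simp: trace_maps_def)
qed

lemma ksub_trace_maps:
  assumes "left_module L U" "left_module L V"
  shows "ksub (hom_space L U V) (trace_maps U V)"
  unfolding trace_maps_eq_image[OF assms]
  by (rule ksub_image[OF kspace_khom kspace_hom_space trace_klin]) (simp_all add: assms kspace_restrict_scalars)

lemma
  assumes "fd_module L U" "fd_module L V"
  shows fdspace_stable_hom: "fdspace (stable_hom L U V)"
    and hdim_eq: "hdim L U V = tdim L U V + sdim L U V"
proof -
  note l = fd_moduleD(1)[OF assms(1)] fd_moduleD(1)[OF assms(2)]
  have s: "ksub (hom_space L U V) (proj_maps L U V)"
    using ksub_trace_maps[OF l] proj_maps_eq_trace_maps[OF assms] by simp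
  show "fdspace (stable_hom L U V)"
    unfolding stable_hom_def by (rule fdspace_quot[OF fdspace_hom_space[OF assms] s])
  show "hdim L U V = tdim L U V + sdim L U V"
    unfolding hdim_def tdim_def sdim_def stable_hom_def
    by (rule kdim_quot[OF fdspace_hom_space[OF assms] s])
qed

text \<open>If the identity of \<open>P\<close> is the trace of \<phi>, then f = tr(\<phi> f) for
  every homomorphism f into \<open>P\<close>.\<close>

lemma tdim_relproj_target:
  assumes "fd_module L X" "fd_module L P" "relproj P" shows "tdim L X P = hdim L X P"
proof -
  note X = fd_moduleD(1)[OF assms(1)]
  obtain \<phi> where phi: "\<phi> \<in> klin (rs P) (rs P)" "\<And>x. x \<in> carrier P \<Longrightarrow> trace P P \<phi> x = x"
    and P: "left_module L P" using assms(3) unfolding relproj_def by blast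
  have "f \<in> trace_maps X P" if f: "f \<in> carrier (hom_space L X P)" for f
  proof -
    have fh: "f \<in> module_hom L X P" using f by simp
    have "f = trace X P (\<lambda>x. \<phi> (f x))"
    proof (rule extensionalityI[where A = "carrier X"])
      show "f x = trace X P (\<lambda>x. \<phi> (f x)) x" if x: "x \<in> carrier X" for x
        using trace_comp_right[OF X P P phi(1) fh x] phi(2) modhom_closed[OF fh x] by simp
    qed (use f in \<open>auto simp: trace_def\<close>)
    then show ?thesis unfolding trace_maps_def using modhom_comp[OF modhom_klin[OF fh] phi(1)] by blast
  qed
  then have "trace_maps X P = carrier (hom_space L X P)"
    using ksub_trace_maps[OF X P] unfolding ksub_def by blast
  then have "sub (hom_space L X P) (trace_maps X P) = hom_space L X P"
    by (simp del: hom_space_simps)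
  then show ?thesis unfolding tdim_eq_trace[OF assms(1,2)] hdim_def by simp
qed

lemma tdim_relproj_source:
  assumes "fd_module L P" "fd_module L Y" "relproj P" shows "tdim L P Y = hdim L P Y"
proof -
  note Y = fd_moduleD(1)[OF assms(2)]
  obtain \<phi> where phi: "\<phi> \<in> klin (rs P) (rs P)" "\<And>x. x \<in> carrier P \<Longrightarrow> trace P P \<phi> x = x"
    and P: "left_module L P" using assms(3) unfolding relproj_def by blast
  have "f \<in> trace_maps P Y" if f: "f \<in> carrier (hom_space L P Y)" for f
  proof -
    have fh: "f \<in> module_hom L P Y" using f by simp
    have "f = trace P Y (\<lambda>x. f (\<phi> x))"
    proof (rule extensionalityI[where A = "carrier P"])
      show "f x = trace P Y (\<lambda>x. f (\<phi> x)) x" if x: "x \<in> carrier P" for x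
        using trace_comp_left[OF P P Y phi(1) fh x] phi(2) x by simp
    qed (use f in \<open>auto simp: trace_def\<close>)
    then show ?thesis unfolding trace_maps_def using modhom_comp[OF phi(1) modhom_klin[OF fh]] by blast
  qed
  then have "trace_maps P Y = carrier (hom_space L P Y)"
    using ksub_trace_maps[OF P Y] unfolding ksub_def by blast
  then have "sub (hom_space L P Y) (trace_maps P Y) = hom_space L P Y"
    by (simp del: hom_space_simps)
  then show ?thesis unfolding tdim_eq_trace[OF assms(1,2)] hdim_def by simp
qed

text \<open>A map from \<open>X\<close> to \<open>V\<close> is a trace exactly when it lifts along
  \<open>p\<close>: a linear section of \<open>p\<close> produces the lift, and maps into
  \<open>P\<close> are traces. So the trace maps are the image of Hom(X, P) in Hom(X, V), with
  kernel Hom(X, W).\<close>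

lemma short_exact_tdim_left:
  assumes W: "fd_module L W" and P: "fd_module L P" and V: "fd_module L V" and X: "fd_module L X"
    and pr: "relproj P" and se: "short_exact L W i P p V"
  shows "tdim L X V + hdim L X W = hdim L X P"
proof -
  note lX = fd_moduleD(1)[OF X] and lP = fd_moduleD(1)[OF P] and lV = fd_moduleD(1)[OF V]
  from se have p: "p \<in> module_hom L P V" and ps: "p ` carrier P = carrier V"
    by (auto simp: short_exact_def)
  obtain \<phi> where phi: "\<phi> \<in> klin (rs P) (rs P)" "\<And>x. x \<in> carrier P \<Longrightarrow> trace P P \<phi> x = x"
    using pr unfolding relproj_def by blast
  let ?F = "\<lambda>f. \<lambda>x\<in>carrier X. p (f x)"
  have im: "?F ` carrier (hom_space L X P) = trace_maps X V"
  proof (intro equalityI subsetI)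
    fix g assume "g \<in> ?F ` carrier (hom_space L X P)"
    then obtain f where f: "f \<in> module_hom L X P" and g: "g = ?F f" by auto
    have fp: "(\<lambda>x. \<phi> (f x)) \<in> klin (rs X) (rs P)" using modhom_comp[OF modhom_klin[OF f] phi(1)] .
    have "g = trace X V (\<lambda>x. p (\<phi> (f x)))"
    proof (rule extensionalityI[where A = "carrier X"])
      fix x assume x: "x \<in> carrier X"
      have "trace X V (\<lambda>x. p (\<phi> (f x))) x = p (trace X P (\<lambda>x. \<phi> (f x)) x)"
        using trace_comp_left[OF lX lP lV fp p x] by simp
      also have "trace X P (\<lambda>x. \<phi> (f x)) x = trace P P \<phi> (f x)"
        using trace_comp_right[OF lX lP lP phi(1) f x] by simp
      finally show "g x = trace X V (\<lambda>x. p (\<phi> (f x))) x"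
        using g phi(2) modhom_closed[OF f x] x by simp
    qed (auto simp: g trace_def)
    then show "g \<in> trace_maps X V"
      unfolding trace_maps_def using modhom_comp[OF fp modhom_klin[OF p]] by blast
  next
    fix g assume "g \<in> trace_maps X V"
    then obtain \<psi> where psi: "\<psi> \<in> klin (rs X) (rs V)" and g: "g = trace X V \<psi>"
      unfolding trace_maps_def by blast
    obtain \<sigma> where sg: "\<sigma> \<in> klin (rs V) (rs P)" "\<And>y. y \<in> carrier (rs V) \<Longrightarrow> p (\<sigma> y) = y"
      using klin_section[OF fd_moduleD(3)[OF P] fd_moduleD(2)[OF V] modhom_klin[OF p]] ps by auto
    have sp: "(\<lambda>x. \<sigma> (\<psi> x)) \<in> klin (rs X) (rs P)" using modhom_comp[OF psi sg(1)] .
    have "g = ?F (trace X P (\<lambda>x. \<sigma> (\<psi> x)))"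
    proof (rule extensionalityI[where A = "carrier X"])
      fix x assume x: "x \<in> carrier X"
      have "p (trace X P (\<lambda>x. \<sigma> (\<psi> x)) x) = trace X V (\<lambda>x. p (\<sigma> (\<psi> x))) x"
        by (rule trace_comp_left[OF lX lP lV sp p x])
      also have "trace X V (\<lambda>x. p (\<sigma> (\<psi> x))) = trace X V \<psi>"
        using trace_cong[OF lX lV psi, of "\<lambda>x. p (\<sigma> (\<psi> x))"] sg(2) modhom_closed[OF psi] by simp
      finally show "g x = ?F (trace X P (\<lambda>x. \<sigma> (\<psi> x))) x" using x g by simp
    qed (auto simp: g trace_def)
    then show "g \<in> ?F ` carrier (hom_space L X P)" using trace_hom[OF lX lP sp] by blast
  qed
  have "hdim L X P = hdim L X W + kdim (sub (hom_space L X V) (?F ` carrier (hom_space L X P)))"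
    unfolding hdim_def
    using rank_nullity(1)[OF fdspace_hom_space[OF X P] kspace_hom_space[OF lX lV] post_comp_klin[OF lX lP p]]
      short_exact_post_comp_kernel[OF W P V X se] by simp
  then show ?thesis unfolding im tdim_eq_trace[OF X V] by simp
qed

text \<open>If \<rho> is a linear retraction of \<open>i\<close>, then tr(\<psi> \<rho>) extends
  tr(\<psi>) from \<open>W\<close> to \<open>P\<close>. In the other direction, maps out of
  \<open>P\<close> are traces and restrict to traces by \<open>trace_comp_right\<close>.\<close>

lemma short_exact_pre_comp_image:
  assumes W: "fd_module L W" and P: "fd_module L P" and V: "fd_module L V" and Y: "fd_module L Y"
    and pr: "relproj P" and se: "short_exact L W i P p V"
  shows "(\<lambda>f. \<lambda>x\<in>carrier W. f (i x)) ` carrier (hom_space L P Y) = trace_maps W Y"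
proof -
  note lW = fd_moduleD(1)[OF W] and lP = fd_moduleD(1)[OF P] and lY = fd_moduleD(1)[OF Y]
  from se have i: "i \<in> module_hom L W P" and inj: "inj_on i (carrier (rs W))"
    by (auto simp: short_exact_def)
  obtain \<phi> where phi: "\<phi> \<in> klin (rs P) (rs P)" "\<And>x. x \<in> carrier P \<Longrightarrow> trace P P \<phi> x = x"
    using pr unfolding relproj_def by blast
  let ?F = "\<lambda>f. \<lambda>x\<in>carrier W. f (i x)"
  show im: "?F ` carrier (hom_space L P Y) = trace_maps W Y"
  proof (intro equalityI subsetI)
    fix g assume "g \<in> ?F ` carrier (hom_space L P Y)"
    then obtain f where f: "f \<in> module_hom L P Y" and g: "g = ?F f" by auto
    have fp: "(\<lambda>x. f (\<phi> x)) \<in> klin (rs P) (rs Y)" using modhom_comp[OF phi(1) modhom_klin[OF f]] .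
    have "g = trace W Y (\<lambda>x. f (\<phi> (i x)))"
    proof (rule extensionalityI[where A = "carrier W"])
      fix x assume x: "x \<in> carrier W"
      have "trace W Y (\<lambda>x. f (\<phi> (i x))) x = trace P Y (\<lambda>x. f (\<phi> x)) (i x)"
        using trace_comp_right[OF lW lP lY fp i x] by simp
      also have "\<dots> = f (trace P P \<phi> (i x))"
        using trace_comp_left[OF lP lP lY phi(1) f modhom_closed[OF i x]] by simp
      finally show "g x = trace W Y (\<lambda>x. f (\<phi> (i x))) x"
        using g phi(2) modhom_closed[OF i x] x by simp
    qed (auto simp: g trace_def)
    then show "g \<in> trace_maps W Y"
      unfolding trace_maps_def using modhom_comp[OF modhom_klin[OF i] fp] by blast
  next
    fix g assume "g \<in> trace_maps W Y"
    then obtain \<psi> where psi: "\<psi> \<in> klin (rs W) (rs Y)" and g: "g = trace W Y \<psi>"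
      unfolding trace_maps_def by blast
    obtain \<rho> where rho: "\<rho> \<in> klin (rs P) (rs W)" "\<And>x. x \<in> carrier (rs W) \<Longrightarrow> \<rho> (i x) = x"
      by (rule klin_retraction[OF fd_moduleD(3)[OF W] fd_moduleD(2)[OF P] modhom_klin[OF i] inj], rule that)
    have rp: "(\<lambda>x. \<psi> (\<rho> x)) \<in> klin (rs P) (rs Y)" using modhom_comp[OF rho(1) psi] .
    have "g = ?F (trace P Y (\<lambda>x. \<psi> (\<rho> x)))"
    proof (rule extensionalityI[where A = "carrier W"])
      fix x assume x: "x \<in> carrier W"
      have "trace P Y (\<lambda>x. \<psi> (\<rho> x)) (i x) = trace W Y (\<lambda>x. \<psi> (\<rho> (i x))) x"
        by (rule trace_comp_right[OF lW lP lY rp i x])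
      also have "trace W Y (\<lambda>x. \<psi> (\<rho> (i x))) = trace W Y \<psi>"
        using trace_cong[OF lW lY psi, of "\<lambda>x. \<psi> (\<rho> (i x))"] rho(2) by simp
      finally show "g x = ?F (trace P Y (\<lambda>x. \<psi> (\<rho> x))) x" using x g by simp
    qed (auto simp: g trace_def)
    then show "g \<in> ?F ` carrier (hom_space L P Y)" using trace_hom[OF lP lY rp] by blast
  qed
qed

lemma short_exact_tdim_right:
  assumes W: "fd_module L W" and P: "fd_module L P" and V: "fd_module L V" and Y: "fd_module L Y"
    and pr: "relproj P" and se: "short_exact L W i P p V"
  shows "tdim L W Y + hdim L V Y = hdim L P Y"
proof -
  note lW = fd_moduleD(1)[OF W] and lP = fd_moduleD(1)[OF P] and lY = fd_moduleD(1)[OF Y]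
  from se have i: "i \<in> module_hom L W P" by (auto simp: short_exact_def)
  have "hdim L P Y = hdim L V Y +
      kdim (sub (hom_space L W Y) ((\<lambda>f. \<lambda>x\<in>carrier W. f (i x)) ` carrier (hom_space L P Y)))"
    unfolding hdim_def
    using rank_nullity(1)[OF fdspace_hom_space[OF P Y] kspace_hom_space[OF lW lY] pre_comp_klin[OF lW lP i]]
      short_exact_pre_comp_kernel[OF W P V Y se] by simp
  then show ?thesis unfolding short_exact_pre_comp_image[OF assms] tdim_eq_trace[OF W Y] by simp
qed

text \<open>The kernel of a relatively projective cover is a witness, so the choice in
  \<open>Syzygy\<close> has the intended property.\<close>

lemma Syzygy_spec:
  fixes V :: "('k, 'l) umodule"
  assumes "fd_module L V"
  shows "fd_module L (Syzygy L V) \<and> (\<exists>(P :: ('k, 'l) umodule) i p.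
    fd_module L P \<and> projective L P \<and> short_exact L (Syzygy L V) i P p V)"
proof -
  obtain F :: "('k, 'l) umodule" and g where F: "fd_module L F" "relproj F" "g \<in> module_hom L F V"
    "g ` carrier F = carrier V" using relproj_cover[OF assms] .
  let ?K = "{x \<in> carrier F. g x = \<zero>\<^bsub>V\<^esub>}"
  have K: "lsub L F ?K" using lsub_kernel[OF fd_moduleD(1)[OF F(1)] fd_moduleD(1)[OF assms] F(3)] .
  have "short_exact L (F\<lparr>carrier := ?K\<rparr>) (\<lambda>x. x) F g V"
    unfolding short_exact_def using F by (auto simp: LinearCombinations.module_hom_def)
  then show ?thesis
    unfolding Syzygy_def
    by (intro someI_ex[where P = "\<lambda>W. fd_module L W \<and> (\<exists>(P :: ('k, 'l) umodule) i p.
      fd_module L P \<and> projective L P \<and> short_exact L W i P p V)"])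
      (use fd_module_sub[OF K F(1)] F relproj_projective in blast)
qed

text \<open>The witness is the cokernel of a relatively projective hull, brought back to
  \<open>nat \<Rightarrow> 'k\<close> by \<open>quotient_umodule\<close>.\<close>

lemma Cosyzygy_spec:
  fixes V :: "('k, 'l) umodule"
  assumes "fd_module L V"
  shows "fd_module L (Cosyzygy L V) \<and> (\<exists>(P :: ('k, 'l) umodule) i p.
    fd_module L P \<and> injective L P \<and> short_exact L V i P p (Cosyzygy L V))"
proof -
  obtain F :: "('k, 'l) umodule" and g where F: "fd_module L F" "relproj F" "g \<in> module_hom L V F"
    "inj_on g (carrier V)" using relproj_hull[OF assms] .
  have "lsub L F (g ` carrier V)"
    using lsub_image[OF fd_moduleD(1)[OF assms] fd_moduleD(1)[OF F(1)] F(3)] .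
  from quotient_umodule[OF F(1) this] obtain W :: "('k, 'l) umodule" and p
    where W: "fd_module L W" "p \<in> module_hom L F W" "p ` carrier F = carrier W"
      "\<And>x. x \<in> carrier F \<Longrightarrow> p x = \<zero>\<^bsub>W\<^esub> \<longleftrightarrow> x \<in> g ` carrier V" by metis
  have "short_exact L V g F p W"
    unfolding short_exact_def using F W modhom_closed[OF F(3)] by auto
  then show ?thesis
    unfolding Cosyzygy_def
    by (intro someI_ex[where P = "\<lambda>W. fd_module L W \<and> (\<exists>(P :: ('k, 'l) umodule) i p.
      fd_module L P \<and> injective L P \<and> short_exact L V i P p W)"])
      (use W(1) F relproj_injective in blast)
qed

end

section \<open>Change of algebra\<close>

lemma modhom_sub:
  assumes "f \<in> module_hom R M N" "S \<subseteq> carrier M"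
  shows "f \<in> module_hom R (M\<lparr>carrier := S\<rparr>) N"
  by (rule modhomI)
    (use assms(2) in \<open>auto simp: subset_iff modhom_closed[OF assms(1)] modhom_add[OF assms(1)]
      modhom_smult[OF assms(1)]\<close>)

definition alg_iso :: "('k::field, 'l) module \<Rightarrow> ('k, 'l2) module \<Rightarrow> ('l \<Rightarrow> 'l2) \<Rightarrow> bool" where
  "alg_iso L L' \<tau> \<longleftrightarrow> \<tau> \<in> klin L L' \<and> bij_betw \<tau> (carrier L) (carrier L') \<and> \<tau> \<one>\<^bsub>L\<^esub> = \<one>\<^bsub>L'\<^esub> \<and>
     (\<forall>x\<in>carrier L. \<forall>y\<in>carrier L. \<tau> (x \<otimes>\<^bsub>L\<^esub> y) = \<tau> x \<otimes>\<^bsub>L'\<^esub> \<tau> y)"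

text \<open>Restriction along \<tau>; for an automorphism this is the twisted module.\<close>

definition pull :: "('l \<Rightarrow> 'l2) \<Rightarrow> ('l2, 'm) module \<Rightarrow> ('l, 'm) module" where
  "pull \<tau> M = \<lparr>carrier = carrier M, mult = mult M, one = one M, zero = zero M, add = add M,
     smult = (\<lambda>l x. \<tau> l \<odot>\<^bsub>M\<^esub> x)\<rparr>"

lemma pull_simps [simp]:
  "carrier (pull \<tau> M) = carrier M" "zero (pull \<tau> M) = zero M" "add (pull \<tau> M) = add M"
  "smult (pull \<tau> M) = (\<lambda>l x. \<tau> l \<odot>\<^bsub>M\<^esub> x)"
  by (auto simp: pull_def)

lemma finsum_pull [simp]: "finsum (pull \<tau> M) = finsum M"
  by (intro ext) (simp add: finsum_def finprod_def)

lemma alg_isoD: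
  assumes "alg_iso L L' \<tau>"
  shows "\<tau> \<in> klin L L'" "bij_betw \<tau> (carrier L) (carrier L')" "\<tau> \<one>\<^bsub>L\<^esub> = \<one>\<^bsub>L'\<^esub>"
    "\<And>x y. x \<in> carrier L \<Longrightarrow> y \<in> carrier L \<Longrightarrow> \<tau> (x \<otimes>\<^bsub>L\<^esub> y) = \<tau> x \<otimes>\<^bsub>L'\<^esub> \<tau> y"
    "\<And>x. x \<in> carrier L \<Longrightarrow> \<tau> x \<in> carrier L'"
  using assms modhom_closed[of \<tau> class_ring L L'] by (auto simp: alg_iso_def)

lemma alg_iso_inv:
  assumes "k_algebra L" "alg_iso L L' \<tau>" shows "alg_iso L' L (inv_into (carrier L) \<tau>)"
proof -
  interpret kalgebra L by unfold_locales fact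
  note t = alg_isoD[OF assms(2)]
  note inv = bij_betw_inv_into_simps[OF t(2)]
  show ?thesis
    unfolding alg_iso_def
  proof (intro conjI ballI)
    show "inv_into (carrier L) \<tau> \<in> klin L' L"
      by (rule modhom_inv_into[OF t(1,2) abelian_group_axioms]) simp
    show "bij_betw (inv_into (carrier L) \<tau>) (carrier L') (carrier L)" using t(2) by (rule bij_betw_inv_into)
    show "inv_into (carrier L) \<tau> \<one>\<^bsub>L'\<^esub> = \<one>\<^bsub>L\<^esub>" using inv(1)[of "\<one>\<^bsub>L\<^esub>"] t(3) by simp
    fix x y assume xy: "x \<in> carrier L'" "y \<in> carrier L'"
    have "x \<otimes>\<^bsub>L'\<^esub> y = \<tau> (inv_into (carrier L) \<tau> x \<otimes>\<^bsub>L\<^esub> inv_into (carrier L) \<tau> y)"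
      using xy inv by (simp add: t(4))
    then show "inv_into (carrier L) \<tau> (x \<otimes>\<^bsub>L'\<^esub> y) =
        inv_into (carrier L) \<tau> x \<otimes>\<^bsub>L\<^esub> inv_into (carrier L) \<tau> y"
      using inv xy by simp
  qed
qed

locale algebra_iso = kalgebra L + L': kalgebra L'
  for L :: "('k::field, 'l) module" and L' :: "('k, 'l2) module" +
  fixes \<tau> :: "'l \<Rightarrow> 'l2"
  assumes alg_iso: "alg_iso L L' \<tau>"
begin

lemmas iso = alg_isoD[OF alg_iso]

lemma surj_iso: "l \<in> carrier L' \<Longrightarrow> \<exists>x\<in>carrier L. l = \<tau> x"
  using iso(2) by (auto simp: bij_betw_def)

lemma restrict_scalars_pull: "restrict_scalars L (pull \<tau> M) = restrict_scalars L' M"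
  by (simp add: restrict_scalars_def pull_def klin_smult[OF iso(1)] iso(3))

lemma left_module_pull: "left_module L' M \<Longrightarrow> left_module L (pull \<tau> M)"
proof -
  assume "left_module L' M"
  then interpret M: left_module L' M .
  have "abelian_group (pull \<tau> M)"
    by (rule abelian_group_transport[OF M.M.abelian_group_axioms, of "\<lambda>x. x"]) auto
  then show ?thesis
    by (intro left_module.intro ring_axioms left_module_axioms.intro)
      (auto simp: iso modhom_add[OF iso(1)] M.smult_closed M.smult_l_distr M.smult_r_distr M.smult_assoc
        M.smult_one)
qed

lemma fd_module_pull: "fd_module L' M \<Longrightarrow> fd_module L (pull \<tau> M)"
  by (simp add: fd_module_def restrict_scalars_pull left_module_pull)

text \<open>Surjectivity of \<tau> gives the inclusion from left to right. As the sets are equal,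
  hom spaces and stable hom spaces of pulled-back modules are later equal, not just
  isomorphic.\<close>

lemma module_hom_pull: "module_hom L (pull \<tau> M) (pull \<tau> N) = module_hom L' M N"
proof (intro equalityI subsetI)
  fix f assume f: "f \<in> module_hom L (pull \<tau> M) (pull \<tau> N)"
  show "f \<in> module_hom L' M N"
  proof (rule modhomI)
    fix r x assume "r \<in> carrier L'" and x: "x \<in> carrier M"
    then obtain l where "l \<in> carrier L" "r = \<tau> l" using surj_iso by blast
    then show "f (r \<odot>\<^bsub>M\<^esub> x) = r \<odot>\<^bsub>N\<^esub> f x" using modhom_smult[OF f] x by simp
  qed (use modhom_closed[OF f] modhom_add[OF f] in auto)
qed (auto simp: LinearCombinations.module_hom_def iso)

lemma lmod_iso_pull: "lmod_iso L' M N \<Longrightarrow> lmod_iso L (pull \<tau> M) (pull \<tau> N)"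
  by (simp add: lmod_iso_def module_hom_pull)

lemma hom_space_pull: "hom_space L (pull \<tau> M) (pull \<tau> N) = hom_space L' M N"
  by (simp add: hom_space_def module_hom_pull klin_smult[OF iso(1)] iso(3))

lemma short_exact_pull: "short_exact L (pull \<tau> W) i (pull \<tau> P) p (pull \<tau> V) \<longleftrightarrow> short_exact L' W i P p V"
  by (simp add: short_exact_def module_hom_pull)

lemma frobenius_image:
  assumes "frobenius L I b c lam"
  shows "frobenius L' I (\<lambda>i. \<tau> (b i)) (\<lambda>i. \<tau> (c i)) (\<lambda>x. lam (inv_into (carrier L) \<tau> x))"
proof -
  interpret F: frobenius L I b c lam by fact
  let ?s = "inv_into (carrier L) \<tau>"
  have inv: "alg_iso L' L ?s" using k_algebra alg_iso by (rule alg_iso_inv)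
  note inv = alg_isoD[OF inv] bij_betw_inv_into_simps[OF iso(2)]
  show ?thesis
  proof (intro frobenius.intro L'.kalgebra_axioms frobenius_axioms.intro)
    show "(\<lambda>x. lam (?s x)) \<in> klin L' ground" using modhom_comp[OF inv(1) F.lam_linear] .
    fix y assume y: "y \<in> carrier L'"
    have "y = \<tau> (\<Oplus>\<^bsub>L\<^esub>i\<in>I. lam (?s y \<otimes>\<^bsub>L\<^esub> c i) \<odot>\<^bsub>L\<^esub> b i)"
      using F.expand_b[of "?s y"] inv y by simp
    also have "\<dots> = (\<Oplus>\<^bsub>L'\<^esub>i\<in>I. \<tau> (lam (?s y \<otimes>\<^bsub>L\<^esub> c i) \<odot>\<^bsub>L\<^esub> b i))"
      using F.b_closed by (intro modhom_finsum[OF abelian_group_axioms L'.abelian_group_axioms iso(1)]) auto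
    also have "\<dots> = (\<Oplus>\<^bsub>L'\<^esub>i\<in>I. lam (?s (y \<otimes>\<^bsub>L'\<^esub> \<tau> (c i))) \<odot>\<^bsub>L'\<^esub> \<tau> (b i))"
      using F.b_closed F.c_closed y
      by (intro L'.finsum_cong') (auto simp: klin_smult[OF iso(1)] inv iso)
    finally show "y = (\<Oplus>\<^bsub>L'\<^esub>i\<in>I. lam (?s (y \<otimes>\<^bsub>L'\<^esub> \<tau> (c i))) \<odot>\<^bsub>L'\<^esub> \<tau> (b i))" .
    have "y = \<tau> (\<Oplus>\<^bsub>L\<^esub>i\<in>I. lam (b i \<otimes>\<^bsub>L\<^esub> ?s y) \<odot>\<^bsub>L\<^esub> c i)"
      using F.expand_c[of "?s y"] inv y by simp
    also have "\<dots> = (\<Oplus>\<^bsub>L'\<^esub>i\<in>I. \<tau> (lam (b i \<otimes>\<^bsub>L\<^esub> ?s y) \<odot>\<^bsub>L\<^esub> c i))"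
      using F.c_closed by (intro modhom_finsum[OF abelian_group_axioms L'.abelian_group_axioms iso(1)]) auto
    also have "\<dots> = (\<Oplus>\<^bsub>L'\<^esub>i\<in>I. lam (?s (\<tau> (b i) \<otimes>\<^bsub>L'\<^esub> y)) \<odot>\<^bsub>L'\<^esub> \<tau> (c i))"
      using F.b_closed F.c_closed y
      by (intro L'.finsum_cong') (auto simp: klin_smult[OF iso(1)] inv iso)
    finally show "y = (\<Oplus>\<^bsub>L'\<^esub>i\<in>I. lam (?s (\<tau> (b i) \<otimes>\<^bsub>L'\<^esub> y)) \<odot>\<^bsub>L'\<^esub> \<tau> (c i))" .
  qed (auto simp: F.finite_I F.b_closed F.c_closed iso)
qed

end

locale frobenius_iso = algebra_iso L L' \<tau> + frobenius L I b c lam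
  for L :: "('k::field, 'l) module" and L' :: "('k, 'l2) module" and \<tau> :: "'l \<Rightarrow> 'l2"
    and I :: "'i set" and b c :: "'i \<Rightarrow> 'l" and lam :: "'l \<Rightarrow> 'k"
begin

sublocale F': frobenius L' I "\<lambda>i. \<tau> (b i)" "\<lambda>i. \<tau> (c i)" "\<lambda>x. lam (inv_into (carrier L) \<tau> x)"
  by (rule frobenius_image) (rule frobenius_axioms)

text \<open>On a pulled-back module \<open>b i\<close> acts as \<open>\<tau> (b i)\<close>, which
  belongs to the dual bases carried to \<open>L'\<close>.\<close>

lemma trace_pull: "trace (pull \<tau> U) (pull \<tau> V) \<phi> = F'.trace U V \<phi>"
  by (simp add: trace_def F'.trace_def)

lemma relproj_pull: "F'.relproj P \<Longrightarrow> relproj (pull \<tau> P)"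
  by (auto simp: relproj_def F'.relproj_def trace_pull restrict_scalars_pull left_module_pull)

lemma proj_maps_pull:
  assumes "fd_module L' U" "fd_module L' V"
  shows "proj_maps L (pull \<tau> U) (pull \<tau> V) = proj_maps L' U V"
  unfolding proj_maps_eq_trace_maps[OF fd_module_pull[OF assms(1)] fd_module_pull[OF assms(2)]]
    F'.proj_maps_eq_trace_maps[OF assms]
  by (simp add: trace_maps_def F'.trace_maps_def trace_pull restrict_scalars_pull)

lemma stable_hom_pull:
  assumes "fd_module L' U" "fd_module L' V"
  shows "stable_hom L (pull \<tau> U) (pull \<tau> V) = stable_hom L' U V"
  by (simp add: stable_hom_def proj_maps_pull[OF assms] hom_space_pull)

lemma sdim_pull:
  "fd_module L' U \<Longrightarrow> fd_module L' V \<Longrightarrow> sdim L (pull \<tau> U) (pull \<tau> V) = sdim L' U V"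
  by (simp add: sdim_def stable_hom_pull)

end

section \<open>Invariance under isomorphism\<close>

context frobenius
begin

text \<open>Composition with the isomorphism maps homomorphisms bijectively to homomorphisms and
  traces to traces; so \<open>hdim\<close> and \<open>tdim\<close> agree, and \<open>sdim\<close> is
  their difference.\<close>

lemma sdim_iso_left:
  assumes M: "fd_module L M" and N: "fd_module L N" and Y: "fd_module L Y" and iso: "lmod_iso L M N"
  shows "sdim L N Y = sdim L M Y"
proof -
  note lM = fd_moduleD(1)[OF M] and lN = fd_moduleD(1)[OF N] and lY = fd_moduleD(1)[OF Y]
  obtain f where f: "f \<in> module_hom L M N" "bij_betw f (carrier M) (carrier N)"
    using iso by (auto simp: lmod_iso_def)
  interpret M: left_module L M by (rule lM)
  define g where "g = inv_into (carrier M) f"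
  have g: "g \<in> module_hom L N M"
    unfolding g_def by (rule modhom_inv_into[OF f M.M.abelian_group_axioms M.smult_closed])
  note inv = bij_betw_inv_into_simps[OF f(2), folded g_def]
  let ?F = "\<lambda>u. \<lambda>x\<in>carrier M. u (f x)"
  have F: "?F \<in> klin (hom_space L N Y) (hom_space L M Y)" by (rule pre_comp_klin[OF lM lN f(1)])
  have F0: "u = \<zero>\<^bsub>hom_space L N Y\<^esub>" if u: "u \<in> carrier (hom_space L N Y)" and z: "?F u = \<zero>\<^bsub>hom_space L M Y\<^esub>" for u
  proof (rule extensionalityI[where A = "carrier N"])
    fix y assume y: "y \<in> carrier N"
    have "?F u (g y) = (\<zero>\<^bsub>hom_space L M Y\<^esub>) (g y)" unfolding z ..
    then show "u y = (\<zero>\<^bsub>hom_space L N Y\<^esub>) y" using y inv by simp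
  qed (use u in auto)
  have surj: "?F (\<lambda>y\<in>carrier N. v (g y)) = v" if v: "v \<in> carrier (hom_space L M Y)" for v
  proof (rule extensionalityI[where A = "carrier M"])
    show "?F (\<lambda>y\<in>carrier N. v (g y)) x = v x" if "x \<in> carrier M" for x
      using that inv(1)[OF that] modhom_closed[OF f(1) that] by simp
  qed (use v in simp_all)
  have im: "?F ` carrier (hom_space L N Y) = carrier (hom_space L M Y)"
  proof
    show "?F ` carrier (hom_space L N Y) \<subseteq> carrier (hom_space L M Y)" using modhom_closed[OF F] by blast
    show "carrier (hom_space L M Y) \<subseteq> ?F ` carrier (hom_space L N Y)"
    proof
      fix v assume v: "v \<in> carrier (hom_space L M Y)"
      show "v \<in> ?F ` carrier (hom_space L N Y)"
        by (rule image_eqI, rule surj[OF v, symmetric], rule modhom_closed[OF pre_comp_klin[OF lN lM g] v])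
    qed
  qed
  have imt: "?F ` trace_maps N Y = trace_maps M Y"
  proof (intro equalityI subsetI)
    fix v assume "v \<in> ?F ` trace_maps N Y"
    then obtain \<phi> where phi: "\<phi> \<in> klin (rs N) (rs Y)" and v: "v = ?F (trace N Y \<phi>)"
      unfolding trace_maps_def by blast
    have "v = trace M Y (\<lambda>x. \<phi> (f x))"
      by (rule extensionalityI[where A = "carrier M"])
        (use v trace_comp_right[OF lM lN lY phi f(1)] in \<open>auto simp: trace_def[of M]\<close>)
    then show "v \<in> trace_maps M Y"
      unfolding trace_maps_def using modhom_comp[OF modhom_klin[OF f(1)] phi] by blast
  next
    fix v assume v: "v \<in> trace_maps M Y"
    then obtain \<phi> where phi: "\<phi> \<in> klin (rs M) (rs Y)" and v': "v = trace M Y \<phi>"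
      unfolding trace_maps_def by blast
    have gp: "(\<lambda>x. \<phi> (g x)) \<in> klin (rs N) (rs Y)" using modhom_comp[OF modhom_klin[OF g] phi] .
    have gv: "(\<lambda>y\<in>carrier N. v (g y)) = trace N Y (\<lambda>x. \<phi> (g x))"
      by (rule extensionalityI[where A = "carrier N"])
        (use v' trace_comp_right[OF lN lM lY phi g] in \<open>auto simp: trace_def[of N]\<close>)
    have gvt: "(\<lambda>y\<in>carrier N. v (g y)) \<in> trace_maps N Y"
      unfolding trace_maps_def gv using gp by (rule imageI)
    have vc: "v \<in> carrier (hom_space L M Y)"
      using ksub_trace_maps[OF lM lY] v unfolding ksub_def by blast
    show "v \<in> ?F ` trace_maps N Y" by (rule image_eqI, rule surj[OF vc, symmetric], rule gvt)
  qed
  have "kdim (sub (hom_space L M Y) (?F ` carrier (hom_space L N Y))) = hdim L N Y"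
    unfolding hdim_def
    by (rule kdim_inj_image[OF fdspace_hom_space[OF N Y] kspace_hom_space[OF lM lY] F F0])
  then have h: "hdim L M Y = hdim L N Y" unfolding im hdim_def by (simp del: hom_space_simps)
  have st: "fdspace (sub (hom_space L N Y) (trace_maps N Y))"
    by (rule fdspace_sub[OF fdspace_hom_space[OF N Y] ksub_trace_maps[OF lN lY]])
  have tc: "trace_maps N Y \<subseteq> carrier (hom_space L N Y)" using ksub_trace_maps[OF lN lY] by (simp add: ksub_def)
  have Ft: "?F \<in> klin (sub (hom_space L N Y) (trace_maps N Y)) (hom_space L M Y)"
    by (rule modhom_sub[OF F tc])
  have "kdim (sub (hom_space L M Y) (?F ` carrier (sub (hom_space L N Y) (trace_maps N Y)))) = tdim L N Y"
    unfolding tdim_eq_trace[OF N Y]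
    by (rule kdim_inj_image[OF st kspace_hom_space[OF lM lY] Ft])
      (use F0 tc in \<open>auto simp del: hom_space_simps\<close>)
  then have "tdim L M Y = tdim L N Y" unfolding tdim_eq_trace[OF M Y] using imt by simp
  then show ?thesis using h hdim_eq[OF M Y] hdim_eq[OF N Y] by simp
qed

lemma sdim_iso_right:
  assumes M: "fd_module L M" and N: "fd_module L N" and X: "fd_module L X" and iso: "lmod_iso L M N"
  shows "sdim L X M = sdim L X N"
proof -
  note lM = fd_moduleD(1)[OF M] and lN = fd_moduleD(1)[OF N] and lX = fd_moduleD(1)[OF X]
  obtain f where f: "f \<in> module_hom L M N" "bij_betw f (carrier M) (carrier N)"
    using iso by (auto simp: lmod_iso_def)
  interpret M: left_module L M by (rule lM)
  define g where "g = inv_into (carrier M) f"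
  have g: "g \<in> module_hom L N M"
    unfolding g_def by (rule modhom_inv_into[OF f M.M.abelian_group_axioms M.smult_closed])
  note inv = bij_betw_inv_into_simps[OF f(2), folded g_def]
  interpret N: left_module L N by (rule lN)
  let ?F = "\<lambda>u. \<lambda>x\<in>carrier X. f (u x)"
  have F: "?F \<in> klin (hom_space L X M) (hom_space L X N)" by (rule post_comp_klin[OF lX lM f(1)])
  have F0: "u = \<zero>\<^bsub>hom_space L X M\<^esub>" if u: "u \<in> carrier (hom_space L X M)" and z: "?F u = \<zero>\<^bsub>hom_space L X N\<^esub>" for u
  proof (rule extensionalityI[where A = "carrier X"])
    fix x assume x: "x \<in> carrier X"
    have "?F u x = (\<zero>\<^bsub>hom_space L X N\<^esub>) x" unfolding z ..
    then have "f (u x) = \<zero>\<^bsub>N\<^esub>" using x by simp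
    moreover have "u x \<in> carrier M" using u x modhom_closed[of u L X M] by simp
    moreover have "inj_on f (carrier M)" using f(2) by (simp add: bij_betw_def)
    ultimately show "u x = (\<zero>\<^bsub>hom_space L X M\<^esub>) x"
      using inj_on_hom_iff[OF lM lN f(1)] x by auto
  qed (use u in auto)
  have surj: "?F (\<lambda>x\<in>carrier X. g (v x)) = v" if v: "v \<in> carrier (hom_space L X N)" for v
  proof (rule extensionalityI[where A = "carrier X"])
    show "?F (\<lambda>x\<in>carrier X. g (v x)) x = v x" if "x \<in> carrier X" for x
      using that v inv(2)[of "v x"] modhom_closed[of v L X N x] by simp
  qed (use v in simp_all)
  have im: "?F ` carrier (hom_space L X M) = carrier (hom_space L X N)"
  proof
    show "?F ` carrier (hom_space L X M) \<subseteq> carrier (hom_space L X N)" using modhom_closed[OF F] by blast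
    show "carrier (hom_space L X N) \<subseteq> ?F ` carrier (hom_space L X M)"
    proof
      fix v assume v: "v \<in> carrier (hom_space L X N)"
      show "v \<in> ?F ` carrier (hom_space L X M)"
        by (rule image_eqI, rule surj[OF v, symmetric], rule modhom_closed[OF post_comp_klin[OF lX lN g] v])
    qed
  qed
  have imt: "?F ` trace_maps X M = trace_maps X N"
  proof (intro equalityI subsetI)
    fix v assume "v \<in> ?F ` trace_maps X M"
    then obtain \<phi> where phi: "\<phi> \<in> klin (rs X) (rs M)" and v: "v = ?F (trace X M \<phi>)"
      unfolding trace_maps_def by blast
    have "v = trace X N (\<lambda>x. f (\<phi> x))"
      by (rule extensionalityI[where A = "carrier X"])
        (use v trace_comp_left[OF lX lM lN phi f(1)] in \<open>auto simp: trace_def[of X N]\<close>)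
    then show "v \<in> trace_maps X N"
      unfolding trace_maps_def using modhom_comp[OF phi modhom_klin[OF f(1)]] by blast
  next
    fix v assume v: "v \<in> trace_maps X N"
    then obtain \<phi> where phi: "\<phi> \<in> klin (rs X) (rs N)" and v': "v = trace X N \<phi>"
      unfolding trace_maps_def by blast
    have gp: "(\<lambda>x. g (\<phi> x)) \<in> klin (rs X) (rs M)" using modhom_comp[OF phi modhom_klin[OF g]] .
    have gv: "(\<lambda>x\<in>carrier X. g (v x)) = trace X M (\<lambda>x. g (\<phi> x))"
      by (rule extensionalityI[where A = "carrier X"])
        (use v' trace_comp_left[OF lX lN lM phi g] in \<open>auto simp: trace_def[of X M]\<close>)
    have gvt: "(\<lambda>x\<in>carrier X. g (v x)) \<in> trace_maps X M"
      unfolding trace_maps_def gv using gp by (rule imageI)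
    have vc: "v \<in> carrier (hom_space L X N)"
      using ksub_trace_maps[OF lX lN] v unfolding ksub_def by blast
    show "v \<in> ?F ` trace_maps X M" by (rule image_eqI, rule surj[OF vc, symmetric], rule gvt)
  qed
  have "kdim (sub (hom_space L X N) (?F ` carrier (hom_space L X M))) = hdim L X M"
    unfolding hdim_def
    by (rule kdim_inj_image[OF fdspace_hom_space[OF X M] kspace_hom_space[OF lX lN] F F0])
  then have h: "hdim L X N = hdim L X M" unfolding im hdim_def by (simp del: hom_space_simps)
  have st: "fdspace (sub (hom_space L X M) (trace_maps X M))"
    by (rule fdspace_sub[OF fdspace_hom_space[OF X M] ksub_trace_maps[OF lX lM]])
  have tc: "trace_maps X M \<subseteq> carrier (hom_space L X M)" using ksub_trace_maps[OF lX lM] by (simp add: ksub_def)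
  have Ft: "?F \<in> klin (sub (hom_space L X M) (trace_maps X M)) (hom_space L X N)"
    by (rule modhom_sub[OF F tc])
  have "kdim (sub (hom_space L X N) (?F ` carrier (sub (hom_space L X M) (trace_maps X M)))) = tdim L X M"
    unfolding tdim_eq_trace[OF X M]
    by (rule kdim_inj_image[OF st kspace_hom_space[OF lX lN] Ft])
      (use F0 tc in \<open>auto simp del: hom_space_simps\<close>)
  then have "tdim L X N = tdim L X M" unfolding tdim_eq_trace[OF X N] using imt by simp
  then show ?thesis using h hdim_eq[OF X M] hdim_eq[OF X N] by simp
qed

end

section \<open>The Nakayama twist\<close>

text \<open>In coordinates both sides are the same double sum of products of matrix entries.\<close>

lemma trace_cyclic:
  assumes V: "kspace V" and B: "coord_system V B \<xi>" and a: "\<alpha> \<in> klin V V" and g: "\<gamma> \<in> klin V V"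
  shows "(\<Sum>e\<in>B. \<xi> e (\<alpha> (\<gamma> e))) = (\<Sum>e\<in>B. \<xi> e (\<gamma> (\<alpha> e)))"
proof -
  interpret V: kspace V by fact
  note B = coord_systemD[OF B]
  have eB: "e \<in> carrier V" if "e \<in> B" for e using B(2) that by blast
  have expand: "\<xi> e (u (w e')) = (\<Sum>f\<in>B. \<xi> f (w e') * \<xi> e (u f))"
    if "e \<in> B" "e' \<in> B" "u \<in> klin V V" "w \<in> klin V V" for e e' u w
  proof -
    have w: "w e' \<in> carrier V" using modhom_closed[OF that(4)] eB that by simp
    have "\<xi> e (u (w e')) = \<xi> e (u (\<Oplus>\<^bsub>V\<^esub>f\<in>B. \<xi> f (w e') \<odot>\<^bsub>V\<^esub> f))" using B(5)[OF w] by simp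
    also have "u (\<Oplus>\<^bsub>V\<^esub>f\<in>B. \<xi> f (w e') \<odot>\<^bsub>V\<^esub> f) = (\<Oplus>\<^bsub>V\<^esub>f\<in>B. u (\<xi> f (w e') \<odot>\<^bsub>V\<^esub> f))"
      using eB by (intro modhom_finsum[OF V.abelian_group_axioms V.abelian_group_axioms that(3)]) auto
    also have "\<dots> = (\<Oplus>\<^bsub>V\<^esub>f\<in>B. \<xi> f (w e') \<odot>\<^bsub>V\<^esub> u f)"
      using eB modhom_closed[OF that(3)] by (intro V.finsum_cong') (auto simp: klin_smult[OF that(3)])
    also have "\<xi> e \<dots> = (\<Oplus>\<^bsub>ground\<^esub>f\<in>B. \<xi> e (\<xi> f (w e') \<odot>\<^bsub>V\<^esub> u f))"
      using eB modhom_closed[OF that(3)]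
      by (intro modhom_finsum[OF V.abelian_group_axioms kspace.axioms(1)[OF kspace_ground] B(4)[OF that(1)]]) auto
    also have "\<dots> = (\<Sum>f\<in>B. \<xi> f (w e') * \<xi> e (u f))"
      using eB modhom_closed[OF that(3)]
      by (auto simp: klin_smult[OF B(4)[OF that(1)]] intro!: sum.cong)
    finally show ?thesis .
  qed
  have "(\<Sum>e\<in>B. \<xi> e (\<alpha> (\<gamma> e))) = (\<Sum>e\<in>B. \<Sum>f\<in>B. \<xi> f (\<gamma> e) * \<xi> e (\<alpha> f))"
    using expand[OF _ _ a g] by simp
  also have "\<dots> = (\<Sum>f\<in>B. \<Sum>e\<in>B. \<xi> e (\<alpha> f) * \<xi> f (\<gamma> e))"
    by (subst sum.swap) (simp add: mult.commute)
  also have "\<dots> = (\<Sum>f\<in>B. \<xi> f (\<gamma> (\<alpha> f)))" using expand[OF _ _ g a] by simp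
  finally show ?thesis .
qed

lemma rank_one_khom:
  assumes "kspace V" "kspace W" "g \<in> klin V ground" "w \<in> carrier W"
  shows "(\<lambda>x\<in>carrier V. g x \<odot>\<^bsub>W\<^esub> w) \<in> carrier (khom V W)"
proof -
  interpret W: kspace W by fact
  have "(\<lambda>x. g x \<odot>\<^bsub>W\<^esub> w) \<in> module_hom ground V W"
    by (rule modhomI) (auto simp: assms(4) modhom_add[OF assms(3)] klin_smult[OF assms(3)]
        W.smult_l_distr W.smult_assoc)
  from modhom_restrict[OF _ this] show ?thesis using assms(1) by simp
qed

text \<open>The left side is the trace of the rank one map g(-) v; nondegeneracy of the trace form
  is tested on such maps.\<close>

lemma functional_expand:
  assumes V: "kspace V" and B: "coord_system V B \<xi>" and g: "g \<in> klin V ground" and v: "v \<in> carrier V"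
  shows "(\<Sum>e\<in>B. g e * \<xi> e v) = g v"
proof -
  interpret V: kspace V by fact
  note B = coord_systemD[OF B]
  have "g v = g (\<Oplus>\<^bsub>V\<^esub>e\<in>B. \<xi> e v \<odot>\<^bsub>V\<^esub> e)" using B(5)[OF v] by simp
  also have "\<dots> = (\<Oplus>\<^bsub>ground\<^esub>e\<in>B. g (\<xi> e v \<odot>\<^bsub>V\<^esub> e))"
    using B(2) by (intro modhom_finsum[OF V.abelian_group_axioms kspace.axioms(1)[OF kspace_ground] g]) auto
  also have "\<dots> = (\<Sum>e\<in>B. g e * \<xi> e v)"
    using B(2) by (auto simp: klin_smult[OF g] mult.commute intro!: sum.cong)
  finally show ?thesis by simp
qed

lemma (in kalgebra) lmult_klin:
  assumes "left_module L M" "l \<in> carrier L"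
  shows "(\<lambda>x. l \<odot>\<^bsub>M\<^esub> x) \<in> klin (rs M) (rs M)"
proof -
  interpret M: left_module L M by fact
  show ?thesis
    by (rule modhomI) (use assms(2) in \<open>auto simp: M.smult_closed M.smult_r_distr scalar_smult_commute(1)[OF assms(1)]\<close>)
qed

locale nakayama = frobenius L I b c lam for L :: "('k::field, 'l) module" (structure)
    and I :: "'i set" and b c lam +
  fixes \<sigma> :: "'l \<Rightarrow> 'l"
  assumes sigma: "alg_iso L L \<sigma>"
    and lam_sigma: "x \<in> carrier L \<Longrightarrow> y \<in> carrier L \<Longrightarrow> lam (x \<otimes> y) = lam (y \<otimes> \<sigma> x)"
begin

definition \<tau> :: "'l \<Rightarrow> 'l" where "\<tau> = inv_into (carrier L) \<sigma>"

lemma tau: "alg_iso L L \<tau>"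
  unfolding \<tau>_def using k_algebra sigma by (rule alg_iso_inv)

sublocale tau: frobenius_iso L L \<tau> I b c lam
  by unfold_locales (rule tau)

text \<open>Since \<open>lam (b i \<otimes> x) = lam (x \<otimes> \<sigma> (b i))\<close>, the two
  bases exchange roles at the cost of applying \<sigma>, with the same form. Traces into a module
  twisted by \<tau> are taken in this second system, because there \<open>\<sigma> (b i)\<close>
  acts as \<open>b i\<close>.\<close>

lemma frobenius_swapped: "frobenius L I c (\<lambda>i. \<sigma> (b i)) lam"
proof (intro frobenius.intro kalgebra_axioms frobenius_axioms.intro)
  note s = alg_isoD[OF sigma]
  fix x assume x: "x \<in> carrier L"
  have "x = (\<Oplus>i\<in>I. lam (b i \<otimes> x) \<odot> c i)" by (rule expand_c[OF x])
  also have "\<dots> = (\<Oplus>i\<in>I. lam (x \<otimes> \<sigma> (b i)) \<odot> c i)"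
    using x b_closed c_closed lam_sigma by (intro finsum_cong') auto
  finally show "x = (\<Oplus>i\<in>I. lam (x \<otimes> \<sigma> (b i)) \<odot> c i)" .
  obtain y where y: "y \<in> carrier L" "x = \<sigma> y" using s(2) x by (auto simp: bij_betw_def)
  have "x = \<sigma> (\<Oplus>i\<in>I. lam (y \<otimes> c i) \<odot> b i)" using expand_b[OF y(1)] y(2) by simp
  also have "\<dots> = (\<Oplus>i\<in>I. \<sigma> (lam (y \<otimes> c i) \<odot> b i))"
    using b_closed by (intro modhom_finsum[OF abelian_group_axioms abelian_group_axioms s(1)]) auto
  also have "\<dots> = (\<Oplus>i\<in>I. lam (c i \<otimes> x) \<odot> \<sigma> (b i))"
    using y b_closed c_closed lam_sigma s(5)
    by (intro finsum_cong') (auto simp: klin_smult[OF s(1)])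
  finally show "x = (\<Oplus>i\<in>I. lam (c i \<otimes> x) \<odot> \<sigma> (b i))" .
qed (use finite_I b_closed c_closed lam_linear alg_isoD(5)[OF sigma] in auto)

text \<open>Pair \<phi> and \<psi> by the trace of \<psi> \<phi> on \<open>X\<close>. Cyclicity
  gives tr(\<psi> c_i \<phi> b_i) = tr(b_i \<psi> c_i \<phi>). Summed over i, this says that the
  operator \<open>trace\<close> for maps from \<open>X\<close> to \<open>Y\<close> in the system (b,
  c) is adjoint to the one for maps from \<open>Y\<close> to the twist of \<open>X\<close> in the
  system (c, \<sigma> b), and \<open>adjoint_rank\<close> applies.\<close>

lemma tdim_nakayama:
  assumes X: "fd_module L X" and Y: "fd_module L Y"
  shows "tdim L X Y = tdim L Y (pull \<tau> X)"
proof -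
  note lX = fd_moduleD[OF X] and lY = fd_moduleD[OF Y]
  note Z = tau.fd_module_pull[OF X]
  let ?Z = "pull \<tau> X"
  note lZ = fd_moduleD(1)[OF Z]
  interpret X: left_module L X by (rule lX)
  interpret Y: left_module L Y by (rule lY)
  interpret kX: kspace "rs X" by (rule lX)
  interpret kY: kspace "rs Y" by (rule lY)
  interpret S: frobenius L I c "\<lambda>i. \<sigma> (b i)" lam by (rule frobenius_swapped)
  \<comment> \<open>The twist leaves the scalar action alone, so linear maps into \<open>X\<close>
    and into its twist are the same.\<close>
  have rsZ: "rs ?Z = rs X" by (rule tau.restrict_scalars_pull)
  have tau1: "\<tau> (k \<odot> \<one>) = k \<odot> \<one>" for k
    using klin_smult[OF tau.iso(1), of \<one> k] tau.iso(3) by simp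
  have tau_sigma: "\<tau> (\<sigma> l) = l" if "l \<in> carrier L" for l
    unfolding \<tau>_def using bij_betw_inv_into_simps(1)[OF alg_isoD(2)[OF sigma] that] .
  obtain B \<xi> where cs: "coord_system (rs X) B \<xi>" using coord_system_exists[OF lX(2)] .
  note B = coord_systemD[OF cs]
  have eX: "e \<in> carrier X" if "e \<in> B" for e using B(2) that by auto
  have xi_add: "\<xi> e (x \<oplus>\<^bsub>X\<^esub> y) = \<xi> e x + \<xi> e y" if "e \<in> B" "x \<in> carrier X" "y \<in> carrier X" for e x y
    using modhom_add[OF B(4)[OF that(1)]] that by simp
  have xi_smult: "\<xi> e ((k \<odot> \<one>) \<odot>\<^bsub>X\<^esub> x) = k * \<xi> e x" if "e \<in> B" "x \<in> carrier X" for e x k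
    using klin_smult[OF B(4)[OF that(1)]] that by simp
  \<comment> \<open>The trace of the endomorphism \<psi> \<phi> of \<open>X\<close>. One formula
    serves as both forms of \<open>adjoint_rank\<close>: all linear \<phi> against L-linear \<psi>,
    and L-linear \<phi> against all linear \<psi>.\<close>
  let ?\<beta> = "\<lambda>\<phi> \<psi>. \<Sum>e\<in>B. \<xi> e (\<psi> (\<phi> e))"
  let ?K = "khom (rs X) (rs Y)" and ?K' = "khom (rs Y) (rs ?Z)"
  let ?H = "hom_space L X Y" and ?H' = "hom_space L Y ?Z"
  have Kc: "\<phi> e \<in> carrier Y" if "\<phi> \<in> carrier ?K" "e \<in> carrier X" for \<phi> e
    using that modhom_closed[of \<phi> class_ring "rs X" "rs Y"] by simp
  have Hc: "\<phi> e \<in> carrier Y" if "\<phi> \<in> carrier ?H" "e \<in> carrier X" for \<phi> e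
    using that modhom_closed[of \<phi> L X Y] by simp
  have H'c: "\<psi> y \<in> carrier X" if "\<psi> \<in> carrier ?H'" "y \<in> carrier Y" for \<psi> y
    using that modhom_closed[of \<psi> L Y ?Z] by simp
  have K'lin: "\<psi> \<in> klin (rs Y) (rs X)" if "\<psi> \<in> carrier ?K'" for \<psi>
    using that by (simp add: rsZ)
  have K'c: "\<psi> y \<in> carrier X" if "\<psi> \<in> carrier ?K'" "y \<in> carrier Y" for \<psi> y
    using that modhom_closed[OF K'lin] by simp
  have "kdim (sub ?H (trace X Y ` carrier ?K)) = kdim (sub ?H' (S.trace Y ?Z ` carrier ?K'))"
  proof (rule adjoint_rank[where \<beta> = ?\<beta> and \<beta>' = ?\<beta>])
    show "fdspace ?K" using lX lY by (intro fdspace_khom)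
    show "kspace ?H" using lX lY by (intro kspace_hom_space)
    show "kspace ?H'" using lY lZ by (intro kspace_hom_space)
    show "fdspace ?K'" unfolding rsZ using lX lY by (intro fdspace_khom)
    show "trace X Y \<in> klin ?K ?H" using lX lY by (intro trace_klin)
    show "S.trace Y ?Z \<in> klin ?K' ?H'" using lY lZ by (intro S.trace_klin)
    show "?\<beta> \<phi> \<in> klin ?H' ground" if "\<phi> \<in> carrier ?K" for \<phi>
      by (rule modhomI) (simp_all add: Kc[OF that eX] H'c xi_add xi_smult tau1 sum.distrib sum_distrib_left
          del: hom_space_simps(1))
    show "(\<lambda>\<phi>. ?\<beta> \<phi> \<psi>) \<in> klin ?H ground" if psi: "\<psi> \<in> carrier ?K'" for \<psi>
    proof (rule modhomI)
      fix \<phi> \<phi>' assume "\<phi> \<in> carrier ?H" "\<phi>' \<in> carrier ?H"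
      then show "?\<beta> (\<phi> \<oplus>\<^bsub>?H\<^esub> \<phi>') \<psi> = ?\<beta> \<phi> \<psi> \<oplus>\<^bsub>ground\<^esub> ?\<beta> \<phi>' \<psi>"
        using modhom_add[OF K'lin[OF psi]]
        by (simp add: eX Hc K'c[OF psi] xi_add sum.distrib del: hom_space_simps(1))
    next
      fix k \<phi> assume "\<phi> \<in> carrier ?H"
      then show "?\<beta> (k \<odot>\<^bsub>?H\<^esub> \<phi>) \<psi> = k \<odot>\<^bsub>ground\<^esub> ?\<beta> \<phi> \<psi>"
        using klin_smult[OF K'lin[OF psi]]
        by (simp add: eX Hc K'c[OF psi] xi_smult sum_distrib_left del: hom_space_simps(1))
    qed simp
    show "?\<beta> (trace X Y \<phi>) \<psi> = ?\<beta> \<phi> (S.trace Y ?Z \<psi>)"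
      if phi: "\<phi> \<in> carrier ?K" and psi: "\<psi> \<in> carrier ?K'" for \<phi> \<psi>
    proof -
      have pl: "\<phi> \<in> klin (rs X) (rs Y)" using phi by simp
      let ?\<alpha> = "\<lambda>i x. \<psi> (c i \<odot>\<^bsub>Y\<^esub> \<phi> x)" and ?\<gamma> = "\<lambda>i x. b i \<odot>\<^bsub>X\<^esub> x"
      have al: "?\<alpha> i \<in> klin (rs X) (rs X)" if "i \<in> I" for i
        using modhom_comp[OF modhom_comp[OF pl lmult_klin[OF lY(1) c_closed[OF that]]] K'lin[OF psi]] .
      have ga: "?\<gamma> i \<in> klin (rs X) (rs X)" if "i \<in> I" for i
        using lmult_klin[OF lX(1) b_closed[OF that]] .
      have alc: "?\<alpha> i x \<in> carrier X" if "i \<in> I" "x \<in> carrier X" for i x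
        using modhom_closed[OF al[OF that(1)]] that by simp
      have gac: "?\<gamma> i x \<in> carrier X" if "i \<in> I" "x \<in> carrier X" for i x
        using modhom_closed[OF ga[OF that(1)]] that by simp
      have xifin: "\<xi> e (finsum X f I) = (\<Sum>i\<in>I. \<xi> e (f i))" if "e \<in> B" "f \<in> I \<rightarrow> carrier X" for e f
        using modhom_finsum[OF kX.abelian_group_axioms kspace.axioms(1)[OF kspace_ground] B(4)[OF that(1)], of f I] that
        by simp
      have 1: "\<xi> e (\<psi> (trace X Y \<phi> e)) = (\<Sum>i\<in>I. \<xi> e (?\<alpha> i (?\<gamma> i e)))" if e: "e \<in> B" for e
      proof -
        have "\<psi> (trace X Y \<phi> e) = (\<Oplus>\<^bsub>X\<^esub>i\<in>I. ?\<alpha> i (?\<gamma> i e))"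
          unfolding trace_apply[OF eX[OF e]]
          using modhom_finsum[OF kY.abelian_group_axioms kX.abelian_group_axioms K'lin[OF psi],
              of "\<lambda>i. c i \<odot>\<^bsub>Y\<^esub> \<phi> (b i \<odot>\<^bsub>X\<^esub> e)" I] gac eX[OF e] Kc[OF phi] c_closed
          by (simp add: Pi_def Y.smult_closed)
        then show ?thesis using xifin[OF e] alc gac eX[OF e] by simp
      qed
      have 2: "\<xi> e (S.trace Y ?Z \<psi> (\<phi> e)) = (\<Sum>i\<in>I. \<xi> e (?\<gamma> i (?\<alpha> i e)))" if e: "e \<in> B" for e
      proof -
        \<comment> \<open>In the twisted target \<sigma>(b_i) acts through \<tau>, that is, as
          b_i.\<close>
        have "S.trace Y ?Z \<psi> (\<phi> e) = (\<Oplus>\<^bsub>X\<^esub>i\<in>I. ?\<gamma> i (?\<alpha> i e))"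
          unfolding S.trace_apply[OF Kc[OF phi eX[OF e]]] finsum_pull
          using alc gac eX[OF e] by (intro X.M.finsum_cong') (auto simp: tau_sigma b_closed)
        then show ?thesis using xifin[OF e] alc gac eX[OF e] by simp
      qed
      have "?\<beta> (trace X Y \<phi>) \<psi> = (\<Sum>i\<in>I. \<Sum>e\<in>B. \<xi> e (?\<alpha> i (?\<gamma> i e)))"
        using 1 by (simp add: sum.swap[of _ I B])
      also have "\<dots> = (\<Sum>i\<in>I. \<Sum>e\<in>B. \<xi> e (?\<gamma> i (?\<alpha> i e)))"
        using trace_cyclic[OF lX(3) cs al ga] by simp
      also have "\<dots> = ?\<beta> \<phi> (S.trace Y ?Z \<psi>)" using 2 by (simp add: sum.swap[of _ I B])
      finally show ?thesis .
    qed
    show "\<psi> = \<zero>\<^bsub>?H'\<^esub>" if psi: "\<psi> \<in> carrier ?H'" and z: "\<And>\<phi>. \<phi> \<in> carrier ?K \<Longrightarrow> ?\<beta> \<phi> \<psi> = 0" for \<psi>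
    proof (rule extensionalityI[where A = "carrier Y"])
      fix y assume y: "y \<in> carrier Y"
      have pl: "\<psi> \<in> klin (rs Y) (rs X)" using modhom_klin[of \<psi> Y ?Z] psi rsZ by simp
      show "\<psi> y = \<zero>\<^bsub>?H'\<^esub> y"
      proof (rule ccontr)
        assume "\<psi> y \<noteq> \<zero>\<^bsub>?H'\<^esub> y"
        then have "\<psi> y \<noteq> \<zero>\<^bsub>rs X\<^esub>" "\<psi> y \<in> carrier (rs X)" using y H'c[OF psi y] by auto
        then obtain g where g: "g \<in> klin (rs X) ground" "g (\<psi> y) \<noteq> 0"
          using separating_functional[OF lX(2)] by blast
        \<comment> \<open>On the rank one map g(-) y the form takes the value g(\<psi> y), which is
          nonzero by the choice of g.\<close>
        have "?\<beta> (\<lambda>x\<in>carrier (rs X). g x \<odot>\<^bsub>rs Y\<^esub> y) \<psi> = (\<Sum>e\<in>B. g e * \<xi> e (\<psi> y))"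
          using eX y klin_smult[OF pl, of y] xi_smult H'c[OF psi y] by simp
        also have "\<dots> = g (\<psi> y)" using functional_expand[OF lX(3) cs g(1)] H'c[OF psi y] by simp
        finally show False using z[OF rank_one_khom[OF lX(3) lY(3) g(1)]] y g(2) by simp
      qed
    qed (use psi in auto)
    show "\<phi> = \<zero>\<^bsub>?H\<^esub>" if phi: "\<phi> \<in> carrier ?H" and z: "\<And>\<psi>. \<psi> \<in> carrier ?K' \<Longrightarrow> ?\<beta> \<phi> \<psi> = 0" for \<phi>
    proof (rule extensionalityI[where A = "carrier X"])
      fix x assume x: "x \<in> carrier X"
      have pl: "\<phi> \<in> klin (rs X) (rs Y)" using modhom_klin[of \<phi> X Y] phi by simp
      show "\<phi> x = \<zero>\<^bsub>?H\<^esub> x"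
      proof (rule ccontr)
        assume "\<phi> x \<noteq> \<zero>\<^bsub>?H\<^esub> x"
        then have "\<phi> x \<noteq> \<zero>\<^bsub>rs Y\<^esub>" "\<phi> x \<in> carrier (rs Y)" using x Hc[OF phi x] by auto
        then obtain g where g: "g \<in> klin (rs Y) ground" "g (\<phi> x) \<noteq> 0"
          using separating_functional[OF lY(2)] by blast
        have "?\<beta> \<phi> (\<lambda>y\<in>carrier (rs Y). g y \<odot>\<^bsub>rs X\<^esub> x) = (\<Sum>e\<in>B. g (\<phi> e) * \<xi> e x)"
          using eX x xi_smult Hc[OF phi eX] by simp
        also have "\<dots> = g (\<phi> x)" using functional_expand[OF lX(3) cs modhom_comp[OF pl g(1)]] x by simp
        finally have "?\<beta> \<phi> (\<lambda>y\<in>carrier (rs Y). g y \<odot>\<^bsub>rs X\<^esub> x) = g (\<phi> x)" .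
        moreover have "?\<beta> \<phi> (\<lambda>y\<in>carrier (rs Y). g y \<odot>\<^bsub>rs X\<^esub> x) = 0"
          by (rule z, unfold rsZ, rule rank_one_khom[OF lY(3) lX(3) g(1)]) (use x in simp)
        ultimately show False using g(2) by simp
      qed
    qed (use phi in auto)
  qed
  \<comment> \<open>\<open>tdim\<close> is defined through projective modules, so it is computed by
    either Frobenius system.\<close>
  then show ?thesis
    unfolding tdim_eq_trace[OF X Y] S.tdim_eq_trace[OF Y Z]
      trace_maps_eq_image[OF lX(1) lY(1)] S.trace_maps_eq_image[OF lY(1) lZ] .
qed

text \<open>Write N for \<open>pull \<tau> X\<close>. Both sides equal hdim P N - tdim V N - tdim W
  N: on the left hdim X W = hdim X P - tdim X V, on the right hdim V N = hdim P N - tdim W N, and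
  \<open>tdim_nakayama\<close> turns each tdim X - into tdim - N. For P all maps are traces, so hdim
  X P = hdim P N.\<close>

lemma serre:
  fixes P :: "('k, 'l) umodule"
  assumes W: "fd_module L W" and P: "fd_module L P" and V: "fd_module L V" and X: "fd_module L X"
    and pr: "projective L P" and se: "short_exact L W i P p V"
  shows "sdim L X W = sdim L V (pull \<tau> X)"
proof -
  note rp = pr[unfolded projective_iff_relproj[OF P]]
  note N = tau.fd_module_pull[OF X]
  have "tdim L X V + hdim L X W = hdim L X P" by (rule short_exact_tdim_left[OF W P V X rp se])
  moreover have "tdim L W (pull \<tau> X) + hdim L V (pull \<tau> X) = hdim L P (pull \<tau> X)"
    by (rule short_exact_tdim_right[OF W P V N rp se])
  moreover have "tdim L X P = hdim L X P" by (rule tdim_relproj_target[OF X P rp])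
  moreover have "tdim L P (pull \<tau> X) = hdim L P (pull \<tau> X)"
    by (rule tdim_relproj_source[OF P N rp])
  ultimately show ?thesis
    using tdim_nakayama[OF X V] tdim_nakayama[OF X W] tdim_nakayama[OF X P]
      hdim_eq[OF X W] hdim_eq[OF V N] by simp
qed

text \<open>Serre duality is applied twice, to the sequence of \<open>Y\<close> and to the twisted
  sequence of \<open>W\<close>: Hom(W, Y) corresponds to Hom(Y', \<tau>W) and this to Hom(\<tau>V,
  \<tau>Y'), where the common twist is dropped. It stands in for the adjunction between \<Omega> and
  its inverse.\<close>

lemma sdim_dimension_shift:
  fixes W P V Y Q Y' :: "('k, 'l) umodule"
  assumes W: "fd_module L W" and P: "fd_module L P" "projective L P" and V: "fd_module L V"
    and se: "short_exact L W i P p V"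
    and Y: "fd_module L Y" and Q: "fd_module L Q" "projective L Q" and Y': "fd_module L Y'"
    and se': "short_exact L Y j Q q Y'"
  shows "sdim L W Y = sdim L V Y'"
proof -
  note N = tau.fd_module_pull
  have "relproj (pull \<tau> P)"
    using P tau.F'.projective_iff_relproj[OF P(1)] by (intro tau.relproj_pull) simp
  then have NP: "projective L (pull \<tau> P)" by (rule relproj_projective)
  have "sdim L W Y = sdim L Y' (pull \<tau> W)" by (rule serre[OF Y Q(1) Y' W Q(2) se'])
  also have "\<dots> = sdim L (pull \<tau> V) (pull \<tau> Y')"
    by (rule serre[OF N[OF W] N[OF P(1)] N[OF V] Y' NP tau.short_exact_pull[THEN iffD2, OF se]])
  also have "\<dots> = sdim L V Y'" by (rule tau.sdim_pull[OF V Y'])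
  finally show ?thesis .
qed

end

text \<open>Any iterated syzygies, not only those picked by \<open>Syzygy\<close>: twisted sequences
  and the images in a projective resolution are of this kind too.\<close>

definition syz_seq :: "('k::field, 'l) module \<Rightarrow> (nat \<Rightarrow> ('k, 'l) umodule) \<Rightarrow> bool" where
  "syz_seq L X \<longleftrightarrow> (\<forall>k. fd_module L (X k) \<and> (\<exists>(P :: ('k, 'l) umodule) i p.
     fd_module L P \<and> projective L P \<and> short_exact L (X (Suc k)) i P p (X k)))"

text \<open>The middle terms are asked to be projective, which over a Frobenius algebra agrees with
  injective and matches the shape of \<open>sdim_dimension_shift\<close>.\<close>

definition cosyz_seq :: "('k::field, 'l) module \<Rightarrow> (nat \<Rightarrow> ('k, 'l) umodule) \<Rightarrow> bool" where
  "cosyz_seq L Y \<longleftrightarrow> (\<forall>k. fd_module L (Y k) \<and> (\<exists>(P :: ('k, 'l) umodule) i p.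
     fd_module L P \<and> projective L P \<and> short_exact L (Y k) i P p (Y (Suc k))))"

lemma (in frobenius) syz_seq_Syzygy:
  fixes V :: "('k, 'l) umodule"
  assumes "fd_module L V" shows "syz_seq L (\<lambda>k. (Syzygy L ^^ k) V)"
proof -
  have fd: "fd_module L ((Syzygy L ^^ k) V)" for k
    by (induction k) (use assms Syzygy_spec in auto)
  then show ?thesis unfolding syz_seq_def using Syzygy_spec[OF fd] by simp
qed

lemma (in frobenius) cosyz_seq_Cosyzygy:
  fixes V :: "('k, 'l) umodule"
  assumes "fd_module L V" shows "cosyz_seq L (\<lambda>k. (Cosyzygy L ^^ k) V)"
proof -
  have fd: "fd_module L ((Cosyzygy L ^^ k) V)" for k
    by (induction k) (use assms Cosyzygy_spec in auto)
  show ?thesis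
    unfolding cosyz_seq_def
  proof (intro allI conjI fd)
    fix k
    obtain P :: "('k, 'l) umodule" and i p where P: "fd_module L P" "injective L P"
      "short_exact L ((Cosyzygy L ^^ k) V) i P p (Cosyzygy L ((Cosyzygy L ^^ k) V))"
      using Cosyzygy_spec[OF fd] by blast
    then have "projective L P"
      using injective_iff_relproj[OF P(1)] relproj_projective by blast
    then show "\<exists>(P :: ('k, 'l) umodule) i p. fd_module L P \<and> projective L P \<and>
        short_exact L ((Cosyzygy L ^^ k) V) i P p ((Cosyzygy L ^^ Suc k) V)"
      using P by auto
  qed
qed

lemma (in frobenius_iso) syz_seq_pull:
  assumes "syz_seq L' X" shows "syz_seq L (\<lambda>k. pull \<tau> (X k))"
  unfolding syz_seq_def
proof (intro allI conjI)
  fix k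
  have X: "fd_module L' (X k)" using assms unfolding syz_seq_def by blast
  then show "fd_module L (pull \<tau> (X k))" by (rule fd_module_pull)
  obtain P :: "('k, 'l2) umodule" and i p where P: "fd_module L' P" "projective L' P"
    "short_exact L' (X (Suc k)) i P p (X k)" using assms unfolding syz_seq_def by blast
  have "projective L (pull \<tau> P)"
    using relproj_pull relproj_projective F'.projective_iff_relproj[OF P(1)] P(2) by blast
  then show "\<exists>(Q :: ('k, 'l) umodule) i p. fd_module L Q \<and> projective L Q \<and>
      short_exact L (pull \<tau> (X (Suc k))) i Q p (pull \<tau> (X k))"
    using fd_module_pull[OF P(1)] P(3) short_exact_pull by blast
qed

section \<open>Duality along sequences of syzygies and cosyzygies\<close>

context nakayama
begin

text \<open>Each step of the induction moves one degree from \<open>X\<close> to \<open>Y\<close>,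
  which is why \<open>m\<close> has to vary.\<close>

lemma sdim_shift:
  assumes X: "syz_seq L X" and Y: "cosyz_seq L Y"
  shows "sdim L (X n) (Y m) = sdim L (X 0) (Y (m + n))"
proof (induction n arbitrary: m)
  case (Suc n)
  have fd: "fd_module L (X k)" "fd_module L (Y k)" for k
    using X Y unfolding syz_seq_def cosyz_seq_def by blast+
  obtain P :: "('k, 'l) umodule" and i p where P: "fd_module L P" "projective L P"
    "short_exact L (X (Suc n)) i P p (X n)" using X unfolding syz_seq_def by blast
  obtain Q :: "('k, 'l) umodule" and j q where Q: "fd_module L Q" "projective L Q"
    "short_exact L (Y m) j Q q (Y (Suc m))" using Y unfolding cosyz_seq_def by blast
  have "sdim L (X (Suc n)) (Y m) = sdim L (X n) (Y (Suc m))"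
    by (rule sdim_dimension_shift[OF fd(1) P(1,2) fd(1) P(3) fd(2) Q(1,2) fd(2) Q(3)])
  then show ?case using Suc[of "Suc m"] by simp
qed simp

text \<open>The two isomorphisms say that \<theta> carries \<open>V2\<close> to \<open>U\<close> and
  \<tau>U to \<open>V\<close>. Serre duality turns Hom(U, \<Omega>^(n+1) V2) into Hom(\<Omega>^n V2,
  \<tau>U); after the twist by \<theta> this is Hom(\<Omega>^n U, V), and the n syzygies move over
  as cosyzygies of \<open>V\<close>.\<close>

lemma sdim_duality:
  assumes U: "fd_module L U" and V: "fd_module L V" and V2: "fd_module L V2"
    and t: "alg_iso L L \<theta>" and isoU: "lmod_iso L (pull \<theta> V2) U" and isoV: "lmod_iso L (pull \<theta> (pull \<tau> U)) V"
    and Y: "cosyz_seq L Y" "lmod_iso L (Y 0) V" and Z: "syz_seq L Z" "lmod_iso L (Z 0) V2"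
  shows "sdim L U (Y n) = sdim L U (Z (Suc n))"
proof -
  interpret T: frobenius_iso L L \<theta> I b c lam by unfold_locales (rule t)
  have fd: "fd_module L (Z k)" "fd_module L (Y k)" for k
    using Y(1) Z(1) unfolding syz_seq_def cosyz_seq_def by blast+
  have sT: "syz_seq L (\<lambda>k. pull \<theta> (Z k))" by (rule T.syz_seq_pull[OF Z(1)])
  obtain P :: "('k, 'l) umodule" and i p where P: "fd_module L P" "projective L P"
    "short_exact L (Z (Suc n)) i P p (Z n)" using Z(1) unfolding syz_seq_def by blast
  have NU: "fd_module L (pull \<tau> U)" by (rule tau.fd_module_pull[OF U])
  have fT: "fd_module L (pull \<theta> (Z k))" for k by (rule T.fd_module_pull[OF fd(1)])
  have VY: "lmod_iso L V (Y 0)" by (rule lmod_iso_sym[OF fd_moduleD(1)[OF fd(2)] Y(2)])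
  have "sdim L U (Z (Suc n)) = sdim L (Z n) (pull \<tau> U)"
    by (rule serre[OF fd(1) P(1) fd(1) U P(2,3)])
  also have "\<dots> = sdim L (pull \<theta> (Z n)) (pull \<theta> (pull \<tau> U))"
    by (rule T.sdim_pull[OF fd(1) NU, symmetric])
  also have "\<dots> = sdim L (pull \<theta> (Z n)) (Y 0)"
    by (rule sdim_iso_right[OF T.fd_module_pull[OF NU] fd(2) fT lmod_iso_trans[OF isoV VY]])
  also have "\<dots> = sdim L (pull \<theta> (Z 0)) (Y n)"
    using sdim_shift[OF sT Y(1), of n 0] by simp
  also have "\<dots> = sdim L U (Y n)"
    by (rule sdim_iso_left[OF fT U fd(2), symmetric])
      (rule lmod_iso_trans[OF T.lmod_iso_pull[OF Z(2)] isoU])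
  finally show ?thesis by simp
qed

end

section \<open>Tensor products\<close>

lemma kspace_free_vs: "kspace (free_vs S)"
proof -
  have fin: "finite {s. f s + g s \<noteq> 0}" if "finite {s. f s \<noteq> 0}" "finite {s. g s \<noteq> 0}" for f g :: "'a \<Rightarrow> 'b"
    by (rule finite_subset[OF _ finite_UnI[OF that]]) auto
  have "abelian_group (free_vs S :: ('b::field, 'a \<Rightarrow> 'b) module)"
  proof (rule abelian_groupI)
    fix f assume "f \<in> carrier (free_vs S :: ('b, 'a \<Rightarrow> 'b) module)"
    then show "\<exists>g\<in>carrier (free_vs S). g \<oplus>\<^bsub>free_vs S\<^esub> f = \<zero>\<^bsub>free_vs S\<^esub>"
      by (intro bexI[of _ "\<lambda>s. - f s"]) (auto simp: free_vs_def)
  next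
    show "f \<oplus>\<^bsub>free_vs S\<^esub> g \<in> carrier (free_vs S)"
      if "f \<in> carrier (free_vs S)" "g \<in> carrier (free_vs S)" for f g :: "'a \<Rightarrow> 'b"
      using that by (force simp: free_vs_def fin)
  qed (auto simp: free_vs_def algebra_simps)
  then show ?thesis
    by (intro kspace.intro kspace_axioms.intro) (auto simp: free_vs_def algebra_simps)
qed

lemma submodule_iff_ksub:
  assumes "kspace V" shows "Module.submodule H class_ring V \<longleftrightarrow> ksub V H"
proof -
  interpret kspace V by fact
  have inv: "a_inv V x \<in> H" if "ksub V H" "x \<in> H" for x
    using that smult_minus_one[of x] unfolding ksub_def by (metis subsetD)
  show ?thesis
  proof
    assume "Module.submodule H class_ring V"
    then interpret H: Module.submodule H class_ring V .
    show "ksub V H"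
      using H.subset H.one_closed H.m_closed H.smult_closed by (auto simp: ksub_def)
  next
    assume H: "ksub V H"
    then show "Module.submodule H class_ring V"
      using inv[OF H]
      by (intro Module.submodule.intro subgroup.intro Module.submodule_axioms.intro)
        (auto simp: ksub_def a_inv_def)
  qed
qed

lemma opp_simps [simp]:
  "carrier (opp A) = carrier A" "zero (opp A) = zero A" "one (opp A) = one A" "add (opp A) = add A"
  "smult (opp A) = smult A" "mult (opp A) = (\<lambda>x y. y \<otimes>\<^bsub>A\<^esub> x)"
  by (auto simp: opp_def)

lemma opp_opp [simp]: "opp (opp A) = A"
  by (simp add: opp_def)

lemma (in kalgebra) k_algebra_opp: "k_algebra (opp L)"
proof -
  have ag: "abelian_group (opp L)"
    by (rule abelian_group_transport[OF abelian_group_axioms, of "\<lambda>x. x"]) auto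
  have "ring (opp L)"
  proof (rule ringI[OF ag])
    show "monoid (opp L)" by (rule monoidI) (auto simp: m_assoc)
  qed (auto simp: l_distr r_distr)
  moreover have "kspace (opp L)"
    by (intro kspace.intro ag kspace_axioms.intro) (auto simp: smult_l_distr smult_r_distr smult_assoc)
  ultimately show ?thesis
    by (auto simp: k_algebra_def kspace_iff[symmetric] smult_mult_left smult_mult_right)
qed

text \<open>Beyond closure there is one condition for each family in \<open>tensor_rels\<close>, so
  the linear extension of such a map kills \<open>tensor_ker\<close>.\<close>

definition balanced ::
  "('k::field, 'l) module \<Rightarrow> ('l, 'm) module \<Rightarrow> ('l, 'n) module \<Rightarrow> ('k, 'x) module \<Rightarrow> ('m \<Rightarrow> 'n \<Rightarrow> 'x) \<Rightarrow> bool"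
where
  "balanced L M N X \<beta> \<longleftrightarrow>
    (\<forall>m\<in>carrier M. \<forall>n\<in>carrier N. \<beta> m n \<in> carrier X) \<and>
    (\<forall>m\<in>carrier M. \<forall>m'\<in>carrier M. \<forall>n\<in>carrier N. \<beta> (m \<oplus>\<^bsub>M\<^esub> m') n = \<beta> m n \<oplus>\<^bsub>X\<^esub> \<beta> m' n) \<and>
    (\<forall>m\<in>carrier M. \<forall>n\<in>carrier N. \<forall>n'\<in>carrier N. \<beta> m (n \<oplus>\<^bsub>N\<^esub> n') = \<beta> m n \<oplus>\<^bsub>X\<^esub> \<beta> m n') \<and>
    (\<forall>l\<in>carrier L. \<forall>m\<in>carrier M. \<forall>n\<in>carrier N. \<beta> (l \<odot>\<^bsub>M\<^esub> m) n = \<beta> m (l \<odot>\<^bsub>N\<^esub> n)) \<and>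
    (\<forall>c. \<forall>m\<in>carrier M. \<forall>n\<in>carrier N. \<beta> ((c \<odot>\<^bsub>L\<^esub> \<one>\<^bsub>L\<^esub>) \<odot>\<^bsub>M\<^esub> m) n = c \<odot>\<^bsub>X\<^esub> \<beta> m n)"

locale tensor_product = kalgebra L + M: left_module "opp L" M + N: left_module L N
  for L :: "('k::field, 'l) module" and M :: "('l, 'm) module" and N :: "('l, 'n) module"
begin

abbreviation F :: "('k, 'm \<times> 'n \<Rightarrow> 'k) module" where "F \<equiv> free_vs (carrier M \<times> carrier N)"

sublocale F: kspace F by (rule kspace_free_vs)

abbreviation "K \<equiv> tensor_ker L M N"
abbreviation "T \<equiv> tensor L M N"
abbreviation "pt \<equiv> pure_tensor L M N"

lemma F_memI: "finite {p. f p \<noteq> 0} \<Longrightarrow> {p. f p \<noteq> 0} \<subseteq> carrier M \<times> carrier N \<Longrightarrow> f \<in> carrier F"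
  by (simp add: free_vs_def)

lemma single_F: "m \<in> carrier M \<Longrightarrow> n \<in> carrier N \<Longrightarrow> single m n \<in> carrier F"
  by (auto simp: free_vs_def single_def)

lemma F_minus: "f \<in> carrier F \<Longrightarrow> g \<in> carrier F \<Longrightarrow> f \<ominus>\<^bsub>F\<^esub> g = (\<lambda>p. f p - g p)"
proof -
  assume f: "f \<in> carrier F" and g: "g \<in> carrier F"
  have "\<ominus>\<^bsub>F\<^esub> g = (- 1) \<odot>\<^bsub>F\<^esub> g" using F.smult_minus_one[OF g] by simp
  then show ?thesis by (simp add: a_minus_def free_vs_def)
qed

lemma rels_F: "tensor_rels L M N \<subseteq> carrier F"
proof -
  have s: "(\<lambda>p. f p - g p) \<in> carrier F" if "f \<in> carrier F" "g \<in> carrier F" for f g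
    using F_minus[OF that] F.minus_closed[OF that] by simp
  have c: "(\<lambda>p. k * f p) \<in> carrier F" if "f \<in> carrier F" for f k
    using F.smult_closed[OF that, of k] by (simp add: free_vs_def)
  show ?thesis
    unfolding tensor_rels_def
    using single_F M.smult_closed N.smult_closed
    by (auto intro!: s c single_F)
qed

lemma ksub_K: "ksub F K"
proof -
  have eq: "K = \<Inter>{H. ksub F H \<and> tensor_rels L M N \<subseteq> H}"
    by (simp add: tensor_ker_def hull_def submodule_iff_ksub[OF kspace_free_vs])
  have "ksub F (carrier F)" by (auto simp: ksub_def)
  then show ?thesis unfolding eq using rels_F unfolding ksub_def by blast
qed

lemma rels_K: "tensor_rels L M N \<subseteq> K"
  unfolding tensor_ker_def by (rule hull_subset)

lemma K_least: "ksub F H \<Longrightarrow> tensor_rels L M N \<subseteq> H \<Longrightarrow> K \<subseteq> H"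
  unfolding tensor_ker_def by (rule hull_minimal) (simp_all add: submodule_iff_ksub[OF kspace_free_vs])

sublocale T: kspace T
  unfolding tensor_def using ksub_K by (rule F.kspace_quot)

abbreviation cls :: "('m \<times> 'n \<Rightarrow> 'k) \<Rightarrow> ('m \<times> 'n \<Rightarrow> 'k) set" where
  "cls f \<equiv> K +>\<^bsub>F\<^esub> f"

lemma carrier_T: "carrier T = cls ` carrier F"
  by (simp add: tensor_def F.quot_carrier)

lemma cls_hom: "cls \<in> klin F T"
  unfolding tensor_def using ksub_K by (rule F.quot_proj)

lemma cls_eq: "f \<in> carrier F \<Longrightarrow> g \<in> carrier F \<Longrightarrow> (\<lambda>p. f p - g p) \<in> K \<Longrightarrow> cls f = cls g"
  using F.coset_eq_iff[OF ksub_K, of f g] F_minus by simp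

lemma pt_cls: "pt m n = cls (single m n)"
  by (simp add: pure_tensor_def)

lemma pt_closed [intro, simp]: "m \<in> carrier M \<Longrightarrow> n \<in> carrier N \<Longrightarrow> pt m n \<in> carrier T"
  unfolding pt_cls by (rule modhom_closed[OF cls_hom single_F])

lemma F_add_eq: "f \<oplus>\<^bsub>F\<^esub> g = (\<lambda>p. f p + g p)"
  by (simp add: free_vs_def)

lemma F_smult_eq: "k \<odot>\<^bsub>F\<^esub> f = (\<lambda>p. k * f p)"
  by (simp add: free_vs_def)

lemma balanced_pt: "balanced L M N T pt"
  unfolding balanced_def
proof (intro conjI ballI allI)
  fix m n assume m: "m \<in> carrier M" and n: "n \<in> carrier N"
  show "pt m n \<in> carrier T" using m n by simp
  show "pt (m \<oplus>\<^bsub>M\<^esub> m') n = pt m n \<oplus>\<^bsub>T\<^esub> pt m' n" if m': "m' \<in> carrier M" for m'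
  proof -
    have "(\<lambda>p. single (m \<oplus>\<^bsub>M\<^esub> m') n p - single m n p - single m' n p) \<in> tensor_rels L M N"
      unfolding tensor_rels_def using m m' n by blast
    then have "(\<lambda>p. single (m \<oplus>\<^bsub>M\<^esub> m') n p - (single m n \<oplus>\<^bsub>F\<^esub> single m' n) p) \<in> K"
      using rels_K by (auto simp: F_add_eq algebra_simps)
    then show ?thesis
      unfolding pt_cls modhom_add[OF cls_hom single_F[OF m n] single_F[OF m' n], symmetric]
      using m m' n single_F by (intro cls_eq) auto
  qed
  show "pt m (n \<oplus>\<^bsub>N\<^esub> n') = pt m n \<oplus>\<^bsub>T\<^esub> pt m n'" if n': "n' \<in> carrier N" for n'
  proof -
    have "(\<lambda>p. single m (n \<oplus>\<^bsub>N\<^esub> n') p - single m n p - single m n' p) \<in> tensor_rels L M N"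
      unfolding tensor_rels_def using m n n' by blast
    then have "(\<lambda>p. single m (n \<oplus>\<^bsub>N\<^esub> n') p - (single m n \<oplus>\<^bsub>F\<^esub> single m n') p) \<in> K"
      using rels_K by (auto simp: F_add_eq algebra_simps)
    then show ?thesis
      unfolding pt_cls modhom_add[OF cls_hom single_F[OF m n] single_F[OF m n'], symmetric]
      using m n n' single_F by (intro cls_eq) auto
  qed
  show "pt ((k \<odot>\<^bsub>L\<^esub> \<one>\<^bsub>L\<^esub>) \<odot>\<^bsub>M\<^esub> m) n = k \<odot>\<^bsub>T\<^esub> pt m n" for k
  proof -
    have mc: "(k \<odot>\<^bsub>L\<^esub> \<one>\<^bsub>L\<^esub>) \<odot>\<^bsub>M\<^esub> m \<in> carrier M" using m by (simp add: M.smult_closed)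
    have "(\<lambda>p. single ((k \<odot>\<^bsub>L\<^esub> \<one>\<^bsub>L\<^esub>) \<odot>\<^bsub>M\<^esub> m) n p - k * single m n p) \<in> tensor_rels L M N"
      unfolding tensor_rels_def using m n by blast
    then have "(\<lambda>p. single ((k \<odot>\<^bsub>L\<^esub> \<one>\<^bsub>L\<^esub>) \<odot>\<^bsub>M\<^esub> m) n p - (k \<odot>\<^bsub>F\<^esub> single m n) p) \<in> K"
      using rels_K by (auto simp: F_smult_eq)
    then show ?thesis
      unfolding pt_cls klin_smult[OF cls_hom single_F[OF m n], symmetric]
      using mc m n single_F by (intro cls_eq F.smult_closed) auto
  qed
next
  fix l m n assume l: "l \<in> carrier L" and m: "m \<in> carrier M" and n: "n \<in> carrier N"
  have "(\<lambda>p. single (l \<odot>\<^bsub>M\<^esub> m) n p - single m (l \<odot>\<^bsub>N\<^esub> n) p) \<in> tensor_rels L M N"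
    unfolding tensor_rels_def using l m n by blast
  then show "pt (l \<odot>\<^bsub>M\<^esub> m) n = pt m (l \<odot>\<^bsub>N\<^esub> n)"
    unfolding pt_cls using rels_K l m n M.smult_closed N.smult_closed
    by (intro cls_eq single_F) auto
qed

lemma pt_add_left: "m \<in> carrier M \<Longrightarrow> m' \<in> carrier M \<Longrightarrow> n \<in> carrier N \<Longrightarrow>
    pt (m \<oplus>\<^bsub>M\<^esub> m') n = pt m n \<oplus>\<^bsub>T\<^esub> pt m' n"
  and pt_add_right: "m \<in> carrier M \<Longrightarrow> n \<in> carrier N \<Longrightarrow> n' \<in> carrier N \<Longrightarrow>
    pt m (n \<oplus>\<^bsub>N\<^esub> n') = pt m n \<oplus>\<^bsub>T\<^esub> pt m n'"
  and pt_middle: "l \<in> carrier L \<Longrightarrow> m \<in> carrier M \<Longrightarrow> n \<in> carrier N \<Longrightarrow>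
    pt (l \<odot>\<^bsub>M\<^esub> m) n = pt m (l \<odot>\<^bsub>N\<^esub> n)"
  and pt_smult: "m \<in> carrier M \<Longrightarrow> n \<in> carrier N \<Longrightarrow>
    pt ((k \<odot>\<^bsub>L\<^esub> \<one>\<^bsub>L\<^esub>) \<odot>\<^bsub>M\<^esub> m) n = k \<odot>\<^bsub>T\<^esub> pt m n"
  using balanced_pt unfolding balanced_def by auto

lemma pt_smult_right: "m \<in> carrier M \<Longrightarrow> n \<in> carrier N \<Longrightarrow>
    pt m ((k \<odot>\<^bsub>L\<^esub> \<one>\<^bsub>L\<^esub>) \<odot>\<^bsub>N\<^esub> n) = k \<odot>\<^bsub>T\<^esub> pt m n"
  using pt_middle[of "k \<odot>\<^bsub>L\<^esub> \<one>\<^bsub>L\<^esub>" m n] pt_smult by simp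

text \<open>A scalar multiple of a pure tensor is again pure, so sums of pure tensors exhaust the
  space. The induction removes one point at a time from the support of a representative.\<close>

lemma tensor_induct [consumes 1, case_names zero pure add]:
  assumes "t \<in> carrier T" "P \<zero>\<^bsub>T\<^esub>"
    and "\<And>m n. m \<in> carrier M \<Longrightarrow> n \<in> carrier N \<Longrightarrow> P (pt m n)"
    and "\<And>s t. s \<in> carrier T \<Longrightarrow> t \<in> carrier T \<Longrightarrow> P s \<Longrightarrow> P t \<Longrightarrow> P (s \<oplus>\<^bsub>T\<^esub> t)"
  shows "P t"
proof -
  have "P (cls f)" if "f \<in> carrier F" "{p. f p \<noteq> 0} = S" "finite S" for f S
    using that(3,1,2)
  proof (induction S arbitrary: f)
    case empty
    then have "f = \<zero>\<^bsub>F\<^esub>" by (auto simp: free_vs_def)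
    then show ?case
      using assms(2) modhom_zero[OF F.abelian_group_axioms T.abelian_group_axioms cls_hom] by simp
  next
    case (insert p S)
    obtain m n where p: "p = (m, n)" by (cases p)
    have mn: "m \<in> carrier M" "n \<in> carrier N" using insert.prems p by (auto simp: free_vs_def)
    let ?g = "f(p := 0)" and ?m = "(f p \<odot>\<^bsub>L\<^esub> \<one>\<^bsub>L\<^esub>) \<odot>\<^bsub>M\<^esub> m"
    have S: "{q. ?g q \<noteq> 0} = S" using insert by auto
    have g: "?g \<in> carrier F"     proof (rule F_memI)
      show "finite {q. ?g q \<noteq> 0}" unfolding S by (rule insert.hyps(1))
      have "{q. ?g q \<noteq> 0} \<subseteq> {q. f q \<noteq> 0}" by auto
      also have "\<dots> \<subseteq> carrier M \<times> carrier N" using insert.prems(1) by (simp add: free_vs_def)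
      finally show "{q. ?g q \<noteq> 0} \<subseteq> carrier M \<times> carrier N" .
    qed
    have f: "f = ?g \<oplus>\<^bsub>F\<^esub> (f p \<odot>\<^bsub>F\<^esub> single m n)" using p by (auto simp: F_add_eq F_smult_eq single_def)
    have "cls f = cls ?g \<oplus>\<^bsub>T\<^esub> (f p \<odot>\<^bsub>T\<^esub> pt m n)"
      using f modhom_add[OF cls_hom g F.smult_closed[OF single_F[OF mn]]]
        klin_smult[OF cls_hom single_F[OF mn]] unfolding pt_cls by metis
    also have "f p \<odot>\<^bsub>T\<^esub> pt m n = pt ?m n" using pt_smult mn by simp
    finally have "cls f = cls ?g \<oplus>\<^bsub>T\<^esub> pt ?m n" .
    moreover have "?m \<in> carrier M" using mn by (simp add: M.smult_closed)
    ultimately show ?case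
      using assms(4)[OF modhom_closed[OF cls_hom g] pt_closed insert.IH[OF g S] assms(3)] mn by metis
  qed
  then show ?thesis using assms(1) unfolding carrier_T by (auto simp: free_vs_def)
qed

lemma klin_eqI:
  assumes "kspace X" "f \<in> klin T X" "g \<in> klin T X"
    and "\<And>m n. m \<in> carrier M \<Longrightarrow> n \<in> carrier N \<Longrightarrow> f (pt m n) = g (pt m n)"
    and "t \<in> carrier T"
  shows "f t = g t"
proof -
  interpret X: kspace X by fact
  show ?thesis using assms(5)
  proof (induction rule: tensor_induct)
    case zero
    show ?case using modhom_zero[OF T.abelian_group_axioms X.abelian_group_axioms] assms(2,3) by metis
  next
    case (add s t)
    then show ?case by (simp add: modhom_add[OF assms(2)] modhom_add[OF assms(3)])
  qed (rule assms(4))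
qed

section \<open>The universal property of the tensor product\<close>

context
  fixes X :: "('k, 'x) module" and \<beta> :: "'m \<Rightarrow> 'n \<Rightarrow> 'x"
  assumes X: "kspace X" and bal: "balanced L M N X \<beta>"
begin

interpretation X: kspace X by (rule X)

lemma bal_closed: "m \<in> carrier M \<Longrightarrow> n \<in> carrier N \<Longrightarrow> \<beta> m n \<in> carrier X"
  using bal by (auto simp: balanced_def)

definition lin_ext :: "('m \<times> 'n \<Rightarrow> 'k) \<Rightarrow> 'x" where
  "lin_ext f = (\<Oplus>\<^bsub>X\<^esub>p\<in>{p. f p \<noteq> 0}. f p \<odot>\<^bsub>X\<^esub> \<beta> (fst p) (snd p))"

text \<open>The supports of two functions and of their sum differ; a common finite superset makes
  the three sums comparable.\<close>

lemma lin_ext_superset: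
  assumes "f \<in> carrier F" "finite S" "{p. f p \<noteq> 0} \<subseteq> S" "S \<subseteq> carrier M \<times> carrier N"
  shows "lin_ext f = (\<Oplus>\<^bsub>X\<^esub>p\<in>S. f p \<odot>\<^bsub>X\<^esub> \<beta> (fst p) (snd p))"
proof -
  have c: "\<beta> (fst p) (snd p) \<in> carrier X" if "p \<in> S" for p using that assms(4) bal_closed by auto
  show ?thesis
    unfolding lin_ext_def
    by (rule X.add.finprod_mono_neutral_cong_left[OF assms(2,3)]) (use c assms(3) in auto)
qed

lemma lin_ext_klin: "lin_ext \<in> klin F X"
proof (rule modhomI)
  have c: "\<beta> (fst p) (snd p) \<in> carrier X" if "p \<in> carrier M \<times> carrier N" for p
    using that bal_closed by auto
  show "lin_ext f \<in> carrier X" if "f \<in> carrier F" for f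
    unfolding lin_ext_def using that c by (intro X.finsum_closed) (auto simp: free_vs_def)
  fix f g assume f: "f \<in> carrier F" and g: "g \<in> carrier F"
  let ?S = "{p. f p \<noteq> 0} \<union> {p. g p \<noteq> 0}"
  have S: "finite ?S" "?S \<subseteq> carrier M \<times> carrier N" using f g by (auto simp: free_vs_def)
  have "lin_ext (f \<oplus>\<^bsub>F\<^esub> g) = (\<Oplus>\<^bsub>X\<^esub>p\<in>?S. (f p + g p) \<odot>\<^bsub>X\<^esub> \<beta> (fst p) (snd p))"
  proof -
    have "{p. (f \<oplus>\<^bsub>F\<^esub> g) p \<noteq> 0} \<subseteq> ?S" by (auto simp: F_add_eq)
    from lin_ext_superset[OF F.a_closed[OF f g] S(1) this S(2)] show ?thesis by (simp add: F_add_eq)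
  qed
  also have "\<dots> = (\<Oplus>\<^bsub>X\<^esub>p\<in>?S. f p \<odot>\<^bsub>X\<^esub> \<beta> (fst p) (snd p) \<oplus>\<^bsub>X\<^esub> g p \<odot>\<^bsub>X\<^esub> \<beta> (fst p) (snd p))"
    using c subsetD[OF S(2)] by (intro X.finsum_cong') (auto simp: X.smult_l_distr)
  also have "\<dots> = (\<Oplus>\<^bsub>X\<^esub>p\<in>?S. f p \<odot>\<^bsub>X\<^esub> \<beta> (fst p) (snd p)) \<oplus>\<^bsub>X\<^esub> (\<Oplus>\<^bsub>X\<^esub>p\<in>?S. g p \<odot>\<^bsub>X\<^esub> \<beta> (fst p) (snd p))"
    using c subsetD[OF S(2)] by (intro X.finsum_addf) auto
  finally show "lin_ext (f \<oplus>\<^bsub>F\<^esub> g) = lin_ext f \<oplus>\<^bsub>X\<^esub> lin_ext g"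
    using lin_ext_superset[OF f S(1) _ S(2)] lin_ext_superset[OF g S(1) _ S(2)] by auto
next
  have c: "\<beta> (fst p) (snd p) \<in> carrier X" if "p \<in> carrier M \<times> carrier N" for p
    using that bal_closed by auto
  fix k f assume f: "f \<in> carrier F"
  let ?S = "{p. f p \<noteq> 0}"
  have S: "finite ?S" "?S \<subseteq> carrier M \<times> carrier N" using f by (auto simp: free_vs_def)
  have "lin_ext (k \<odot>\<^bsub>F\<^esub> f) = (\<Oplus>\<^bsub>X\<^esub>p\<in>?S. (k * f p) \<odot>\<^bsub>X\<^esub> \<beta> (fst p) (snd p))"
    using lin_ext_superset[OF F.smult_closed[OF f] S(1) _ S(2), of k] by (auto simp: F_smult_eq)
  also have "\<dots> = (\<Oplus>\<^bsub>X\<^esub>p\<in>?S. k \<odot>\<^bsub>X\<^esub> (f p \<odot>\<^bsub>X\<^esub> \<beta> (fst p) (snd p)))"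
    using c subsetD[OF S(2)] by (intro X.finsum_cong') (auto simp: X.smult_assoc)
  also have "\<dots> = k \<odot>\<^bsub>X\<^esub> lin_ext f"
    unfolding lin_ext_def using c subsetD[OF S(2)] by (subst X.smult_finsum) auto
  finally show "lin_ext (k \<odot>\<^bsub>F\<^esub> f) = k \<odot>\<^bsub>X\<^esub> lin_ext f" .
qed

lemma lin_ext_single: "m \<in> carrier M \<Longrightarrow> n \<in> carrier N \<Longrightarrow> lin_ext (single m n) = \<beta> m n"
  using lin_ext_superset[of "single m n" "{(m, n)}"] bal_closed[of m n] single_F[of m n]
  by (auto simp: single_def split: if_splits)

lemma lin_ext_diff: "f \<in> carrier F \<Longrightarrow> g \<in> carrier F \<Longrightarrow> lin_ext f = lin_ext g \<Longrightarrow>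
    (\<lambda>p. f p - g p) \<in> {f \<in> carrier F. lin_ext f = \<zero>\<^bsub>X\<^esub>}"
  using modhom_minus[OF F.abelian_group_axioms X.abelian_group_axioms lin_ext_klin, of f g]
    F_minus[of f g] F.minus_closed[of f g] modhom_closed[OF lin_ext_klin, of g]
  by (simp add: a_minus_def X.r_neg)

text \<open>\<open>K\<close> is the least subspace containing the relations, so it is enough that
  the kernel of \<open>lin_ext\<close> is a subspace and contains each of the four families.\<close>

lemma lin_ext_K: "f \<in> K \<Longrightarrow> lin_ext f = \<zero>\<^bsub>X\<^esub>"
proof -
  let ?H = "{f \<in> carrier F. lin_ext f = \<zero>\<^bsub>X\<^esub>}"
  have H: "ksub F ?H" by (rule ksub_kernel[OF F.kspace_axioms X lin_ext_klin])
  have 1: "(\<lambda>p. single (m \<oplus>\<^bsub>M\<^esub> m') n p - single m n p - single m' n p) \<in> ?H"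
    if m: "m \<in> carrier M" "m' \<in> carrier M" "n \<in> carrier N" for m m' n
  proof -
    have "lin_ext (single (m \<oplus>\<^bsub>M\<^esub> m') n) = lin_ext (single m n \<oplus>\<^bsub>F\<^esub> single m' n)"
      using m bal by (simp add: lin_ext_single modhom_add[OF lin_ext_klin] single_F balanced_def)
    from lin_ext_diff[OF _ _ this] show ?thesis
      unfolding diff_diff_eq using m by (simp add: single_F F.a_closed) (simp add: F_add_eq)
  qed
  have 2: "(\<lambda>p. single m (n \<oplus>\<^bsub>N\<^esub> n') p - single m n p - single m n' p) \<in> ?H"
    if m: "m \<in> carrier M" "n \<in> carrier N" "n' \<in> carrier N" for m n n'
  proof -
    have "lin_ext (single m (n \<oplus>\<^bsub>N\<^esub> n')) = lin_ext (single m n \<oplus>\<^bsub>F\<^esub> single m n')"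
      using m bal by (simp add: lin_ext_single modhom_add[OF lin_ext_klin] single_F balanced_def)
    from lin_ext_diff[OF _ _ this] show ?thesis
      unfolding diff_diff_eq using m by (simp add: single_F F.a_closed) (simp add: F_add_eq)
  qed
  have 3: "(\<lambda>p. single (l \<odot>\<^bsub>M\<^esub> m) n p - single m (l \<odot>\<^bsub>N\<^esub> n) p) \<in> ?H"
    if m: "l \<in> carrier L" "m \<in> carrier M" "n \<in> carrier N" for l m n
    using m bal M.smult_closed N.smult_closed
    by (intro lin_ext_diff) (simp_all add: lin_ext_single single_F balanced_def)
  have 4: "(\<lambda>p. single ((k \<odot>\<^bsub>L\<^esub> \<one>\<^bsub>L\<^esub>) \<odot>\<^bsub>M\<^esub> m) n p - k * single m n p) \<in> ?H"
    if m: "m \<in> carrier M" "n \<in> carrier N" for k m n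
  proof -
    have mc: "(k \<odot>\<^bsub>L\<^esub> \<one>\<^bsub>L\<^esub>) \<odot>\<^bsub>M\<^esub> m \<in> carrier M" using m by (simp add: M.smult_closed)
    have e: "lin_ext (single ((k \<odot>\<^bsub>L\<^esub> \<one>\<^bsub>L\<^esub>) \<odot>\<^bsub>M\<^esub> m) n) = lin_ext (k \<odot>\<^bsub>F\<^esub> single m n)"
    proof -
      have "\<beta> ((k \<odot>\<^bsub>L\<^esub> \<one>\<^bsub>L\<^esub>) \<odot>\<^bsub>M\<^esub> m) n = k \<odot>\<^bsub>X\<^esub> \<beta> m n" using bal m unfolding balanced_def by blast
      then show ?thesis using m mc by (simp add: lin_ext_single klin_smult[OF lin_ext_klin] single_F)
    qed
    have "(\<lambda>p. single ((k \<odot>\<^bsub>L\<^esub> \<one>\<^bsub>L\<^esub>) \<odot>\<^bsub>M\<^esub> m) n p - (k \<odot>\<^bsub>F\<^esub> single m n) p) \<in> ?H"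
      by (rule lin_ext_diff[OF single_F[OF mc m(2)] F.smult_closed[OF single_F[OF m]] e])
    then show ?thesis unfolding F_smult_eq .
  qed
  have "tensor_rels L M N \<subseteq> ?H"
    unfolding tensor_rels_def
    by (intro Un_least subsetI; elim CollectE exE conjE, hypsubst, rule 1 2 3 4; assumption)
  from K_least[OF H this] show "f \<in> K \<Longrightarrow> lin_ext f = \<zero>\<^bsub>X\<^esub>" by blast
qed

text \<open>The representative picked by \<open>SOME\<close> differs from \<open>f\<close> by an
  element of \<open>K\<close>, on which \<open>lin_ext\<close> vanishes.\<close>

lemma tensor_lift_cls:
  assumes f: "f \<in> carrier F" shows "tensor_lift X \<beta> (cls f) = lin_ext f"
proof -
  interpret S: abelian_subgroup K F by (rule F.abelian_subgroup_ksub[OF ksub_K])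
  have "f \<in> cls f" using S.a_rcos_self[OF f] .
  then have some: "(SOME g. g \<in> cls f) \<in> cls f" by (rule someI[where P = "\<lambda>g. g \<in> cls f"])
  define g where "g = (SOME g. g \<in> cls f)"
  have g: "g \<in> carrier F" "cls g = cls f" using F.mem_coset[OF ksub_K f] some by (auto simp: g_def)
  then have "g \<ominus>\<^bsub>F\<^esub> f \<in> K" using F.coset_eq_iff[OF ksub_K g(1) f] by simp
  then have "lin_ext (g \<ominus>\<^bsub>F\<^esub> f) = \<zero>\<^bsub>X\<^esub>" by (rule lin_ext_K)
  then have "lin_ext g \<ominus>\<^bsub>X\<^esub> lin_ext f = \<zero>\<^bsub>X\<^esub>"
    using modhom_minus[OF F.abelian_group_axioms X.abelian_group_axioms lin_ext_klin g(1) f] by simp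
  then have "(lin_ext g \<ominus>\<^bsub>X\<^esub> lin_ext f) \<oplus>\<^bsub>X\<^esub> lin_ext f = lin_ext f"
    using modhom_closed[OF lin_ext_klin f] by simp
  then have "lin_ext g = lin_ext f"
    using modhom_closed[OF lin_ext_klin f] modhom_closed[OF lin_ext_klin g(1)]
    by (simp add: a_minus_def X.a_assoc X.l_neg)
  then show ?thesis by (simp add: tensor_lift_def g_def lin_ext_def Let_def)
qed

lemma tensor_lift_pure: "m \<in> carrier M \<Longrightarrow> n \<in> carrier N \<Longrightarrow> tensor_lift X \<beta> (pt m n) = \<beta> m n"
  by (simp add: pt_cls tensor_lift_cls single_F lin_ext_single)

lemma tensor_lift_klin: "tensor_lift X \<beta> \<in> klin T X"
proof (rule modhomI)
  show "tensor_lift X \<beta> t \<in> carrier X" if "t \<in> carrier T" for t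
    using that modhom_closed[OF lin_ext_klin] by (auto simp: carrier_T tensor_lift_cls)
  fix s t assume "s \<in> carrier T" "t \<in> carrier T"
  then obtain f g where f: "f \<in> carrier F" "s = cls f" and g: "g \<in> carrier F" "t = cls g"
    by (auto simp: carrier_T)
  have "tensor_lift X \<beta> (s \<oplus>\<^bsub>T\<^esub> t) = tensor_lift X \<beta> (cls (f \<oplus>\<^bsub>F\<^esub> g))"
    using f g modhom_add[OF cls_hom f(1) g(1)] by simp
  also have "\<dots> = lin_ext f \<oplus>\<^bsub>X\<^esub> lin_ext g"
    using f g by (simp add: tensor_lift_cls modhom_add[OF lin_ext_klin])
  finally show "tensor_lift X \<beta> (s \<oplus>\<^bsub>T\<^esub> t) = tensor_lift X \<beta> s \<oplus>\<^bsub>X\<^esub> tensor_lift X \<beta> t"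
    using f g by (simp add: tensor_lift_cls)
next
  fix k s assume "s \<in> carrier T"
  then obtain f where f: "f \<in> carrier F" "s = cls f" by (auto simp: carrier_T)
  have "tensor_lift X \<beta> (k \<odot>\<^bsub>T\<^esub> s) = tensor_lift X \<beta> (cls (k \<odot>\<^bsub>F\<^esub> f))"
    using f klin_smult[OF cls_hom f(1)] by simp
  also have "\<dots> = k \<odot>\<^bsub>X\<^esub> lin_ext f" using f by (simp add: tensor_lift_cls klin_smult[OF lin_ext_klin])
  finally show "tensor_lift X \<beta> (k \<odot>\<^bsub>T\<^esub> s) = k \<odot>\<^bsub>X\<^esub> tensor_lift X \<beta> s" using f by (simp add: tensor_lift_cls)
qed

end

text \<open>Scalars appear as multiples of the unit of \<open>L\<close>; with \<open>L\<close> the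
  ground field the same formula serves for tensor products of algebras.\<close>

lemma pt_sum:
  assumes I: "finite I" "\<And>i. i \<in> I \<Longrightarrow> v i \<in> carrier M"
    and J: "finite J" "\<And>j. j \<in> J \<Longrightarrow> w j \<in> carrier N"
  shows "pt (\<Oplus>\<^bsub>M\<^esub>i\<in>I. (x i \<odot>\<^bsub>L\<^esub> \<one>\<^bsub>L\<^esub>) \<odot>\<^bsub>M\<^esub> v i) (\<Oplus>\<^bsub>N\<^esub>j\<in>J. (y j \<odot>\<^bsub>L\<^esub> \<one>\<^bsub>L\<^esub>) \<odot>\<^bsub>N\<^esub> w j) =
    (\<Oplus>\<^bsub>T\<^esub>p\<in>I \<times> J. (x (fst p) * y (snd p)) \<odot>\<^bsub>T\<^esub> pt (v (fst p)) (w (snd p)))"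
proof -
  have vM: "(k \<odot>\<^bsub>L\<^esub> \<one>\<^bsub>L\<^esub>) \<odot>\<^bsub>M\<^esub> v i \<in> carrier M" if "i \<in> I" for i k
    using that I(2) by (auto intro!: M.smult_closed)
  have wN: "(k \<odot>\<^bsub>L\<^esub> \<one>\<^bsub>L\<^esub>) \<odot>\<^bsub>N\<^esub> w j \<in> carrier N" if "j \<in> J" for j k
    using that J(2) by (auto intro!: N.smult_closed)
  let ?n = "\<Oplus>\<^bsub>N\<^esub>j\<in>J. (y j \<odot>\<^bsub>L\<^esub> \<one>\<^bsub>L\<^esub>) \<odot>\<^bsub>N\<^esub> w j"
  have n: "?n \<in> carrier N" using wN by (intro N.M.finsum_closed) auto
  have "pt (\<Oplus>\<^bsub>M\<^esub>i\<in>I. (x i \<odot>\<^bsub>L\<^esub> \<one>\<^bsub>L\<^esub>) \<odot>\<^bsub>M\<^esub> v i) ?n = (\<Oplus>\<^bsub>T\<^esub>i\<in>I. pt ((x i \<odot>\<^bsub>L\<^esub> \<one>\<^bsub>L\<^esub>) \<odot>\<^bsub>M\<^esub> v i) ?n)"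
    by (rule additive_finsum[OF M.M.abelian_group_axioms T.abelian_group_axioms, of "\<lambda>m. pt m ?n"])
      (use n vM pt_add_left in auto)
  also have "\<dots> = (\<Oplus>\<^bsub>T\<^esub>i\<in>I. \<Oplus>\<^bsub>T\<^esub>j\<in>J. (x i * y j) \<odot>\<^bsub>T\<^esub> pt (v i) (w j))"
  proof (rule T.finsum_cong'[OF refl])
    show "(\<lambda>i. \<Oplus>\<^bsub>T\<^esub>j\<in>J. (x i * y j) \<odot>\<^bsub>T\<^esub> pt (v i) (w j)) \<in> I \<rightarrow> carrier T"
      using I(2) J(2) by (intro Pi_I T.finsum_closed) auto
    fix i assume i: "i \<in> I"
    have "pt ((x i \<odot>\<^bsub>L\<^esub> \<one>\<^bsub>L\<^esub>) \<odot>\<^bsub>M\<^esub> v i) ?n = x i \<odot>\<^bsub>T\<^esub> pt (v i) ?n" using pt_smult I(2)[OF i] n by simp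
    also have "pt (v i) ?n = (\<Oplus>\<^bsub>T\<^esub>j\<in>J. pt (v i) ((y j \<odot>\<^bsub>L\<^esub> \<one>\<^bsub>L\<^esub>) \<odot>\<^bsub>N\<^esub> w j))"
      by (rule additive_finsum[OF N.M.abelian_group_axioms T.abelian_group_axioms, of "\<lambda>n. pt (v i) n"])
        (use I(2)[OF i] wN pt_add_right in auto)
    also have "\<dots> = (\<Oplus>\<^bsub>T\<^esub>j\<in>J. y j \<odot>\<^bsub>T\<^esub> pt (v i) (w j))"
      using I(2)[OF i] J(2) by (intro T.finsum_cong') (auto simp: pt_smult_right)
    also have "x i \<odot>\<^bsub>T\<^esub> \<dots> = (\<Oplus>\<^bsub>T\<^esub>j\<in>J. (x i * y j) \<odot>\<^bsub>T\<^esub> pt (v i) (w j))"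
    proof -
      have "x i \<odot>\<^bsub>T\<^esub> (\<Oplus>\<^bsub>T\<^esub>j\<in>J. y j \<odot>\<^bsub>T\<^esub> pt (v i) (w j)) =
          (\<Oplus>\<^bsub>T\<^esub>j\<in>J. x i \<odot>\<^bsub>T\<^esub> (y j \<odot>\<^bsub>T\<^esub> pt (v i) (w j)))"
        by (rule T.smult_finsum) (use I(2)[OF i] J(2) in auto)
      also have "\<dots> = (\<Oplus>\<^bsub>T\<^esub>j\<in>J. (x i * y j) \<odot>\<^bsub>T\<^esub> pt (v i) (w j))"
        using I(2)[OF i] J(2) by (intro T.finsum_cong') (auto simp: T.smult_assoc)
      finally show ?thesis .
    qed
    finally show "pt ((x i \<odot>\<^bsub>L\<^esub> \<one>\<^bsub>L\<^esub>) \<odot>\<^bsub>M\<^esub> v i) ?n = (\<Oplus>\<^bsub>T\<^esub>j\<in>J. (x i * y j) \<odot>\<^bsub>T\<^esub> pt (v i) (w j))" .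
  qed
  also have "\<dots> = (\<Oplus>\<^bsub>T\<^esub>p\<in>I \<times> J. (x (fst p) * y (snd p)) \<odot>\<^bsub>T\<^esub> pt (v (fst p)) (w (snd p)))"
    using I J by (intro T.finsum_Times[where f = "\<lambda>i j. (x i * y j) \<odot>\<^bsub>T\<^esub> pt (v i) (w j)", symmetric]) auto
  finally show ?thesis .
qed

lemma tensor_span:
  assumes B: "finite B" "B \<subseteq> carrier M" "\<And>m. m \<in> carrier M \<Longrightarrow> \<exists>x. m = (\<Oplus>\<^bsub>M\<^esub>b\<in>B. (x b \<odot>\<^bsub>L\<^esub> \<one>\<^bsub>L\<^esub>) \<odot>\<^bsub>M\<^esub> b)"
    and C: "finite C" "C \<subseteq> carrier N" "\<And>n. n \<in> carrier N \<Longrightarrow> \<exists>y. n = (\<Oplus>\<^bsub>N\<^esub>c\<in>C. (y c \<odot>\<^bsub>L\<^esub> \<one>\<^bsub>L\<^esub>) \<odot>\<^bsub>N\<^esub> c)"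
    and t: "t \<in> carrier T"
  shows "\<exists>a. t = (\<Oplus>\<^bsub>T\<^esub>p\<in>B \<times> C. a p \<odot>\<^bsub>T\<^esub> pt (fst p) (snd p))"
proof -
  have pc: "pt (fst p) (snd p) \<in> carrier T" if "p \<in> B \<times> C" for p
    using that subsetD[OF B(2)] subsetD[OF C(2)] by auto
  show ?thesis using t
  proof (induction rule: tensor_induct)
    case zero
    have "\<zero>\<^bsub>T\<^esub> = (\<Oplus>\<^bsub>T\<^esub>p\<in>B \<times> C. 0 \<odot>\<^bsub>T\<^esub> pt (fst p) (snd p))"
      using pc by (intro T.finsum_all_zero[symmetric]) simp
    then show ?case by (rule exI[of _ "\<lambda>p. 0"])
  next
    case (add s t)
    then obtain a a' where "s = (\<Oplus>\<^bsub>T\<^esub>p\<in>B \<times> C. a p \<odot>\<^bsub>T\<^esub> pt (fst p) (snd p))"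
      "t = (\<Oplus>\<^bsub>T\<^esub>p\<in>B \<times> C. a' p \<odot>\<^bsub>T\<^esub> pt (fst p) (snd p))" by blast
    then have "s \<oplus>\<^bsub>T\<^esub> t = (\<Oplus>\<^bsub>T\<^esub>p\<in>B \<times> C. a p \<odot>\<^bsub>T\<^esub> pt (fst p) (snd p) \<oplus>\<^bsub>T\<^esub> a' p \<odot>\<^bsub>T\<^esub> pt (fst p) (snd p))"
      using pc by (subst T.finsum_addf) auto
    also have "\<dots> = (\<Oplus>\<^bsub>T\<^esub>p\<in>B \<times> C. (a p + a' p) \<odot>\<^bsub>T\<^esub> pt (fst p) (snd p))"
      using pc by (intro T.finsum_cong') (simp_all add: T.smult_l_distr)
    finally show ?case by (rule exI[of _ "\<lambda>p. a p + a' p"])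
  next
    case (pure m n)
    obtain x where x: "m = (\<Oplus>\<^bsub>M\<^esub>b\<in>B. (x b \<odot>\<^bsub>L\<^esub> \<one>\<^bsub>L\<^esub>) \<odot>\<^bsub>M\<^esub> b)" using B(3)[OF pure(1)] by blast
    obtain y where y: "n = (\<Oplus>\<^bsub>N\<^esub>c\<in>C. (y c \<odot>\<^bsub>L\<^esub> \<one>\<^bsub>L\<^esub>) \<odot>\<^bsub>N\<^esub> c)" using C(3)[OF pure(2)] by blast
    have "pt m n = (\<Oplus>\<^bsub>T\<^esub>p\<in>B \<times> C. (x (fst p) * y (snd p)) \<odot>\<^bsub>T\<^esub> pt (fst p) (snd p))"
      unfolding x y by (rule pt_sum[where v = "\<lambda>b. b" and w = "\<lambda>c. c"]) (use B C in auto)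
    then show ?case by (rule exI[of _ "\<lambda>p. x (fst p) * y (snd p)"])
  qed
qed

lemma fdspace_tensor:
  assumes "fdspace (restrict_scalars L M)" "fdspace (restrict_scalars L N)"
  shows "fdspace T"
proof -
  obtain B \<xi> where "coord_system (restrict_scalars L M) B \<xi>" using coord_system_exists[OF assms(1)] .
  note B = coord_systemD[OF this]
  obtain C \<eta> where "coord_system (restrict_scalars L N) C \<eta>" using coord_system_exists[OF assms(2)] .
  note C = coord_systemD[OF this]
  have BM: "B \<subseteq> carrier M" and CN: "C \<subseteq> carrier N" using B(2) C(2) by auto
  have 1: "\<exists>x. m = (\<Oplus>\<^bsub>M\<^esub>b\<in>B. (x b \<odot>\<^bsub>L\<^esub> \<one>\<^bsub>L\<^esub>) \<odot>\<^bsub>M\<^esub> b)" if "m \<in> carrier M" for m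
    using B(5)[of m] that by (intro exI[of _ "\<lambda>b. \<xi> b m"]) simp
  have 2: "\<exists>x. n = (\<Oplus>\<^bsub>N\<^esub>b\<in>C. (x b \<odot>\<^bsub>L\<^esub> \<one>\<^bsub>L\<^esub>) \<odot>\<^bsub>N\<^esub> b)" if "n \<in> carrier N" for n
    using C(5)[of n] that by (intro exI[of _ "\<lambda>b. \<eta> b n"]) simp
  have "finite_dimensional T"
  proof (rule T.fin_dimI[of "B \<times> C" "\<lambda>p. pt (fst p) (snd p)"])
    show "finite (B \<times> C)" using B(1) C(1) by simp
    show "pt (fst p) (snd p) \<in> carrier T" if "p \<in> B \<times> C" for p
      using that subsetD[OF BM] subsetD[OF CN] by auto
    show "\<exists>a. t = (\<Oplus>\<^bsub>T\<^esub>p\<in>B \<times> C. a p \<odot>\<^bsub>T\<^esub> pt (fst p) (snd p))" if "t \<in> carrier T" for t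
      by (rule tensor_span[OF B(1) BM 1 C(1) CN 2 that])
  qed
  then show ?thesis using T.kspace_axioms by (simp add: fdspace_def)
qed

end

section \<open>Tensor products of algebras\<close>

lemma opp_ground [simp]: "opp ground = ground"
  by (simp add: opp_def regular_def mult.commute)

lemma klin_finsum:
  assumes "kspace W" "\<And>i. i \<in> I \<Longrightarrow> f i \<in> klin V W"
  shows "(\<lambda>x. \<Oplus>\<^bsub>W\<^esub>i\<in>I. f i x) \<in> klin V W"
proof -
  interpret W: kspace W by fact
  have c: "f i x \<in> carrier W" if "i \<in> I" "x \<in> carrier V" for i x
    using modhom_closed[OF assms(2)[OF that(1)] that(2)] .
  show ?thesis
  proof (rule modhomI)
    show "(\<Oplus>\<^bsub>W\<^esub>i\<in>I. f i x) \<in> carrier W" if "x \<in> carrier V" for x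
      using c that by (intro W.finsum_closed) auto
    show "(\<Oplus>\<^bsub>W\<^esub>i\<in>I. f i (x \<oplus>\<^bsub>V\<^esub> y)) = (\<Oplus>\<^bsub>W\<^esub>i\<in>I. f i x) \<oplus>\<^bsub>W\<^esub> (\<Oplus>\<^bsub>W\<^esub>i\<in>I. f i y)"
      if "x \<in> carrier V" "y \<in> carrier V" for x y
    proof -
      have "(\<Oplus>\<^bsub>W\<^esub>i\<in>I. f i (x \<oplus>\<^bsub>V\<^esub> y)) = (\<Oplus>\<^bsub>W\<^esub>i\<in>I. f i x \<oplus>\<^bsub>W\<^esub> f i y)"
        using c that by (intro W.finsum_cong') (auto simp: modhom_add[OF assms(2)])
      also have "\<dots> = (\<Oplus>\<^bsub>W\<^esub>i\<in>I. f i x) \<oplus>\<^bsub>W\<^esub> (\<Oplus>\<^bsub>W\<^esub>i\<in>I. f i y)"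
        using c that by (intro W.finsum_addf) auto
      finally show ?thesis .
    qed
    show "(\<Oplus>\<^bsub>W\<^esub>i\<in>I. f i (k \<odot>\<^bsub>V\<^esub> x)) = k \<odot>\<^bsub>W\<^esub> (\<Oplus>\<^bsub>W\<^esub>i\<in>I. f i x)" if "x \<in> carrier V" for k x
    proof -
      have "(\<Oplus>\<^bsub>W\<^esub>i\<in>I. f i (k \<odot>\<^bsub>V\<^esub> x)) = (\<Oplus>\<^bsub>W\<^esub>i\<in>I. k \<odot>\<^bsub>W\<^esub> f i x)"
        using c that by (intro W.finsum_cong') (auto simp: klin_smult[OF assms(2)])
      also have "\<dots> = k \<odot>\<^bsub>W\<^esub> (\<Oplus>\<^bsub>W\<^esub>i\<in>I. f i x)"
        using c that by (subst W.smult_finsum) auto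
      finally show ?thesis .
    qed
  qed
qed

lemma klin_smult_const:
  assumes "kspace W" "g \<in> klin V ground" "w \<in> carrier W"
  shows "(\<lambda>x. g x \<odot>\<^bsub>W\<^esub> w) \<in> klin V W"
proof -
  interpret W: kspace W by fact
  show ?thesis
    by (rule modhomI) (auto simp: assms(3) modhom_add[OF assms(2)] klin_smult[OF assms(2)]
        W.smult_l_distr W.smult_assoc)
qed

text \<open>Over the ground field the middle relation follows from linearity in both
  arguments.\<close>

lemma balanced_groundI:
  assumes "\<And>a. a \<in> carrier A \<Longrightarrow> \<beta> a \<in> klin B X" "\<And>b. b \<in> carrier B \<Longrightarrow> (\<lambda>a. \<beta> a b) \<in> klin A X"
  shows "balanced ground A B X \<beta>"
  unfolding balanced_def
  using modhom_closed[OF assms(1)] modhom_add[OF assms(1)] modhom_add[OF assms(2)]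
    klin_smult[OF assms(1)] klin_smult[OF assms(2)]
  by simp

locale tensor_algebras = A: kalgebra A + B: kalgebra B
  for A :: "('k::field, 'a) module" and B :: "('k, 'b) module"
begin

sublocale tensor_product ground A B
  by (intro tensor_product.intro ground.kalgebra_axioms)
    (simp_all add: A.kspace_axioms B.kspace_axioms)

abbreviation "TA \<equiv> tensor_algebra A B"

lemma TA_simps [simp]:
  "carrier TA = carrier T" "zero TA = zero T" "add TA = add T" "smult TA = smult T" "one TA = pt \<one>\<^bsub>A\<^esub> \<one>\<^bsub>B\<^esub>"
  by (auto simp: tensor_algebra_def Let_def)

lemma pt_klin_right: "a \<in> carrier A \<Longrightarrow> pt a \<in> klin B T"
  using pt_add_right pt_smult_right by (intro modhomI) auto

lemma pt_klin_left: "b \<in> carrier B \<Longrightarrow> (\<lambda>a. pt a b) \<in> klin A T"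
  using pt_add_left pt_smult by (intro modhomI) auto

text \<open>Left multiplication by a pure tensor, the inner of the two lifts that define the product
  of \<open>tensor_algebra\<close>.\<close>

definition lmul :: "'a \<Rightarrow> 'b \<Rightarrow> ('a \<times> 'b \<Rightarrow> 'k) set \<Rightarrow> ('a \<times> 'b \<Rightarrow> 'k) set" where
  "lmul a b = tensor_lift T (\<lambda>a' b'. pt (a \<otimes>\<^bsub>A\<^esub> a') (b \<otimes>\<^bsub>B\<^esub> b'))"

lemma mult_TA: "s \<otimes>\<^bsub>TA\<^esub> t = tensor_lift T (\<lambda>a b. lmul a b t) s"
  by (simp add: tensor_algebra_def Let_def lmul_def)

lemma lmul_balanced:
  assumes a: "a \<in> carrier A" and b: "b \<in> carrier B"
  shows "balanced ground A B T (\<lambda>a' b'. pt (a \<otimes>\<^bsub>A\<^esub> a') (b \<otimes>\<^bsub>B\<^esub> b'))"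
proof (rule balanced_groundI)
  fix a' assume a': "a' \<in> carrier A"
  have "(\<lambda>b'. b \<otimes>\<^bsub>B\<^esub> b') \<in> klin B B"
    using b by (intro modhomI) (auto simp: B.r_distr B.smult_mult_right)
  then show "(\<lambda>b'. pt (a \<otimes>\<^bsub>A\<^esub> a') (b \<otimes>\<^bsub>B\<^esub> b')) \<in> klin B T"
    by (rule modhom_comp) (use a a' in \<open>simp add: pt_klin_right\<close>)
next
  fix b' assume b': "b' \<in> carrier B"
  have "(\<lambda>a'. a \<otimes>\<^bsub>A\<^esub> a') \<in> klin A A"
    using a by (intro modhomI) (auto simp: A.r_distr A.smult_mult_right)
  then show "(\<lambda>a'. pt (a \<otimes>\<^bsub>A\<^esub> a') (b \<otimes>\<^bsub>B\<^esub> b')) \<in> klin A T"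
    by (rule modhom_comp) (use b b' in \<open>simp add: pt_klin_left\<close>)
qed

lemma lmul_klin: "a \<in> carrier A \<Longrightarrow> b \<in> carrier B \<Longrightarrow> lmul a b \<in> klin T T"
  unfolding lmul_def by (rule tensor_lift_klin[OF T.kspace_axioms lmul_balanced])

lemma lmul_pt:
  "\<lbrakk>a \<in> carrier A; b \<in> carrier B; a' \<in> carrier A; b' \<in> carrier B\<rbrakk> \<Longrightarrow>
    lmul a b (pt a' b') = pt (a \<otimes>\<^bsub>A\<^esub> a') (b \<otimes>\<^bsub>B\<^esub> b')"
  unfolding lmul_def by (rule tensor_lift_pure[OF T.kspace_axioms lmul_balanced])

lemma klin_add: "kspace W \<Longrightarrow> f \<in> klin V W \<Longrightarrow> g \<in> klin V W \<Longrightarrow> (\<lambda>x. f x \<oplus>\<^bsub>W\<^esub> g x) \<in> klin V W"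
  and klin_scale: "kspace W \<Longrightarrow> f \<in> klin V W \<Longrightarrow> (\<lambda>x. k \<odot>\<^bsub>W\<^esub> f x) \<in> klin V W"
proof -
  assume W: "kspace W" and f: "f \<in> klin V W"
  interpret W: kspace W by fact
  note fc = modhom_closed[OF f]
  show "(\<lambda>x. k \<odot>\<^bsub>W\<^esub> f x) \<in> klin V W"
    by (rule modhomI)
      (auto simp: fc modhom_add[OF f] klin_smult[OF f] W.smult_r_distr mult.commute simp flip: W.smult_assoc)
  assume g: "g \<in> klin V W"
  note gc = modhom_closed[OF g]
  show "(\<lambda>x. f x \<oplus>\<^bsub>W\<^esub> g x) \<in> klin V W"
    by (rule modhomI)
      (auto simp: fc gc modhom_add[OF f] modhom_add[OF g] klin_smult[OF f] klin_smult[OF g]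
        W.smult_r_distr W.a_ac)
qed

text \<open>The outer lift requires that \<open>lmul a b t\<close> be bilinear in \<open>a\<close>
  and \<open>b\<close> for every \<open>t\<close>. Each identity compares linear maps in
  \<open>t\<close> and is checked on pure tensors.\<close>

lemma mult_balanced:
  assumes t: "t \<in> carrier T" shows "balanced ground A B T (\<lambda>a b. lmul a b t)"
proof (rule balanced_groundI)
  fix a assume a: "a \<in> carrier A"
  show "(\<lambda>b. lmul a b t) \<in> klin B T"
  proof (rule modhomI)
    fix b b' assume b: "b \<in> carrier B" "b' \<in> carrier B"
    show "lmul a (b \<oplus>\<^bsub>B\<^esub> b') t = lmul a b t \<oplus>\<^bsub>T\<^esub> lmul a b' t"
      by (rule klin_eqI[OF T.kspace_axioms lmul_klin klin_add[OF T.kspace_axioms lmul_klin lmul_klin] _ t])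
        (use a b in \<open>simp_all add: lmul_pt B.l_distr pt_add_right\<close>)
  next
    fix k b assume b: "b \<in> carrier B"
    show "lmul a (k \<odot>\<^bsub>B\<^esub> b) t = k \<odot>\<^bsub>T\<^esub> lmul a b t"
      by (rule klin_eqI[OF T.kspace_axioms lmul_klin klin_scale[OF T.kspace_axioms lmul_klin] _ t])
        (use a b klin_smult[OF pt_klin_right] in \<open>simp_all add: lmul_pt B.smult_mult_left\<close>)
  qed (use a t modhom_closed[OF lmul_klin] in auto)
next
  fix b assume b: "b \<in> carrier B"
  show "(\<lambda>a. lmul a b t) \<in> klin A T"
  proof (rule modhomI)
    fix a a' assume a: "a \<in> carrier A" "a' \<in> carrier A"
    show "lmul (a \<oplus>\<^bsub>A\<^esub> a') b t = lmul a b t \<oplus>\<^bsub>T\<^esub> lmul a' b t"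
      by (rule klin_eqI[OF T.kspace_axioms lmul_klin klin_add[OF T.kspace_axioms lmul_klin lmul_klin] _ t])
        (use a b in \<open>simp_all add: lmul_pt A.l_distr pt_add_left\<close>)
  next
    fix k a assume a: "a \<in> carrier A"
    show "lmul (k \<odot>\<^bsub>A\<^esub> a) b t = k \<odot>\<^bsub>T\<^esub> lmul a b t"
      by (rule klin_eqI[OF T.kspace_axioms lmul_klin klin_scale[OF T.kspace_axioms lmul_klin] _ t])
        (use a b klin_smult[OF pt_klin_left] in \<open>simp_all add: lmul_pt A.smult_mult_left\<close>)
  qed (use b t modhom_closed[OF lmul_klin] in auto)
qed

lemma mult_klin_left: "t \<in> carrier T \<Longrightarrow> (\<lambda>s. s \<otimes>\<^bsub>TA\<^esub> t) \<in> klin T T"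
  unfolding mult_TA by (rule tensor_lift_klin[OF T.kspace_axioms mult_balanced])

lemma mult_pt_left: "a \<in> carrier A \<Longrightarrow> b \<in> carrier B \<Longrightarrow> t \<in> carrier T \<Longrightarrow> pt a b \<otimes>\<^bsub>TA\<^esub> t = lmul a b t"
  unfolding mult_TA by (rule tensor_lift_pure[OF T.kspace_axioms mult_balanced])

lemma mult_pt:
  "\<lbrakk>a \<in> carrier A; b \<in> carrier B; a' \<in> carrier A; b' \<in> carrier B\<rbrakk> \<Longrightarrow>
    pt a b \<otimes>\<^bsub>TA\<^esub> pt a' b' = pt (a \<otimes>\<^bsub>A\<^esub> a') (b \<otimes>\<^bsub>B\<^esub> b')"
  by (simp add: mult_pt_left lmul_pt)

lemma mult_TA_closed: "s \<in> carrier T \<Longrightarrow> t \<in> carrier T \<Longrightarrow> s \<otimes>\<^bsub>TA\<^esub> t \<in> carrier T"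
  by (rule modhom_closed[OF mult_klin_left])

lemma mult_klin_right:
  assumes s: "s \<in> carrier T" shows "(\<lambda>t. s \<otimes>\<^bsub>TA\<^esub> t) \<in> klin T T"
proof (rule modhomI)
  show "s \<otimes>\<^bsub>TA\<^esub> t \<in> carrier T" if "t \<in> carrier T" for t using mult_TA_closed s that .
  fix t t' assume t: "t \<in> carrier T" "t' \<in> carrier T"
  show "s \<otimes>\<^bsub>TA\<^esub> (t \<oplus>\<^bsub>T\<^esub> t') = s \<otimes>\<^bsub>TA\<^esub> t \<oplus>\<^bsub>T\<^esub> s \<otimes>\<^bsub>TA\<^esub> t'"
    by (rule klin_eqI[OF T.kspace_axioms mult_klin_left klin_add[OF T.kspace_axioms mult_klin_left mult_klin_left] _ s])
      (use t in \<open>simp_all add: mult_pt_left modhom_add[OF lmul_klin]\<close>)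
next
  fix k t assume t: "t \<in> carrier T"
  show "s \<otimes>\<^bsub>TA\<^esub> (k \<odot>\<^bsub>T\<^esub> t) = k \<odot>\<^bsub>T\<^esub> (s \<otimes>\<^bsub>TA\<^esub> t)"
    by (rule klin_eqI[OF T.kspace_axioms mult_klin_left klin_scale[OF T.kspace_axioms mult_klin_left] _ s])
      (use t in \<open>simp_all add: mult_pt_left klin_smult[OF lmul_klin]\<close>)
qed

text \<open>Associativity is an identity of trilinear maps, so the three factors are reduced to pure
  tensors one after the other.\<close>

lemma k_algebra_TA: "k_algebra TA"
proof -
  have kTA: "kspace TA"
    by (rule kspace_transport[OF T.kspace_axioms, of "\<lambda>x. x"]) (auto intro!: modhomI)
  interpret TA: kspace TA by (rule kTA)
  have assoc: "(r \<otimes>\<^bsub>TA\<^esub> s) \<otimes>\<^bsub>TA\<^esub> t = r \<otimes>\<^bsub>TA\<^esub> (s \<otimes>\<^bsub>TA\<^esub> t)"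
    if r: "r \<in> carrier T" and s: "s \<in> carrier T" and t: "t \<in> carrier T" for r s t
  proof (rule klin_eqI[OF T.kspace_axioms _ _ _ r])
    show "(\<lambda>r. (r \<otimes>\<^bsub>TA\<^esub> s) \<otimes>\<^bsub>TA\<^esub> t) \<in> klin T T"
      using modhom_comp[OF mult_klin_left[OF s] mult_klin_left[OF t]] .
    show "(\<lambda>r. r \<otimes>\<^bsub>TA\<^esub> (s \<otimes>\<^bsub>TA\<^esub> t)) \<in> klin T T" using mult_klin_left[OF mult_TA_closed[OF s t]] .
    fix a b assume ab: "a \<in> carrier A" "b \<in> carrier B"
    show "(pt a b \<otimes>\<^bsub>TA\<^esub> s) \<otimes>\<^bsub>TA\<^esub> t = pt a b \<otimes>\<^bsub>TA\<^esub> (s \<otimes>\<^bsub>TA\<^esub> t)"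
    proof (rule klin_eqI[OF T.kspace_axioms _ _ _ s])
      show "(\<lambda>s. (pt a b \<otimes>\<^bsub>TA\<^esub> s) \<otimes>\<^bsub>TA\<^esub> t) \<in> klin T T"
        using modhom_comp[OF mult_klin_right mult_klin_left[OF t]] ab by simp
      show "(\<lambda>s. pt a b \<otimes>\<^bsub>TA\<^esub> (s \<otimes>\<^bsub>TA\<^esub> t)) \<in> klin T T"
        using modhom_comp[OF mult_klin_left[OF t] mult_klin_right] ab by simp
      fix a' b' assume ab': "a' \<in> carrier A" "b' \<in> carrier B"
      show "(pt a b \<otimes>\<^bsub>TA\<^esub> pt a' b') \<otimes>\<^bsub>TA\<^esub> t = pt a b \<otimes>\<^bsub>TA\<^esub> (pt a' b' \<otimes>\<^bsub>TA\<^esub> t)"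
      proof (rule klin_eqI[OF T.kspace_axioms _ _ _ t])
        show "(\<lambda>t. (pt a b \<otimes>\<^bsub>TA\<^esub> pt a' b') \<otimes>\<^bsub>TA\<^esub> t) \<in> klin T T"
          using ab ab' by (intro mult_klin_right mult_TA_closed) auto
        show "(\<lambda>t. pt a b \<otimes>\<^bsub>TA\<^esub> (pt a' b' \<otimes>\<^bsub>TA\<^esub> t)) \<in> klin T T"
          using modhom_comp[OF mult_klin_right mult_klin_right] ab ab' by simp
      qed (use ab ab' in \<open>simp add: mult_pt A.m_assoc B.m_assoc\<close>)
    qed
  qed
  have one_l: "pt \<one>\<^bsub>A\<^esub> \<one>\<^bsub>B\<^esub> \<otimes>\<^bsub>TA\<^esub> t = t" if t: "t \<in> carrier T" for t
    by (rule klin_eqI[OF T.kspace_axioms _ modhom_id _ t]) (use mult_klin_right in \<open>auto simp: mult_pt\<close>)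
  have one_r: "t \<otimes>\<^bsub>TA\<^esub> pt \<one>\<^bsub>A\<^esub> \<one>\<^bsub>B\<^esub> = t" if t: "t \<in> carrier T" for t
    by (rule klin_eqI[OF T.kspace_axioms _ modhom_id _ t]) (use mult_klin_left in \<open>auto simp: mult_pt\<close>)
  have "ring TA"
  proof (rule ringI[OF TA.abelian_group_axioms])
    show "monoid TA"
      by (rule monoidI) (simp_all add: mult_TA_closed assoc one_l one_r)
  qed (simp_all add: modhom_add[OF mult_klin_left] modhom_add[OF mult_klin_right])
  then show ?thesis
    using kTA by (simp add: k_algebra_def kspace_iff[symmetric] klin_smult[OF mult_klin_left]
        klin_smult[OF mult_klin_right])
qed

lemma klin_TA [simp]: "klin TA X = klin T X" "klin X TA = klin X T"
  by (auto simp: LinearCombinations.module_hom_def)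

lemma finsum_TA [simp]: "finsum TA = finsum T"
  by (intro ext) (simp add: finsum_def finprod_def)

text \<open>Both expansions are linear in \<open>t\<close>; on a pure tensor they factor by
  \<open>pt_sum\<close> into the expansions of the two algebras.\<close>

lemma frobenius_TA:
  assumes FA: "frobenius A I b c lam" and FB: "frobenius B J b' c' lam'"
  shows "frobenius TA (I \<times> J) (\<lambda>p. pt (b (fst p)) (b' (snd p))) (\<lambda>p. pt (c (fst p)) (c' (snd p)))
    (tensor_lift ground (\<lambda>x y. lam x * lam' y))"
proof -
  interpret FA: frobenius A I b c lam by fact
  interpret FB: frobenius B J b' c' lam' by fact
  interpret TA: kalgebra TA by unfold_locales (rule k_algebra_TA)
  let ?L = "tensor_lift ground (\<lambda>x y. lam x * lam' y)"
  have bal: "balanced ground A B ground (\<lambda>x y. lam x * lam' y)"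
    by (rule balanced_groundI)
      (auto intro!: modhomI simp: modhom_add[OF FA.lam_linear] modhom_add[OF FB.lam_linear]
        klin_smult[OF FA.lam_linear] klin_smult[OF FB.lam_linear] algebra_simps)
  have L: "?L \<in> klin T ground" by (rule tensor_lift_klin[OF kspace_ground bal])
  have Lp: "?L (pt x y) = lam x * lam' y" if "x \<in> carrier A" "y \<in> carrier B" for x y
    by (rule tensor_lift_pure[OF kspace_ground bal that])
  have bc: "pt (b (fst p)) (b' (snd p)) \<in> carrier T" "pt (c (fst p)) (c' (snd p)) \<in> carrier T"
    if "p \<in> I \<times> J" for p
    using that FA.b_closed FA.c_closed FB.b_closed FB.c_closed by auto
  show ?thesis
  proof (intro frobenius.intro TA.kalgebra_axioms frobenius_axioms.intro)
    fix t assume "t \<in> carrier TA"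
    then have t: "t \<in> carrier T" by simp
    have "t = (\<Oplus>\<^bsub>T\<^esub>p\<in>I \<times> J. ?L (t \<otimes>\<^bsub>TA\<^esub> pt (c (fst p)) (c' (snd p))) \<odot>\<^bsub>T\<^esub> pt (b (fst p)) (b' (snd p)))"
    proof (rule klin_eqI[OF T.kspace_axioms modhom_id _ _ t])
      show "(\<lambda>t. \<Oplus>\<^bsub>T\<^esub>p\<in>I \<times> J. ?L (t \<otimes>\<^bsub>TA\<^esub> pt (c (fst p)) (c' (snd p))) \<odot>\<^bsub>T\<^esub> pt (b (fst p)) (b' (snd p)))
          \<in> klin T T"
        by (intro klin_finsum klin_smult_const T.kspace_axioms modhom_comp[OF mult_klin_left L] bc)
      fix x y assume x: "x \<in> carrier A" and y: "y \<in> carrier B"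
      have "pt x y = pt (\<Oplus>\<^bsub>A\<^esub>i\<in>I. (lam (x \<otimes>\<^bsub>A\<^esub> c i) \<odot>\<^bsub>ground\<^esub> \<one>\<^bsub>ground\<^esub>) \<odot>\<^bsub>A\<^esub> b i)
          (\<Oplus>\<^bsub>B\<^esub>j\<in>J. (lam' (y \<otimes>\<^bsub>B\<^esub> c' j) \<odot>\<^bsub>ground\<^esub> \<one>\<^bsub>ground\<^esub>) \<odot>\<^bsub>B\<^esub> b' j)"
        using FA.expand_b[OF x] FB.expand_b[OF y] by simp
      also have "\<dots> = (\<Oplus>\<^bsub>T\<^esub>p\<in>I \<times> J. (lam (x \<otimes>\<^bsub>A\<^esub> c (fst p)) * lam' (y \<otimes>\<^bsub>B\<^esub> c' (snd p))) \<odot>\<^bsub>T\<^esub>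
          pt (b (fst p)) (b' (snd p)))"
        by (rule pt_sum) (simp_all add: FA.finite_I FB.finite_I FA.b_closed FB.b_closed)
      also have "\<dots> = (\<Oplus>\<^bsub>T\<^esub>p\<in>I \<times> J. ?L (pt x y \<otimes>\<^bsub>TA\<^esub> pt (c (fst p)) (c' (snd p))) \<odot>\<^bsub>T\<^esub>
          pt (b (fst p)) (b' (snd p)))"
        using bc x y FA.c_closed FB.c_closed FA.b_closed FB.b_closed
        by (intro T.finsum_cong') (auto simp: mult_pt Lp)
      finally show "pt x y = \<dots>" .
    qed
    then show "t = (\<Oplus>\<^bsub>TA\<^esub>p\<in>I \<times> J. ?L (t \<otimes>\<^bsub>TA\<^esub> pt (c (fst p)) (c' (snd p))) \<odot>\<^bsub>TA\<^esub> pt (b (fst p)) (b' (snd p)))"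
      by simp
    have "t = (\<Oplus>\<^bsub>T\<^esub>p\<in>I \<times> J. ?L (pt (b (fst p)) (b' (snd p)) \<otimes>\<^bsub>TA\<^esub> t) \<odot>\<^bsub>T\<^esub> pt (c (fst p)) (c' (snd p)))"
    proof (rule klin_eqI[OF T.kspace_axioms modhom_id _ _ t])
      show "(\<lambda>t. \<Oplus>\<^bsub>T\<^esub>p\<in>I \<times> J. ?L (pt (b (fst p)) (b' (snd p)) \<otimes>\<^bsub>TA\<^esub> t) \<odot>\<^bsub>T\<^esub> pt (c (fst p)) (c' (snd p)))
          \<in> klin T T"
        by (intro klin_finsum klin_smult_const T.kspace_axioms modhom_comp[OF mult_klin_right L] bc)
      fix x y assume x: "x \<in> carrier A" and y: "y \<in> carrier B"
      have "pt x y = pt (\<Oplus>\<^bsub>A\<^esub>i\<in>I. (lam (b i \<otimes>\<^bsub>A\<^esub> x) \<odot>\<^bsub>ground\<^esub> \<one>\<^bsub>ground\<^esub>) \<odot>\<^bsub>A\<^esub> c i)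
          (\<Oplus>\<^bsub>B\<^esub>j\<in>J. (lam' (b' j \<otimes>\<^bsub>B\<^esub> y) \<odot>\<^bsub>ground\<^esub> \<one>\<^bsub>ground\<^esub>) \<odot>\<^bsub>B\<^esub> c' j)"
        using FA.expand_c[OF x] FB.expand_c[OF y] by simp
      also have "\<dots> = (\<Oplus>\<^bsub>T\<^esub>p\<in>I \<times> J. (lam (b (fst p) \<otimes>\<^bsub>A\<^esub> x) * lam' (b' (snd p) \<otimes>\<^bsub>B\<^esub> y)) \<odot>\<^bsub>T\<^esub>
          pt (c (fst p)) (c' (snd p)))"
        by (rule pt_sum) (simp_all add: FA.finite_I FB.finite_I FA.c_closed FB.c_closed)
      also have "\<dots> = (\<Oplus>\<^bsub>T\<^esub>p\<in>I \<times> J. ?L (pt (b (fst p)) (b' (snd p)) \<otimes>\<^bsub>TA\<^esub> pt x y) \<odot>\<^bsub>T\<^esub>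
          pt (c (fst p)) (c' (snd p)))"
        using bc x y FA.c_closed FB.c_closed FA.b_closed FB.b_closed
        by (intro T.finsum_cong') (auto simp: mult_pt Lp)
      finally show "pt x y = \<dots>" .
    qed
    then show "t = (\<Oplus>\<^bsub>TA\<^esub>p\<in>I \<times> J. ?L (pt (b (fst p)) (b' (snd p)) \<otimes>\<^bsub>TA\<^esub> t) \<odot>\<^bsub>TA\<^esub> pt (c (fst p)) (c' (snd p)))"
      by simp
  qed (use bc L FA.finite_I FB.finite_I in auto)
qed

end

context tensor_algebras
begin

text \<open>Both sides are bilinear in \<open>s\<close> and \<open>t\<close>, so multiplicativity on
  pure tensors is enough.\<close>

lemma alg_hom_lift:
  assumes L': "k_algebra L'" and bal: "balanced ground A B L' \<beta>"
    and mult: "\<And>a b a' b'. \<lbrakk>a \<in> carrier A; b \<in> carrier B; a' \<in> carrier A; b' \<in> carrier B\<rbrakk> \<Longrightarrow>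
      \<beta> (a \<otimes>\<^bsub>A\<^esub> a') (b \<otimes>\<^bsub>B\<^esub> b') = \<beta> a b \<otimes>\<^bsub>L'\<^esub> \<beta> a' b'"
    and s: "s \<in> carrier T" and t: "t \<in> carrier T"
  shows "tensor_lift L' \<beta> (s \<otimes>\<^bsub>TA\<^esub> t) = tensor_lift L' \<beta> s \<otimes>\<^bsub>L'\<^esub> tensor_lift L' \<beta> t"
proof -
  interpret L': kalgebra L' by unfold_locales fact
  let ?f = "tensor_lift L' \<beta>"
  have f: "?f \<in> klin T L'" by (rule tensor_lift_klin[OF L'.kspace_axioms bal])
  have fp: "?f (pt a b) = \<beta> a b" if "a \<in> carrier A" "b \<in> carrier B" for a b
    by (rule tensor_lift_pure[OF L'.kspace_axioms bal that])
  have left: "(\<lambda>x. x \<otimes>\<^bsub>L'\<^esub> y) \<in> klin L' L'" and right: "(\<lambda>x. y \<otimes>\<^bsub>L'\<^esub> x) \<in> klin L' L'"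
    if "y \<in> carrier L'" for y
    using that by (auto intro!: modhomI simp: L'.l_distr L'.r_distr L'.smult_mult_left L'.smult_mult_right)
  have fc: "?f x \<in> carrier L'" if "x \<in> carrier T" for x using modhom_closed[OF f that] .
  show ?thesis
  proof (rule klin_eqI[OF L'.kspace_axioms _ _ _ s])
    show "(\<lambda>s. ?f (s \<otimes>\<^bsub>TA\<^esub> t)) \<in> klin T L'" using modhom_comp[OF mult_klin_left[OF t] f] .
    show "(\<lambda>s. ?f s \<otimes>\<^bsub>L'\<^esub> ?f t) \<in> klin T L'" using modhom_comp[OF f left[OF fc[OF t]]] .
    fix a b assume ab: "a \<in> carrier A" "b \<in> carrier B"
    show "?f (pt a b \<otimes>\<^bsub>TA\<^esub> t) = ?f (pt a b) \<otimes>\<^bsub>L'\<^esub> ?f t"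
    proof (rule klin_eqI[OF L'.kspace_axioms _ _ _ t])
      show "(\<lambda>t. ?f (pt a b \<otimes>\<^bsub>TA\<^esub> t)) \<in> klin T L'"
        using modhom_comp[OF mult_klin_right f] ab by simp
      show "(\<lambda>t. ?f (pt a b) \<otimes>\<^bsub>L'\<^esub> ?f t) \<in> klin T L'" using modhom_comp[OF f right[OF fc]] ab by simp
    qed (use ab in \<open>simp add: mult_pt fp mult\<close>)
  qed
qed

definition tmap :: "('a \<Rightarrow> 'a) \<Rightarrow> ('b \<Rightarrow> 'b) \<Rightarrow> ('a \<times> 'b \<Rightarrow> 'k) set \<Rightarrow> ('a \<times> 'b \<Rightarrow> 'k) set" where
  "tmap \<alpha> \<beta> = tensor_lift TA (\<lambda>a b. pt (\<alpha> a) (\<beta> b))"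

lemma
  assumes \<alpha>: "\<alpha> \<in> klin A A" and \<beta>: "\<beta> \<in> klin B B"
  shows tmap_klin: "tmap \<alpha> \<beta> \<in> klin T T"
    and tmap_pt: "a \<in> carrier A \<Longrightarrow> b \<in> carrier B \<Longrightarrow> tmap \<alpha> \<beta> (pt a b) = pt (\<alpha> a) (\<beta> b)"
    and tmap_balanced: "balanced ground A B TA (\<lambda>a b. pt (\<alpha> a) (\<beta> b))"
proof -
  have k: "kspace TA" using k_algebra_TA by (simp add: k_algebra_def kspace_iff)
  show bal: "balanced ground A B TA (\<lambda>a b. pt (\<alpha> a) (\<beta> b))"
    using modhom_comp[OF \<beta> pt_klin_right[OF modhom_closed[OF \<alpha>]]]
      modhom_comp[OF \<alpha> pt_klin_left[OF modhom_closed[OF \<beta>]]]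
    by (intro balanced_groundI) simp_all
  show "tmap \<alpha> \<beta> \<in> klin T T" using tensor_lift_klin[OF k bal] by (simp add: tmap_def)
  show "a \<in> carrier A \<Longrightarrow> b \<in> carrier B \<Longrightarrow> tmap \<alpha> \<beta> (pt a b) = pt (\<alpha> a) (\<beta> b)"
    unfolding tmap_def by (rule tensor_lift_pure[OF k bal])
qed

lemma tmap_inverse:
  assumes "\<alpha> \<in> klin A A" "\<beta> \<in> klin B B" "\<alpha>' \<in> klin A A" "\<beta>' \<in> klin B B"
    "\<And>a. a \<in> carrier A \<Longrightarrow> \<alpha>' (\<alpha> a) = a" "\<And>b. b \<in> carrier B \<Longrightarrow> \<beta>' (\<beta> b) = b" "t \<in> carrier T"
  shows "tmap \<alpha>' \<beta>' (tmap \<alpha> \<beta> t) = t"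
proof (rule klin_eqI[OF T.kspace_axioms modhom_comp[OF tmap_klin[OF assms(1,2)] tmap_klin[OF assms(3,4)]]
      modhom_id _ assms(7)])
  fix a b assume "a \<in> carrier A" "b \<in> carrier B"
  then show "tmap \<alpha>' \<beta>' (tmap \<alpha> \<beta> (pt a b)) = pt a b"
    using modhom_closed[OF assms(1)] modhom_closed[OF assms(2)]
    by (simp add: tmap_pt[OF assms(1,2)] tmap_pt[OF assms(3,4)] assms(5,6))
qed

lemma alg_iso_tmap:
  assumes \<alpha>: "alg_iso A A \<alpha>" and \<beta>: "alg_iso B B \<beta>"
  shows "alg_iso TA TA (tmap \<alpha> \<beta>)"
proof -
  note a = alg_isoD[OF \<alpha>] and b = alg_isoD[OF \<beta>]
  define \<alpha>' where "\<alpha>' = inv_into (carrier A) \<alpha>"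
  define \<beta>' where "\<beta>' = inv_into (carrier B) \<beta>"
  note a' = alg_isoD[OF alg_iso_inv[OF A.k_algebra \<alpha>], folded \<alpha>'_def]
  note b' = alg_isoD[OF alg_iso_inv[OF B.k_algebra \<beta>], folded \<beta>'_def]
  note ia = bij_betw_inv_into_simps[OF a(2), folded \<alpha>'_def]
  note ib = bij_betw_inv_into_simps[OF b(2), folded \<beta>'_def]
  have "bij_betw (tmap \<alpha> \<beta>) (carrier T) (carrier T)"
  proof (rule bij_betwI[where g = "tmap \<alpha>' \<beta>'"])
    show "tmap \<alpha> \<beta> \<in> carrier T \<rightarrow> carrier T" "tmap \<alpha>' \<beta>' \<in> carrier T \<rightarrow> carrier T"
      using modhom_closed[OF tmap_klin[OF a(1) b(1)]] modhom_closed[OF tmap_klin[OF a'(1) b'(1)]] by auto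
    show "tmap \<alpha>' \<beta>' (tmap \<alpha> \<beta> t) = t" if "t \<in> carrier T" for t
      by (rule tmap_inverse[OF a(1) b(1) a'(1) b'(1) ia(1) ib(1) that])
    show "tmap \<alpha> \<beta> (tmap \<alpha>' \<beta>' t) = t" if "t \<in> carrier T" for t
      by (rule tmap_inverse[OF a'(1) b'(1) a(1) b(1) ia(2) ib(2) that])
  qed
  moreover have "tmap \<alpha> \<beta> (s \<otimes>\<^bsub>TA\<^esub> t) = tmap \<alpha> \<beta> s \<otimes>\<^bsub>TA\<^esub> tmap \<alpha> \<beta> t"
    if "s \<in> carrier T" "t \<in> carrier T" for s t
    unfolding tmap_def
    by (rule alg_hom_lift[OF k_algebra_TA tmap_balanced[OF a(1) b(1)] _ that]) (simp add: a b mult_pt)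
  ultimately show ?thesis
    unfolding alg_iso_def using tmap_klin[OF a(1) b(1)] tmap_pt[OF a(1) b(1)] a(3) b(3) by simp
qed

lemma inv_tmap_pt:
  assumes \<alpha>: "alg_iso A A \<alpha>" and \<beta>: "alg_iso B B \<beta>" and x: "x \<in> carrier A" and y: "y \<in> carrier B"
  shows "inv_into (carrier TA) (tmap \<alpha> \<beta>) (pt x y) =
    pt (inv_into (carrier A) \<alpha> x) (inv_into (carrier B) \<beta> y)"
proof -
  note a = alg_isoD[OF \<alpha>] and b = alg_isoD[OF \<beta>]
  note ia = bij_betw_inv_into_simps[OF a(2)] and ib = bij_betw_inv_into_simps[OF b(2)]
  note it = bij_betw_inv_into_simps[OF alg_isoD(2)[OF alg_iso_tmap[OF \<alpha> \<beta>]]]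
  have "tmap \<alpha> \<beta> (pt (inv_into (carrier A) \<alpha> x) (inv_into (carrier B) \<beta> y)) = pt x y"
    using tmap_pt[OF a(1) b(1)] ia ib x y by simp
  then show ?thesis using it(1)[of "pt (inv_into (carrier A) \<alpha> x) (inv_into (carrier B) \<beta> y)"] ia ib x y by simp
qed

end

section \<open>The enveloping algebra and its bimodules\<close>

locale env = kalgebra A for A :: "('k::field, 'a) module" (structure)
begin

sublocale E: tensor_algebras A "opp A"
  by (intro tensor_algebras.intro kalgebra_axioms) (unfold_locales, rule k_algebra_opp)

abbreviation "\<E> \<equiv> enveloping A"

lemma enveloping_eq: "\<E> = E.TA"
  by (simp add: enveloping_def)

sublocale EE: kalgebra "enveloping A"
  unfolding enveloping_eq by unfold_locales (rule E.k_algebra_TA)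

lemma carrier_env: "carrier \<E> = carrier E.T"
  by (simp add: enveloping_eq)

text \<open>Pure tensors generate the enveloping algebra additively, so a map that commutes with
  their action is linear over the whole algebra.\<close>

lemma env_homI:
  assumes M: "left_module \<E> M" and N: "left_module \<E> N"
    and "\<And>x. x \<in> carrier M \<Longrightarrow> f x \<in> carrier N"
    and "\<And>x y. x \<in> carrier M \<Longrightarrow> y \<in> carrier M \<Longrightarrow> f (x \<oplus>\<^bsub>M\<^esub> y) = f x \<oplus>\<^bsub>N\<^esub> f y"
    and eq: "\<And>a b x. \<lbrakk>a \<in> carrier A; b \<in> carrier A; x \<in> carrier M\<rbrakk> \<Longrightarrow> f (E.pt a b \<odot>\<^bsub>M\<^esub> x) = E.pt a b \<odot>\<^bsub>N\<^esub> f x"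
  shows "f \<in> module_hom \<E> M N"
proof (rule modhomI[OF assms(3,4)])
  interpret M: left_module \<E> M by fact
  interpret N: left_module \<E> N by fact
  interpret rM: kspace "restrict_scalars \<E> M" by (rule EE.kspace_restrict_scalars) fact
  interpret rN: kspace "restrict_scalars \<E> N" by (rule EE.kspace_restrict_scalars) fact
  fix t x assume t: "t \<in> carrier \<E>" and x: "x \<in> carrier M"
  have z: "\<zero>\<^bsub>\<E>\<^esub> \<odot>\<^bsub>P\<^esub> y = \<zero>\<^bsub>P\<^esub>" if P: "left_module \<E> P" and y: "y \<in> carrier P"
    for P :: "(('k, 'a) env, 'z) module" and y
  proof -
    interpret P: left_module \<E> P by fact
    have "\<zero>\<^bsub>\<E>\<^esub> \<odot>\<^bsub>P\<^esub> y \<oplus>\<^bsub>P\<^esub> \<zero>\<^bsub>\<E>\<^esub> \<odot>\<^bsub>P\<^esub> y = \<zero>\<^bsub>\<E>\<^esub> \<odot>\<^bsub>P\<^esub> y"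
      using P.smult_l_distr[of "\<zero>\<^bsub>\<E>\<^esub>" "\<zero>\<^bsub>\<E>\<^esub>" y] y by simp
    then show ?thesis using P.smult_closed[OF _ y, of "\<zero>\<^bsub>\<E>\<^esub>"] by (metis P.M.add.l_cancel_one EE.zero_closed)
  qed
  from t have "t \<in> carrier E.T" by (simp add: carrier_env)
  then show "f (t \<odot>\<^bsub>M\<^esub> x) = t \<odot>\<^bsub>N\<^esub> f x"
  proof (induction rule: E.tensor_induct)
    case zero
    have "f \<zero>\<^bsub>M\<^esub> = \<zero>\<^bsub>N\<^esub>"
      by (rule additive_zero[OF M.M.abelian_group_axioms N.M.abelian_group_axioms]) (use assms(3,4) in auto)
    then show ?case using z[OF M x] z[OF N assms(3)[OF x]] by (simp add: enveloping_eq)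
  next
    case (pure a b)
    then show ?case using eq x by simp
  next
    case (add s t)
    then have st: "s \<in> carrier \<E>" "t \<in> carrier \<E>" by (auto simp: carrier_env)
    have "s \<oplus>\<^bsub>E.T\<^esub> t = s \<oplus>\<^bsub>\<E>\<^esub> t" by (simp add: enveloping_eq)
    then show ?case
      using add.IH st x assms(3)[OF x] assms(4) by (simp add: M.smult_l_distr N.smult_l_distr M.smult_closed)
  qed
qed

text \<open>The bimodule axioms, with scalars acting in the same way from both sides, for the raw
  actions that \<open>bimodule\<close> takes as arguments.\<close>

definition bimod_actions ::
  "('k, 'x) module \<Rightarrow> ('a \<Rightarrow> 'x \<Rightarrow> 'x) \<Rightarrow> ('x \<Rightarrow> 'a \<Rightarrow> 'x) \<Rightarrow> bool" where
  "bimod_actions X l r \<longleftrightarrow> kspace X \<and>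
    (\<forall>x\<in>carrier X. (\<lambda>a. l a x) \<in> klin A X \<and> r x \<in> klin A X) \<and>
    (\<forall>a\<in>carrier A. l a \<in> klin X X \<and> (\<lambda>x. r x a) \<in> klin X X) \<and>
    (\<forall>x\<in>carrier X. l \<one> x = x \<and> r x \<one> = x) \<and>
    (\<forall>a\<in>carrier A. \<forall>b\<in>carrier A. \<forall>x\<in>carrier X.
      l (a \<otimes> b) x = l a (l b x) \<and> r x (a \<otimes> b) = r (r x a) b \<and> l a (r x b) = r (l a x) b)"

lemma bimodule_simps [simp]:
  "carrier (bimodule X l r) = carrier X" "zero (bimodule X l r) = zero X" "add (bimodule X l r) = add X"
  by (auto simp: bimodule_def)

context
  fixes X :: "('k, 'x) module" and l r
  assumes act: "bimod_actions X l r"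
begin

interpretation X: kspace X using act by (simp add: bimod_actions_def)

lemma actD:
  shows "x \<in> carrier X \<Longrightarrow> (\<lambda>a. l a x) \<in> klin A X" "x \<in> carrier X \<Longrightarrow> r x \<in> klin A X"
    "a \<in> carrier A \<Longrightarrow> l a \<in> klin X X" "a \<in> carrier A \<Longrightarrow> (\<lambda>x. r x a) \<in> klin X X"
    "x \<in> carrier X \<Longrightarrow> l \<one> x = x" "x \<in> carrier X \<Longrightarrow> r x \<one> = x"
    "\<lbrakk>a \<in> carrier A; b \<in> carrier A; x \<in> carrier X\<rbrakk> \<Longrightarrow> l (a \<otimes> b) x = l a (l b x)"
    "\<lbrakk>a \<in> carrier A; b \<in> carrier A; x \<in> carrier X\<rbrakk> \<Longrightarrow> r x (a \<otimes> b) = r (r x a) b"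
    "\<lbrakk>a \<in> carrier A; b \<in> carrier A; x \<in> carrier X\<rbrakk> \<Longrightarrow> l a (r x b) = r (l a x) b"
  using act unfolding bimod_actions_def by auto

lemma act_closed: "a \<in> carrier A \<Longrightarrow> x \<in> carrier X \<Longrightarrow> l a x \<in> carrier X"
  "a \<in> carrier A \<Longrightarrow> x \<in> carrier X \<Longrightarrow> r x a \<in> carrier X"
  using modhom_closed[OF actD(1)] modhom_closed[OF actD(2)] by auto

lemma act_balanced: "x \<in> carrier X \<Longrightarrow> balanced ground A (opp A) X (\<lambda>a b. l a (r x b))"
proof (rule balanced_groundI)
  fix a assume x: "x \<in> carrier X" and a: "a \<in> carrier A"
  have "(\<lambda>b. l a (r x b)) \<in> klin A X" using modhom_comp[OF actD(2)[OF x] actD(3)[OF a]] .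
  then show "(\<lambda>b. l a (r x b)) \<in> klin (opp A) X" by (auto simp: LinearCombinations.module_hom_def)
next
  fix b assume x: "x \<in> carrier X" and "b \<in> carrier (opp A)"
  then show "(\<lambda>a. l a (r x b)) \<in> klin A X" using act_closed by (intro actD(1)) simp
qed

lemma bimodule_smult: "t \<odot>\<^bsub>bimodule X l r\<^esub> x = tensor_lift X (\<lambda>a b. l a (r x b)) t"
  by (simp add: bimodule_def)

lemma act_klin: "x \<in> carrier X \<Longrightarrow> (\<lambda>t. t \<odot>\<^bsub>bimodule X l r\<^esub> x) \<in> klin E.T X"
  unfolding bimodule_smult by (rule E.tensor_lift_klin[OF X.kspace_axioms act_balanced])

lemma bimodule_pure: "a \<in> carrier A \<Longrightarrow> b \<in> carrier A \<Longrightarrow> x \<in> carrier X \<Longrightarrow>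
    E.pt a b \<odot>\<^bsub>bimodule X l r\<^esub> x = l a (r x b)"
  unfolding bimodule_smult using E.tensor_lift_pure[OF X.kspace_axioms act_balanced] by simp

text \<open>Associativity is reduced to pure tensors, first in \<open>s\<close> and then in
  \<open>t\<close>. There the second factors multiply in the opposite algebra, which fits
  \<open>r\<close> being a right action.\<close>

lemma left_module_bimodule: "left_module \<E> (bimodule X l r)"
proof -
  let ?M = "bimodule X l r"
  have ag: "abelian_group ?M"
    by (rule abelian_group_transport[OF X.abelian_group_axioms, of "\<lambda>x. x"]) auto
  have cl: "t \<odot>\<^bsub>?M\<^esub> x \<in> carrier X" if "t \<in> carrier E.T" "x \<in> carrier X" for t x
    using modhom_closed[OF act_klin that(1)] that(2) by simp
  show ?thesis
  proof (intro left_module.intro EE.ring_axioms ag left_module_axioms.intro)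
    fix s x assume s: "s \<in> carrier \<E>" and x: "x \<in> carrier ?M"
    show "s \<odot>\<^bsub>?M\<^esub> x \<in> carrier ?M" using cl s x by (simp add: carrier_env)
    fix t assume t: "t \<in> carrier \<E>"
    show "(s \<oplus>\<^bsub>\<E>\<^esub> t) \<odot>\<^bsub>?M\<^esub> x = s \<odot>\<^bsub>?M\<^esub> x \<oplus>\<^bsub>?M\<^esub> t \<odot>\<^bsub>?M\<^esub> x"
      using modhom_add[OF act_klin] s t x by (simp add: enveloping_eq)
    have s': "s \<in> carrier E.T" and t': "t \<in> carrier E.T" and x': "x \<in> carrier X"
      using s t x by (auto simp: carrier_env)
    have "(s \<otimes>\<^bsub>E.TA\<^esub> t) \<odot>\<^bsub>?M\<^esub> x = s \<odot>\<^bsub>?M\<^esub> (t \<odot>\<^bsub>?M\<^esub> x)"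
    proof (rule E.klin_eqI[OF X.kspace_axioms _ _ _ s'])
      show "(\<lambda>s. (s \<otimes>\<^bsub>E.TA\<^esub> t) \<odot>\<^bsub>?M\<^esub> x) \<in> klin E.T X"
        using modhom_comp[OF E.mult_klin_left[OF t'] act_klin[OF x']] .
      show "(\<lambda>s. s \<odot>\<^bsub>?M\<^esub> (t \<odot>\<^bsub>?M\<^esub> x)) \<in> klin E.T X" using cl t' x' by (intro act_klin)
      fix a b assume "a \<in> carrier A" "b \<in> carrier (opp A)"
      then have ab: "a \<in> carrier A" "b \<in> carrier A" by auto
      have "(E.pt a b \<otimes>\<^bsub>E.TA\<^esub> t) \<odot>\<^bsub>?M\<^esub> x = l a (r (t \<odot>\<^bsub>?M\<^esub> x) b)"
      proof (rule E.klin_eqI[OF X.kspace_axioms _ _ _ t'])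
        show "(\<lambda>t. (E.pt a b \<otimes>\<^bsub>E.TA\<^esub> t) \<odot>\<^bsub>?M\<^esub> x) \<in> klin E.T X"
          using modhom_comp[OF E.mult_klin_right act_klin[OF x']] ab by simp
        show "(\<lambda>t. l a (r (t \<odot>\<^bsub>?M\<^esub> x) b)) \<in> klin E.T X"
          using modhom_comp[OF modhom_comp[OF act_klin[OF x'] actD(4)[OF ab(2)]] actD(3)[OF ab(1)]] .
        fix a' b' assume "a' \<in> carrier A" "b' \<in> carrier (opp A)"
        then have ab': "a' \<in> carrier A" "b' \<in> carrier A" by auto
        show "(E.pt a b \<otimes>\<^bsub>E.TA\<^esub> E.pt a' b') \<odot>\<^bsub>?M\<^esub> x = l a (r (E.pt a' b' \<odot>\<^bsub>?M\<^esub> x) b)"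
          using ab ab' x' act_closed by (simp add: E.mult_pt bimodule_pure actD(7-9))
      qed
      then show "(E.pt a b \<otimes>\<^bsub>E.TA\<^esub> t) \<odot>\<^bsub>?M\<^esub> x = E.pt a b \<odot>\<^bsub>?M\<^esub> (t \<odot>\<^bsub>?M\<^esub> x)"
        using ab cl t' x' by (simp add: bimodule_pure)
    qed
    then show "(s \<otimes>\<^bsub>\<E>\<^esub> t) \<odot>\<^bsub>?M\<^esub> x = s \<odot>\<^bsub>?M\<^esub> (t \<odot>\<^bsub>?M\<^esub> x)" by (simp add: enveloping_eq)
  next
    fix s x y assume "s \<in> carrier \<E>" and xy: "x \<in> carrier ?M" "y \<in> carrier ?M"
    then have s: "s \<in> carrier E.T" and x: "x \<in> carrier X" and y: "y \<in> carrier X" by (auto simp: carrier_env)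
    have "s \<odot>\<^bsub>?M\<^esub> (x \<oplus>\<^bsub>X\<^esub> y) = s \<odot>\<^bsub>?M\<^esub> x \<oplus>\<^bsub>X\<^esub> s \<odot>\<^bsub>?M\<^esub> y"
    proof (rule E.klin_eqI[OF X.kspace_axioms _ _ _ s])
      show "(\<lambda>s. s \<odot>\<^bsub>?M\<^esub> (x \<oplus>\<^bsub>X\<^esub> y)) \<in> klin E.T X" using x y by (intro act_klin) simp
      show "(\<lambda>s. s \<odot>\<^bsub>?M\<^esub> x \<oplus>\<^bsub>X\<^esub> s \<odot>\<^bsub>?M\<^esub> y) \<in> klin E.T X"
        using E.klin_add[OF X.kspace_axioms act_klin act_klin] x y by simp
      fix a b assume "a \<in> carrier A" "b \<in> carrier (opp A)"
      then show "E.pt a b \<odot>\<^bsub>?M\<^esub> (x \<oplus>\<^bsub>X\<^esub> y) = E.pt a b \<odot>\<^bsub>?M\<^esub> x \<oplus>\<^bsub>X\<^esub> E.pt a b \<odot>\<^bsub>?M\<^esub> y"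
        using x y act_closed by (simp add: bimodule_pure modhom_add[OF actD(3)] modhom_add[OF actD(4)])
    qed
    then show "s \<odot>\<^bsub>?M\<^esub> (x \<oplus>\<^bsub>?M\<^esub> y) = s \<odot>\<^bsub>?M\<^esub> x \<oplus>\<^bsub>?M\<^esub> s \<odot>\<^bsub>?M\<^esub> y" by simp
  next
    fix x assume "x \<in> carrier ?M"
    then show "\<one>\<^bsub>\<E>\<^esub> \<odot>\<^bsub>?M\<^esub> x = x" by (simp add: enveloping_eq bimodule_pure actD(5,6))
  qed
qed

text \<open>The unit of the enveloping algebra is the pure tensor of two units and acts as the
  identity. The lemma carries finite-dimensionality from \<open>X\<close> to the bimodule.\<close>

lemma bimodule_scalar:
  assumes "x \<in> carrier X" shows "(k \<odot>\<^bsub>\<E>\<^esub> \<one>\<^bsub>\<E>\<^esub>) \<odot>\<^bsub>bimodule X l r\<^esub> x = k \<odot>\<^bsub>X\<^esub> x"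
  using assms klin_smult[OF act_klin[OF assms], of "E.pt \<one> \<one>" k]
  by (simp add: enveloping_eq bimodule_pure actD(5,6))

lemma fd_module_bimodule:
  assumes "fdspace X" shows "fd_module \<E> (bimodule X l r)"
proof -
  have "(\<lambda>x. x) \<in> klin X (restrict_scalars \<E> (bimodule X l r))"
    by (rule modhomI) (auto simp: bimodule_scalar)
  moreover have "bij_betw (\<lambda>x. x) (carrier X) (carrier (restrict_scalars \<E> (bimodule X l r)))"
    by (simp add: bij_betw_def)
  ultimately have "fdspace (restrict_scalars \<E> (bimodule X l r))"
    using fdspace_bij(1)[OF assms EE.kspace_restrict_scalars[OF left_module_bimodule]] by blast
  then show ?thesis using left_module_bimodule by (simp add: EE.fdspace_restrict_scalars)
qed

end

text \<open>The isomorphism of the enveloping algebra with its opposite. \<open>tor\<close> takes a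
  module over the opposite algebra as first argument; along \<open>swap\<close> it becomes a
  bimodule again.\<close>

definition swap :: "('k, 'a) env \<Rightarrow> ('k, 'a) env" where
  "swap = tensor_lift (opp \<E>) (\<lambda>a b. E.pt b a)"

lemma swap_balanced: "balanced ground A (opp A) (opp \<E>) (\<lambda>a b. E.pt b a)"
proof (rule balanced_groundI)
  fix a assume "a \<in> carrier A"
  then have "(\<lambda>b. E.pt b a) \<in> klin A E.T" by (intro E.pt_klin_left) simp
  then show "(\<lambda>b. E.pt b a) \<in> klin (opp A) (opp \<E>)"
    by (auto simp: LinearCombinations.module_hom_def enveloping_eq)
next
  fix b assume "b \<in> carrier (opp A)"
  then have "(\<lambda>a. E.pt b a) \<in> klin (opp A) E.T" by (intro E.pt_klin_right) simp
  then show "(\<lambda>a. E.pt b a) \<in> klin A (opp \<E>)"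
    by (auto simp: LinearCombinations.module_hom_def enveloping_eq)
qed

lemma kspace_opp_env: "kspace (opp \<E>)"
  using EE.k_algebra_opp by (simp add: k_algebra_def kspace_iff)

lemma klin_opp_env: "klin V (opp \<E>) = klin V E.T"
  by (auto simp: LinearCombinations.module_hom_def enveloping_eq)

lemma swap_klin: "swap \<in> klin E.T E.T"
  using E.tensor_lift_klin[OF kspace_opp_env swap_balanced] by (simp add: swap_def klin_opp_env)

lemma swap_pt: "a \<in> carrier A \<Longrightarrow> b \<in> carrier A \<Longrightarrow> swap (E.pt a b) = E.pt b a"
  unfolding swap_def using E.tensor_lift_pure[OF kspace_opp_env swap_balanced] by simp

lemma alg_iso_swap: "alg_iso \<E> (opp \<E>) swap"
proof -
  have ss: "swap (swap t) = t" if "t \<in> carrier E.T" for t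
    by (rule E.klin_eqI[OF E.T.kspace_axioms modhom_comp[OF swap_klin swap_klin] modhom_id _ that])
      (simp add: swap_pt)
  have "bij_betw swap (carrier E.T) (carrier E.T)"
    by (rule bij_betwI[where g = swap]) (use modhom_closed[OF swap_klin] ss in auto)
  moreover have "swap (s \<otimes>\<^bsub>E.TA\<^esub> t) = swap s \<otimes>\<^bsub>opp \<E>\<^esub> swap t" if "s \<in> carrier E.T" "t \<in> carrier E.T" for s t
    unfolding swap_def
    by (rule E.alg_hom_lift[OF EE.k_algebra_opp swap_balanced _ that]) (simp add: enveloping_eq E.mult_pt)
  moreover have "swap \<in> klin \<E> (opp \<E>)"
    unfolding klin_opp_env using swap_klin by (simp add: enveloping_eq)
  ultimately show ?thesis by (simp add: alg_iso_def enveloping_eq swap_pt)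
qed

end

lemma finsum_opp [simp]: "finsum (opp L) = finsum L"
  by (intro ext) (simp add: finsum_def finprod_def)

lemma frobenius_opp:
  assumes "frobenius L I b c lam" shows "frobenius (opp L) I c b lam"
proof -
  interpret frobenius L I b c lam by fact
  have k: "kalgebra (opp L)" by unfold_locales (rule k_algebra_opp)
  show ?thesis
  proof (intro frobenius.intro k frobenius_axioms.intro)
    show "lam \<in> klin (opp L) ground" using lam_linear by (auto simp: LinearCombinations.module_hom_def)
  qed (use finite_I b_closed c_closed expand_b expand_c in auto)
qed

lemma alg_iso_opp: "alg_iso L L' \<phi> \<Longrightarrow> alg_iso (opp L) (opp L') \<phi>"
  by (auto simp: alg_iso_def LinearCombinations.module_hom_def)

lemma alg_iso_id: "alg_iso L L (\<lambda>x. x)"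
  by (auto simp: alg_iso_def modhom_id bij_betw_def)

lemma alg_iso_comp: "alg_iso L L' \<phi> \<Longrightarrow> alg_iso L' L'' \<psi> \<Longrightarrow> alg_iso L L'' (\<lambda>x. \<psi> (\<phi> x))"
  using bij_betw_trans[of \<phi> "carrier L" "carrier L'" \<psi> "carrier L''"]
  by (auto simp: alg_iso_def modhom_comp comp_def modhom_closed)

lemma alg_iso_funpow: "alg_iso L L \<phi> \<Longrightarrow> alg_iso L L (\<phi> ^^ n)"
  by (induction n) (use alg_iso_id alg_iso_comp in \<open>auto simp: comp_def id_def\<close>)

section \<open>Twisted bimodules\<close>

context env
begin

abbreviation tw :: "('a \<Rightarrow> 'a) \<Rightarrow> (('k, 'a) env, 'a) module" where
  "tw \<equiv> twisted_bimodule A"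

lemma tw_actions:
  assumes "alg_iso A A \<phi>"
  shows "bimod_actions A (\<lambda>a x. a \<otimes> x) (\<lambda>x b. x \<otimes> \<phi> b)"
proof -
  note p = alg_isoD[OF assms]
  have "(\<lambda>a. a \<otimes> x) \<in> klin A A" "(\<lambda>b. x \<otimes> \<phi> b) \<in> klin A A" "(\<otimes>) x \<in> klin A A" "(\<lambda>y. y \<otimes> \<phi> x) \<in> klin A A"
    if "x \<in> carrier A" for x
    using that by (auto intro!: modhomI simp: p(3-5) modhom_add[OF p(1)] klin_smult[OF p(1)] l_distr r_distr
        smult_mult_left smult_mult_right)
  moreover have "\<one> \<otimes> x = x" "x \<otimes> \<phi> \<one> = x" if "x \<in> carrier A" for x using that by (simp_all add: p(3))
  moreover have "(a \<otimes> b) \<otimes> x = a \<otimes> (b \<otimes> x)" "x \<otimes> \<phi> (a \<otimes> b) = (x \<otimes> \<phi> a) \<otimes> \<phi> b"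
    "a \<otimes> (x \<otimes> \<phi> b) = (a \<otimes> x) \<otimes> \<phi> b"
    if "a \<in> carrier A" "b \<in> carrier A" "x \<in> carrier A" for a b x
    using that by (simp_all add: p(4,5) m_assoc)
  ultimately show ?thesis
    unfolding bimod_actions_def by (intro conjI ballI kspace_axioms) assumption+
qed

lemma tw_simps [simp]: "carrier (tw \<phi>) = carrier A" "zero (tw \<phi>) = zero A" "add (tw \<phi>) = add A"
  by (simp_all add: twisted_bimodule_def)

lemma
  assumes "alg_iso A A \<phi>"
  shows left_module_tw: "left_module \<E> (tw \<phi>)"
    and fd_module_tw: "fdspace A \<Longrightarrow> fd_module \<E> (tw \<phi>)"
    and tw_pure: "\<lbrakk>a \<in> carrier A; b \<in> carrier A; x \<in> carrier A\<rbrakk> \<Longrightarrow> E.pt a b \<odot>\<^bsub>tw \<phi>\<^esub> x = a \<otimes> (x \<otimes> \<phi> b)"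
  unfolding twisted_bimodule_def
  using left_module_bimodule[OF tw_actions[OF assms]] fd_module_bimodule[OF tw_actions[OF assms]]
    bimodule_pure[OF tw_actions[OF assms]] by simp_all

lemma regular_eq_tw: "regular_bimodule A = tw (\<lambda>b. b)"
  by (simp add: regular_bimodule_def twisted_bimodule_def)

text \<open>\<open>f\<close> is multiplicative with f \<alpha> = id and f \<beta> = \<phi>, hence
  f(\<alpha>(a) x \<beta>(b)) = a f(x) \<phi>(b): a twist on the left is moved to the right.\<close>

lemma lmod_iso_tw:
  assumes M: "left_module \<E> M" "carrier M = carrier A" "add M = add A"
    and pure: "\<And>a b x. \<lbrakk>a \<in> carrier A; b \<in> carrier A; x \<in> carrier A\<rbrakk> \<Longrightarrow>
      E.pt a b \<odot>\<^bsub>M\<^esub> x = \<alpha> a \<otimes> (x \<otimes> \<beta> b)"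
    and ab: "\<And>a. a \<in> carrier A \<Longrightarrow> \<alpha> a \<in> carrier A" "\<And>a. a \<in> carrier A \<Longrightarrow> \<beta> a \<in> carrier A"
    and f: "alg_iso A A f" "\<And>a. a \<in> carrier A \<Longrightarrow> f (\<alpha> a) = a"
    and \<phi>: "alg_iso A A \<phi>" "\<And>a. a \<in> carrier A \<Longrightarrow> f (\<beta> a) = \<phi> a"
  shows "lmod_iso \<E> M (tw \<phi>)"
proof -
  note fD = alg_isoD[OF f(1)]
  have "f \<in> module_hom \<E> M (tw \<phi>)"
    by (rule env_homI[OF M(1) left_module_tw[OF \<phi>(1)]])
      (auto simp: M pure tw_pure[OF \<phi>(1)] fD modhom_add[OF fD(1)] ab f(2) \<phi>(2))
  then show ?thesis using fD(2) by (auto simp: lmod_iso_def M)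
qed

definition dl :: "'a \<Rightarrow> ('a \<Rightarrow> 'k) \<Rightarrow> 'a \<Rightarrow> 'k" where "dl a f = (\<lambda>x\<in>carrier A. f (x \<otimes> a))"
definition dr :: "('a \<Rightarrow> 'k) \<Rightarrow> 'a \<Rightarrow> 'a \<Rightarrow> 'k" where "dr f b = (\<lambda>x\<in>carrier A. f (b \<otimes> x))"

lemma dual_bimodule_eq: "dual_bimodule A = bimodule (dual A) dl dr"
proof -
  have "dl = (\<lambda>a f. \<lambda>x\<in>carrier A. f (x \<otimes> a))" "dr = (\<lambda>f b. \<lambda>x\<in>carrier A. f (b \<otimes> x))"
    by (auto simp: dl_def dr_def fun_eq_iff)
  then show ?thesis by (simp add: dual_bimodule_def)
qed

lemma dual_simps:
  "carrier (dual A) = klin A ground \<inter> extensional (carrier A)"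
  "zero (dual A) = (\<lambda>x\<in>carrier A. 0)"
  "add (dual A) = (\<lambda>f g. \<lambda>x\<in>carrier A. f x + g x)"
  "smult (dual A) = (\<lambda>c f. \<lambda>x\<in>carrier A. c * f x)"
  by (simp_all add: dual_def)

lemma dl_dr_closed:
  assumes "f \<in> carrier (dual A)" "a \<in> carrier A"
  shows "dl a f \<in> carrier (dual A)" "dr f a \<in> carrier (dual A)"
proof -
  have f: "f \<in> klin A ground" using assms(1) by (simp add: dual_simps)
  have "(\<lambda>x. f (x \<otimes> a)) \<in> module_hom ground A ground" "(\<lambda>x. f (a \<otimes> x)) \<in> module_hom ground A ground"
    using assms(2) by (auto intro!: modhomI simp: l_distr r_distr modhom_add[OF f] klin_smult[OF f]
        smult_mult_left smult_mult_right)
  then show "dl a f \<in> carrier (dual A)" "dr f a \<in> carrier (dual A)"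
    using modhom_restrict[of ground A _ ground] kspace_axioms by (auto simp: dual_simps dl_def dr_def)
qed

lemma dual_actions: "bimod_actions (dual A) dl dr"
proof -
  have fD: "f (x \<oplus> y) = f x + f y" "f (c \<odot> x) = c * f x"
    if "f \<in> carrier (dual A)" "x \<in> carrier A" "y \<in> carrier A" for f x y c
    using that modhom_add[of f class_ring A ground] klin_smult[of f A ground] by (auto simp: dual_simps)
  have lin: "(\<lambda>a. dl a f) \<in> klin A (dual A)" "dr f \<in> klin A (dual A)" if f: "f \<in> carrier (dual A)" for f
    using f by (auto intro!: modhomI dl_dr_closed simp: dual_simps(3,4))
      (auto intro!: restrict_ext simp: dl_def dr_def l_distr r_distr fD smult_mult_left smult_mult_right)
  have lin': "dl a \<in> klin (dual A) (dual A)" "(\<lambda>f. dr f a) \<in> klin (dual A) (dual A)" if a: "a \<in> carrier A" for a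
    using a by (auto intro!: modhomI dl_dr_closed simp: dual_simps(3,4))
      (auto intro!: restrict_ext simp: dl_def dr_def)
  have one: "dl \<one> f = f" "dr f \<one> = f" if "f \<in> carrier (dual A)" for f
    using that by (auto simp: dl_def dr_def dual_simps intro!: extensionalityI[where A = "carrier A"])
  have "dl (a \<otimes> b) f = dl a (dl b f)" "dr f (a \<otimes> b) = dr (dr f a) b" "dl a (dr f b) = dr (dl a f) b"
    if "a \<in> carrier A" "b \<in> carrier A" for a b f
    using that by (auto simp: dl_def dr_def m_assoc intro!: restrict_ext)
  then show ?thesis
    unfolding bimod_actions_def by (intro conjI ballI kspace_dual[OF kspace_axioms] lin lin' one) assumption+
qed

lemma left_module_dual: "left_module \<E> (dual_bimodule A)"
  and dual_pure: "\<lbrakk>a \<in> carrier A; b \<in> carrier A; f \<in> carrier (dual A)\<rbrakk> \<Longrightarrow>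
    E.pt a b \<odot>\<^bsub>dual_bimodule A\<^esub> f = dl a (dr f b)"
  unfolding dual_bimodule_eq
  using left_module_bimodule[OF dual_actions] bimodule_pure[OF dual_actions] by simp_all

lemma fd_module_dual: "fdspace A \<Longrightarrow> fd_module \<E> (dual_bimodule A)"
  unfolding dual_bimodule_eq using fd_module_bimodule[OF dual_actions] fdspace_dual by blast

end

locale nakayama_env = env A for A :: "('k::field, 'a) module" (structure) +
  fixes \<nu> :: "'a \<Rightarrow> 'a"
  assumes fdA: "fdspace A" and nakayama_nu: "nakayama_automorphism A \<nu>"
begin

lemma nu: "alg_iso A A \<nu>"
  using nakayama_nu unfolding nakayama_automorphism_def alg_iso_def ring_iso_def
  by (auto simp: ring_hom_one ring_hom_mult)

definition \<nu>' :: "'a \<Rightarrow> 'a" where "\<nu>' = inv_into (carrier A) \<nu>"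

lemma nu': "alg_iso A A \<nu>'"
  unfolding \<nu>'_def using k_algebra nu by (rule alg_iso_inv)

lemmas nuD = alg_isoD[OF nu]
lemmas nu'D = alg_isoD[OF nu']
lemmas nu_inv = bij_betw_inv_into_simps[OF nuD(2), folded \<nu>'_def]

text \<open>The functional corresponding to the unit under \<open>DA \<cong> \<^sub>1A\<^sub>\<nu>\<close> is a Frobenius form.\<close>

lemma frobenius_form:
  obtains I :: "'a set" and c lam where "frobenius A I (\<lambda>e. e) c lam"
    "\<And>x y. x \<in> carrier A \<Longrightarrow> y \<in> carrier A \<Longrightarrow> lam (x \<otimes> y) = lam (y \<otimes> \<nu> x)"
proof -
  have iso: "lmod_iso \<E> (dual_bimodule A) (tw \<nu>)" using nakayama_nu by (simp add: nakayama_automorphism_def)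
  from EE.lmod_iso_sym[OF left_module_dual iso] obtain g where
    g: "g \<in> module_hom \<E> (tw \<nu>) (dual_bimodule A)" "bij_betw g (carrier A) (carrier (dual A))"
    by (auto simp: lmod_iso_def dual_bimodule_eq)
  define lam where "lam = g \<one>"
  have lamD: "lam \<in> carrier (dual A)" using g(2) by (auto simp: lam_def bij_betw_def)
  then have lam: "lam \<in> klin A ground" by (simp add: dual_simps)
  have gact: "g (a \<otimes> (x \<otimes> \<nu> b)) = dl a (dr (g x) b)" if "a \<in> carrier A" "b \<in> carrier A" "x \<in> carrier A" for a b x
  proof -
    have "g (E.pt a b \<odot>\<^bsub>tw \<nu>\<^esub> x) = E.pt a b \<odot>\<^bsub>dual_bimodule A\<^esub> g x"
      using modhom_smult[OF g(1)] that by (simp add: carrier_env)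
    moreover have "g x \<in> carrier (dual A)" using g(2) that by (auto simp: bij_betw_def)
    ultimately show ?thesis using that by (simp add: tw_pure[OF nu] dual_pure)
  qed
  have g1: "g a = (\<lambda>x\<in>carrier A. lam (x \<otimes> a))" if a: "a \<in> carrier A" for a
  proof -
    have "g a = dl a (dr lam \<one>)" using gact[OF a, of \<one> \<one>] a by (simp add: nuD(3) lam_def)
    also have "\<dots> = (\<lambda>x\<in>carrier A. lam (x \<otimes> a))" using a unfolding dl_def dr_def by (intro restrict_ext) simp
    finally show ?thesis .
  qed
  have g2: "g (\<nu> b) = (\<lambda>x\<in>carrier A. lam (b \<otimes> x))" if b: "b \<in> carrier A" for b
  proof -
    have "g (\<nu> b) = dl \<one> (dr lam b)" using gact[of \<one> b \<one>] b nuD(5)[OF b] by (simp add: lam_def)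
    also have "\<dots> = (\<lambda>x\<in>carrier A. lam (b \<otimes> x))" using b unfolding dl_def dr_def by (intro restrict_ext) simp
    finally show ?thesis .
  qed
  \<comment> \<open>\<open>g (\<nu> x)\<close> is computed in two ways: as \<nu>(x) acting on g(1)
    from the left, and as x acting on g(1) from the right, since the unit times x in the twisted
    bimodule is \<nu>(x).\<close>
  have sym: "lam (x \<otimes> y) = lam (y \<otimes> \<nu> x)" if "x \<in> carrier A" "y \<in> carrier A" for x y
    using g1[OF nuD(5)[OF that(1)]] g2[OF that(1)] that(2) by (metis restrict_apply')
  have cancel: "x = y" if "x \<in> carrier A" "y \<in> carrier A" "\<And>z. z \<in> carrier A \<Longrightarrow> lam (z \<otimes> x) = lam (z \<otimes> y)" for x y
  proof -
    have "g x = g y" unfolding g1[OF that(1)] g1[OF that(2)] by (rule restrict_ext) (rule that(3))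
    then show ?thesis using g(2) that(1,2) by (auto simp: bij_betw_def inj_on_def)
  qed
  obtain B \<xi> where "coord_system A B \<xi>" using coord_system_exists[OF fdA] .
  note B = coord_systemD[OF this]
  have BA: "e \<in> carrier A" if "e \<in> B" for e using subsetD[OF B(2) that] .
  \<comment> \<open>Surjectivity of \<open>g\<close> represents each coordinate functional by the
    form; the representing elements are the dual basis.\<close>
  have "\<forall>e\<in>B. \<exists>a\<in>carrier A. \<forall>x\<in>carrier A. \<xi> e x = lam (x \<otimes> a)"
  proof
    fix e assume e: "e \<in> B"
    have "restrict (\<xi> e) (carrier A) \<in> carrier (dual A)"
      using modhom_restrict[of ground A "\<xi> e" ground] B(4)[OF e] kspace_axioms by (simp add: dual_simps)
    then obtain a where a: "a \<in> carrier A" "restrict (\<xi> e) (carrier A) = g a"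
      using g(2) unfolding bij_betw_def by blast
    have "\<xi> e x = lam (x \<otimes> a)" if "x \<in> carrier A" for x
      using fun_cong[OF a(2), of x] that by (simp add: g1[OF a(1)])
    then show "\<exists>a\<in>carrier A. \<forall>x\<in>carrier A. \<xi> e x = lam (x \<otimes> a)" using a(1) by blast
  qed
  then obtain c where c: "\<And>e. e \<in> B \<Longrightarrow> c e \<in> carrier A"
    "\<And>e x. e \<in> B \<Longrightarrow> x \<in> carrier A \<Longrightarrow> \<xi> e x = lam (x \<otimes> c e)" by metis
  have "frobenius A B (\<lambda>e. e) c lam"
  proof (intro frobenius.intro kalgebra_axioms frobenius_axioms.intro B(1) c(1) BA lam)
    fix x assume x: "x \<in> carrier A"
    show expand: "x = (\<Oplus>e\<in>B. lam (x \<otimes> c e) \<odot> e)" if "x \<in> carrier A" for x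
    proof -
      have "x = (\<Oplus>e\<in>B. \<xi> e x \<odot> e)" by (rule B(5)[OF that])
      also have "\<dots> = (\<Oplus>e\<in>B. lam (x \<otimes> c e) \<odot> e)" using c that BA by (intro finsum_cong') auto
      finally show ?thesis .
    qed
    \<comment> \<open>By \<open>cancel\<close> it suffices to apply lam(z -) to both sides, and then
      the claim is the first expansion for z.\<close>
    show "x = (\<Oplus>e\<in>B. lam (e \<otimes> x) \<odot> c e)"
    proof (rule cancel[OF x])
      show s: "(\<Oplus>e\<in>B. lam (e \<otimes> x) \<odot> c e) \<in> carrier A" using c(1) by (intro finsum_closed) auto
      fix z assume z: "z \<in> carrier A"
      have lm: "(\<lambda>y. lam (y \<otimes> x)) \<in> klin A ground" "(\<lambda>y. lam (z \<otimes> y)) \<in> klin A ground"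
        using x z by (auto intro!: modhomI simp: l_distr r_distr modhom_add[OF lam] klin_smult[OF lam]
            smult_mult_left smult_mult_right)
      have "lam (z \<otimes> x) = lam ((\<Oplus>e\<in>B. lam (z \<otimes> c e) \<odot> e) \<otimes> x)" using expand[OF z] by simp
      also have "\<dots> = (\<Oplus>\<^bsub>ground\<^esub>e\<in>B. lam ((lam (z \<otimes> c e) \<odot> e) \<otimes> x))"
        using BA by (intro modhom_finsum[OF abelian_group_axioms kspace.axioms(1)[OF kspace_ground] lm(1)]) auto
      also have "\<dots> = (\<Oplus>\<^bsub>ground\<^esub>e\<in>B. lam (z \<otimes> (lam (e \<otimes> x) \<odot> c e)))"
        using BA c(1) x z
        by (auto simp: smult_mult_left smult_mult_right klin_smult[OF lam] mult.commute intro!: sum.cong)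
      also have "\<dots> = lam (z \<otimes> (\<Oplus>e\<in>B. lam (e \<otimes> x) \<odot> c e))"
        using c(1) by (intro modhom_finsum[OF abelian_group_axioms kspace.axioms(1)[OF kspace_ground] lm(2), symmetric]) auto
      finally show "lam (z \<otimes> x) = lam (z \<otimes> (\<Oplus>e\<in>B. lam (e \<otimes> x) \<odot> c e))" .
    qed
  qed
  with sym show ?thesis by (rule that[rotated])
qed

text \<open>Passing to the opposite algebra inverts the Nakayama automorphism, hence \<nu>^-1 in the
  second factor.\<close>

definition \<sigma> where "\<sigma> = E.tmap \<nu> \<nu>'"

lemma nakayama_enveloping:
  obtains I :: "('a \<times> 'a) set" and b c lam where "nakayama \<E> I b c lam \<sigma>"
proof -
  obtain I :: "'a set" and c lam where F: "frobenius A I (\<lambda>e. e) c lam"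
    and sym: "\<And>x y. x \<in> carrier A \<Longrightarrow> y \<in> carrier A \<Longrightarrow> lam (x \<otimes> y) = lam (y \<otimes> \<nu> x)"
    using frobenius_form by blast
  interpret F: frobenius A I "\<lambda>e. e" c lam by fact
  note FE = E.frobenius_TA[OF F frobenius_opp[OF F]]
  interpret FE: frobenius E.TA "I \<times> I" "\<lambda>p. E.pt (fst p) (c (snd p))" "\<lambda>p. E.pt (c (fst p)) (snd p)"
    "tensor_lift ground (\<lambda>x y. lam x * lam y)" by (rule FE)
  let ?L = "tensor_lift ground (\<lambda>x y. lam x * lam y)"
  have lo: "lam \<in> klin (opp A) ground" using F.lam_linear by (auto simp: LinearCombinations.module_hom_def)
  have bal: "balanced ground A (opp A) ground (\<lambda>x y. lam x * lam y)"
    by (rule balanced_groundI)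
      (auto intro!: modhomI simp: modhom_add[OF F.lam_linear] klin_smult[OF F.lam_linear] algebra_simps)
  have L: "?L \<in> klin E.T ground" by (rule E.tensor_lift_klin[OF kspace_ground bal])
  have Lp: "?L (E.pt x y) = lam x * lam y" if "x \<in> carrier A" "y \<in> carrier A" for x y
    using E.tensor_lift_pure[OF kspace_ground bal] that by simp
  have s: "alg_iso E.TA E.TA \<sigma>" unfolding \<sigma>_def by (rule E.alg_iso_tmap[OF nu alg_iso_opp[OF nu']])
  have sk: "\<sigma> \<in> klin E.T E.T" using alg_isoD(1)[OF s] by simp
  have spt: "\<sigma> (E.pt a b) = E.pt (\<nu> a) (\<nu>' b)" if "a \<in> carrier A" "b \<in> carrier A" for a b
    unfolding \<sigma>_def using E.tmap_pt[OF nuD(1) alg_isoD(1)[OF alg_iso_opp[OF nu']]] that by simp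
  have "nakayama E.TA (I \<times> I) (\<lambda>p. E.pt (fst p) (c (snd p))) (\<lambda>p. E.pt (c (fst p)) (snd p)) ?L \<sigma>"
  proof (intro nakayama.intro FE.frobenius_axioms nakayama_axioms.intro s)
    fix x y assume "x \<in> carrier E.TA" "y \<in> carrier E.TA"
    then have x: "x \<in> carrier E.T" and y: "y \<in> carrier E.T" by auto
    show "?L (x \<otimes>\<^bsub>E.TA\<^esub> y) = ?L (y \<otimes>\<^bsub>E.TA\<^esub> \<sigma> x)"
    proof (rule E.klin_eqI[OF kspace_ground modhom_comp[OF E.mult_klin_left[OF y] L]
          modhom_comp[OF sk modhom_comp[OF E.mult_klin_right[OF y] L]] _ x])
      fix a b assume "a \<in> carrier A" "b \<in> carrier (opp A)"
      then have ab: "a \<in> carrier A" "b \<in> carrier A" by auto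
      have pab: "E.pt a b \<in> carrier E.T" "\<sigma> (E.pt a b) \<in> carrier E.T" using ab modhom_closed[OF sk] by auto
      show "?L (E.pt a b \<otimes>\<^bsub>E.TA\<^esub> y) = ?L (y \<otimes>\<^bsub>E.TA\<^esub> \<sigma> (E.pt a b))"
      proof (rule E.klin_eqI[OF kspace_ground modhom_comp[OF E.mult_klin_right[OF pab(1)] L]
            modhom_comp[OF E.mult_klin_left[OF pab(2)] L] _ y])
        fix a' b' assume "a' \<in> carrier A" "b' \<in> carrier (opp A)"
        then have ab': "a' \<in> carrier A" "b' \<in> carrier A" by auto
        \<comment> \<open>The opposite algebra reverses the factors, so the identity for \<nu> is
          used at \<nu>^-1(b).\<close>
        have "lam (b' \<otimes> b) = lam (\<nu>' b \<otimes> b')"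
          using sym[OF nu'D(5)[OF ab(2)] ab'(2)] nu_inv(2)[OF ab(2)] by simp
        then show "?L (E.pt a b \<otimes>\<^bsub>E.TA\<^esub> E.pt a' b') = ?L (E.pt a' b' \<otimes>\<^bsub>E.TA\<^esub> \<sigma> (E.pt a b))"
          using ab ab' sym[OF ab(1) ab'(1)] by (simp add: spt E.mult_pt Lp nuD(5) nu'D(5))
      qed
    qed
  qed
  then show ?thesis unfolding enveloping_eq[symmetric] by (rule that)
qed

definition pw :: "int \<Rightarrow> 'a \<Rightarrow> 'a" where "pw m = aut_power A \<nu> m"

lemma pw: "alg_iso A A (pw m)"
  unfolding pw_def aut_power_def \<nu>'_def[symmetric] using alg_iso_funpow[OF nu] alg_iso_funpow[OF nu'] by simp

lemma omega_power_eq: "omega_power A \<nu> m = tw (pw m)"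
  by (simp add: omega_power_def pw_def)

lemma pw_closed: "x \<in> carrier A \<Longrightarrow> pw m x \<in> carrier A"
  by (rule alg_isoD(5)[OF pw])

text \<open>\<open>aut_power\<close> is defined by cases on the sign of the exponent. The two
  branches meet at m = -1, where m + 1 = 0 falls into the nonnegative one.\<close>

lemma pw_Suc: assumes x: "x \<in> carrier A" shows "pw (m + 1) x = \<nu> (pw m x)"
proof (cases "m \<ge> 0")
  case True
  then have "nat (m + 1) = Suc (nat m)" by simp
  then show ?thesis using True by (simp add: pw_def aut_power_def)
next
  case False
  define j where "j = nat (- m - 1)"
  have j: "nat (- m) = Suc j" using False by (simp add: j_def)
  have pm: "pw m x = \<nu>' ((\<nu>' ^^ j) x)" using False j by (simp add: pw_def aut_power_def \<nu>'_def)
  have pm1: "pw (m + 1) x = (\<nu>' ^^ j) x"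
  proof (cases "m = - 1")
    case True
    then show ?thesis by (simp add: pw_def aut_power_def j_def)
  next
    case m: False
    then have "nat (- (m + 1)) = j" "\<not> m + 1 \<ge> 0" using False by (auto simp: j_def)
    then show ?thesis by (simp add: pw_def aut_power_def \<nu>'_def)
  qed
  have "(\<nu>' ^^ j) x \<in> carrier A" using alg_isoD(5)[OF alg_iso_funpow[OF nu']] x by blast
  then show ?thesis using pm pm1 nu_inv(2) by simp
qed

lemma pw_add: assumes x: "x \<in> carrier A" shows "pw (m + n) x = pw m (pw n x)"
proof (induction m rule: int_induct[where k = 0])
  case base show ?case by (simp add: pw_def[of 0] aut_power_def)
next
  case (step1 i)
  have "pw (i + 1 + n) x = \<nu> (pw (i + n) x)" using pw_Suc[OF x, of "i + n"] by (simp add: algebra_simps)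
  then show ?case using step1 pw_Suc[OF pw_closed[OF x], of i] by simp
next
  case (step2 i)
  have p: "pw j y = \<nu>' (pw (j + 1) y)" if "y \<in> carrier A" for j y
    using pw_Suc[OF that, of j] nu_inv(1)[OF pw_closed[OF that]] by simp
  have "pw (i - 1 + n) x = \<nu>' (pw (i + n) x)" using p[OF x, of "i - 1 + n"] by (simp add: algebra_simps)
  then show ?case using step2 p[OF pw_closed[OF x], of "i - 1" n] by simp
qed

lemma pw_0: "pw 0 x = x" and pw_1: "pw 1 x = \<nu> x"
  by (simp_all add: pw_def aut_power_def)

end

section \<open>Duality for Tate extension groups\<close>

text \<open>The copy with which \<open>Suspension\<close> starts, given by the same choice.\<close>

definition rep :: "('k::field, 'l) module \<Rightarrow> ('l, 'm) module \<Rightarrow> ('k, 'l) umodule" where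
  "rep L V = (SOME W. fd_module L W \<and> lmod_iso L V W)"

context frobenius
begin

text \<open>The second formula is stated at -n-1, which is always negative. Degree 0 belongs to the
  first one, and the duality n \<mapsto> -n-1 exchanges the two without overlap.\<close>

lemma
  assumes V: "fd_module L V"
  shows fd_module_rep: "fd_module L (rep L V)"
    and lmod_iso_rep: "lmod_iso L V (rep L V)" "lmod_iso L (rep L V) V"
    and Suspension_pos: "Suspension L (int n) V = (Cosyzygy L ^^ n) (rep L V)"
    and Suspension_neg: "Suspension L (- int n - 1) V = (Syzygy L ^^ Suc n) (rep L V)"
    and fd_module_Suspension: "fd_module L (Suspension L k V)"
proof -
  have "\<exists>W :: ('k, 'l) umodule. fd_module L W \<and> lmod_iso L V W"
    by (rule umodule_copy[OF V]) blast
  from someI_ex[OF this] show W: "fd_module L (rep L V)" and i: "lmod_iso L V (rep L V)"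
    unfolding rep_def by blast+
  show "lmod_iso L (rep L V) V" by (rule lmod_iso_sym[OF fd_moduleD(1)[OF V] i])
  have "nat (- (- int n - 1)) = Suc n" by simp
  then show "Suspension L (int n) V = (Cosyzygy L ^^ n) (rep L V)"
    "Suspension L (- int n - 1) V = (Syzygy L ^^ Suc n) (rep L V)"
    by (simp_all add: Suspension_def rep_def Let_def del: funpow.simps)
  show "fd_module L (Suspension L k V)"
    using syz_seq_Syzygy[OF W] cosyz_seq_Cosyzygy[OF W]
    by (simp add: Suspension_def rep_def Let_def syz_seq_def cosyz_seq_def)
qed

text \<open>\<open>V\<close> enters \<open>Suspension\<close> only through the class of modules
  isomorphic to it, so the same copy is chosen and the suspensions are equal.\<close>

lemma Suspension_iso:
  assumes V: "fd_module L V" and iso: "lmod_iso L V W"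
  shows "Suspension L n V = Suspension L n W"
proof -
  have "lmod_iso L V X \<longleftrightarrow> lmod_iso L W X" for X :: "('k, 'l) umodule"
    using lmod_iso_trans[OF iso, of X] lmod_iso_trans[OF lmod_iso_sym[OF fd_moduleD(1)[OF V] iso], of X] by blast
  then show ?thesis by (simp add: Suspension_def)
qed

lemma fdspace_tate_ext: "fd_module L U \<Longrightarrow> fd_module L V \<Longrightarrow> fdspace (tate_ext L n U V)"
  unfolding tate_ext_def by (intro fdspace_stable_hom fd_module_Suspension)

lemma kdim_tate_ext: "kdim (tate_ext L n U V) = sdim L U (Suspension L n V)"
  by (simp add: tate_ext_def sdim_def)

end

lemma k_iso_dual: "fdspace V \<Longrightarrow> fdspace W \<Longrightarrow> kdim V = kdim W \<Longrightarrow> k_iso V (dual W)"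
  by (rule k_iso_of_kdim) (simp_all add: fdspace_dual kdim_dual)

lemma (in nakayama) tate_kdim_duality:
  assumes U: "fd_module L U" and V: "fd_module L V" and V2: "fd_module L V2"
    and t: "alg_iso L L \<theta>" and isoU: "lmod_iso L (pull \<theta> V2) U" and isoV: "lmod_iso L (pull \<theta> (pull \<tau> U)) V"
  shows "kdim (tate_ext L (int n) U V) = kdim (tate_ext L (- int n - 1) U V2)"
  unfolding kdim_tate_ext Suspension_pos[OF V] Suspension_neg[OF V2]
  by (rule sdim_duality[OF U V V2 t isoU isoV cosyz_seq_Cosyzygy[OF fd_module_rep[OF V]] _
        syz_seq_Syzygy[OF fd_module_rep[OF V2]]])
    (use lmod_iso_rep(2)[OF V] lmod_iso_rep(2)[OF V2] in simp_all)

context nakayama_env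
begin

abbreviation "\<Omega> m \<equiv> omega_power A \<nu> m"

lemma fd_regular: "fd_module \<E> (regular_bimodule A)"
  unfolding regular_eq_tw by (rule fd_module_tw[OF alg_iso_id fdA])

lemma fd_omega: "fd_module \<E> (\<Omega> m)"
  unfolding omega_power_eq by (rule fd_module_tw[OF pw fdA])

lemma tate_omega_kdim:
  "kdim (tate_ext \<E> (int n) (regular_bimodule A) (\<Omega> m)) =
   kdim (tate_ext \<E> (- int n - 1) (regular_bimodule A) (\<Omega> (2 - m)))"
proof -
  obtain I :: "('a \<times> 'a) set" and b c lam where "nakayama \<E> I b c lam \<sigma>" using nakayama_enveloping .
  then interpret N: nakayama \<E> I b c lam \<sigma> .
  \<comment> \<open>The exponent is the one that turns \<omega>^(2-m) into A.\<close>
  define \<theta> where "\<theta> = E.tmap (\<lambda>x. x) (pw (m - 2))"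
  have t: "alg_iso \<E> \<E> \<theta>"
    unfolding enveloping_eq \<theta>_def by (rule E.alg_iso_tmap[OF alg_iso_id alg_iso_opp[OF pw]])
  interpret T: frobenius_iso \<E> \<E> \<theta> I b c lam by unfold_locales (rule t)
  have tpt: "\<theta> (E.pt a b) = E.pt a (pw (m - 2) b)" if "a \<in> carrier A" "b \<in> carrier A" for a b
    unfolding \<theta>_def
    using E.tmap_pt[OF alg_isoD(1)[OF alg_iso_id] alg_isoD(1)[OF alg_iso_opp[OF pw]]] that by simp
  have inv: "inv_into (carrier A) \<nu>' y = \<nu> y" if "y \<in> carrier A" for y
    using bij_betw_inv_into_simps(1)[OF nu'D(2), of "\<nu> y"] that nuD(5)[OF that] nu_inv(1)[OF that] by simp
  have spt: "N.\<tau> (E.pt a b) = E.pt (\<nu>' a) (\<nu> b)" if "a \<in> carrier A" "b \<in> carrier A" for a b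
    unfolding N.\<tau>_def unfolding \<sigma>_def enveloping_eq
    using E.inv_tmap_pt[OF nu alg_iso_opp[OF nu'], of a b] that inv by (simp add: \<nu>'_def)
  have reg: "left_module \<E> (tw (\<lambda>b. b))" by (rule left_module_tw[OF alg_iso_id])
  have "lmod_iso \<E> (pull \<theta> (\<Omega> (2 - m))) (regular_bimodule A)"
    unfolding regular_eq_tw omega_power_eq
  proof (rule lmod_iso_tw[where f = "\<lambda>x. x" and \<alpha> = "\<lambda>x. x" and \<beta> = "\<lambda>b. pw (2 - m) (pw (m - 2) b)"])
    show "left_module \<E> (pull \<theta> (tw (pw (2 - m))))" by (rule T.left_module_pull[OF left_module_tw[OF pw]])
    show "pw (2 - m) (pw (m - 2) a) = a" if "a \<in> carrier A" for a
      using pw_add[OF that, of "2 - m" "m - 2"] by (simp add: pw_0)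
  qed (simp_all add: tpt pw_closed tw_pure[OF pw] alg_iso_id)
  moreover have "lmod_iso \<E> (pull \<theta> (pull N.\<tau> (regular_bimodule A))) (\<Omega> m)"
    unfolding regular_eq_tw omega_power_eq
  \<comment> \<open>After both pullbacks \<open>a\<close> acts as \<nu>^-1(a) and \<open>b\<close>
    as \<nu>^(m-1)(b). Applying \<nu> removes the left twist and raises the right one to
    \<nu>^m.\<close>
  proof (rule lmod_iso_tw[where f = \<nu> and \<alpha> = \<nu>' and \<beta> = "\<lambda>b. \<nu> (pw (m - 2) b)"])
    show "left_module \<E> (pull \<theta> (pull N.\<tau> (tw (\<lambda>b. b))))"
      by (rule T.left_module_pull[OF N.tau.left_module_pull[OF reg]])
    show "\<nu> (\<nu> (pw (m - 2) a)) = pw m a" if "a \<in> carrier A" for a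
      using pw_Suc[OF that, of "m - 2"] pw_Suc[OF that, of "m - 1"] by simp
  qed (simp_all add: tpt spt pw_closed nuD nu'D(5) nu_inv nu pw tw_pure[OF alg_iso_id])
  ultimately show ?thesis by (rule N.tate_kdim_duality[OF fd_regular fd_omega fd_omega t])
qed

lemma frobenius_env: obtains I :: "('a \<times> 'a) set" and b c lam where "frobenius \<E> I b c lam"
proof (rule nakayama_enveloping)
  fix I :: "('a \<times> 'a) set" and b c lam assume "nakayama \<E> I b c lam \<sigma>"
  then show thesis by (rule that[OF nakayama.axioms(1)])
qed

lemma fdspace_tate_omega: "fdspace (tate_ext \<E> n (regular_bimodule A) (\<Omega> m))"
proof (rule frobenius_env)
  fix I :: "('a \<times> 'a) set" and b c lam assume "frobenius \<E> I b c lam"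
  then show ?thesis by (rule frobenius.fdspace_tate_ext[OF _ fd_regular fd_omega])
qed

lemma tate_omega_duality:
  "k_iso (tate_ext \<E> n (regular_bimodule A) (\<Omega> m))
    (dual (tate_ext \<E> (- n - 1) (regular_bimodule A) (\<Omega> (2 - m))))"
proof (rule k_iso_dual[OF fdspace_tate_omega fdspace_tate_omega])
  show "kdim (tate_ext \<E> n (regular_bimodule A) (\<Omega> m)) =
    kdim (tate_ext \<E> (- n - 1) (regular_bimodule A) (\<Omega> (2 - m)))"
  proof (cases "n \<ge> 0")
    case True
    then show ?thesis using tate_omega_kdim[of "nat n" m] by simp
  next
    case False
    \<comment> \<open>The involution (n, m) \<mapsto> (-n-1, 2-m) exchanges negative and nonnegative
      degrees, so the nonnegative case is read backwards.\<close>
    then show ?thesis using tate_omega_kdim[of "nat (- n - 1)" "2 - m"] by simp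
  qed
qed

text \<open>DA is isomorphic to \<omega>^1, and by \<open>Suspension_iso\<close> isomorphic
  coefficients have equal suspensions.\<close>

lemma tate_dual_bimodule: "tate_ext \<E> n (regular_bimodule A) (dual_bimodule A) =
    tate_ext \<E> n (regular_bimodule A) (\<Omega> 1)"
proof (rule frobenius_env)
  fix I :: "('a \<times> 'a) set" and b c lam assume "frobenius \<E> I b c lam"
  then interpret N: frobenius \<E> I b c lam .
  have "pw 1 = \<nu>" by (rule ext) (rule pw_1)
  then have "lmod_iso \<E> (dual_bimodule A) (\<Omega> 1)"
    using nakayama_nu by (simp add: nakayama_automorphism_def omega_power_eq)
  from N.Suspension_iso[OF fd_module_dual[OF fdA] this] show ?thesis by (simp add: tate_ext_def)
qed

end

section \<open>Tensor products and duality\<close>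

text \<open>For a left module \<open>N\<close> this is a right module, encoded over
  \<open>opp L\<close>; it is the target in the Hom-tensor adjunction below.\<close>

definition dual_module :: "('k::field, 'l) module \<Rightarrow> ('l, 'n) module \<Rightarrow> ('l, 'n \<Rightarrow> 'k) module" where
  "dual_module L N = (let D = dual (restrict_scalars L N) in
     \<lparr>carrier = carrier D, mult = mult D, one = one D, zero = zero D, add = add D,
      smult = (\<lambda>l f. \<lambda>x\<in>carrier N. f (l \<odot>\<^bsub>N\<^esub> x))\<rparr>)"

lemma dual_module_simps [simp]:
  "carrier (dual_module L N) = klin (restrict_scalars L N) ground \<inter> extensional (carrier N)"
  "zero (dual_module L N) = (\<lambda>x\<in>carrier N. 0)"
  "add (dual_module L N) = (\<lambda>f g. \<lambda>x\<in>carrier N. f x + g x)"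
  "smult (dual_module L N) = (\<lambda>l f. \<lambda>x\<in>carrier N. f (l \<odot>\<^bsub>N\<^esub> x))"
  by (simp_all add: dual_module_def dual_def Let_def)

context kalgebra
begin

lemma dual_module_action:
  assumes N: "left_module L N" and f: "f \<in> klin (rs N) ground" and l: "l \<in> carrier L"
  shows "(\<lambda>x\<in>carrier N. f (l \<odot>\<^bsub>N\<^esub> x)) \<in> klin (rs N) ground"
proof -
  interpret N: left_module L N by fact
  interpret rN: kspace "rs N" by (rule kspace_restrict_scalars) fact
  have "(\<lambda>x. f (l \<odot>\<^bsub>N\<^esub> x)) \<in> module_hom ground (rs N) ground"
  proof (rule modhomI)
    fix x y assume "x \<in> carrier (rs N)" "y \<in> carrier (rs N)"
    then show "f (l \<odot>\<^bsub>N\<^esub> (x \<oplus>\<^bsub>rs N\<^esub> y)) = f (l \<odot>\<^bsub>N\<^esub> x) \<oplus>\<^bsub>ground\<^esub> f (l \<odot>\<^bsub>N\<^esub> y)"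
      using modhom_add[OF f, of "l \<odot>\<^bsub>N\<^esub> x" "l \<odot>\<^bsub>N\<^esub> y"] l
      by (simp add: N.smult_r_distr N.smult_closed)
  next
    fix c x assume x: "x \<in> carrier (rs N)"
    have "l \<odot>\<^bsub>N\<^esub> ((c \<odot> \<one>) \<odot>\<^bsub>N\<^esub> x) = (c \<odot> \<one>) \<odot>\<^bsub>N\<^esub> (l \<odot>\<^bsub>N\<^esub> x)"
      using l x by (simp add: smult_mult_left smult_mult_right flip: N.smult_assoc)
    then show "f (l \<odot>\<^bsub>N\<^esub> (c \<odot>\<^bsub>rs N\<^esub> x)) = c \<odot>\<^bsub>ground\<^esub> f (l \<odot>\<^bsub>N\<^esub> x)"
      using klin_smult[OF f, of "l \<odot>\<^bsub>N\<^esub> x" c] l x by (simp add: N.smult_closed)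
  qed simp
  then show ?thesis using modhom_restrict[of ground "rs N" _ ground] rN.kspace_axioms by simp
qed

lemma left_module_dual_module:
  assumes N: "left_module L N" shows "left_module (opp L) (dual_module L N)"
proof -
  interpret N: left_module L N by fact
  interpret rN: kspace "rs N" by (rule kspace_restrict_scalars) fact
  interpret D: kspace "dual (rs N)" by (rule kspace_dual[OF rN.kspace_axioms])
  interpret O: kalgebra "opp L" by unfold_locales (rule k_algebra_opp)
  have ag: "abelian_group (dual_module L N)"
    by (rule abelian_group_transport[OF D.abelian_group_axioms, of "\<lambda>x. x"]) (simp_all add: dual_def)
  have add: "f (x \<oplus>\<^bsub>N\<^esub> y) = f x + f y"
    if "f \<in> carrier (dual_module L N)" "x \<in> carrier N" "y \<in> carrier N" for f x y
    using that modhom_add[of f class_ring "rs N" ground x y] by simp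
  show ?thesis
  proof (intro left_module.intro O.ring_axioms ag left_module_axioms.intro)
    fix r f assume "r \<in> carrier (opp L)" and f: "f \<in> carrier (dual_module L N)"
    then have r: "r \<in> carrier L" by simp
    show "r \<odot>\<^bsub>dual_module L N\<^esub> f \<in> carrier (dual_module L N)"
      using dual_module_action[OF N _ r, of f] f by simp
    fix s assume "s \<in> carrier (opp L)"
    then have s: "s \<in> carrier L" by simp
    show "(r \<oplus>\<^bsub>opp L\<^esub> s) \<odot>\<^bsub>dual_module L N\<^esub> f =
      r \<odot>\<^bsub>dual_module L N\<^esub> f \<oplus>\<^bsub>dual_module L N\<^esub> s \<odot>\<^bsub>dual_module L N\<^esub> f"
      using r s by (simp del: dual_module_simps(1) add: N.smult_l_distr N.smult_closed add[OF f] cong: restrict_cong)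
    show "(r \<otimes>\<^bsub>opp L\<^esub> s) \<odot>\<^bsub>dual_module L N\<^esub> f = r \<odot>\<^bsub>dual_module L N\<^esub> (s \<odot>\<^bsub>dual_module L N\<^esub> f)"
      using r s by (simp add: N.smult_assoc N.smult_closed cong: restrict_cong)
  next
    fix r f g assume "r \<in> carrier (opp L)"
    then show "r \<odot>\<^bsub>dual_module L N\<^esub> (f \<oplus>\<^bsub>dual_module L N\<^esub> g) =
      r \<odot>\<^bsub>dual_module L N\<^esub> f \<oplus>\<^bsub>dual_module L N\<^esub> r \<odot>\<^bsub>dual_module L N\<^esub> g"
      by (simp add: N.smult_closed cong: restrict_cong)
  next
    fix f assume "f \<in> carrier (dual_module L N)"
    then show "\<one>\<^bsub>opp L\<^esub> \<odot>\<^bsub>dual_module L N\<^esub> f = f"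
      by (auto simp: N.smult_one intro!: extensionalityI[where A = "carrier N"])
  qed
qed

lemma fd_module_dual_module:
  assumes N: "fd_module L N" shows "fd_module (opp L) (dual_module L N)"
proof -
  interpret O: kalgebra "opp L" by unfold_locales (rule k_algebra_opp)
  note lN = fd_moduleD[OF N]
  note D = left_module_dual_module[OF lN(1)]
  have "(\<lambda>f. f) \<in> klin (dual (rs N)) (O.rs (dual_module L N))"
  proof (rule modhomI)
    fix c f assume "f \<in> carrier (dual (rs N))"
    then have f: "f \<in> klin (rs N) ground" by (simp add: dual_def)
    show "c \<odot>\<^bsub>dual (rs N)\<^esub> f = c \<odot>\<^bsub>O.rs (dual_module L N)\<^esub> f"
      using klin_smult[OF f] by (simp add: dual_def cong: restrict_cong)
  qed (simp_all add: dual_def)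
  from fdspace_bij(1)[OF fdspace_dual[OF lN(2)] O.kspace_restrict_scalars[OF D] this]
  show ?thesis using D by (simp add: O.fdspace_restrict_scalars bij_betw_def dual_def)
qed

end

context tensor_product
begin

abbreviation "D \<equiv> dual_module L N"

context
  fixes f assumes f: "f \<in> module_hom (opp L) M D"
begin

lemma pairing_klin: "m \<in> carrier M \<Longrightarrow> f m \<in> klin (restrict_scalars L N) ground"
  using modhom_closed[OF f] by simp

text \<open>Hom-tensor adjunction: a homomorphism into the dual of \<open>N\<close> is a balanced
  form on \<open>M\<close> and \<open>N\<close>, so it induces a functional on the tensor product.
  This pairs Hom(M, DN) with the tensor product of \<open>M\<close> and \<open>N\<close>.\<close>

lemma pairing_balanced: "balanced L M N ground f"
  unfolding balanced_def
proof (intro conjI ballI allI)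
  fix m m' n assume "m \<in> carrier M" "m' \<in> carrier M" "n \<in> carrier N"
  then show "f (m \<oplus>\<^bsub>M\<^esub> m') n = f m n \<oplus>\<^bsub>ground\<^esub> f m' n" using modhom_add[OF f, of m m'] by simp
next
  fix m n n' assume "m \<in> carrier M" "n \<in> carrier N" "n' \<in> carrier N"
  then show "f m (n \<oplus>\<^bsub>N\<^esub> n') = f m n \<oplus>\<^bsub>ground\<^esub> f m n'" using modhom_add[OF pairing_klin, of m n n'] by simp
next
  fix l m n assume "l \<in> carrier L" "m \<in> carrier M" "n \<in> carrier N"
  then show "f (l \<odot>\<^bsub>M\<^esub> m) n = f m (l \<odot>\<^bsub>N\<^esub> n)" using modhom_smult[OF f, of l m] by simp
next
  fix c m n assume "m \<in> carrier M" "n \<in> carrier N"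
  then show "f ((c \<odot>\<^bsub>L\<^esub> \<one>\<^bsub>L\<^esub>) \<odot>\<^bsub>M\<^esub> m) n = c \<odot>\<^bsub>ground\<^esub> f m n"
    using modhom_smult[OF f, of "c \<odot>\<^bsub>L\<^esub> \<one>\<^bsub>L\<^esub>" m] klin_smult[OF pairing_klin, of m n c] by simp
qed simp

lemma pairing_lift: "tensor_lift ground f \<in> klin T ground"
  by (rule tensor_lift_klin[OF kspace_ground pairing_balanced])

lemma pairing_pt: "m \<in> carrier M \<Longrightarrow> n \<in> carrier N \<Longrightarrow> tensor_lift ground f (pt m n) = f m n"
  by (rule tensor_lift_pure[OF kspace_ground pairing_balanced])

end

lemma kspace_H: "kspace (hom_space (opp L) M D)"
proof -
  interpret O: kalgebra "opp L" by unfold_locales (rule k_algebra_opp)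
  show ?thesis by (rule O.kspace_hom_space[OF M.left_module_axioms left_module_dual_module[OF N.left_module_axioms]])
qed

lemma pairing_klin_right:
  assumes t: "t \<in> carrier T"
  shows "(\<lambda>f. tensor_lift ground f t) \<in> klin (hom_space (opp L) M D) ground"
proof (rule modhomI)
  interpret H: kspace "hom_space (opp L) M D" by (rule kspace_H)
  fix f assume f: "f \<in> carrier (hom_space (opp L) M D)"
  then have fh: "f \<in> module_hom (opp L) M D" by simp
  {
    fix g assume g: "g \<in> carrier (hom_space (opp L) M D)"
    then have gh: "g \<in> module_hom (opp L) M D" by simp
    have s: "f \<oplus>\<^bsub>hom_space (opp L) M D\<^esub> g \<in> module_hom (opp L) M D" using H.a_closed[OF f g] by simp
    have "(\<lambda>t. tensor_lift ground f t + tensor_lift ground g t) \<in> klin T ground"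
      by (rule modhomI) (simp_all add: modhom_add[OF pairing_lift[OF fh]] modhom_add[OF pairing_lift[OF gh]]
          klin_smult[OF pairing_lift[OF fh]] klin_smult[OF pairing_lift[OF gh]] distrib_left)
    from klin_eqI[OF kspace_ground pairing_lift[OF s] this _ t]
    show "tensor_lift ground (f \<oplus>\<^bsub>hom_space (opp L) M D\<^esub> g) t =
        tensor_lift ground f t \<oplus>\<^bsub>ground\<^esub> tensor_lift ground g t"
      using pairing_pt[OF s] by (simp add: pairing_pt[OF fh] pairing_pt[OF gh])
  }
  fix c
  have s: "c \<odot>\<^bsub>hom_space (opp L) M D\<^esub> f \<in> module_hom (opp L) M D" using H.smult_closed[OF f] by simp
  have "(\<lambda>t. c * tensor_lift ground f t) \<in> klin T ground"
    by (rule modhomI) (simp_all add: modhom_add[OF pairing_lift[OF fh]] klin_smult[OF pairing_lift[OF fh]] distrib_left)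
  from klin_eqI[OF kspace_ground pairing_lift[OF s] this _ t]
  show "tensor_lift ground (c \<odot>\<^bsub>hom_space (opp L) M D\<^esub> f) t = c \<odot>\<^bsub>ground\<^esub> tensor_lift ground f t"
    using pairing_pt[OF s] klin_smult[OF pairing_klin[OF fh]] by (simp add: pairing_pt[OF fh])
qed simp

lemma pairing_nondeg_hom:
  assumes f: "f \<in> carrier (hom_space (opp L) M D)" and z: "\<And>t. t \<in> carrier T \<Longrightarrow> tensor_lift ground f t = 0"
  shows "f = \<zero>\<^bsub>hom_space (opp L) M D\<^esub>"
proof (rule extensionalityI[where A = "carrier M"])
  fix m assume m: "m \<in> carrier M"
  have fh: "f \<in> module_hom (opp L) M D" using f by simp
  have "f m = \<zero>\<^bsub>D\<^esub>"
  proof (rule extensionalityI[where A = "carrier N"])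
    show "f m n = \<zero>\<^bsub>D\<^esub> n" if "n \<in> carrier N" for n
      using z[of "pt m n"] m that by (simp add: pairing_pt[OF fh])
  qed (use modhom_closed[OF fh m] in simp_all)
  then show "f m = \<zero>\<^bsub>hom_space (opp L) M D\<^esub> m" using m by simp
qed (use f in simp_all)

text \<open>A functional on the tensor product that does not vanish at \<open>t\<close> comes, by
  currying, from a homomorphism into the dual of \<open>N\<close>.\<close>

lemma pairing_nondeg_tensor:
  assumes T: "fdspace T" and t: "t \<in> carrier T"
    and z: "\<And>f. f \<in> carrier (hom_space (opp L) M D) \<Longrightarrow> tensor_lift ground f t = 0"
  shows "t = \<zero>\<^bsub>T\<^esub>"
proof (rule ccontr)
  assume "t \<noteq> \<zero>\<^bsub>T\<^esub>"
  then obtain \<phi> where phi: "\<phi> \<in> klin T ground" "\<phi> t \<noteq> 0" using separating_functional[OF T t] by blast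
  interpret rN: kspace "restrict_scalars L N" by (rule kspace_restrict_scalars[OF N.left_module_axioms])
  define f where "f = (\<lambda>m\<in>carrier M. \<lambda>n\<in>carrier N. \<phi> (pt m n))"
  have fm: "f m \<in> carrier D" if m: "m \<in> carrier M" for m
  proof -
    have "(\<lambda>n. \<phi> (pt m n)) \<in> module_hom ground (restrict_scalars L N) ground"
    proof (rule modhomI)
      fix c n assume "n \<in> carrier (restrict_scalars L N)"
      then show "\<phi> (pt m (c \<odot>\<^bsub>restrict_scalars L N\<^esub> n)) = c \<odot>\<^bsub>ground\<^esub> \<phi> (pt m n)"
        using m by (simp add: pt_smult_right klin_smult[OF phi(1)])
    qed (use m in \<open>simp_all add: pt_add_right modhom_add[OF phi(1)]\<close>)
    then show ?thesis
      using modhom_restrict[of ground "restrict_scalars L N" _ ground] rN.kspace_axioms m by (simp add: f_def)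
  qed
  have fh: "f \<in> module_hom (opp L) M D"
  proof (rule modhomI[OF fm])
    fix m m' assume m: "m \<in> carrier M" "m' \<in> carrier M"
    then show "f (m \<oplus>\<^bsub>M\<^esub> m') = f m \<oplus>\<^bsub>D\<^esub> f m'"
      by (simp add: f_def pt_add_left modhom_add[OF phi(1)] cong: restrict_cong)
  next
    fix l m assume "l \<in> carrier (opp L)" "m \<in> carrier M"
    then show "f (l \<odot>\<^bsub>M\<^esub> m) = l \<odot>\<^bsub>D\<^esub> f m"
      using M.smult_closed[of l m] N.smult_closed[of l] by (simp add: f_def pt_middle cong: restrict_cong)
  qed
  have "tensor_lift ground f t = \<phi> t"
    by (rule klin_eqI[OF kspace_ground pairing_lift[OF fh] phi(1) _ t], subst pairing_pt[OF fh])
      (simp_all add: f_def)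
  then show False using z[of f] fh phi(2) by (simp add: f_def)
qed

lemma balanced_map:
  assumes "left_module (opp L) M'" "d \<in> module_hom (opp L) M' M"
  shows "balanced L M' N T (\<lambda>x y. pt (d x) y)"
  unfolding balanced_def
  by (simp add: modhom_closed[OF assms(2)] modhom_add[OF assms(2)] modhom_smult[OF assms(2)]
      pt_add_left pt_add_right pt_middle pt_smult_right)

end

section \<open>Tor and stable homomorphisms\<close>

text \<open>The short exact sequences of iterated syzygies are spliced: the differential is
  \<open>p (Suc k)\<close> followed by \<open>i k\<close>. As \<open>i k\<close> is injective, the
  kernel is that of \<open>p (Suc k)\<close>, which is the image of the next differential.\<close>

lemma (in frobenius) proj_resolution_exists:
  fixes M :: "('l, 'm) module"
  assumes M: "fd_module L M"
  shows "\<exists>P d. proj_resolution L M P d"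
proof -
  define Z where "Z k = (Syzygy L ^^ k) (rep L M)" for k
  have sZ: "syz_seq L Z" unfolding Z_def by (rule syz_seq_Syzygy[OF fd_module_rep[OF M]])
  then have fZ: "fd_module L (Z k)" for k by (simp add: syz_seq_def)
  have "\<forall>k. \<exists>(P :: ('k, 'l) umodule) i p. fd_module L P \<and> projective L P \<and> short_exact L (Z (Suc k)) i P p (Z k)"
    using sZ by (simp add: syz_seq_def)
  from choice[OF this] obtain P :: "nat \<Rightarrow> ('k, 'l) umodule" where
    "\<forall>k. \<exists>i p. fd_module L (P k) \<and> projective L (P k) \<and> short_exact L (Z (Suc k)) i (P k) p (Z k)" ..
  from choice[OF this] obtain i where
    "\<forall>k. \<exists>p. fd_module L (P k) \<and> projective L (P k) \<and> short_exact L (Z (Suc k)) (i k) (P k) p (Z k)" ..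
  from choice[OF this] obtain p where
    P: "\<And>k. fd_module L (P k)" "\<And>k. projective L (P k)"
    and se: "\<And>k. short_exact L (Z (Suc k)) (i k) (P k) (p k) (Z k)" by blast
  have ih: "i k \<in> module_hom L (Z (Suc k)) (P k)" and ph: "p k \<in> module_hom L (P k) (Z k)"
    and ii: "inj_on (i k) (carrier (Z (Suc k)))" and ps: "p k ` carrier (P k) = carrier (Z k)"
    and ip: "i k ` carrier (Z (Suc k)) = {y \<in> carrier (P k). p k y = \<zero>\<^bsub>Z k\<^esub>}" for k
    using se[of k] by (simp_all add: short_exact_def)
  obtain f where f: "f \<in> module_hom L (Z 0) M" "bij_betw f (carrier (Z 0)) (carrier M)"
    using lmod_iso_rep(2)[OF M] by (auto simp: lmod_iso_def Z_def)
  have zero_iff: "g x = \<zero>\<^bsub>Y\<^esub> \<longleftrightarrow> x = \<zero>\<^bsub>X\<^esub>"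
    if "left_module L X" "left_module L Y" "g \<in> module_hom L X Y" "inj_on g (carrier X)" "x \<in> carrier X"
    for g and X :: "('k, 'l) umodule" and Y :: "('l, 'z) module" and x
  proof -
    interpret X: left_module L X by fact
    interpret Y: left_module L Y by fact
    show ?thesis
      using inj_on_hom_iff[OF that(1-3)] that(4,5) modhom_zero[OF X.M.abelian_group_axioms Y.M.abelian_group_axioms that(3)]
      by auto
  qed
  define d where "d k x = i k (p (Suc k) x)" for k x
  have dh: "d n \<in> module_hom L (P (Suc n)) (P n)" for n
    unfolding d_def by (rule modhom_comp[OF ph ih])
  have dim: "d n ` carrier (P (Suc n)) = {y \<in> carrier (P n). p n y = \<zero>\<^bsub>Z n\<^esub>}" for n
    unfolding d_def ip[symmetric] ps[symmetric] by (simp add: image_image)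
  have dker: "{x \<in> carrier (P (Suc n)). d n x = \<zero>\<^bsub>P n\<^esub>} = {x \<in> carrier (P (Suc n)). p (Suc n) x = \<zero>\<^bsub>Z (Suc n)\<^esub>}" for n
    using zero_iff[OF fd_moduleD(1)[OF fZ] fd_moduleD(1)[OF P(1)] ih ii] modhom_closed[OF ph[of "Suc n"]]
    by (auto simp: d_def)
  have "\<exists>\<epsilon>\<in>module_hom L (P 0) M. \<epsilon> ` carrier (P 0) = carrier M \<and>
      d 0 ` carrier (P 1) = {x \<in> carrier (P 0). \<epsilon> x = \<zero>\<^bsub>M\<^esub>}"
  proof (intro bexI conjI)
    show "(\<lambda>x. f (p 0 x)) \<in> module_hom L (P 0) M" by (rule modhom_comp[OF ph f(1)])
    show "(\<lambda>x. f (p 0 x)) ` carrier (P 0) = carrier M"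
      using f(2) ps[of 0] by (simp add: bij_betw_def flip: image_image)
    show "d 0 ` carrier (P 1) = {x \<in> carrier (P 0). f (p 0 x) = \<zero>\<^bsub>M\<^esub>}"
      using dim[of 0] zero_iff[OF fd_moduleD(1)[OF fZ] fd_moduleD(1)[OF M] f(1)] f(2) modhom_closed[OF ph[of 0]]
      by (auto simp: bij_betw_def)
  qed
  then have "proj_resolution L M P d"
    unfolding proj_resolution_def using P dh dim dker by auto
  then show ?thesis by blast
qed

section \<open>The complex that computes Tor\<close>

locale tensor_resolution = kalgebra L + R: frobenius "opp L" I b c lam
  for L :: "('k::field, 'l) module" (structure) and I :: "'i set" and b c :: "'i \<Rightarrow> 'l" and lam +
  fixes M :: "('l, 'm) module" and N :: "('l, 'n) module"
    and P :: "nat \<Rightarrow> ('k, 'l) umodule" and d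
  assumes fd_M: "fd_module (opp L) M" and fd_N: "fd_module L N"
    and resolution: "proj_resolution (opp L) M P d"
begin

abbreviation "D \<equiv> dual_module L N"
abbreviation "TP k \<equiv> tensor L (P k) N"
abbreviation "\<delta> \<equiv> tensor_differential L P d N"
abbreviation "H k \<equiv> hom_space (opp L) (P k) D"

text \<open>The image of the differential inside \<open>P k\<close>, a syzygy of \<open>M\<close> of
  order k + 1.\<close>

definition W :: "nat \<Rightarrow> ('k, 'l) umodule" where
  "W k = (P k)\<lparr>carrier := d k ` carrier (P (Suc k))\<rparr>"

text \<open>The dual differential, adjoint to \<open>\<delta> k\<close> under the Hom-tensor
  pairing.\<close>

definition S where "S k = (\<lambda>f. \<lambda>x\<in>carrier (P (Suc k)). f (d k x))" for k

lemma fd_P: "fd_module (opp L) (P k)" and projective_P: "projective (opp L) (P k)"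
  and d_hom: "d k \<in> module_hom (opp L) (P (Suc k)) (P k)"
  and d_exact: "d (Suc k) ` carrier (P (Suc (Suc k))) = {x \<in> carrier (P (Suc k)). d k x = \<zero>\<^bsub>P k\<^esub>}"
  using resolution by (simp_all add: proj_resolution_def)

lemmas left_P = R.fd_moduleD(1)[OF fd_P]

lemma relproj_P: "R.relproj (P k)"
  using projective_P R.projective_iff_relproj[OF fd_P] by blast

lemma fd_D: "fd_module (opp L) D"
  by (rule fd_module_dual_module[OF fd_N])

lemma tensor_product_P: "tensor_product L (P k) N"
  by (intro tensor_product.intro kalgebra_axioms left_P fd_moduleD(1)[OF fd_N])

lemma fdspace_TP: "fdspace (TP k)"
proof -
  have "restrict_scalars (opp L) (P k) = rs (P k)" by (simp add: restrict_scalars_def)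
  then show ?thesis
    using tensor_product.fdspace_tensor[OF tensor_product_P, of k] R.fd_moduleD(2)[OF fd_P[of k]] fd_moduleD(2)[OF fd_N]
    by simp
qed

lemma kspace_TP: "kspace (TP k)"
  using fdspace_TP by (simp add: fdspace_def)

lemma W_simps [simp]: "carrier (W k) = d k ` carrier (P (Suc k))" "zero (W k) = zero (P k)"
  "add (W k) = add (P k)" "smult (W k) = smult (P k)"
  by (simp_all add: W_def)

lemma fd_W: "fd_module (opp L) (W k)"
  unfolding W_def by (rule R.fd_module_sub[OF lsub_image[OF left_P left_P d_hom] fd_P])

lemma W_subset: "carrier (W k) \<subseteq> carrier (P k)"
  using modhom_closed[OF d_hom] by auto

lemma inclusion_hom: "(\<lambda>x. x) \<in> module_hom (opp L) (W k) (P k)"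
  by (rule modhomI) (use W_subset in \<open>auto simp del: W_simps(1)\<close>)

lemma d_hom_W: "d k \<in> module_hom (opp L) (P (Suc k)) (W k)"
  by (rule modhomI) (simp_all add: modhom_add[OF d_hom] modhom_smult[OF d_hom])

lemma short_exact_Suc: "short_exact (opp L) (W (Suc k)) (\<lambda>x. x) (P (Suc k)) (d k) (W k)"
  using inclusion_hom d_hom_W d_exact by (simp add: short_exact_def)

lemma short_exact_0: obtains \<epsilon> where "short_exact (opp L) (W 0) (\<lambda>x. x) (P 0) \<epsilon> M"
proof -
  obtain \<epsilon> where "\<epsilon> \<in> module_hom (opp L) (P 0) M" "\<epsilon> ` carrier (P 0) = carrier M"
    "d 0 ` carrier (P 1) = {x \<in> carrier (P 0). \<epsilon> x = \<zero>\<^bsub>M\<^esub>}"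
    using resolution by (auto simp: proj_resolution_def)
  then show ?thesis using inclusion_hom[of 0] by (intro that[of \<epsilon>]) (simp add: short_exact_def)
qed

text \<open>\<open>W\<close> begins with the first syzygy, so a copy of \<open>M\<close> is put in
  front of it; \<open>M\<close> itself may have another carrier type.\<close>

lemma syz_seq_W: "syz_seq (opp L) (\<lambda>k. case k of 0 \<Rightarrow> rep (opp L) M | Suc j \<Rightarrow> W j)"
  unfolding syz_seq_def
proof
  fix k
  show "fd_module (opp L) (case k of 0 \<Rightarrow> rep (opp L) M | Suc j \<Rightarrow> W j) \<and>
      (\<exists>(Q :: ('k, 'l) umodule) i p. fd_module (opp L) Q \<and> projective (opp L) Q \<and>
        short_exact (opp L) (case Suc k of 0 \<Rightarrow> rep (opp L) M | Suc j \<Rightarrow> W j) i Q p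
          (case k of 0 \<Rightarrow> rep (opp L) M | Suc j \<Rightarrow> W j))"
  proof (cases k)
    case 0
    obtain \<epsilon> where e: "short_exact (opp L) (W 0) (\<lambda>x. x) (P 0) \<epsilon> M" by (rule short_exact_0)
    then have eh: "\<epsilon> \<in> module_hom (opp L) (P 0) M" and es: "\<epsilon> ` carrier (P 0) = carrier M"
      by (simp_all add: short_exact_def)
    note fr = R.fd_module_rep[OF fd_M]
    note lM = R.fd_moduleD(1)[OF fd_M] and lr = R.fd_moduleD(1)[OF fr]
    interpret M: left_module "opp L" M by (rule lM)
    interpret X: left_module "opp L" "rep (opp L) M" by (rule lr)
    obtain f where f: "f \<in> module_hom (opp L) M (rep (opp L) M)" "bij_betw f (carrier M) (carrier (rep (opp L) M))"
      using R.lmod_iso_rep(1)[OF fd_M] by (auto simp: lmod_iso_def)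
    have "f y = \<zero>\<^bsub>rep (opp L) M\<^esub> \<longleftrightarrow> y = \<zero>\<^bsub>M\<^esub>" if "y \<in> carrier M" for y
      using R.inj_on_hom_iff[OF lM lr f(1)] f(2) that
        modhom_zero[OF M.M.abelian_group_axioms X.M.abelian_group_axioms f(1)]
      by (auto simp: bij_betw_def)
    then have "{x \<in> carrier (P 0). f (\<epsilon> x) = \<zero>\<^bsub>rep (opp L) M\<^esub>} = {x \<in> carrier (P 0). \<epsilon> x = \<zero>\<^bsub>M\<^esub>}"
      using modhom_closed[OF eh] by blast
    moreover have "(\<lambda>x. f (\<epsilon> x)) ` carrier (P 0) = carrier (rep (opp L) M)"
      using f(2) es by (simp add: bij_betw_def flip: image_image)
    ultimately have "short_exact (opp L) (W 0) (\<lambda>x. x) (P 0) (\<lambda>x. f (\<epsilon> x)) (rep (opp L) M)"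
      using e modhom_comp[OF eh f(1)] by (simp add: short_exact_def)
    then show ?thesis using 0 fr fd_P projective_P by (simp del: W_simps) blast
  next
    case (Suc j)
    then show ?thesis using fd_W fd_P projective_P short_exact_Suc[of j] by (simp del: W_simps) blast
  qed
qed

lemma S_klin: "S k \<in> klin (H k) (H (Suc k))"
  unfolding S_def by (rule R.pre_comp_klin[OF left_P left_P d_hom])

text \<open>\<open>S k f\<close> depends only on the restriction of \<open>f\<close> to
  \<open>W k\<close>, the image of \<open>d k\<close>. So \<open>S k\<close> has the kernel, hence
  the rank, of restriction to \<open>W k\<close>, and the restrictions are the trace maps by
  \<open>short_exact_pre_comp_image\<close>.\<close>

lemma S_rank: "kdim (sub (H (Suc k)) (S k ` carrier (H k))) = tdim (opp L) (W k) D"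
proof -
  let ?r = "\<lambda>f. \<lambda>x\<in>carrier (W k). f x"
  let ?HW = "hom_space (opp L) (W k) D"
  have fH: "fdspace (H k)" by (rule R.fdspace_hom_space[OF fd_P fd_D])
  have kH: "kspace (H (Suc k))" "kspace ?HW"
    using R.fdspace_hom_space[OF fd_P fd_D] R.fdspace_hom_space[OF fd_W fd_D] by (simp_all add: fdspace_def)
  have r: "?r \<in> klin (H k) ?HW"
    by (rule R.pre_comp_klin[OF R.fd_moduleD(1)[OF fd_W] left_P inclusion_hom])
  have "S k f = \<zero>\<^bsub>H (Suc k)\<^esub> \<longleftrightarrow> ?r f = \<zero>\<^bsub>?HW\<^esub>" for f
    unfolding S_def by (auto simp: fun_eq_iff restrict_def)
  then have ker: "{f \<in> carrier (H k). S k f = \<zero>\<^bsub>H (Suc k)\<^esub>} = {f \<in> carrier (H k). ?r f = \<zero>\<^bsub>?HW\<^esub>}"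
    by blast
  have "?r ` carrier (H k) = R.trace_maps (W k) D"
  \<comment> \<open>The short exact sequence through \<open>P k\<close> ends in \<open>M\<close> for
    k = 0 and in the previous image otherwise.\<close>
  proof (cases k)
    case 0
    obtain \<epsilon> where "short_exact (opp L) (W 0) (\<lambda>x. x) (P 0) \<epsilon> M" by (rule short_exact_0)
    from R.short_exact_pre_comp_image[OF fd_W fd_P fd_M fd_D relproj_P this] 0 show ?thesis by simp
  next
    case (Suc j)
    from R.short_exact_pre_comp_image[OF fd_W fd_P fd_W fd_D relproj_P short_exact_Suc[of j]] Suc show ?thesis by simp
  qed
  then have "tdim (opp L) (W k) D = kdim (sub ?HW (?r ` carrier (H k)))"
    by (simp only: R.tdim_eq_trace[OF fd_W fd_D])
  then show ?thesis
    using rank_nullity(1)[OF fH kH(1) S_klin] rank_nullity(1)[OF fH kH(2) r] ker by simp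
qed

lemma \<delta>_klin: "\<delta> k \<in> klin (TP (Suc k)) (TP k)"
  and \<delta>_pure: "x \<in> carrier (P (Suc k)) \<Longrightarrow> y \<in> carrier N \<Longrightarrow>
    \<delta> k (pure_tensor L (P (Suc k)) N x y) = pure_tensor L (P k) N (d k x) y"
proof -
  interpret A: tensor_product L "P k" N by (rule tensor_product_P)
  interpret B: tensor_product L "P (Suc k)" N by (rule tensor_product_P)
  note bal = A.balanced_map[OF left_P d_hom]
  show "\<delta> k \<in> klin (TP (Suc k)) (TP k)"
    unfolding tensor_differential_def by (rule B.tensor_lift_klin[OF kspace_TP bal])
  show "x \<in> carrier (P (Suc k)) \<Longrightarrow> y \<in> carrier N \<Longrightarrow>
    \<delta> k (pure_tensor L (P (Suc k)) N x y) = pure_tensor L (P k) N (d k x) y"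
    unfolding tensor_differential_def by (rule B.tensor_lift_pure[OF kspace_TP bal])
qed

lemma kdim_TP: "kdim (TP k) = hdim (opp L) (P k) D"
proof -
  interpret A: tensor_product L "P k" N by (rule tensor_product_P)
  show ?thesis
    unfolding hdim_def
  proof (rule pairing_kdim_eq[where \<beta> = "\<lambda>t f. tensor_lift ground f t"])
    show "fdspace (TP k)" by (rule fdspace_TP)
    show "fdspace (H k)" by (rule R.fdspace_hom_space[OF fd_P fd_D])
    show "tensor_lift ground f \<in> klin (TP k) ground" if "f \<in> carrier (H k)" for f
      using that by (intro A.pairing_lift) simp
  qed (use A.pairing_klin_right A.pairing_nondeg_hom A.pairing_nondeg_tensor[OF fdspace_TP] in blast)+
qed

text \<open>\<open>\<delta> k\<close> and \<open>S k\<close> are adjoint: on a pure tensor of x and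
  y both sides of the adjunction are \<open>f (d k x) y\<close>.\<close>

lemma \<delta>_rank: "kdim (sub (TP k) (\<delta> k ` carrier (TP (Suc k)))) = tdim (opp L) (W k) D"
proof -
  interpret A: tensor_product L "P k" N by (rule tensor_product_P)
  interpret B: tensor_product L "P (Suc k)" N by (rule tensor_product_P)
  have fH: "fdspace (H j)" for j by (rule R.fdspace_hom_space[OF fd_P fd_D])
  have "kdim (sub (TP k) (\<delta> k ` carrier (TP (Suc k)))) = kdim (sub (H (Suc k)) (S k ` carrier (H k)))"
  proof (rule adjoint_rank[OF fdspace_TP kspace_TP _ fH \<delta>_klin S_klin,
        where \<beta> = "\<lambda>t f. tensor_lift ground f t" and \<beta>' = "\<lambda>t f. tensor_lift ground f t"])
    show "kspace (H (Suc k))" using fH by (simp add: fdspace_def)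
    show "(\<lambda>f. tensor_lift ground f t) \<in> klin (H (Suc k)) ground" if "t \<in> carrier (TP (Suc k))" for t
      by (rule B.pairing_klin_right[OF that])
    show "tensor_lift ground f \<in> klin (TP k) ground" if "f \<in> carrier (H k)" for f
      using that by (intro A.pairing_lift) simp
    show "f = \<zero>\<^bsub>H (Suc k)\<^esub>"
      if "f \<in> carrier (H (Suc k))" "\<And>t. t \<in> carrier (TP (Suc k)) \<Longrightarrow> tensor_lift ground f t = 0" for f
      by (rule B.pairing_nondeg_hom[OF that])
    show "t = \<zero>\<^bsub>TP k\<^esub>"
      if "t \<in> carrier (TP k)" "\<And>f. f \<in> carrier (H k) \<Longrightarrow> tensor_lift ground f t = 0" for t
      by (rule A.pairing_nondeg_tensor[OF fdspace_TP that])
    fix t f assume t: "t \<in> carrier (TP (Suc k))" and f: "f \<in> carrier (H k)"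
    have fh: "f \<in> module_hom (opp L) (P k) D" using f by simp
    have Sf: "S k f \<in> module_hom (opp L) (P (Suc k)) D" using modhom_closed[OF S_klin f] by simp
    show "tensor_lift ground f (\<delta> k t) = tensor_lift ground (S k f) t"
    proof (rule B.klin_eqI[OF kspace_ground modhom_comp[OF \<delta>_klin A.pairing_lift[OF fh]] B.pairing_lift[OF Sf] _ t])
      fix x y assume xy: "x \<in> carrier (P (Suc k))" "y \<in> carrier N"
      show "tensor_lift ground f (\<delta> k (B.pt x y)) = tensor_lift ground (S k f) (B.pt x y)"
        unfolding \<delta>_pure[OF xy] A.pairing_pt[OF fh modhom_closed[OF d_hom xy(1)] xy(2)] B.pairing_pt[OF Sf xy]
        using xy(1) by (simp add: S_def)
    qed
  qed
  then show ?thesis by (simp only: S_rank)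
qed

lemma \<delta>\<delta>: assumes t: "t \<in> carrier (TP (Suc (Suc k)))" shows "\<delta> k (\<delta> (Suc k) t) = \<zero>\<^bsub>TP k\<^esub>"
proof -
  interpret A: tensor_product L "P k" N by (rule tensor_product_P)
  interpret B: tensor_product L "P (Suc (Suc k))" N by (rule tensor_product_P)
  have z: "(\<lambda>t. \<zero>\<^bsub>TP k\<^esub>) \<in> klin (TP (Suc (Suc k))) (TP k)" by (rule modhomI) simp_all
  show ?thesis
  proof (rule B.klin_eqI[OF kspace_TP modhom_comp[OF \<delta>_klin \<delta>_klin] z _ t])
    fix x y assume xy: "x \<in> carrier (P (Suc (Suc k)))" "y \<in> carrier N"
    have "d (Suc k) x \<in> carrier (P (Suc k))" "d k (d (Suc k) x) = \<zero>\<^bsub>P k\<^esub>" using d_exact[of k] xy(1) by blast+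
    moreover have "A.pt \<zero>\<^bsub>P k\<^esub> y = \<zero>\<^bsub>TP k\<^esub>"
      using A.pt_add_left[of "\<zero>\<^bsub>P k\<^esub>" "\<zero>\<^bsub>P k\<^esub>" y] xy(2) A.pt_closed[of "\<zero>\<^bsub>P k\<^esub>" y]
      by (metis A.M.M.zero_closed A.M.M.l_zero A.T.add.l_cancel_one)
    ultimately show "\<delta> k (\<delta> (Suc k) (B.pt x y)) = \<zero>\<^bsub>TP k\<^esub>" using xy by (simp add: \<delta>_pure)
  qed
qed

text \<open>Count maps into the dual of \<open>N\<close>, with P for \<open>P (Suc j)\<close>. The
  cycles have dimension hdim P - tdim W_j and the boundaries tdim W_(j+1). The exact sequence from
  W_(j+1) through P to W_j gives hdim P = tdim W_(j+1) + hdim W_j, so hdim W_j - tdim W_j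
  remains.\<close>

lemma
  fixes j defines "Q \<equiv> quot (sub (TP (Suc j)) (tensor_cycles L P d N (Suc j)))
    (\<delta> (Suc j) ` carrier (TP (Suc (Suc j))))"
  shows fdspace_homology: "fdspace Q" and kdim_homology: "kdim Q = sdim (opp L) (W j) D"
proof -
  let ?C = "tensor_cycles L P d N (Suc j)"
  let ?B = "\<delta> (Suc j) ` carrier (TP (Suc (Suc j)))"
  have C: "?C = {t \<in> carrier (TP (Suc j)). \<delta> j t = \<zero>\<^bsub>TP j\<^esub>}" by (simp add: tensor_cycles_def)
  have ks: "ksub (TP (Suc j)) ?C" unfolding C by (rule ksub_kernel[OF kspace_TP kspace_TP \<delta>_klin])
  have fC: "fdspace (sub (TP (Suc j)) ?C)" by (rule fdspace_sub[OF fdspace_TP ks])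
  have "?B \<subseteq> ?C" unfolding C using modhom_closed[OF \<delta>_klin] \<delta>\<delta> by blast
  then have kB: "ksub (sub (TP (Suc j)) ?C) ?B"
    using ksub_image[OF kspace_TP kspace_TP \<delta>_klin[of "Suc j"]] by (simp add: ksub_def)
  show "fdspace Q" unfolding Q_def by (rule fdspace_quot[OF fC kB])
  have "hdim (opp L) (P (Suc j)) D = kdim (sub (TP (Suc j)) ?C) + tdim (opp L) (W j) D"
    using rank_nullity(1)[OF fdspace_TP kspace_TP \<delta>_klin[of j]] unfolding \<delta>_rank kdim_TP C .
  moreover have "kdim (sub (TP (Suc j)) ?C) = tdim (opp L) (W (Suc j)) D + kdim Q"
    using kdim_quot[OF fC kB] \<delta>_rank[of "Suc j"] by (simp add: Q_def)
  ultimately show "kdim Q = sdim (opp L) (W j) D"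
    using R.short_exact_tdim_right[OF fd_W fd_P fd_W fd_D relproj_P short_exact_Suc[of j]]
      R.hdim_eq[OF fd_W fd_D, of j] by simp
qed

end

text \<open>The resolution chosen inside \<open>tor\<close> stays hidden in the proof; outside, only
  a sequence of syzygies is visible, and any such sequence can be compared with the Tate
  groups.\<close>

lemma (in kalgebra) tor_stable:
  fixes M :: "('l, 'm) module" and N :: "('l, 'n) module"
  assumes F: "frobenius (opp L) I b c lam" and M: "fd_module (opp L) M" and N: "fd_module L N"
  obtains Z :: "nat \<Rightarrow> ('k, 'l) umodule" where "syz_seq (opp L) Z" "lmod_iso (opp L) (Z 0) M"
    "\<And>n. n \<ge> 1 \<Longrightarrow> fdspace (tor L n M N) \<and> kdim (tor L n M N) = sdim (opp L) (Z n) (dual_module L N)"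
proof -
  interpret R: frobenius "opp L" I b c lam by (rule F)
  \<comment> \<open>The choice in \<open>tor\<close> depends neither on the degree nor on
    \<open>N\<close>; naming the pair fixes one resolution for all n.\<close>
  define Pd where "Pd = (SOME Pd. case Pd of (P, d) \<Rightarrow> proj_resolution (opp L) M P d)"
  obtain P d where Pd: "Pd = (P, d)" by (cases Pd)
  have "\<exists>Pd. case Pd of (P, d) \<Rightarrow> proj_resolution (opp L) M P d"
    using R.proj_resolution_exists[OF M] by simp
  from someI_ex[OF this] have "proj_resolution (opp L) M P d" by (simp flip: Pd_def add: Pd)
  then interpret tensor_resolution L I b c lam M N P d
    by (intro tensor_resolution.intro tensor_resolution_axioms.intro kalgebra_axioms F M N)
  have tor: "tor L n M N = quot (sub (TP n) (tensor_cycles L P d N n)) (\<delta> n ` carrier (TP (Suc n)))" for n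
    unfolding tor_def Pd_def[symmetric] Pd by simp
  show ?thesis
  proof (rule that[OF syz_seq_W])
    show "lmod_iso (opp L) (case 0 of 0 \<Rightarrow> rep (opp L) M | Suc j \<Rightarrow> W j) M"
      using R.lmod_iso_rep(2)[OF M] by simp
    fix n :: nat assume "n \<ge> 1"
    then obtain j where "n = Suc j" by (cases n) auto
    then show "fdspace (tor L n M N) \<and>
        kdim (tor L n M N) = sdim (opp L) (case n of 0 \<Rightarrow> rep (opp L) M | Suc j \<Rightarrow> W j) (dual_module L N)"
      using fdspace_homology[of j] kdim_homology[of j] by (simp add: tor)
  qed
qed

section \<open>Hochschild homology\<close>

context env
begin

abbreviation "rr \<equiv> regular_bimodule_right A"

lemma rr_simps [simp]: "carrier rr = carrier A" "zero rr = zero A" "add rr = add A"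
  by (simp_all add: regular_bimodule_right_def)

text \<open>Both actions are linear in \<open>t\<close>, and on pure tensors b x a is the left
  action of b \<otimes> a.\<close>

lemma rr_smult: "x \<in> carrier A \<Longrightarrow> t \<in> carrier \<E> \<Longrightarrow> t \<odot>\<^bsub>rr\<^esub> x = swap t \<odot>\<^bsub>regular_bimodule A\<^esub> x"
  and rr_pure: "x \<in> carrier A \<Longrightarrow> a \<in> carrier A \<Longrightarrow> b \<in> carrier A \<Longrightarrow> E.pt a b \<odot>\<^bsub>rr\<^esub> x = b \<otimes> x \<otimes> a"
proof -
  assume x: "x \<in> carrier A"
  have bal: "balanced ground A (opp A) A (\<lambda>a b. b \<otimes> x \<otimes> a)"
  proof (rule balanced_groundI)
    show "(\<lambda>b. b \<otimes> x \<otimes> a) \<in> klin (opp A) A" if "a \<in> carrier A" for a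
      using that x by (intro modhomI) (simp_all add: l_distr smult_mult_left)
    show "(\<lambda>a. b \<otimes> x \<otimes> a) \<in> klin A A" if "b \<in> carrier (opp A)" for b
      using that x by (intro modhomI) (simp_all add: r_distr smult_mult_right)
  qed
  have sm: "t \<odot>\<^bsub>rr\<^esub> x = tensor_lift A (\<lambda>a b. b \<otimes> x \<otimes> a) t" for t
    by (simp add: regular_bimodule_right_def bimodule_def)
  show pure: "E.pt a b \<odot>\<^bsub>rr\<^esub> x = b \<otimes> x \<otimes> a" if "a \<in> carrier A" "b \<in> carrier A" for a b
    using E.tensor_lift_pure[OF kspace_axioms bal] that by (simp add: sm)
  have kr: "(\<lambda>t. t \<odot>\<^bsub>rr\<^esub> x) \<in> klin E.T A"
    unfolding sm by (rule E.tensor_lift_klin[OF kspace_axioms bal])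
  have kl: "(\<lambda>t. t \<odot>\<^bsub>regular_bimodule A\<^esub> x) \<in> klin E.T A"
    unfolding regular_eq_tw twisted_bimodule_def by (rule act_klin[OF tw_actions[OF alg_iso_id] x])
  show "t \<odot>\<^bsub>rr\<^esub> x = swap t \<odot>\<^bsub>regular_bimodule A\<^esub> x" if t: "t \<in> carrier \<E>"
  proof (rule E.klin_eqI[OF kspace_axioms kr modhom_comp[OF swap_klin kl]])
    show "t \<in> carrier E.T" using t by (simp add: carrier_env)
    fix a b assume "a \<in> carrier A" "b \<in> carrier (opp A)"
    then show "E.pt a b \<odot>\<^bsub>rr\<^esub> x = swap (E.pt a b) \<odot>\<^bsub>regular_bimodule A\<^esub> x"
      using x by (simp add: pure swap_pt regular_eq_tw tw_pure[OF alg_iso_id] m_assoc)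
  qed
qed

text \<open>The actions of \<open>rr\<close> and of the pullback of A along \<open>swap\<close> are
  compared only on the carriers, so the axioms are transported along the identity instead of by an
  equality of records.\<close>

lemma left_module_rr: "left_module (opp \<E>) rr"
proof -
  have s: "alg_iso (opp \<E>) \<E> swap"
    using alg_iso_opp[OF alg_iso_swap] by simp
  interpret S: algebra_iso "opp \<E>" \<E> swap
    by unfold_locales (rule EE.k_algebra_opp, rule s)
  have "left_module (opp \<E>) (pull swap (regular_bimodule A))"
    unfolding regular_eq_tw by (rule S.left_module_pull[OF left_module_tw[OF alg_iso_id]])
  then show ?thesis
    by (rule left_module_transport[where f = "\<lambda>x. x"]) (simp_all add: regular_eq_tw rr_smult)
qed

lemma fd_module_rr: "fdspace A \<Longrightarrow> fd_module (opp \<E>) rr"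
proof -
  assume fd: "fdspace A"
  interpret O: kalgebra "opp \<E>" by unfold_locales (rule EE.k_algebra_opp)
  have "(\<lambda>x. x) \<in> klin A (O.rs rr)"
  proof (rule modhomI)
    fix c x assume x: "x \<in> carrier A"
    have "swap (c \<odot>\<^bsub>\<E>\<^esub> \<one>\<^bsub>\<E>\<^esub>) = c \<odot>\<^bsub>\<E>\<^esub> \<one>\<^bsub>\<E>\<^esub>"
      using klin_smult[OF swap_klin, of "E.pt \<one> \<one>" c] by (simp add: enveloping_eq swap_pt)
    then show "c \<odot> x = c \<odot>\<^bsub>O.rs rr\<^esub> x"
      using x bimodule_scalar[OF tw_actions[OF alg_iso_id], of x c]
      by (simp add: rr_smult regular_eq_tw twisted_bimodule_def)
  qed simp_all
  from fdspace_bij(1)[OF fd O.kspace_restrict_scalars[OF left_module_rr] this]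
  show ?thesis using left_module_rr by (simp add: O.fdspace_restrict_scalars bij_betw_def)
qed

end

section \<open>Hochschild homology with coefficients in powers of the dualizing bimodule\<close>

context nakayama_env
begin

text \<open>\<open>tor_stable\<close> gives stable homomorphisms over the opposite algebra from the
  n-th syzygy of A to the dual of \<omega>^(1-m). Pulled back along \<open>swap\<close> the target
  is \<omega>^m, and \<open>sdim_shift\<close> turns the n syzygies of the source into n cosyzygies
  of the target.\<close>

lemma tor_omega:
  assumes n: "n \<ge> 1"
  shows "fdspace (hochschild_homology A n (\<Omega> (1 - m))) \<and>
    kdim (tate_ext \<E> (int n) (regular_bimodule A) (\<Omega> m)) = kdim (hochschild_homology A n (\<Omega> (1 - m)))"
proof -
  obtain I :: "('a \<times> 'a) set" and b c lam where "nakayama \<E> I b c lam \<sigma>" by (rule nakayama_enveloping)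
  then interpret N: nakayama \<E> I b c lam \<sigma> .
  interpret S: frobenius_iso \<E> "opp \<E>" swap I b c lam
    by unfold_locales (rule EE.k_algebra_opp, rule alg_iso_swap)
  note fM = fd_module_rr[OF fdA]
  obtain Z :: "nat \<Rightarrow> ('k, ('k, 'a) env) umodule" where Z: "syz_seq (opp \<E>) Z" "lmod_iso (opp \<E>) (Z 0) rr"
    and tor: "\<And>n. n \<ge> 1 \<Longrightarrow> fdspace (tor \<E> n rr (\<Omega> (1 - m))) \<and>
      kdim (tor \<E> n rr (\<Omega> (1 - m))) = sdim (opp \<E>) (Z n) (dual_module \<E> (\<Omega> (1 - m)))"
    by (rule EE.tor_stable[OF frobenius_opp[OF N.frobenius_axioms] fM fd_omega], rule that)
  define D where "D = dual_module \<E> (\<Omega> (1 - m))"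
  have fD: "fd_module (opp \<E>) D" unfolding D_def by (rule EE.fd_module_dual_module[OF fd_omega])
  define X where "X k = pull swap (Z k)" for k
  have sX: "syz_seq \<E> X" unfolding X_def by (rule S.syz_seq_pull[OF Z(1)])
  have fZ: "fd_module (opp \<E>) (Z k)" and fX: "fd_module \<E> (X k)" for k
    using Z(1) sX by (simp_all add: syz_seq_def)
  have lr: "left_module \<E> (pull swap rr)" by (rule S.left_module_pull[OF left_module_rr])
  have "lmod_iso \<E> (pull swap rr) (regular_bimodule A)"
    unfolding regular_eq_tw
    by (rule lmod_iso_tw[OF lr, where f = "\<lambda>x. x" and \<alpha> = "\<lambda>x. x" and \<beta> = "\<lambda>x. x"])
      (simp_all add: swap_pt rr_pure alg_iso_id m_assoc)
  then have X0: "lmod_iso \<E> (X 0) (regular_bimodule A)"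
    unfolding X_def by (rule EE.lmod_iso_trans[OF S.lmod_iso_pull[OF Z(2)]])
  \<comment> \<open>Under the isomorphism h from DA to \<omega> the action becomes left
    multiplication by \<nu>^(1-m)(a) and right multiplication by \<nu>(b). Applying \<nu>^(m-1)
    clears the left side and leaves \<nu>^m on the right.\<close>
  have DV: "lmod_iso \<E> (pull swap D) (\<Omega> m)"
  proof -
    obtain h where h: "h \<in> module_hom \<E> (dual_bimodule A) (tw \<nu>)" "bij_betw h (carrier (dual_bimodule A)) (carrier (tw \<nu>))"
      using nakayama_nu by (auto simp: nakayama_automorphism_def lmod_iso_def)
    let ?\<phi> = "pw (1 - m)"
    let ?\<psi> = "pw (m - 1)"
    note psi = alg_isoD[OF pw[of "m - 1"]]
    have scal: "(c \<odot>\<^bsub>\<E>\<^esub> \<one>\<^bsub>\<E>\<^esub>) \<odot>\<^bsub>tw ?\<phi>\<^esub> x = c \<odot> x" if "x \<in> carrier A" for c x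
      using bimodule_scalar[OF tw_actions[OF pw] that] by (simp add: twisted_bimodule_def)
    have cD: "carrier D = carrier (dual_bimodule A)"
    proof -
      have "klin (EE.rs (tw ?\<phi>)) ground = klin A ground"
        by (simp add: LinearCombinations.module_hom_def scal cong: conj_cong)
      then show ?thesis by (simp add: D_def omega_power_eq dual_bimodule_eq dual_simps)
    qed
    have addD: "add D = add (dual_bimodule A)"
      by (simp add: D_def omega_power_eq dual_bimodule_eq dual_simps)
    have lD: "left_module \<E> (pull swap D)" by (rule S.left_module_pull[OF S.L'.fd_moduleD(1)[OF fD]])
    have hc: "h f \<in> carrier A" if "f \<in> carrier (dual A)" for f
      using modhom_closed[OF h(1)] that by (simp add: dual_bimodule_eq)
    have hact: "h (dl a (dr f b)) = a \<otimes> (h f \<otimes> \<nu> b)"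
      if "a \<in> carrier A" "b \<in> carrier A" "f \<in> carrier (dual A)" for a b f
      using modhom_smult[OF h(1), of "E.pt a b" f] that hc[OF that(3)]
      by (simp add: carrier_env dual_bimodule_eq[symmetric] dual_pure tw_pure[OF nu])
        (simp add: dual_bimodule_eq)
    have Dact: "E.pt b a \<odot>\<^bsub>D\<^esub> f = dl (?\<phi> a) (dr f b)"
      if "a \<in> carrier A" "b \<in> carrier A" "f \<in> carrier (dual A)" for a b f
      using that by (simp add: D_def omega_power_eq tw_pure[OF pw] pw_closed dl_def dr_def cong: restrict_cong)
    have inv: "?\<psi> (?\<phi> a) = a" if "a \<in> carrier A" for a
      using pw_add[OF that, of "m - 1" "1 - m"] by (simp add: pw_0)
    have nupw: "?\<psi> (\<nu> a) = pw m a" if "a \<in> carrier A" for a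
      using pw_add[OF that, of "m - 1" 1] by (simp add: pw_1)
    have "(\<lambda>f. ?\<psi> (h f)) \<in> module_hom \<E> (pull swap D) (tw (pw m))"
    proof (rule env_homI[OF lD left_module_tw[OF pw]])
      show "?\<psi> (h f) \<in> carrier (tw (pw m))" if "f \<in> carrier (pull swap D)" for f
        using that hc by (simp add: cD dual_bimodule_eq pw_closed)
      show "?\<psi> (h (f \<oplus>\<^bsub>pull swap D\<^esub> g)) = ?\<psi> (h f) \<oplus>\<^bsub>tw (pw m)\<^esub> ?\<psi> (h g)"
        if "f \<in> carrier (pull swap D)" "g \<in> carrier (pull swap D)" for f g
        using that modhom_add[OF h(1), of f g] modhom_add[OF psi(1), of "h f" "h g"] hc
        by (simp add: cD addD) (simp add: dual_bimodule_eq)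
      fix a b f assume ab: "a \<in> carrier A" "b \<in> carrier A" and "f \<in> carrier (pull swap D)"
      then have f: "f \<in> carrier (dual A)" by (simp add: cD dual_bimodule_eq)
      have "E.pt a b \<odot>\<^bsub>pull swap D\<^esub> f = dl (?\<phi> a) (dr f b)"
        using Dact[OF ab f] ab by (simp add: swap_pt)
      moreover have "?\<psi> (h (dl (?\<phi> a) (dr f b))) = a \<otimes> (?\<psi> (h f) \<otimes> pw m b)"
        using hact[OF pw_closed[OF ab(1)] ab(2) f] ab hc[OF f]
        by (simp add: psi(4) pw_closed nuD(5) inv nupw)
      ultimately show "?\<psi> (h (E.pt a b \<odot>\<^bsub>pull swap D\<^esub> f)) = E.pt a b \<odot>\<^bsub>tw (pw m)\<^esub> ?\<psi> (h f)"
        using ab hc[OF f] by (simp add: tw_pure[OF pw] pw_closed)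
    qed
    moreover have "bij_betw (\<lambda>f. ?\<psi> (h f)) (carrier (pull swap D)) (carrier (tw (pw m)))"
      using bij_betw_trans[OF h(2), of ?\<psi> "carrier A"] psi(2) by (simp add: cD comp_def)
    ultimately show ?thesis unfolding omega_power_eq lmod_iso_def by blast
  qed
  have fDp: "fd_module \<E> (pull swap D)" by (rule S.fd_module_pull[OF fD])
  define Y where "Y k = (Cosyzygy \<E> ^^ k) (rep \<E> (\<Omega> m))" for k
  have sY: "cosyz_seq \<E> Y" unfolding Y_def by (rule N.cosyz_seq_Cosyzygy[OF N.fd_module_rep[OF fd_omega]])
  then have fY: "fd_module \<E> (Y k)" for k by (simp add: cosyz_seq_def)
  have DY: "lmod_iso \<E> (pull swap D) (Y 0)"
    using EE.lmod_iso_trans[OF DV N.lmod_iso_rep(1)[OF fd_omega]] by (simp add: Y_def)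
  have "kdim (tor \<E> n rr (\<Omega> (1 - m))) = sdim \<E> (X n) (pull swap D)"
    using tor[OF n] S.sdim_pull[OF fZ fD, of n] by (simp add: D_def X_def)
  also have "\<dots> = sdim \<E> (X n) (Y 0)" by (rule N.sdim_iso_right[OF fDp fY fX DY])
  also have "\<dots> = sdim \<E> (X 0) (Y n)" using N.sdim_shift[OF sX sY, of n 0] by simp
  also have "\<dots> = sdim \<E> (regular_bimodule A) (Y n)"
    by (rule N.sdim_iso_left[OF fX fd_regular fY X0, symmetric])
  also have "\<dots> = kdim (tate_ext \<E> (int n) (regular_bimodule A) (\<Omega> m))"
    by (simp add: N.kdim_tate_ext N.Suspension_pos[OF fd_omega] Y_def)
  finally show ?thesis using tor[OF n] by (simp add: hochschild_homology_def)
qed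

lemma tate_homology:
  "n \<ge> 1 \<Longrightarrow> k_iso (tate_ext \<E> (int n) (regular_bimodule A) (\<Omega> m)) (dual (hochschild_homology A n (\<Omega> (1 - m))))"
  using tor_omega[of n m] by (intro k_iso_dual fdspace_tate_omega) simp_all

end

theorem theorem5p2:
  fixes A :: "('k::field, 'a) module" and \<nu> :: "'a \<Rightarrow> 'a"
  assumes "k_algebra A"
    and "finite_dimensional A"
    and "self_injective A"
    and "separable_algebra (quot A (jacobson_radical A))"
    and "nakayama_automorphism A \<nu>"
  shows "(\<forall>n m :: int.
            k_iso (tate_ext (enveloping A) n (regular_bimodule A) (omega_power A \<nu> m))
                  (dual (tate_ext (enveloping A) (- n - 1) (regular_bimodule A)
                           (omega_power A \<nu> (2 - m))))) \<and>
         (\<forall>n :: int.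
            k_iso (tate_ext (enveloping A) n (regular_bimodule A) (dual_bimodule A))
                  (dual (tate_ext (enveloping A) (- n - 1) (regular_bimodule A)
                           (dual_bimodule A)))) \<and>
         (\<forall>(n :: nat) (m :: int). n \<ge> 1 \<longrightarrow>
            k_iso (tate_ext (enveloping A) (int n) (regular_bimodule A) (omega_power A \<nu> m))
                  (dual (hochschild_homology A n (omega_power A \<nu> (1 - m)))))"
proof -
  interpret kalgebra A by unfold_locales (rule assms(1))
  interpret nakayama_env A \<nu>
    by unfold_locales (simp add: fdspace_def kspace_axioms assms(2), rule assms(5))
  \<comment> \<open>The second statement is the case m = 1, the fixed point of m \<mapsto> 2 - m,
    with \<omega>^1 replaced by DA through \<open>tate_dual_bimodule\<close>.\<close>
  show ?thesis
    using tate_omega_duality tate_omega_duality[of _ 1] tate_homology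
    by (simp add: tate_dual_bimodule)
qed

end
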